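(* Suppose the solution $(\boldsymbol{u},\boldsymbol{B},p)$ of the MHD system (M) described in the context satisfies Assumption (A) of the context. Then the semi-discrete scheme (S) of the context is unconditionally convergent (no restriction on the time step $\delta t$) and satisfies the following error estimate: there is a constant $C>0$ independent of $\delta t$ such that, for $0\le m\le[\frac{T}{\delta t}]-1$, $$\|e_b^{m+1}\|^2+\|e_u^{m+1}\|^2+\delta t^2\|\nabla e_p^{m+1}\|^2+\delta t\sum_{n=0}^{m}\left(\eta\|\nabla\times e_b^{n+1}\|^2+\nu\|\nabla\tilde e_u^{n+1}\|^2\right)\le C\,\delta t^2 .$$
   Context: $\Omega\subset\mathbb{R}^2$ is a bounded domain with outward unit normal $\boldsymbol{n}$ on $\partial\Omega$; $T>0$ is the final time; $\nu,\eta,s>0$ are constants; $[\cdot]$ is the integer part. $\|\cdot\|$ is the $L^2(\Omega)$ norm; $H^k(\Omega)$ are the usual Sobolev spaces (also used for vector fields); $L_0^2(\Omega)=\{\phi\in L^2(\Omega):\int_\Omega\phi\,dx=0\}$. Two-dimensional conventions: for vectors, $\boldsymbol{a}\times\boldsymbol{b}=a_1b_2-a_2b_1$ (scalar); for a vector $\boldsymbol{a}$ and scalar $c$, $\boldsymbol{a}\times c=(a_2c,-a_1c)$; for a vector field $\nabla\times\boldsymbol{B}=\partial_xB_2-\partial_yB_1$ (scalar); for a scalar field $\nabla\times\phi=(\partial_y\phi,-\partial_x\phi)$. $\boldsymbol{B}\times\nabla\times\boldsymbol{C}$ means $\boldsymbol{B}\times(\nabla\times\boldsymbol{C})$. MHD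 system (M), on $\Omega\times[0,T)$: $$\boldsymbol{u}_t-\nu\Delta\boldsymbol{u}+(\boldsymbol{u}\cdot\nabla)\boldsymbol{u}+\nabla p+s\boldsymbol{B}\times\nabla\times\boldsymbol{B}=0,\quad \boldsymbol{B}_t+\eta\nabla\times\nabla\times\boldsymbol{B}-\nabla\times(\boldsymbol{u}\times\boldsymbol{B})=0,\quad \nabla\cdot\boldsymbol{u}=0,\quad \nabla\cdot\boldsymbol{B}=0,$$ with $\boldsymbol{u}|_{\partial\Omega}=0$, $\boldsymbol{B}\times\boldsymbol{n}|_{\partial\Omega}=0$, $\boldsymbol{u}|_{t=0}=\boldsymbol{u}_0$, $\boldsymbol{B}|_{t=0}=\boldsymbol{B}_0$, where $\nabla\cdot\boldsymbol{u}_0=0$, $\nabla\cdot\boldsymbol{B}_0=0$; the pressure is normalized by $p(t)\in L_0^2(\Omega)$. Assumption (A): $\boldsymbol{u},\boldsymbol{B}\in L^\infty(0,T;H^2(\Omega))$, $p\in L^\infty(0,T;H^1(\Omega))$; $\boldsymbol{u}_t,p_t,\boldsymbol{B}_t\in L^\infty(0,T;H^1(\Omega))$; $\boldsymbol{u}_{tt},\boldsymbol{B}_{tt}\in L^\infty(0,T;L^2(\Omega))\cap L^2(0,T;H^1(\Omega))$, $p_{tt}\in L^2(0,T;H^1(\Omega))$; $\boldsymbol{u}_{ttt},\boldsymbol{B}_{ttt}\in L^2(0,T;L^2(\Omega))$. Scheme (S): let $\delta t>0$, $t_n=n\delta t$, $\boldsymbol{u}^0=\boldsymbol{u}_0$,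 $\boldsymbol{B}^0=\boldsymbol{B}_0$, $p^0=p(0)$. Given $(\boldsymbol{u}^n,\boldsymbol{B}^n,p^n)$, $n\ge0$, compute $(\boldsymbol{u}^{n+1},\boldsymbol{B}^{n+1},p^{n+1})$ by: Step 1: find $\boldsymbol{B}^{n+1},\boldsymbol{u}_\star^n$ with $\frac{\boldsymbol{B}^{n+1}-\boldsymbol{B}^n}{\delta t}+\eta\nabla\times\nabla\times\boldsymbol{B}^{n+1}-\nabla\times(\boldsymbol{u}_\star^n\times\boldsymbol{B}^n)=0$, $\frac{\boldsymbol{u}_\star^n-\boldsymbol{u}^n}{\delta t}+s\boldsymbol{B}^n\times\nabla\times\boldsymbol{B}^{n+1}=0$, $\boldsymbol{B}^{n+1}\times\boldsymbol{n}|_{\partial\Omega}=0$. Step 2: find $\tilde{\boldsymbol{u}}^{n+1}$ with $\frac{\tilde{\boldsymbol{u}}^{n+1}-\boldsymbol{u}_\star^n}{\delta t}+(\boldsymbol{u}^n\cdot\nabla)\tilde{\boldsymbol{u}}^{n+1}-\nu\Delta\tilde{\boldsymbol{u}}^{n+1}+\nabla p^n=0$, $\tilde{\boldsymbol{u}}^{n+1}|_{\partial\Omega}=0$. Step 3: find $\boldsymbol{u}^{n+1}$ and $p^{n+1}\in L^2_0(\Omega)$ with $\frac{\boldsymbol{u}^{n+1}-\tilde{\boldsymbol{u}}^{n+1}}{\delta t}+\nabla(p^{n+1}-p^n)=0$, $\nabla\cdot\boldsymbol{u}^{n+1}=0$, $\boldsymbol{u}^{n+1}\cdot\boldsymbol{n}|_{\partial\Omega}=0$.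 Errors: $e_b^n=\boldsymbol{B}(t_n)-\boldsymbol{B}^n$, $e_u^n=\boldsymbol{u}(t_n)-\boldsymbol{u}^n$, $\tilde e_u^n=\boldsymbol{u}(t_n)-\tilde{\boldsymbol{u}}^n$ (for $n\ge1$), $e_p^n=p(t_n)-p^n$. Constants "independent of $\delta t$" may depend on the data ($\Omega,T,\nu,\eta,s$, initial data) and on the exact solution. *)

theory Defs
  imports "HOL-Analysis.Analysis"
begin

text \<open>
  Vector fields on the plane have type \<open>real^2 \<Rightarrow> real^2\<close>. Functions represent their classes modulo
  equality almost everywhere: every notion below except the test functions is invariant under changes
  on null sets. Derivatives of functions that are not test functions are weak derivatives.
\<close>


section \<open>Planar Lipschitz domains\<close>

text \<open>
  The outward unit normal is defined almost everywhere on the boundary of a Lipschitz domain: near a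
  boundary point \<open>x0\<close>, in suitable orthonormal coordinates \<open>(a, b)\<close> centred at \<open>x0\<close>, the domain is the
  part \<open>b < g a\<close> below the graph of a Lipschitz function \<open>g\<close>.
\<close>

definition lipschitz_domain :: "(real^2) set \<Rightarrow> bool" where
  "lipschitz_domain \<Omega> \<longleftrightarrow> open \<Omega> \<and> connected \<Omega> \<and> bounded \<Omega> \<and> \<Omega> \<noteq> {} \<and>
    (\<forall>x0\<in>frontier \<Omega>. \<exists>e1 e2 r h L g.
        norm e1 = 1 \<and> norm e2 = 1 \<and> e1 \<bullet> e2 = 0 \<and> 0 < r \<and> 0 < h \<and>
        L-lipschitz_on {-r<..<r} g \<and>
        (\<forall>a b. \<bar>a\<bar> < r \<and> \<bar>b\<bar> < h \<longrightarrow> (x0 + a *\<^sub>R e1 + b *\<^sub>R e2 \<in> \<Omega> \<longleftrightarrow> b < g a)))"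


section \<open>Planar cross products and test functions\<close>

definition cross_vv :: "real^2 \<Rightarrow> real^2 \<Rightarrow> real" where
  "cross_vv a b = a$1 * b$2 - a$2 * b$1"

definition cross_vs :: "real^2 \<Rightarrow> real \<Rightarrow> real^2" where
  "cross_vs a c = vector [a$2 * c, - (a$1 * c)]"

definition pd :: "2 \<Rightarrow> (real^2 \<Rightarrow> 'a::real_normed_vector) \<Rightarrow> real^2 \<Rightarrow> 'a" where
  "pd i f x = frechet_derivative f (at x) (axis i 1)"

primrec C_k :: "nat \<Rightarrow> (real^2 \<Rightarrow> 'a::real_normed_vector) \<Rightarrow> bool" where
  "C_k 0 f \<longleftrightarrow> continuous_on UNIV f"
| "C_k (Suc k) f \<longleftrightarrow> (\<forall>x. f differentiable (at x)) \<and> (\<forall>i. C_k k (pd i f))"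

definition test_fun :: "(real^2) set \<Rightarrow> (real^2 \<Rightarrow> 'a::real_normed_vector) \<Rightarrow> bool" where
  "test_fun \<Omega> \<phi> \<longleftrightarrow> (\<forall>k. C_k k \<phi>) \<and> (\<exists>K. compact K \<and> K \<subseteq> \<Omega> \<and> (\<forall>x. x \<notin> K \<longrightarrow> \<phi> x = 0))"


section \<open>Lebesgue and Sobolev spaces on the domain\<close>

definition L2 :: "(real^2) set \<Rightarrow> (real^2 \<Rightarrow> 'a::euclidean_space) \<Rightarrow> bool" where
  "L2 \<Omega> f \<longleftrightarrow> f \<in> borel_measurable (lebesgue_on \<Omega>) \<and>
     integrable (lebesgue_on \<Omega>) (\<lambda>x. (norm (f x))\<^sup>2)"

definition L2_norm :: "(real^2) set \<Rightarrow> (real^2 \<Rightarrow> 'a::euclidean_space) \<Rightarrow> real" where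
  "L2_norm \<Omega> f = sqrt (LINT x|lebesgue_on \<Omega>. (norm (f x))\<^sup>2)"

definition L2_zero_mean :: "(real^2) set \<Rightarrow> (real^2 \<Rightarrow> real) \<Rightarrow> bool" where
  "L2_zero_mean \<Omega> f \<longleftrightarrow> L2 \<Omega> f \<and> (LINT x|lebesgue_on \<Omega>. f x) = 0"

definition has_weak_pd ::
  "(real^2) set \<Rightarrow> 2 \<Rightarrow> (real^2 \<Rightarrow> 'a::euclidean_space) \<Rightarrow> (real^2 \<Rightarrow> 'a) \<Rightarrow> bool" where
  "has_weak_pd \<Omega> i f g \<longleftrightarrow> L2 \<Omega> f \<and> L2 \<Omega> g \<and>
     (\<forall>\<phi>. test_fun \<Omega> \<phi> \<longrightarrow>
        (LINT x|lebesgue_on \<Omega>. pd i \<phi> x *\<^sub>R f x) = - (LINT x|lebesgue_on \<Omega>. \<phi> x *\<^sub>R g x))"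

text \<open>
  Weak derivatives are unique almost everywhere, so the choice of a representative in \<open>weak_pd\<close> and
  \<open>weak_curl\<close> is immaterial wherever a weak derivative in \<open>L2\<close> exists; elsewhere the values are junk.
\<close>

definition weak_pd :: "(real^2) set \<Rightarrow> 2 \<Rightarrow> (real^2 \<Rightarrow> 'a::euclidean_space) \<Rightarrow> real^2 \<Rightarrow> 'a" where
  "weak_pd \<Omega> i f = (SOME g. has_weak_pd \<Omega> i f g)"

primrec sobolev :: "(real^2) set \<Rightarrow> nat \<Rightarrow> (real^2 \<Rightarrow> 'a::euclidean_space) \<Rightarrow> bool" where
  "sobolev \<Omega> 0 f \<longleftrightarrow> L2 \<Omega> f"
| "sobolev \<Omega> (Suc k) f \<longleftrightarrow> L2 \<Omega> f \<and> (\<forall>i. \<exists>g. has_weak_pd \<Omega> i f g \<and> sobolev \<Omega> k g)"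

primrec sobolev_norm :: "(real^2) set \<Rightarrow> nat \<Rightarrow> (real^2 \<Rightarrow> 'a::euclidean_space) \<Rightarrow> real" where
  "sobolev_norm \<Omega> 0 f = L2_norm \<Omega> f"
| "sobolev_norm \<Omega> (Suc k) f =
     sqrt ((L2_norm \<Omega> f)\<^sup>2 + (\<Sum>i\<in>UNIV. (sobolev_norm \<Omega> k (weak_pd \<Omega> i f))\<^sup>2))"

definition grad_norm :: "(real^2) set \<Rightarrow> (real^2 \<Rightarrow> 'a::euclidean_space) \<Rightarrow> real" where
  "grad_norm \<Omega> f = sqrt (\<Sum>i\<in>UNIV. (L2_norm \<Omega> (weak_pd \<Omega> i f))\<^sup>2)"

definition weak_grad :: "(real^2) set \<Rightarrow> (real^2 \<Rightarrow> real) \<Rightarrow> real^2 \<Rightarrow> real^2" where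
  "weak_grad \<Omega> q x = (\<chi> i. weak_pd \<Omega> i q x)"

definition weak_curl_s :: "(real^2) set \<Rightarrow> (real^2 \<Rightarrow> real) \<Rightarrow> real^2 \<Rightarrow> real^2" where
  "weak_curl_s \<Omega> q x = vector [weak_pd \<Omega> 2 q x, - weak_pd \<Omega> 1 q x]"

definition convect ::
  "(real^2) set \<Rightarrow> (real^2 \<Rightarrow> real^2) \<Rightarrow> (real^2 \<Rightarrow> real^2) \<Rightarrow> real^2 \<Rightarrow> real^2" where
  "convect \<Omega> v w x = (\<Sum>i\<in>UNIV. v x $ i *\<^sub>R weak_pd \<Omega> i w x)"

text \<open>
  The curl and the divergence of a square integrable vector field. They may exist in \<open>L2\<close> although the
  individual partial derivatives do not.
\<close>

definition has_weak_curl :: "(real^2) set \<Rightarrow> (real^2 \<Rightarrow> real^2) \<Rightarrow> (real^2 \<Rightarrow> real) \<Rightarrow> bool" where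
  "has_weak_curl \<Omega> v c \<longleftrightarrow> L2 \<Omega> v \<and> L2 \<Omega> c \<and>
     (\<forall>\<phi>. test_fun \<Omega> \<phi> \<longrightarrow>
        (LINT x|lebesgue_on \<Omega>. v x \<bullet> vector [pd 2 \<phi> x, - pd 1 \<phi> x]) =
        (LINT x|lebesgue_on \<Omega>. c x * \<phi> x))"

definition weak_curl :: "(real^2) set \<Rightarrow> (real^2 \<Rightarrow> real^2) \<Rightarrow> real^2 \<Rightarrow> real" where
  "weak_curl \<Omega> v = (SOME c. has_weak_curl \<Omega> v c)"

definition has_weak_div :: "(real^2) set \<Rightarrow> (real^2 \<Rightarrow> real^2) \<Rightarrow> (real^2 \<Rightarrow> real) \<Rightarrow> bool" where
  "has_weak_div \<Omega> v d \<longleftrightarrow> L2 \<Omega> v \<and> L2 \<Omega> d \<and>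
     (\<forall>\<phi>. test_fun \<Omega> \<phi> \<longrightarrow>
        (LINT x|lebesgue_on \<Omega>. v x \<bullet> (\<chi> i. pd i \<phi> x)) = - (LINT x|lebesgue_on \<Omega>. d x * \<phi> x))"

abbreviation div_free :: "(real^2) set \<Rightarrow> (real^2 \<Rightarrow> real^2) \<Rightarrow> bool" where
  "div_free \<Omega> v \<equiv> has_weak_div \<Omega> v (\<lambda>_. 0)"


section \<open>Boundary conditions\<close>

text \<open>
  Full traces vanish on the closure of the test functions in the first Sobolev space.
\<close>

definition zero_trace :: "(real^2) set \<Rightarrow> (real^2 \<Rightarrow> 'a::euclidean_space) \<Rightarrow> bool" where
  "zero_trace \<Omega> f \<longleftrightarrow> sobolev \<Omega> 1 f \<and>
     (\<exists>\<Phi>. (\<forall>k. test_fun \<Omega> (\<Phi> k)) \<and> (\<lambda>k. sobolev_norm \<Omega> 1 (\<lambda>x. f x - \<Phi> k x)) \<longlonglongrightarrow> 0)"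

text \<open>
  For fields whose curl (divergence) is square integrable, the tangential trace \<open>v \<times> n\<close> (normal trace
  \<open>v \<cdot> n\<close>) is the functional on the first Sobolev space that Green's formula gives:
  the boundary integral of \<open>(v \<times> n) q\<close> is the integral of \<open>v \<cdot> curl q - (curl v) q\<close> over the domain,
  and that of \<open>(v \<cdot> n) q\<close> is the integral of \<open>v \<cdot> grad q + (div v) q\<close>.
\<close>

definition zero_tangential_trace :: "(real^2) set \<Rightarrow> (real^2 \<Rightarrow> real^2) \<Rightarrow> bool" where
  "zero_tangential_trace \<Omega> v \<longleftrightarrow> (\<exists>c. has_weak_curl \<Omega> v c \<and>
     (\<forall>q. sobolev \<Omega> 1 q \<longrightarrow>
        (LINT x|lebesgue_on \<Omega>. v x \<bullet> weak_curl_s \<Omega> q x - c x * q x) = 0))"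

definition zero_normal_trace :: "(real^2) set \<Rightarrow> (real^2 \<Rightarrow> real^2) \<Rightarrow> bool" where
  "zero_normal_trace \<Omega> v \<longleftrightarrow> (\<exists>d. has_weak_div \<Omega> v d \<and>
     (\<forall>q. sobolev \<Omega> 1 q \<longrightarrow>
        (LINT x|lebesgue_on \<Omega>. v x \<bullet> weak_grad \<Omega> q x + d x * q x) = 0))"


section \<open>Vector-valued distributions\<close>

text \<open>
  The differential equations are equations between distributions, that is, they hold when applied to
  all test fields \<open>\<phi>\<close>. The functionals below are the distributions given by a field \<open>f\<close>, by the
  Laplacian of a field \<open>f\<close>, and by the curl of a scalar \<open>g\<close>.
\<close>

definition distr :: "(real^2) set \<Rightarrow> (real^2 \<Rightarrow> real^2) \<Rightarrow> (real^2 \<Rightarrow> real^2) \<Rightarrow> real" where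
  "distr \<Omega> f \<phi> = (LINT x|lebesgue_on \<Omega>. f x \<bullet> \<phi> x)"

definition distr_laplacian ::
  "(real^2) set \<Rightarrow> (real^2 \<Rightarrow> real^2) \<Rightarrow> (real^2 \<Rightarrow> real^2) \<Rightarrow> real" where
  "distr_laplacian \<Omega> f \<phi> = (LINT x|lebesgue_on \<Omega>. f x \<bullet> (\<Sum>i\<in>UNIV. pd i (pd i \<phi>) x))"

definition distr_curl :: "(real^2) set \<Rightarrow> (real^2 \<Rightarrow> real) \<Rightarrow> (real^2 \<Rightarrow> real^2) \<Rightarrow> real" where
  "distr_curl \<Omega> g \<phi> = (LINT x|lebesgue_on \<Omega>. g x * (pd 1 \<phi> x $ 2 - pd 2 \<phi> x $ 1))"


section \<open>Bochner spaces on the time interval\<close>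

text \<open>
  A time-dependent field \<open>f\<close> is the map \<open>t \<mapsto> f t\<close> into a Sobolev space of order \<open>k\<close>. It is strongly
  measurable if it is almost everywhere the limit in norm of simple functions.
\<close>

definition bochner_measurable ::
  "(real^2) set \<Rightarrow> real \<Rightarrow> nat \<Rightarrow> (real \<Rightarrow> real^2 \<Rightarrow> 'a::euclidean_space) \<Rightarrow> bool" where
  "bochner_measurable \<Omega> T k f \<longleftrightarrow>
     (\<exists>S. (\<forall>j. simple_function (lebesgue_on {0<..<T}) (S j)) \<and>
          (\<forall>j. \<forall>t\<in>{0<..<T}. sobolev \<Omega> k (S j t)) \<and>
          (AE t in lebesgue_on {0<..<T}. sobolev \<Omega> k (f t) \<and>
             (\<lambda>j. sobolev_norm \<Omega> k (\<lambda>x. S j t x - f t x)) \<longlonglongrightarrow> 0))"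

definition Linf_H ::
  "(real^2) set \<Rightarrow> real \<Rightarrow> nat \<Rightarrow> (real \<Rightarrow> real^2 \<Rightarrow> 'a::euclidean_space) \<Rightarrow> bool" where
  "Linf_H \<Omega> T k f \<longleftrightarrow> bochner_measurable \<Omega> T k f \<and>
     (\<exists>M. AE t in lebesgue_on {0<..<T}. sobolev_norm \<Omega> k (f t) \<le> M)"

definition L2_H ::
  "(real^2) set \<Rightarrow> real \<Rightarrow> nat \<Rightarrow> (real \<Rightarrow> real^2 \<Rightarrow> 'a::euclidean_space) \<Rightarrow> bool" where
  "L2_H \<Omega> T k f \<longleftrightarrow> bochner_measurable \<Omega> T k f \<and>
     integrable (lebesgue_on {0<..<T}) (\<lambda>t. (sobolev_norm \<Omega> k (f t))\<^sup>2)"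

definition C_L2 :: "(real^2) set \<Rightarrow> real \<Rightarrow> (real \<Rightarrow> real^2 \<Rightarrow> 'a::euclidean_space) \<Rightarrow> bool" where
  "C_L2 \<Omega> T f \<longleftrightarrow> (\<forall>t\<in>{0..T}. L2 \<Omega> (f t) \<and>
     ((\<lambda>r. L2_norm \<Omega> (\<lambda>x. f r x - f t x)) \<longlongrightarrow> 0) (at t within {0..T}))"

definition time_test :: "real \<Rightarrow> (real \<Rightarrow> real) \<Rightarrow> bool" where
  "time_test T \<theta> \<longleftrightarrow> (\<forall>k t. (deriv ^^ k) \<theta> field_differentiable (at t)) \<and>
     (\<exists>a b. 0 < a \<and> b < T \<and> (\<forall>t. t \<notin> {a..b} \<longrightarrow> \<theta> t = 0))"

text \<open>
  The weak time derivative: for every scalar test function \<open>\<theta>\<close>, the Bochner integrals of \<open>\<theta>' f\<close> and of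
  \<open>- \<theta> g\<close> are the same element of \<open>L2\<close>, as seen by pairing with all \<open>\<psi>\<close> in \<open>L2\<close>.
\<close>

definition has_time_deriv ::
  "(real^2) set \<Rightarrow> real \<Rightarrow> (real \<Rightarrow> real^2 \<Rightarrow> 'a::euclidean_space) \<Rightarrow>
   (real \<Rightarrow> real^2 \<Rightarrow> 'a) \<Rightarrow> bool" where
  "has_time_deriv \<Omega> T f g \<longleftrightarrow> L2_H \<Omega> T 0 f \<and> L2_H \<Omega> T 0 g \<and>
     (\<forall>\<theta> \<psi>. time_test T \<theta> \<and> L2 \<Omega> \<psi> \<longrightarrow>
        (LINT t|lebesgue_on {0<..<T}. deriv \<theta> t * (LINT x|lebesgue_on \<Omega>. f t x \<bullet> \<psi> x)) =
        - (LINT t|lebesgue_on {0<..<T}. \<theta> t * (LINT x|lebesgue_on \<Omega>. g t x \<bullet> \<psi> x)))"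


section \<open>The MHD system\<close>

text \<open>
  The solution is identified with its representative that is continuous in time with values in \<open>L2\<close>
  (under the regularity assumption below it exists and is unique), so that \<open>u t\<close>, \<open>B t\<close> and \<open>p t\<close>
  are meaningful for each single \<open>t\<close> in \<open>{0..T}\<close>.
\<close>

definition mhd_solution ::
  "(real^2) set \<Rightarrow> real \<Rightarrow> real \<Rightarrow> real \<Rightarrow> real \<Rightarrow> (real^2 \<Rightarrow> real^2) \<Rightarrow> (real^2 \<Rightarrow> real^2) \<Rightarrow>
   (real \<Rightarrow> real^2 \<Rightarrow> real^2) \<Rightarrow> (real \<Rightarrow> real^2 \<Rightarrow> real^2) \<Rightarrow> (real \<Rightarrow> real^2 \<Rightarrow> real) \<Rightarrow> bool" where
  "mhd_solution \<Omega> T \<nu> \<eta> s u0 B0 u B p \<longleftrightarrow>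
     C_L2 \<Omega> T u \<and> C_L2 \<Omega> T B \<and> C_L2 \<Omega> T p \<and>
     div_free \<Omega> u0 \<and> div_free \<Omega> B0 \<and>
     (AE x in lebesgue_on \<Omega>. u 0 x = u0 x) \<and> (AE x in lebesgue_on \<Omega>. B 0 x = B0 x) \<and>
     (\<forall>t\<in>{0..T}. L2_zero_mean \<Omega> (p t)) \<and>
     (\<exists>u_t B_t. has_time_deriv \<Omega> T u u_t \<and> has_time_deriv \<Omega> T B B_t \<and>
       (AE t in lebesgue_on {0<..<T}.
          zero_trace \<Omega> (u t) \<and> zero_tangential_trace \<Omega> (B t) \<and> sobolev \<Omega> 1 (p t) \<and>
          div_free \<Omega> (u t) \<and> div_free \<Omega> (B t) \<and>
          (\<forall>\<phi>. test_fun \<Omega> \<phi> \<longrightarrow>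
             distr \<Omega> (u_t t) \<phi> - \<nu> * distr_laplacian \<Omega> (u t) \<phi>
               + distr \<Omega> (convect \<Omega> (u t) (u t)) \<phi> + distr \<Omega> (weak_grad \<Omega> (p t)) \<phi>
               + s * distr \<Omega> (\<lambda>x. cross_vs (B t x) (weak_curl \<Omega> (B t) x)) \<phi> = 0) \<and>
          (\<forall>\<phi>. test_fun \<Omega> \<phi> \<longrightarrow>
             distr \<Omega> (B_t t) \<phi> + \<eta> * distr_curl \<Omega> (weak_curl \<Omega> (B t)) \<phi>
               - distr_curl \<Omega> (\<lambda>x. cross_vv (u t x) (B t x)) \<phi> = 0)))"

definition regular_solution ::
  "(real^2) set \<Rightarrow> real \<Rightarrow>
   (real \<Rightarrow> real^2 \<Rightarrow> real^2) \<Rightarrow> (real \<Rightarrow> real^2 \<Rightarrow> real^2) \<Rightarrow> (real \<Rightarrow> real^2 \<Rightarrow> real) \<Rightarrow> bool" where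
  "regular_solution \<Omega> T u B p \<longleftrightarrow>
     (\<forall>f\<in>{u, B}. \<exists>f_t f_tt f_ttt.
        has_time_deriv \<Omega> T f f_t \<and> has_time_deriv \<Omega> T f_t f_tt \<and> has_time_deriv \<Omega> T f_tt f_ttt \<and>
        Linf_H \<Omega> T 2 f \<and> Linf_H \<Omega> T 1 f_t \<and>
        Linf_H \<Omega> T 0 f_tt \<and> L2_H \<Omega> T 1 f_tt \<and> L2_H \<Omega> T 0 f_ttt) \<and>
     (\<exists>p_t p_tt. has_time_deriv \<Omega> T p p_t \<and> has_time_deriv \<Omega> T p_t p_tt \<and>
        Linf_H \<Omega> T 1 p \<and> Linf_H \<Omega> T 1 p_t \<and> L2_H \<Omega> T 1 p_tt)"


section \<open>The semi-discrete scheme\<close>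

text \<open>
  The iterates are \<open>Bn n\<close>, \<open>un n\<close>, \<open>pn n\<close>, the intermediate velocities are \<open>ustar n\<close> and \<open>utilde (Suc n)\<close>;
  the value \<open>utilde 0\<close> is not used. They are sought in the spaces in which all terms make sense as
  distributions; more regular solutions are solutions in this sense.
\<close>

definition scheme_step1 ::
  "(real^2) set \<Rightarrow> real \<Rightarrow> real \<Rightarrow> real \<Rightarrow> (real^2 \<Rightarrow> real^2) \<Rightarrow> (real^2 \<Rightarrow> real^2) \<Rightarrow>
   (real^2 \<Rightarrow> real^2) \<Rightarrow> (real^2 \<Rightarrow> real^2) \<Rightarrow> bool" where
  "scheme_step1 \<Omega> \<eta> s \<delta>t B u B' ustar \<longleftrightarrow>
     L2 \<Omega> ustar \<and> zero_tangential_trace \<Omega> B' \<and>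
     (\<forall>\<phi>. test_fun \<Omega> \<phi> \<longrightarrow>
        distr \<Omega> (\<lambda>x. (1 / \<delta>t) *\<^sub>R (B' x - B x)) \<phi> + \<eta> * distr_curl \<Omega> (weak_curl \<Omega> B') \<phi>
          - distr_curl \<Omega> (\<lambda>x. cross_vv (ustar x) (B x)) \<phi> = 0) \<and>
     (AE x in lebesgue_on \<Omega>.
        (1 / \<delta>t) *\<^sub>R (ustar x - u x) + s *\<^sub>R cross_vs (B x) (weak_curl \<Omega> B' x) = 0)"

definition scheme_step2 ::
  "(real^2) set \<Rightarrow> real \<Rightarrow> real \<Rightarrow> (real^2 \<Rightarrow> real^2) \<Rightarrow> (real^2 \<Rightarrow> real) \<Rightarrow>
   (real^2 \<Rightarrow> real^2) \<Rightarrow> (real^2 \<Rightarrow> real^2) \<Rightarrow> bool" where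
  "scheme_step2 \<Omega> \<nu> \<delta>t u p ustar utilde \<longleftrightarrow>
     zero_trace \<Omega> utilde \<and>
     (\<forall>\<phi>. test_fun \<Omega> \<phi> \<longrightarrow>
        distr \<Omega> (\<lambda>x. (1 / \<delta>t) *\<^sub>R (utilde x - ustar x)) \<phi> + distr \<Omega> (convect \<Omega> u utilde) \<phi>
          - \<nu> * distr_laplacian \<Omega> utilde \<phi> + distr \<Omega> (weak_grad \<Omega> p) \<phi> = 0)"

definition scheme_step3 ::
  "(real^2) set \<Rightarrow> real \<Rightarrow> (real^2 \<Rightarrow> real) \<Rightarrow> (real^2 \<Rightarrow> real^2) \<Rightarrow>
   (real^2 \<Rightarrow> real^2) \<Rightarrow> (real^2 \<Rightarrow> real) \<Rightarrow> bool" where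
  "scheme_step3 \<Omega> \<delta>t p utilde u' p' \<longleftrightarrow>
     div_free \<Omega> u' \<and> zero_normal_trace \<Omega> u' \<and> sobolev \<Omega> 1 p' \<and> L2_zero_mean \<Omega> p' \<and>
     (AE x in lebesgue_on \<Omega>.
        (1 / \<delta>t) *\<^sub>R (u' x - utilde x) + weak_grad \<Omega> (\<lambda>y. p' y - p y) x = 0)"

definition scheme_solution ::
  "(real^2) set \<Rightarrow> real \<Rightarrow> real \<Rightarrow> real \<Rightarrow> real \<Rightarrow>
   (real^2 \<Rightarrow> real^2) \<Rightarrow> (real^2 \<Rightarrow> real^2) \<Rightarrow> (real^2 \<Rightarrow> real) \<Rightarrow>
   (nat \<Rightarrow> real^2 \<Rightarrow> real^2) \<Rightarrow> (nat \<Rightarrow> real^2 \<Rightarrow> real^2) \<Rightarrow> (nat \<Rightarrow> real^2 \<Rightarrow> real) \<Rightarrow>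
   (nat \<Rightarrow> real^2 \<Rightarrow> real^2) \<Rightarrow> (nat \<Rightarrow> real^2 \<Rightarrow> real^2) \<Rightarrow> bool" where
  "scheme_solution \<Omega> \<nu> \<eta> s \<delta>t u0 B0 p0 un Bn pn ustar utilde \<longleftrightarrow>
     (AE x in lebesgue_on \<Omega>. un 0 x = u0 x) \<and>
     (AE x in lebesgue_on \<Omega>. Bn 0 x = B0 x) \<and>
     (AE x in lebesgue_on \<Omega>. pn 0 x = p0 x) \<and>
     (\<forall>n. scheme_step1 \<Omega> \<eta> s \<delta>t (Bn n) (un n) (Bn (Suc n)) (ustar n) \<and>
          scheme_step2 \<Omega> \<nu> \<delta>t (un n) (pn n) (ustar n) (utilde (Suc n)) \<and>
          scheme_step3 \<Omega> \<delta>t (pn n) (utilde (Suc n)) (un (Suc n)) (pn (Suc n)))"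

definition grid_error ::
  "real \<Rightarrow> (real \<Rightarrow> real^2 \<Rightarrow> 'a::euclidean_space) \<Rightarrow> (nat \<Rightarrow> real^2 \<Rightarrow> 'a) \<Rightarrow> nat \<Rightarrow> real^2 \<Rightarrow> 'a" where
  "grid_error \<delta>t f fn n x = f (real n * \<delta>t) x - fn n x"

definition total_error ::
  "(real^2) set \<Rightarrow> real \<Rightarrow> real \<Rightarrow> real \<Rightarrow>
   (real \<Rightarrow> real^2 \<Rightarrow> real^2) \<Rightarrow> (real \<Rightarrow> real^2 \<Rightarrow> real^2) \<Rightarrow> (real \<Rightarrow> real^2 \<Rightarrow> real) \<Rightarrow>
   (nat \<Rightarrow> real^2 \<Rightarrow> real^2) \<Rightarrow> (nat \<Rightarrow> real^2 \<Rightarrow> real^2) \<Rightarrow> (nat \<Rightarrow> real^2 \<Rightarrow> real) \<Rightarrow>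
   (nat \<Rightarrow> real^2 \<Rightarrow> real^2) \<Rightarrow> nat \<Rightarrow> real" where
  "total_error \<Omega> \<nu> \<eta> \<delta>t u B p un Bn pn utilde m =
     (L2_norm \<Omega> (grid_error \<delta>t B Bn (m + 1)))\<^sup>2
     + (L2_norm \<Omega> (grid_error \<delta>t u un (m + 1)))\<^sup>2
     + \<delta>t\<^sup>2 * (grad_norm \<Omega> (grid_error \<delta>t p pn (m + 1)))\<^sup>2
     + \<delta>t * (\<Sum>n=0..m.
         \<eta> * (L2_norm \<Omega> (weak_curl \<Omega> (grid_error \<delta>t B Bn (n + 1))))\<^sup>2
         + \<nu> * (grad_norm \<Omega> (grid_error \<delta>t u utilde (n + 1)))\<^sup>2)"

end

theory Submission
 imports Defs "HOL-Analysis.Analysis"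
begin

text \<open>With $b, u, u_\star, \tilde u, p$ denoting the errors, the discrete energy is
$X_n = s\|b^n\|^2 + \|u^n\|^2 + \delta t^2\|\nabla p^n\|^2$.
Test the error equation for the induction step with $b^{n+1}$. The error of $u_\star$ is taken relative to
$u(t_n) - \delta t  s  B(t_n)\times\nabla\times B(t_{n+1})$, so that $u_\star - u^n$ equals $-\delta t  s$ times the error
of the Lorentz force, and the coupling between the two equations of Step 1 cancels up to terms of size $\|b^n\|$.
In Step 2 the convection by $u^n$ is skew; since $u^n$ is only square integrable, this is shown by testing with the
bounded truncations $K\sin(\cdot/K)$. Step 3 is handled by taking the norm of both sides of
$u^{n+1} + \delta t\nabla p^{n+1} = \tilde u^{n+1} + \delta t\nabla p^n + \delta t\nabla(p(t_{n+1}) - p(t_n))$,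
whose left-hand side is an orthogonal sum. Altogether $X_{n+1}\le(1 + C\delta t)X_n + C\delta t^3$ up to the dissipation,
for every $\delta t\le T$, and the discrete Gronwall inequality concludes.

The estimates need $\nabla\times B\in L^\infty$, although Assumption (A) only puts it in $H^1$: the induction equation says that the gradient of
$q = \eta\nabla\times B - u\times B$ is the rotated field $B_t\in H^1$, so $q\in H^2\subset L^\infty$.\<close>

section \<open>Calculus in the space of square integrable fields\<close>

text \<open>The iterates are known only in the spaces where the scheme makes sense as distributions:
  \<open>b\<close> and \<open>v\<close> are merely square integrable, the product of
  \<open>vs\<close> and \<open>b\<close> merely integrable. So no quantitative bound on an iterate
  is used: each product in the error equations has a bounded factor from the exact solution or drops
  out by an exact cancellation. The predicted velocity is not divergence free, so Step 2 leaves its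
  error paired with the pressure gradient error. This pairing is also the cross term in the square
  of Step 3 and cancels, which explains the weight \<delta>t squared of the pressure gradient.
  Consistency needs no Taylor expansion: the weak equations are integrated over one step and
  compared with their terms frozen at grid points. Each frozen term is Lipschitz in time and costs
  one factor \<delta>t beyond the length of the step. Assumption (A) controls almost every time
  only, but the scheme samples the solution at grid points. Lipschitz continuity, with closedness of
  traces and bounds under limits, extends what is needed to every time in [0, T].\<close>

lemma measurable_lebesgue_on_cong_AE:
 fixes f g :: "'a::euclidean_space \<Rightarrow> 'b::topological_space"
 assumes S: "S \<in> sets lebesgue" and f: "f \<in> borel_measurable (lebesgue_on S)"
  and eq: "AE x in lebesgue_on S. f x = g x"
 shows "g \<in> borel_measurable (lebesgue_on S)"
proof -
 obtain N where N: "\<And>x. x \<in> space (lebesgue_on S) - N \<Longrightarrow> f x = g x" "N \<in> null_sets (lebesgue_on S)"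
  using AE_E3[OF eq] by blast
 have Nl: "N \<in> null_sets lebesgue" "N \<subseteq> S" using N(2) S by (auto simp: null_sets_restrict_space)
 show ?thesis
 proof (rule measurableI)
  fix A :: "'b set" assume A: "A \<in> sets borel"
  have 1: "f -` A \<inter> S \<in> sets lebesgue" using measurable_sets[OF f A] S by (simp add: sets_restrict_space_iff)
  \<comment> \<open>Lebesgue measure is complete: every subset of a null set is measurable, so the
    values of \<open>g\<close> on \<open>N\<close> do not matter.\<close>
  have "g -` A \<inter> S \<inter> N \<in> null_sets lebesgue" using Nl(1) by (rule completion.complete2[rotated]) auto
  then have 2: "g -` A \<inter> S \<inter> N \<in> sets lebesgue" by auto
  have "g -` A \<inter> S = (f -` A \<inter> S - N) \<union> (g -` A \<inter> S \<inter> N)" using N(1) by auto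
  also have "\<dots> \<in> sets lebesgue" using 1 2 Nl by auto
  finally show "g -` A \<inter> space (lebesgue_on S) \<in> sets (lebesgue_on S)"
   using S by (simp add: sets_restrict_space_iff)
 qed auto
qed

text \<open>Setting everything to 0 on the exceptional null set turns convergence almost everywhere
  into convergence everywhere; the limit is then changed back on that set.\<close>

lemma borel_measurable_lebesgue_on_LIMSEQ_AE:
 fixes F :: "nat \<Rightarrow> 'a::euclidean_space \<Rightarrow> 'b::{real_normed_vector, second_countable_topology}"
 assumes S: "S \<in> sets lebesgue" and F: "\<And>j. F j \<in> borel_measurable (lebesgue_on S)"
  and lim: "AE x in lebesgue_on S. (\<lambda>j. F j x) \<longlonglongrightarrow> f x"
 shows "f \<in> borel_measurable (lebesgue_on S)"
proof -
 obtain N where N: "\<And>x. x \<in> space (lebesgue_on S) - N \<Longrightarrow> (\<lambda>j. F j x) \<longlonglongrightarrow> f x"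
  "N \<in> null_sets (lebesgue_on S)" using AE_E3[OF lim] by blast
 have [measurable]: "N \<in> sets (lebesgue_on S)" using N by auto
 note F[measurable]
 have "(\<lambda>x. if x \<in> N then 0 else f x) \<in> borel_measurable (lebesgue_on S)"
 proof (rule borel_measurable_LIMSEQ_metric)
  show "(\<lambda>x. if x \<in> N then 0 else F j x) \<in> borel_measurable (lebesgue_on S)" for j by measurable
  show "(\<lambda>j. if x \<in> N then 0 else F j x) \<longlonglongrightarrow> (if x \<in> N then 0 else f x)"
   if "x \<in> space (lebesgue_on S)" for x using N(1) that by auto
 qed
 then show ?thesis by (rule measurable_lebesgue_on_cong_AE[OF S]) (use AE_not_in[OF N(2)] in \<open>eventually_elim, auto\<close>)
qed

lemma borel_measurable_vec:
 fixes F :: "2 \<Rightarrow> 'b \<Rightarrow> real"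
 assumes "\<And>k. F k \<in> borel_measurable M"
 shows "(\<lambda>x. \<chi> k. F k x) \<in> borel_measurable M"
proof -
 have "(\<lambda>x. \<chi> k. F k x) = (\<lambda>x. F 1 x *\<^sub>R axis 1 1 + F 2 x *\<^sub>R (axis 2 1 :: real^2))"
  by (auto simp: vec_eq_iff forall_2 axis_def)
 then show ?thesis using assms by simp
qed

text \<open>The bilinear rules below carry different side conditions because the Bochner integral is
  0 off the integrable functions: scaling holds for all arguments, additivity only within
  \<open>L2\<close>.\<close>

definition ip :: "(real^2) set \<Rightarrow> (real^2 \<Rightarrow> 'a::euclidean_space) \<Rightarrow> (real^2 \<Rightarrow> 'a) \<Rightarrow> real" where
 "ip U f g = (LINT x|lebesgue_on U. f x \<bullet> g x)"

lemma tendsto_0_le: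
 fixes f g :: "nat \<Rightarrow> real"
 assumes "\<And>j. f j \<le> g j" "g \<longlonglongrightarrow> 0" "\<And>j. 0 \<le> f j"
 shows "f \<longlonglongrightarrow> 0" by (rule tendsto_sandwich[OF _ _ tendsto_const assms(2)]) (use assms in auto)

abbreviation L2_dist where
 "L2_dist U f g \<equiv> L2_norm U (\<lambda>x. f x - g x)"

abbreviation L2_lim where
 "L2_lim U F f \<equiv> (\<lambda>j::nat. L2_dist U (F j) f) \<longlonglongrightarrow> 0"

lemma L2_measurable: "L2 U f \<Longrightarrow> f \<in> borel_measurable (lebesgue_on U)"
 and L2_integrable_norm_sq: "L2 U f \<Longrightarrow> integrable (lebesgue_on U) (\<lambda>x. (norm (f x))\<^sup>2)" by (auto simp: L2_def)

lemma L2_integrable_inner: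
 assumes "L2 U f" "L2 U g"
 shows "integrable (lebesgue_on U) (\<lambda>x. f x \<bullet> g x)"
proof (rule Bochner_Integration.integrable_bound)
 show "integrable (lebesgue_on U) (\<lambda>x. (norm (f x))\<^sup>2 + (norm (g x))\<^sup>2)"
  using assms by (intro Bochner_Integration.integrable_add L2_integrable_norm_sq)
 show "(\<lambda>x. f x \<bullet> g x) \<in> borel_measurable (lebesgue_on U)" using assms[THEN L2_measurable] by measurable
 have "\<bar>a \<bullet> b\<bar> \<le> (norm a)\<^sup>2 + (norm b)\<^sup>2" for a b :: 'a
 proof -
  have "\<bar>a \<bullet> b\<bar> \<le> norm a * norm b" by (rule Cauchy_Schwarz_ineq2)
  also have "\<dots> \<le> (norm a)\<^sup>2 + (norm b)\<^sup>2"
   using sum_squares_bound[of "norm a" "norm b"] mult_nonneg_nonneg[OF norm_ge_zero norm_ge_zero, of a b]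
   by linarith
  finally show ?thesis .
 qed
 then show "AE x in lebesgue_on U. norm (f x \<bullet> g x) \<le> norm ((norm (f x))\<^sup>2 + (norm (g x))\<^sup>2)"
  by (intro AE_I2) (metis abs_ge_self order_trans real_norm_def)
qed

text \<open>Workhorse for products with a bounded factor. The first conclusion needs no sign of
  \<open>K\<close>, since the pointwise bound already makes \<open>K * norm (f x)\<close>
  nonnegative wherever it holds.\<close>

lemma L2_dominated:
 assumes f: "L2 U f" and g: "g \<in> borel_measurable (lebesgue_on U)"
  and le: "AE x in lebesgue_on U. norm (g x) \<le> K * norm (f x)"
 shows "L2 U g" and "K \<ge> 0 \<Longrightarrow> L2_norm U g \<le> K * L2_norm U f"
proof -
 have sq: "AE x in lebesgue_on U. (norm (g x))\<^sup>2 \<le> K\<^sup>2 * (norm (f x))\<^sup>2"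
  using le by eventually_elim (metis norm_ge_zero power_mono power_mult_distrib)
 have int: "integrable (lebesgue_on U) (\<lambda>x. K\<^sup>2 * (norm (f x))\<^sup>2)" using L2_integrable_norm_sq[OF f] by simp
 have "integrable (lebesgue_on U) (\<lambda>x. (norm (g x))\<^sup>2)"
 proof (rule Bochner_Integration.integrable_bound[OF int])
  show "(\<lambda>x. (norm (g x))\<^sup>2) \<in> borel_measurable (lebesgue_on U)" using g by measurable
  show "AE x in lebesgue_on U. norm ((norm (g x))\<^sup>2) \<le> norm (K\<^sup>2 * (norm (f x))\<^sup>2)" using sq by eventually_elim simp
 qed
 with g show L2g: "L2 U g" by (simp add: L2_def)
 assume "K \<ge> 0"
 have "(LINT x|lebesgue_on U. (norm (g x))\<^sup>2) \<le> (LINT x|lebesgue_on U. K\<^sup>2 * (norm (f x))\<^sup>2)"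
  by (rule integral_mono_AE[OF L2_integrable_norm_sq[OF L2g] int sq])
 then show "L2_norm U g \<le> K * L2_norm U f" using \<open>K \<ge> 0\<close> unfolding L2_norm_def
  by (metis integral_mult_right_zero real_sqrt_abs abs_of_nonneg real_sqrt_le_mono real_sqrt_mult)
qed

lemma L2_zero [simp]: "L2 U (\<lambda>x. 0)" by (simp add: L2_def)

lemma L2_add:
 assumes "L2 U f" "L2 U g"
 shows "L2 U (\<lambda>x. f x + g x)" unfolding L2_def
proof
 note [measurable] = assms[THEN L2_measurable]
 show "(\<lambda>x. f x + g x) \<in> borel_measurable (lebesgue_on U)" by measurable
 show "integrable (lebesgue_on U) (\<lambda>x. (norm (f x + g x))\<^sup>2)" using assms
  by (simp add: dot_square_norm[symmetric] inner_simps L2_integrable_inner)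
qed

lemma L2_scaleR:
 assumes "L2 U f"
 shows "L2 U (\<lambda>x. c *\<^sub>R f x)" by (rule L2_dominated(1)[OF assms, where K = "\<bar>c\<bar>"])
   (use L2_measurable[OF assms] in auto)

lemma L2_mult: "L2 U f \<Longrightarrow> L2 U (\<lambda>x. c * f x :: real)" using L2_scaleR[of U f c] by simp

lemma L2_minus: "L2 U f \<Longrightarrow> L2 U (\<lambda>x. - f x)" using L2_scaleR[of U f "-1"] by simp

lemma L2_diff: "L2 U f \<Longrightarrow> L2 U g \<Longrightarrow> L2 U (\<lambda>x. f x - g x)" using L2_add[of U f "\<lambda>x. - g x"] L2_minus[of U g] by simp

lemma L2_sum: "(\<And>i. i \<in> I \<Longrightarrow> L2 U (f i)) \<Longrightarrow> L2 U (\<lambda>x. \<Sum>i\<in>I. f i x)"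
 by (induction I rule: infinite_finite_induct) (auto intro: L2_add)

lemma L2_inner:
 assumes "L2 U f"
 shows "L2 U (\<lambda>x. f x \<bullet> b)"
proof (rule L2_dominated(1)[OF assms, where K = "norm b"])
 show "(\<lambda>x. f x \<bullet> b) \<in> borel_measurable (lebesgue_on U)" using L2_measurable[OF assms] by measurable
 show "AE x in lebesgue_on U. norm (f x \<bullet> b) \<le> norm b * norm (f x)"
  by (intro AE_I2) (metis Cauchy_Schwarz_ineq2 mult.commute real_norm_def)
qed

lemma L2_scaleR_right:
 assumes "L2 U f"
 shows "L2 U (\<lambda>x. f x *\<^sub>R b)" by (rule L2_dominated(1)[OF assms, where K = "norm b"])
   (use L2_measurable[OF assms] in \<open>auto simp: mult.commute\<close>)

lemma L2_norm:
 assumes "L2 U f"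
 shows "L2 U (\<lambda>x. norm (f x))" by (rule L2_dominated(1)[OF assms, where K = 1]) (use L2_measurable[OF assms] in auto)

lemma L2_nth: "L2 U (f :: real^2 \<Rightarrow> real^2) \<Longrightarrow> L2 U (\<lambda>x. f x $ i)"
 using L2_inner[of U f "axis i 1"] by (simp add: inner_axis)

lemma L2_componentwise:
 fixes f :: "real^2 \<Rightarrow> real^2"
 assumes "\<And>i. L2 U (\<lambda>x. f x $ i)"
 shows "L2 U f"
proof -
 have "L2 U (\<lambda>x. \<Sum>i\<in>UNIV. f x $ i *\<^sub>R (axis i 1 :: real^2))" by (intro L2_sum L2_scaleR_right assms)
 moreover have "(\<lambda>x. \<Sum>i\<in>UNIV. f x $ i *\<^sub>R (axis i 1 :: real^2)) = f"
  using basis_expansion[of "f _"] by (auto simp: fun_eq_iff scalar_mult_eq_scaleR)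
 ultimately show ?thesis by simp
qed

lemma L2_cong_AE:
 assumes "U \<in> sets lebesgue" "L2 U f" "AE x in lebesgue_on U. f x = g x"
 shows "L2 U g"
proof (rule L2_dominated(1)[OF assms(2), where K = 1])
 show "g \<in> borel_measurable (lebesgue_on U)"
  using measurable_lebesgue_on_cong_AE[OF assms(1) L2_measurable[OF assms(2)] assms(3)] .
 show "AE x in lebesgue_on U. norm (g x) \<le> 1 * norm (f x)" using assms(3) by eventually_elim simp
qed

lemma ip_commute: "ip U f g = ip U g f" by (simp add: ip_def inner_commute)

lemma ip_add_left: "L2 U f \<Longrightarrow> L2 U g \<Longrightarrow> L2 U h \<Longrightarrow> ip U (\<lambda>x. f x + g x) h = ip U f h + ip U g h"
 by (simp add: ip_def inner_simps L2_integrable_inner)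

lemma ip_diff_left: "L2 U f \<Longrightarrow> L2 U g \<Longrightarrow> L2 U h \<Longrightarrow> ip U (\<lambda>x. f x - g x) h = ip U f h - ip U g h"
 by (simp add: ip_def inner_simps L2_integrable_inner)

lemma ip_scaleR_left: "ip U (\<lambda>x. c *\<^sub>R f x) h = c * ip U f h" by (simp add: ip_def)

lemma ip_mult_left: "ip U (\<lambda>x. c * f x) h = c * ip U f (h::real^2 \<Rightarrow> real)" by (simp add: ip_def algebra_simps)

lemma ip_minus_left: "ip U (\<lambda>x. - f x) h = - ip U f h" by (simp add: ip_def)

lemma ip_zero_left [simp]: "ip U (\<lambda>x. 0) h = 0" by (simp add: ip_def)

lemma ip_add_right: "L2 U f \<Longrightarrow> L2 U g \<Longrightarrow> L2 U h \<Longrightarrow> ip U h (\<lambda>x. f x + g x) = ip U h f + ip U h g"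
 by (simp add: ip_def inner_simps L2_integrable_inner)

lemma ip_diff_right: "L2 U f \<Longrightarrow> L2 U g \<Longrightarrow> L2 U h \<Longrightarrow> ip U h (\<lambda>x. f x - g x) = ip U h f - ip U h g"
 by (simp add: ip_def inner_simps L2_integrable_inner)

lemma ip_scaleR_right: "ip U h (\<lambda>x. c *\<^sub>R f x) = c * ip U h f" by (simp add: ip_def)

lemma ip_mult_right: "ip U h (\<lambda>x. c * f x) = c * ip U (h::real^2 \<Rightarrow> real) f" by (simp add: ip_def algebra_simps)

lemma ip_minus_right: "ip U h (\<lambda>x. - f x) = - ip U h f" by (simp add: ip_def)

lemma ip_zero_right [simp]: "ip U h (\<lambda>x. 0) = 0" by (simp add: ip_def)

lemma ip_sum_left:
 "(\<And>i. i \<in> I \<Longrightarrow> L2 U (f i)) \<Longrightarrow> L2 U h \<Longrightarrow> ip U (\<lambda>x. \<Sum>i\<in>I. f i x) h = (\<Sum>i\<in>I. ip U (f i) h)"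
 by (induction I rule: infinite_finite_induct) (auto simp: ip_add_left L2_sum)

lemma ip_sum_right:
 "(\<And>i. i \<in> I \<Longrightarrow> L2 U (f i)) \<Longrightarrow> L2 U h \<Longrightarrow> ip U h (\<lambda>x. \<Sum>i\<in>I. f i x) = (\<Sum>i\<in>I. ip U h (f i))"
 by (simp add: ip_commute[of U h] ip_sum_left)

lemmas L2_intros = L2_add L2_diff L2_scaleR L2_mult L2_minus L2_sum

lemmas ip_simps = ip_add_left ip_diff_left ip_scaleR_left ip_mult_left ip_minus_left
 ip_add_right ip_diff_right ip_scaleR_right ip_mult_right ip_minus_right

lemma ip_cong_AE:
 assumes "U \<in> sets lebesgue" "f \<in> borel_measurable (lebesgue_on U)" "g \<in> borel_measurable (lebesgue_on U)"
  and f: "AE x in lebesgue_on U. f x = f' x" and g: "AE x in lebesgue_on U. g x = g' x"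
 shows "ip U f g = ip U f' g'" unfolding ip_def
proof (rule integral_cong_AE)
 note [measurable] = assms(2,3) measurable_lebesgue_on_cong_AE[OF assms(1,2) f]
  measurable_lebesgue_on_cong_AE[OF assms(1,3) g]
 show "(\<lambda>x. f x \<bullet> g x) \<in> borel_measurable (lebesgue_on U)"
  "(\<lambda>x. f' x \<bullet> g' x) \<in> borel_measurable (lebesgue_on U)" by measurable
 show "AE x in lebesgue_on U. f x \<bullet> g x = f' x \<bullet> g' x" using f g by eventually_elim simp
qed

lemma L2_norm_nonneg [simp]: "0 \<le> L2_norm U f" by (simp add: L2_norm_def)

lemma L2_norm_sq: "(L2_norm U f)\<^sup>2 = ip U f f" by (simp add: L2_norm_def ip_def dot_square_norm)

lemma ip_self_nonneg [simp]: "0 \<le> ip U f f" by (simp add: ip_def)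

lemma L2_norm_zero [simp]: "L2_norm U (\<lambda>x. 0) = 0" by (simp add: L2_norm_def)

lemma L2_norm_scaleR: "L2_norm U (\<lambda>x. c *\<^sub>R f x) = \<bar>c\<bar> * L2_norm U f"
 by (simp add: L2_norm_def power_mult_distrib real_sqrt_mult)

lemma L2_norm_mult: "L2_norm U (\<lambda>x. c * f x :: real) = \<bar>c\<bar> * L2_norm U f" using L2_norm_scaleR[of U c f] by simp

lemma L2_norm_uminus: "L2_norm U (\<lambda>x. - f x) = L2_norm U f" by (simp add: L2_norm_def)

lemma L2_norm_minus_commute: "L2_dist U f g = L2_dist U g f" by (simp add: L2_norm_def norm_minus_commute)

lemma L2_norm_norm: "L2_norm U (\<lambda>x. norm (f x)) = L2_norm U f" by (simp add: L2_norm_def)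

text \<open>The square of \<open>f - t g\<close> is nonnegative for every real \<open>t\<close>; the
  optimal \<open>t\<close> exists unless \<open>g\<close> has norm 0.\<close>

lemma ip_Cauchy_Schwarz:
 assumes "L2 U f" "L2 U g"
 shows "\<bar>ip U f g\<bar> \<le> L2_norm U f * L2_norm U g"
proof -
 have quad: "0 \<le> ip U f f - 2 * t * ip U f g + t\<^sup>2 * ip U g g" for t
 proof -
  have "0 \<le> ip U (\<lambda>x. f x - t *\<^sub>R g x) (\<lambda>x. f x - t *\<^sub>R g x)" by simp
  also have "\<dots> = ip U f f - 2 * t * ip U f g + t\<^sup>2 * ip U g g"
   using assms by (simp add: ip_simps L2_intros ip_commute[of U g f] power2_eq_square algebra_simps)
  finally show ?thesis .
 qed
 have "(ip U f g)\<^sup>2 \<le> ip U f f * ip U g g"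
 proof (cases "ip U g g = 0")
  case True
  have "ip U f g = 0"
  proof (rule ccontr)
   assume "ip U f g \<noteq> 0"
   \<comment> \<open>For norm 0 the quadratic in \<open>t\<close> is affine, and at this
     \<open>t\<close> it equals -1.\<close>
   with quad[of "(ip U f f + 1) / (2 * ip U f g)"] True show False by (simp add: field_simps)
  qed
  then show ?thesis using True by simp
 next
  case False
  then have pos: "ip U g g > 0" using ip_self_nonneg[of U g] by linarith
  have "ip U f f - 2 * (ip U f g / ip U g g) * ip U f g + (ip U f g / ip U g g)\<^sup>2 * ip U g g
    = ip U f f - (ip U f g)\<^sup>2 / ip U g g" using pos by (simp add: field_simps power2_eq_square)
  then have "(ip U f g)\<^sup>2 / ip U g g \<le> ip U f f" using quad[of "ip U f g / ip U g g"] by linarith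
  then show ?thesis using pos by (simp add: divide_le_eq)
 qed
 then have "(ip U f g)\<^sup>2 \<le> (L2_norm U f * L2_norm U g)\<^sup>2" by (simp add: power_mult_distrib L2_norm_sq)
 then show ?thesis by (metis L2_norm_nonneg abs_le_square_iff abs_of_nonneg mult_nonneg_nonneg)
qed

lemma L2_norm_triangle:
 assumes "L2 U f" "L2 U g"
 shows "L2_norm U (\<lambda>x. f x + g x) \<le> L2_norm U f + L2_norm U g"
proof (rule power2_le_imp_le)
 show "(L2_norm U (\<lambda>x. f x + g x))\<^sup>2 \<le> (L2_norm U f + L2_norm U g)\<^sup>2" using ip_Cauchy_Schwarz[OF assms] assms
  by (simp add: power2_sum L2_norm_sq ip_simps L2_intros ip_commute[of U g f])
qed simp

lemma L2_norm_triangle_diff: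
 assumes "L2 U f" "L2 U g"
 shows "L2_dist U f g \<le> L2_norm U f + L2_norm U g"
 using L2_norm_triangle[OF assms(1) L2_minus[OF assms(2)]] by (simp add: L2_norm_uminus)

lemma L2_norm_triangle3:
 assumes "L2 U f" "L2 U g" "L2 U h"
 shows "L2_dist U f h \<le> L2_dist U f g + L2_dist U g h"
 using L2_norm_triangle[of U "\<lambda>x. f x - g x" "\<lambda>x. g x - h x"] assms by (simp add: L2_diff)

lemma L2_norm_triangle_rev:
 assumes "L2 U f" "L2 U g"
 shows "\<bar>L2_norm U f - L2_norm U g\<bar> \<le> L2_dist U f g"
 using L2_norm_triangle[of U "\<lambda>x. f x - g x" g] L2_norm_triangle[of U "\<lambda>x. g x - f x" f] assms
  L2_norm_minus_commute[of U f g] by (auto simp: L2_diff)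

lemma L2_norm_sum:
 "(\<And>i. i \<in> I \<Longrightarrow> L2 U (f i)) \<Longrightarrow> L2_norm U (\<lambda>x. \<Sum>i\<in>I. f i x) \<le> (\<Sum>i\<in>I. L2_norm U (f i))"
proof (induction I rule: infinite_finite_induct)
 case (insert i I)
 have "L2_norm U (\<lambda>x. f i x + (\<Sum>i\<in>I. f i x)) \<le> L2_norm U (f i) + L2_norm U (\<lambda>x. \<Sum>i\<in>I. f i x)"
  using insert by (intro L2_norm_triangle L2_sum) auto
 with insert show ?case by force
qed auto

lemma L2_norm_eq_0_iff:
 assumes "L2 U f"
 shows "L2_norm U f = 0 \<longleftrightarrow> (AE x in lebesgue_on U. f x = 0)"
 using integral_nonneg_eq_0_iff_AE[OF L2_integrable_norm_sq[OF assms]] by (simp add: L2_norm_def)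

lemma L2_norm_cong_AE:
 assumes "U \<in> sets lebesgue" "L2 U f" "AE x in lebesgue_on U. f x = g x"
 shows "L2_norm U f = L2_norm U g"
proof -
 have "(L2_norm U f)\<^sup>2 = (L2_norm U g)\<^sup>2"
  unfolding L2_norm_sq using assms by (intro ip_cong_AE) (auto dest: L2_measurable)
 then show ?thesis by simp
qed

text \<open>Scalar dominated convergence for the squared distance, with four times the square of
  \<open>h\<close> as majorant.\<close>

lemma L2_dominated_convergence:
 assumes F: "\<And>j. F j \<in> borel_measurable (lebesgue_on U)" and f: "f \<in> borel_measurable (lebesgue_on U)"
  and h: "L2 U h" and le: "\<And>j. AE x in lebesgue_on U. norm (F j x) \<le> norm (h x)"
  and lim: "AE x in lebesgue_on U. (\<lambda>j. F j x) \<longlonglongrightarrow> f x"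
 shows "L2 U f" "\<And>j. L2 U (F j)" "L2_lim U F f"
proof -
 have le': "AE x in lebesgue_on U. \<forall>j. norm (F j x) \<le> norm (h x)" using le by (simp add: AE_all_countable)
 then have lef: "AE x in lebesgue_on U. norm (f x) \<le> norm (h x)" using lim
 proof eventually_elim
  case (elim x)
  then show ?case by (intro LIMSEQ_le_const2[OF tendsto_norm[OF elim(2)]]) auto
 qed
 then show Lf: "L2 U f" by (intro L2_dominated(1)[OF h f, where K = 1]) simp
 show "L2 U (F j)" for j using le[of j] by (intro L2_dominated(1)[OF h F, where K = 1]) simp
 note [measurable] = F f L2_measurable[OF h]
 have "(\<lambda>j. LINT x|lebesgue_on U. (norm (F j x - f x))\<^sup>2) \<longlonglongrightarrow> (LINT x|lebesgue_on U. 0)"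
 proof (rule integral_dominated_convergence[where w = "\<lambda>x. 4 * (norm (h x))\<^sup>2"])
  show "AE x in lebesgue_on U. (\<lambda>j. (norm (F j x - f x))\<^sup>2) \<longlonglongrightarrow> 0" using lim
  proof eventually_elim
   case (elim x)
   from tendsto_power[OF tendsto_norm[OF tendsto_diff[OF elim tendsto_const[of "f x"]]], of 2]
   show ?case by simp
  qed
  show "AE x in lebesgue_on U. norm ((norm (F j x - f x))\<^sup>2) \<le> 4 * (norm (h x))\<^sup>2" for j using le' lef
  proof eventually_elim
   case (elim x)
   have "norm (F j x - f x) \<le> 2 * norm (h x)"
    using elim(1)[rule_format, of j] elim(2) norm_triangle_ineq4[of "F j x" "f x"] by linarith
   then have "(norm (F j x - f x))\<^sup>2 \<le> (2 * norm (h x))\<^sup>2" by (intro power_mono) auto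
   then show ?case by (simp add: power_mult_distrib)
  qed
 qed (use L2_integrable_norm_sq[OF h] in auto)
 then have "(\<lambda>j. sqrt (LINT x|lebesgue_on U. (norm (F j x - f x))\<^sup>2)) \<longlonglongrightarrow> sqrt 0" by (intro tendsto_real_sqrt) simp
 then show "L2_lim U F f" by (simp add: L2_norm_def)
qed

lemma L2_AE_subseq:
 assumes F: "\<And>j. L2 U (F j)" and f: "L2 U f"
  and lim: "L2_lim U F f"
 obtains r where "strict_mono r" "AE x in lebesgue_on U. (\<lambda>j. F (r j) x) \<longlonglongrightarrow> f x"
proof -
 have "(\<lambda>j. (L2_dist U (F j) f)\<^sup>2) \<longlonglongrightarrow> 0\<^sup>2" by (intro tendsto_power lim)
 then have "(\<lambda>j. LINT x|lebesgue_on U. norm ((norm (F j x - f x))\<^sup>2)) \<longlonglongrightarrow> 0"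
  by (simp add: L2_norm_sq ip_def dot_square_norm)
 from tendsto_L1_AE_subseq[OF L2_integrable_norm_sq[OF L2_diff[OF F f]] this]
 obtain r where r: "strict_mono r" "AE x in lebesgue_on U. (\<lambda>j. (norm (F (r j) x - f x))\<^sup>2) \<longlonglongrightarrow> 0" by blast
 from r(2) have "AE x in lebesgue_on U. (\<lambda>j. F (r j) x) \<longlonglongrightarrow> f x"
 proof eventually_elim
  case (elim x)
  from tendsto_real_sqrt[OF elim] show ?case by (simp add: tendsto_norm_zero_iff LIM_zero_iff)
 qed
 with r(1) that show ?thesis by blast
qed

lemma tendsto_ip_left:
 assumes F: "\<And>j. L2 U (F j)" and f: "L2 U f" and g: "L2 U g"
  and lim: "((\<lambda>j. L2_dist U (F j) f) \<longlongrightarrow> 0) A"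
 shows "((\<lambda>j. ip U (F j) g) \<longlongrightarrow> ip U f g) A"
proof (rule LIM_zero_cancel, rule Lim_null_comparison)
 show "\<forall>\<^sub>F j in A. norm (ip U (F j) g - ip U f g) \<le> L2_dist U (F j) f * L2_norm U g"
  using ip_Cauchy_Schwarz[OF L2_diff[OF F f] g] F f g by (simp add: ip_simps)
 show "((\<lambda>j. L2_dist U (F j) f * L2_norm U g) \<longlongrightarrow> 0) A" using tendsto_mult_right[OF lim, of "L2_norm U g"] by simp
qed

lemma tendsto_ip_right:
 assumes "\<And>j. L2 U (F j)" "L2 U f" "L2 U g" "((\<lambda>j. L2_dist U (F j) f) \<longlongrightarrow> 0) A"
 shows "((\<lambda>j. ip U g (F j)) \<longlongrightarrow> ip U g f) A" using tendsto_ip_left[OF assms] by (simp add: ip_commute)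

lemma tendsto_L2_norm:
 assumes "\<And>j. L2 U (F j)" "L2 U f" "((\<lambda>j. L2_dist U (F j) f) \<longlongrightarrow> 0) A"
 shows "((\<lambda>j. L2_norm U (F j)) \<longlongrightarrow> L2_norm U f) A"
proof (rule LIM_zero_cancel, rule Lim_null_comparison)
 show "\<forall>\<^sub>F j in A. norm (L2_norm U (F j) - L2_norm U f) \<le> L2_dist U (F j) f"
  using L2_norm_triangle_rev[OF assms(1,2)] by simp
qed (rule assms(3))

text \<open>The Riesz-Fischer argument, for geometrically decreasing increments only, which is the
  form in which completeness is applied to dyadic sequences of times. The partial sums
  \<open>S n\<close> of the increments increase to a square integrable \<open>g\<close> by monotone
  convergence, so the series converges absolutely almost everywhere and
  \<open>norm (F 0 x) + g x\<close> dominates the sequence.\<close>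

lemma L2_complete:
 fixes F :: "nat \<Rightarrow> real^2 \<Rightarrow> 'a::euclidean_space"
 assumes U: "U \<in> sets lebesgue" and F: "\<And>j. L2 U (F j)"
  and cauchy: "\<And>j. L2_dist U (F (Suc j)) (F j) \<le> C * (1/2)^j"
 obtains f where "L2 U f" "L2_lim U F f"
proof -
 define D where "D j x = norm (F (Suc j) x - F j x)" for j x
 have D: "L2 U (D j)" for j unfolding D_def by (intro L2_norm L2_diff F)
 note [measurable] = L2_measurable[OF D] L2_measurable[OF F]
 have C: "C \<ge> 0" using order_trans[OF L2_norm_nonneg cauchy[of 0]] by simp
 define S where "S n x = (\<Sum>j<n. D j x)" for n x
 have S: "L2 U (S n)" for n unfolding S_def by (intro L2_sum D)
 note [measurable] = L2_measurable[OF S]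
 have S_nonneg: "S n x \<ge> 0" for n x by (auto simp: S_def D_def intro: sum_nonneg)
 have S_mono: "S n x \<le> S (Suc n) x" for n x by (simp add: S_def D_def)
 have S_bound: "L2_norm U (S n) \<le> 2 * C" for n
 proof -
  have "L2_norm U (S n) \<le> (\<Sum>j<n. L2_norm U (D j))" unfolding S_def by (intro L2_norm_sum D)
  also have "\<dots> \<le> (\<Sum>j<n. C * (1/2)^j)" using cauchy by (intro sum_mono) (simp add: D_def[abs_def] L2_norm_norm)
  also have "\<dots> = C * (\<Sum>j<n. (1/2)^j)" by (simp add: sum_distrib_left)
  also have "\<dots> \<le> C * 2" using C by (intro mult_left_mono) (auto simp: sum_gp_strict)
  finally show ?thesis by simp
 qed
 define G where "G x = (SUP n. ennreal ((S n x)\<^sup>2))" for x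
 have [measurable]: "G \<in> borel_measurable (lebesgue_on U)" unfolding G_def by measurable
 have "(\<integral>\<^sup>+x. G x \<partial>lebesgue_on U) = (SUP n. \<integral>\<^sup>+x. ennreal ((S n x)\<^sup>2) \<partial>lebesgue_on U)" unfolding G_def
  by (intro nn_integral_monotone_convergence_SUP)
    (auto simp: incseq_Suc_iff le_fun_def intro!: ennreal_leI power_mono S_mono S_nonneg)
 also have "\<dots> \<le> ennreal ((2 * C)\<^sup>2)"
 proof (rule SUP_least)
  fix n
  have "(\<integral>\<^sup>+x. ennreal ((S n x)\<^sup>2) \<partial>lebesgue_on U) = ennreal (LINT x|lebesgue_on U. (S n x)\<^sup>2)"
   using L2_integrable_norm_sq[OF S] by (intro nn_integral_eq_integral) auto
  also have "(LINT x|lebesgue_on U. (S n x)\<^sup>2) = (L2_norm U (S n))\<^sup>2"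
   by (simp only: L2_norm_sq) (simp add: ip_def power2_eq_square)
  also have "\<dots> \<le> (2 * C)\<^sup>2" using S_bound by (intro power_mono) auto
  finally show "(\<integral>\<^sup>+x. ennreal ((S n x)\<^sup>2) \<partial>lebesgue_on U) \<le> ennreal ((2 * C)\<^sup>2)" by (simp add: ennreal_leI)
 qed
 finally have intG: "(\<integral>\<^sup>+x. G x \<partial>lebesgue_on U) \<le> ennreal ((2 * C)\<^sup>2)" .
 then have finG: "AE x in lebesgue_on U. G x \<noteq> \<infinity>" by (intro nn_integral_PInf_AE) (auto simp: top_unique)
 define g where "g x = sqrt (enn2real (G x))" for x
 have g2: "AE x in lebesgue_on U. ennreal ((g x)\<^sup>2) = G x" using finG by eventually_elim (auto simp: g_def less_top)
 have Lg: "L2 U g" unfolding L2_def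
 proof
  show "g \<in> borel_measurable (lebesgue_on U)" unfolding g_def by measurable
  then show "integrable (lebesgue_on U) (\<lambda>x. (norm (g x))\<^sup>2)" using intG nn_integral_cong_AE[OF g2]
   by (intro integrableI_bounded) (auto simp: order_le_less_trans)
 qed
 have SG: "AE x in lebesgue_on U. \<forall>n. S n x \<le> g x" using g2
 proof eventually_elim
  case (elim x)
  show ?case
  proof
   fix n
   have "ennreal ((S n x)\<^sup>2) \<le> G x" unfolding G_def by (rule SUP_upper) simp
   then have "(S n x)\<^sup>2 \<le> (g x)\<^sup>2" using elim by (metis ennreal_le_iff zero_le_power2)
   then show "S n x \<le> g x" by (rule power2_le_imp_le) (simp add: g_def)
  qed
 qed
 have tele: "F n x = F 0 x + (\<Sum>j<n. F (Suc j) x - F j x)" for n x by (induction n) auto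
 have conv: "AE x in lebesgue_on U. convergent (\<lambda>n. F n x)" using SG
 proof eventually_elim
  case (elim x)
  have "summable (\<lambda>j. norm (F (Suc j) x - F j x))"
   using elim by (intro summableI_nonneg_bounded[where x = "g x"]) (auto simp: S_def D_def)
  then have "summable (\<lambda>j. F (Suc j) x - F j x)" by (rule summable_norm_cancel)
  then have "convergent (\<lambda>n. \<Sum>j<n. F (Suc j) x - F j x)" by (simp add: summable_iff_convergent)
  then have "convergent (\<lambda>n. F 0 x + (\<Sum>j<n. F (Suc j) x - F j x))" by (intro convergent_add convergent_const)
  then show ?case by (simp only: tele[symmetric])
 qed
 define f where "f x = lim (\<lambda>n. F n x)" for x
 have lim: "AE x in lebesgue_on U. (\<lambda>n. F n x) \<longlonglongrightarrow> f x"
  using conv by eventually_elim (simp add: f_def convergent_LIMSEQ_iff)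
 have mf: "f \<in> borel_measurable (lebesgue_on U)"
  by (rule borel_measurable_lebesgue_on_LIMSEQ_AE[OF U L2_measurable[OF F] lim])
 have Lh: "L2 U (\<lambda>x. norm (F 0 x) + g x)" by (intro L2_add L2_norm F Lg)
 have dom: "AE x in lebesgue_on U. norm (F n x) \<le> norm (norm (F 0 x) + g x)" for n using SG
 proof eventually_elim
  case (elim x)
  have "norm (F n x) \<le> norm (F 0 x) + norm (\<Sum>j<n. F (Suc j) x - F j x)"
   using tele[of n x] norm_triangle_ineq by metis
  also have "\<dots> \<le> norm (F 0 x) + S n x" by (simp add: S_def D_def norm_sum)
  also have "\<dots> \<le> norm (F 0 x) + g x" using elim by simp
  finally show ?case by simp
 qed
 show ?thesis by (rule that[OF L2_dominated_convergence(1,3)[OF L2_measurable[OF F] mf Lh dom lim]])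
qed

section \<open>Smooth functions\<close>

text \<open>The derivative is quantified existentially instead of being written as
  \<open>deriv f\<close>: the closure properties then follow by one induction on \<open>k\<close>,
  with an explicit derivative at each level.\<close>

primrec Cr :: "nat \<Rightarrow> (real \<Rightarrow> real) \<Rightarrow> bool" where
 "Cr 0 f \<longleftrightarrow> continuous_on UNIV f"
| "Cr (Suc k) f \<longleftrightarrow> (\<exists>f'. (\<forall>x. (f has_real_derivative f' x) (at x)) \<and> Cr k f')"

definition smooth :: "(real \<Rightarrow> real) \<Rightarrow> bool" where
 "smooth f \<longleftrightarrow> (\<forall>k. Cr k f)"

lemma Cr_SucI: "(\<And>x. (f has_real_derivative f' x) (at x)) \<Longrightarrow> Cr k f' \<Longrightarrow> Cr (Suc k) f" by auto

lemma Cr_SucE: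
 assumes "Cr (Suc k) f"
 obtains f' where "\<And>x. (f has_real_derivative f' x) (at x)" "Cr k f'" using assms by auto

lemma Cr_Suc_imp: "Cr (Suc k) f \<Longrightarrow> Cr k f"
proof (induction k arbitrary: f)
 case 0
 then show ?case by (auto intro!: continuous_at_imp_continuous_on intro: DERIV_isCont)
next
 case (Suc k)
 obtain f' where "\<And>x. (f has_real_derivative f' x) (at x)" "Cr (Suc k) f'"
  using Suc.prems unfolding Cr.simps by blast
 with Suc.IH show ?case by (intro Cr_SucI[of f f']) auto
qed

lemma Cr_const: "Cr k (\<lambda>x. c)"
proof (induction k arbitrary: c)
 case (Suc k)
 then show ?case by (intro Cr_SucI[where f' = "\<lambda>_. 0"]) auto
qed auto

lemma Cr_ident: "Cr k (\<lambda>x. x)"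
proof (cases k)
 case (Suc j)
 then show ?thesis by (auto intro!: exI[of _ "\<lambda>_. 1"] Cr_const)
qed auto

lemma Cr_add: "Cr k f \<Longrightarrow> Cr k g \<Longrightarrow> Cr k (\<lambda>x. f x + g x)"
proof (induction k arbitrary: f g)
 case (Suc k)
 obtain f' g' where "\<And>x. (f has_real_derivative f' x) (at x)" "Cr k f'"
  "\<And>x. (g has_real_derivative g' x) (at x)" "Cr k g'" using Suc.prems unfolding Cr.simps by blast
 with Suc.IH show ?case by (intro Cr_SucI[where f' = "\<lambda>x. f' x + g' x"] DERIV_add) auto
qed (auto intro: continuous_intros)

lemma Cr_mult: "Cr k f \<Longrightarrow> Cr k g \<Longrightarrow> Cr k (\<lambda>x. f x * g x)"
proof (induction k arbitrary: f g)
 case (Suc k)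
 obtain f' g' where *: "\<And>x. (f has_real_derivative f' x) (at x)" "Cr k f'"
  "\<And>x. (g has_real_derivative g' x) (at x)" "Cr k g'" using Suc.prems unfolding Cr.simps by blast
 show ?case
 proof (rule Cr_SucI)
  show "((\<lambda>x. f x * g x) has_real_derivative f' x * g x + g' x * f x) (at x)" for x
   using * by (intro DERIV_mult) auto
  show "Cr k (\<lambda>x. f' x * g x + g' x * f x)"
   by (intro Cr_add Suc.IH * Cr_Suc_imp[OF Suc.prems(1)] Cr_Suc_imp[OF Suc.prems(2)])
 qed
qed (auto intro: continuous_intros)

lemma Cr_minus: "Cr k f \<Longrightarrow> Cr k (\<lambda>x. - f x)" using Cr_mult[OF Cr_const[of k "-1"]] by simp

lemma Cr_inverse: "Cr k f \<Longrightarrow> (\<And>x. f x \<noteq> 0) \<Longrightarrow> Cr k (\<lambda>x. inverse (f x))"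
proof (induction k arbitrary: f)
 case (Suc k)
 obtain f' where *: "\<And>x. (f has_real_derivative f' x) (at x)" "Cr k f'" using Suc.prems unfolding Cr.simps by blast
 show ?case
 proof (rule Cr_SucI)
  show "((\<lambda>x. inverse (f x)) has_real_derivative - (inverse (f x) * f' x * inverse (f x))) (at x)" for x
   using * Suc.prems by (intro DERIV_inverse') auto
  show "Cr k (\<lambda>x. - (inverse (f x) * f' x * inverse (f x)))"
   using * Suc.IH[OF Cr_Suc_imp[OF Suc.prems(1)] Suc.prems(2)] by (intro Cr_minus Cr_mult)
 qed
qed (auto intro!: continuous_intros)

lemma Cr_compose: "Cr k f \<Longrightarrow> Cr k g \<Longrightarrow> Cr k (\<lambda>x. f (g x))"
proof (induction k arbitrary: f g)
 case 0
 then show ?case by (auto intro: continuous_on_compose2)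
next
 case (Suc k)
 obtain f' g' where *: "\<And>x. (f has_real_derivative f' x) (at x)" "Cr k f'"
  "\<And>x. (g has_real_derivative g' x) (at x)" "Cr k g'" using Suc.prems unfolding Cr.simps by blast
 show ?case
 proof (rule Cr_SucI)
  show "((\<lambda>x. f (g x)) has_real_derivative f' (g x) * g' x) (at x)" for x
   using DERIV_chain2[of f "f' (g x)" g x "g' x" UNIV] * by simp
  show "Cr k (\<lambda>x. f' (g x) * g' x)" by (rule Cr_mult[OF Suc.IH[OF *(2) Cr_Suc_imp[OF Suc.prems(2)]] *(4)])
 qed
qed

text \<open>A family closed under differentiation consists of smooth functions. This avoids explicit
  formulas for the higher derivatives of \<open>sin\<close> and \<open>flat\<close>.\<close>

lemma Cr_coinduct:
 assumes "f \<in> S" and "\<And>f. f \<in> S \<Longrightarrow> \<exists>f'\<in>S. \<forall>x. (f has_real_derivative f' x) (at x)"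
 shows "Cr k f" using assms(1)
proof (induction k arbitrary: f)
 case 0
 obtain f' where "\<forall>x. (f has_real_derivative f' x) (at x)" using assms(2)[OF 0] by blast
 then show ?case by (auto intro!: continuous_at_imp_continuous_on intro: DERIV_isCont)
next
 case (Suc k)
 then show ?case using assms(2)[OF Suc.prems] by auto
qed

lemma smooth_const: "smooth (\<lambda>x. c)"
 and smooth_ident: "smooth (\<lambda>x. x)"
 and smooth_add: "smooth f \<Longrightarrow> smooth g \<Longrightarrow> smooth (\<lambda>x. f x + g x)"
 and smooth_mult: "smooth f \<Longrightarrow> smooth g \<Longrightarrow> smooth (\<lambda>x. f x * g x)"
 and smooth_minus: "smooth f \<Longrightarrow> smooth (\<lambda>x. - f x)"
 and smooth_inverse: "smooth f \<Longrightarrow> (\<And>x. f x \<noteq> 0) \<Longrightarrow> smooth (\<lambda>x. inverse (f x))"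
 and smooth_compose: "smooth f \<Longrightarrow> smooth g \<Longrightarrow> smooth (\<lambda>x. f (g x))" unfolding smooth_def
 by (blast intro: Cr_const Cr_ident Cr_add Cr_mult Cr_minus Cr_inverse Cr_compose)+

lemma smooth_diff: "smooth f \<Longrightarrow> smooth g \<Longrightarrow> smooth (\<lambda>x. f x - g x)"
 using smooth_add[of f "\<lambda>x. - g x"] smooth_minus[of g] by simp

lemma smooth_sin: "smooth sin" and smooth_cos: "smooth cos"
proof -
 let ?S = "{sin, cos, \<lambda>x. - sin x, \<lambda>x. - cos x :: real}"
 have d: "\<forall>x. (sin has_real_derivative cos x) (at x)" "\<forall>x. (cos has_real_derivative - sin x) (at x)"
  "\<forall>x. ((\<lambda>x. - sin x) has_real_derivative - cos x) (at x)"
  "\<forall>x. ((\<lambda>x. - cos x) has_real_derivative sin x) (at x)" by (auto intro!: derivative_eq_intros)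
 have *: "\<exists>f'\<in>?S. \<forall>x. (f has_real_derivative f' x) (at x)" if f: "f \<in> ?S" for f
 proof -
  consider "f = sin" | "f = cos" | "f = (\<lambda>x. - sin x)" | "f = (\<lambda>x. - cos x)" using f by auto
  then show ?thesis
  proof cases
   case 1 then show ?thesis using d(1) by (intro bexI[of _ cos]) simp_all
  next
   case 2 then show ?thesis using d(2) by (intro bexI[of _ "\<lambda>x. - sin x"]) simp_all
  next
   case 3 then show ?thesis using d(3) by (intro bexI[of _ "\<lambda>x. - cos x"]) simp_all
  next
   case 4 then show ?thesis using d(4) by (intro bexI[of _ sin]) simp_all
  qed
 qed
 have "Cr k sin" "Cr k cos" for k by (rule Cr_coinduct[OF _ *, of _ k]; simp)+
 then show "smooth sin" "smooth cos" by (simp_all add: smooth_def)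
qed

text \<open>Bridge to \<open>time_test\<close>, which speaks of iterated
  \<open>deriv\<close>.\<close>

lemma smooth_higher_deriv:
 assumes "smooth f"
 shows "(deriv ^^ k) f field_differentiable (at x)"
proof -
 have "smooth ((deriv ^^ k) f)"
 proof (induction k)
  case (Suc k)
  show ?case unfolding smooth_def
  proof
   fix j
   obtain f' where f': "\<And>x. ((deriv ^^ k) f has_real_derivative f' x) (at x)" "Cr j f'"
    using Suc unfolding smooth_def by (metis Cr_SucE)
   then have "deriv ((deriv ^^ k) f) = f'" by (auto simp: fun_eq_iff DERIV_imp_deriv)
   then show "Cr j ((deriv ^^ Suc k) f)" using f' by simp
  qed
 qed (use assms in auto)
 then have "Cr (Suc 0) ((deriv ^^ k) f)" by (auto simp: smooth_def simp del: Cr.simps)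
 then show ?thesis by (auto simp: field_differentiable_def)
qed

definition flat :: "real \<Rightarrow> real" where
 "flat x = (if x > 0 then exp (- inverse x) else 0)"

text \<open>For x > 0 every derivative is a polynomial in 1/x times exp(-1/x), and these tend to 0
  at the origin because the exponential beats every polynomial. Extended by 0 they form a family
  \<open>F\<close> closed under differentiation.\<close>

lemma smooth_flat: "smooth flat"
proof -
 define F where "F p x = (if x > 0 then poly p (inverse x) * exp (- inverse x) else 0)"
  for p :: "real poly" and x :: real
 have lim: "((\<lambda>x::real. poly p (inverse x) * exp (- inverse x)) \<longlongrightarrow> 0) (at_right 0)" for p :: "real poly"
 proof -
  have "((\<lambda>y::real. poly p y * exp (- y)) \<longlongrightarrow> 0) at_top"
  proof -
   have "((\<lambda>y::real. \<Sum>i\<le>degree p. coeff p i * (y ^ i / exp y)) \<longlongrightarrow> (\<Sum>i\<le>degree p. coeff p i * 0)) at_top"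
    by (intro tendsto_sum tendsto_mult tendsto_const tendsto_power_div_exp_0)
   then show ?thesis by (simp add: poly_altdef exp_minus sum_distrib_right divide_inverse mult.assoc)
  qed
  then show ?thesis by (simp add: filterlim_at_top_to_right)
 qed
 have F: "\<exists>f'\<in>range F. \<forall>x. (f has_real_derivative f' x) (at x)" if f: "f \<in> range F" for f
 proof -
  from f obtain p where p: "f = F p" by auto
  \<comment> \<open>Chain rule with y = 1/x, whose derivative is minus y squared: p(y) exp(-y) has
    y-derivative (p' - p)(y) exp(-y).\<close>
  define q where "q = [:0, 0, 1:] * (p - pderiv p)"
  have "(F p has_real_derivative F q x) (at x)" for x
  proof -
   consider "x > 0" | "x < 0" | "x = 0" by linarith
   then show ?thesis
   proof cases
    case 1
    have "((\<lambda>x. poly p (inverse x) * exp (- inverse x)) has_real_derivative F q x) (at x)"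
     using 1 by (auto intro!: derivative_eq_intros simp: F_def q_def field_simps power2_eq_square)
    moreover have "\<forall>\<^sub>F y in nhds x. F p y = poly p (inverse y) * exp (- inverse y)"
     using eventually_gt_at_top[of 0] 1 eventually_nhds_in_open[of "{0<..}" x]
     by (auto simp: F_def elim!: eventually_mono)
    ultimately show ?thesis by (simp add: DERIV_cong_ev)
   next
    case 2
    have "\<forall>\<^sub>F y in nhds x. F p y = 0" using 2 eventually_nhds_in_open[of "{..<0}" x]
     by (auto simp: F_def elim!: eventually_mono)
    moreover have "F q x = 0" using 2 by (simp add: F_def)
    ultimately show ?thesis using DERIV_const[of 0 "at x"] by (simp add: DERIV_cong_ev[of x x "F p" "\<lambda>_. 0" 0 0])
   next
    case 3
    have "((\<lambda>h. F p h / h) \<longlongrightarrow> 0) (at_right 0)"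
    proof (rule Lim_transform_eventually)
     show "((\<lambda>x. poly ([:0, 1:] * p) (inverse x) * exp (- inverse x)) \<longlongrightarrow> 0) (at_right 0)" by (rule lim)
     show "\<forall>\<^sub>F x in at_right 0. poly ([:0, 1:] * p) (inverse x) * exp (- inverse x) = F p x / x"
      using eventually_at_right_less[of 0] by eventually_elim (auto simp: F_def field_simps)
    qed
    moreover have "((\<lambda>h. F p h / h) \<longlongrightarrow> 0) (at_left 0)" by (rule Lim_transform_eventually[OF tendsto_const])
       (auto simp: eventually_at_filter F_def)
    ultimately have "((\<lambda>h. F p h / h) \<longlongrightarrow> 0) (at 0)" by (simp add: filterlim_split_at)
    with 3 show ?thesis by (simp add: DERIV_def F_def)
   qed
  qed
  then show ?thesis using p by auto
 qed
 have "flat = F 1" by (auto simp: flat_def F_def)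
 then have "flat \<in> range F" by auto
 then show ?thesis unfolding smooth_def using Cr_coinduct[OF _ F] by blast
qed

text \<open>A smooth transition from 0 on the negative axis to 1 beyond 1. The denominator never
  vanishes, since \<open>x\<close> or \<open>1 - x\<close> is positive. It serves for cutoffs in
  space and, rescaled, for mollifiers in time.\<close>

definition step :: "real \<Rightarrow> real" where
 "step x = flat x * inverse (flat x + flat (1 - x))"

lemma flat_nonneg: "flat x \<ge> 0" and flat_pos: "x > 0 \<Longrightarrow> flat x > 0" by (auto simp: flat_def)

lemma step_denom_pos: "flat x + flat (1 - x) > 0"
 using flat_pos[of x] flat_pos[of "1 - x"] flat_nonneg[of x] flat_nonneg[of "1 - x"]
 by (cases "x > 0") (auto intro: add_pos_nonneg add_nonneg_pos)

lemma smooth_step: "smooth step"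
proof -
 have "flat x + flat (1 - x) \<noteq> 0" for x using step_denom_pos[of x] by simp
 then have "smooth (\<lambda>x. flat x * inverse (flat x + flat (1 - x)))"
  by (intro smooth_mult smooth_inverse smooth_add smooth_flat smooth_compose[OF smooth_flat]
    smooth_diff smooth_const smooth_ident)
 then show ?thesis by (simp add: step_def[abs_def])
qed

lemma step_nonneg: "0 \<le> step x" and step_le_1: "step x \<le> 1"
 using step_denom_pos[of x] flat_nonneg[of x] flat_nonneg[of "1 - x"] by (auto simp: step_def field_simps)

lemma step_eq_0: "x \<le> 0 \<Longrightarrow> step x = 0" by (simp add: step_def flat_def)

lemma step_eq_1: "x \<ge> 1 \<Longrightarrow> step x = 1" using step_denom_pos[of x] by (simp add: step_def) (simp add: flat_def)

section \<open>Continuously differentiable functions on the plane\<close>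

lemma pd_eq: "(f has_derivative D) (at x) \<Longrightarrow> pd i f x = D (axis i 1)"
 unfolding pd_def using frechet_derivative_at by metis

lemma C_k_SucI:
 assumes "\<And>x. (f has_derivative D x) (at x)" "\<And>i. C_k k (\<lambda>x. D x (axis i 1))"
 shows "C_k (Suc k) f"
proof -
 have "pd i f = (\<lambda>x. D x (axis i 1))" for i using pd_eq[OF assms(1)] by auto
 then show ?thesis using assms by (auto simp: differentiable_def)
qed

lemma C_k_Suc_imp: "C_k (Suc k) f \<Longrightarrow> C_k k f"
proof (induction k arbitrary: f)
 case 0
 then show ?case by (auto intro!: continuous_at_imp_continuous_on differentiable_imp_continuous_within)
next
 case (Suc k)
 then show ?case by simp
qed

lemma C_k_Suc_derivative:
 "C_k (Suc k) f \<Longrightarrow> (f has_derivative frechet_derivative f (at x)) (at x)" by (simp add: frechet_derivative_works)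

lemma frechet_derivative_pd:
 assumes "f differentiable (at x)"
 shows "frechet_derivative f (at x) h = (\<Sum>i\<in>UNIV. h $ i *\<^sub>R pd i f x)"
proof -
 interpret bounded_linear "frechet_derivative f (at x)"
  using assms frechet_derivative_works has_derivative_bounded_linear by blast
 have "frechet_derivative f (at x) h = frechet_derivative f (at x) (\<Sum>i\<in>UNIV. h $ i *\<^sub>R axis i 1)"
  using basis_expansion[of h] by (simp add: scalar_mult_eq_scaleR)
 then show ?thesis by (simp add: sum scaleR pd_def)
qed

lemma C_k_const: "C_k k (\<lambda>x. c)"
proof (induction k arbitrary: c)
 case (Suc k)
 then show ?case by (intro C_k_SucI[where D = "\<lambda>_ _. 0"]) auto
qed auto

lemma C_k_bounded_linear:
 assumes "bounded_linear L"
 shows "C_k k f \<Longrightarrow> C_k k (\<lambda>x. L (f x))"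
proof (induction k arbitrary: f)
 case 0
 then show ?case using bounded_linear.continuous_on[OF assms, of UNIV f] by simp
next
 case (Suc k)
 show ?case
 proof (rule C_k_SucI)
  show "((\<lambda>x. L (f x)) has_derivative (\<lambda>h. L (frechet_derivative f (at x) h))) (at x)" for x
   by (rule bounded_linear.has_derivative[OF assms C_k_Suc_derivative[OF Suc.prems]])
  show "C_k k (\<lambda>x. L (frechet_derivative f (at x) (axis i 1)))" for i using Suc by (simp add: pd_def[symmetric])
 qed
qed

lemma C_k_add: "C_k k f \<Longrightarrow> C_k k g \<Longrightarrow> C_k k (\<lambda>x. f x + g x)"
proof (induction k arbitrary: f g)
 case (Suc k)
 show ?case
 proof (rule C_k_SucI)
  show "((\<lambda>x. f x + g x) has_derivative
    (\<lambda>h. frechet_derivative f (at x) h + frechet_derivative g (at x) h)) (at x)" for x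
   by (intro has_derivative_add C_k_Suc_derivative[OF Suc.prems(1)] C_k_Suc_derivative[OF Suc.prems(2)])
  show "C_k k (\<lambda>x. frechet_derivative f (at x) (axis i 1) + frechet_derivative g (at x) (axis i 1))" for i
   using Suc by (simp add: pd_def[symmetric])
 qed
qed (auto intro: continuous_intros)

lemma C_k_bilinear:
 assumes "bounded_bilinear pr"
 shows "C_k k f \<Longrightarrow> C_k k g \<Longrightarrow> C_k k (\<lambda>x. pr (f x) (g x))"
proof (induction k arbitrary: f g)
 case 0
 then show ?case using bounded_bilinear.continuous_on[OF assms] by auto
next
 case (Suc k)
 show ?case
 proof (rule C_k_SucI)
  show "((\<lambda>x. pr (f x) (g x)) has_derivative
    (\<lambda>h. pr (f x) (frechet_derivative g (at x) h) + pr (frechet_derivative f (at x) h) (g x))) (at x)" for x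
   by (intro bounded_bilinear.FDERIV[OF assms] C_k_Suc_derivative[OF Suc.prems(1)] C_k_Suc_derivative[OF Suc.prems(2)])
  show "C_k k (\<lambda>x. pr (f x) (frechet_derivative g (at x) (axis i 1)) +
     pr (frechet_derivative f (at x) (axis i 1)) (g x))" for i
   using Suc.prems C_k_Suc_imp[OF Suc.prems(1)] C_k_Suc_imp[OF Suc.prems(2)]
   by (intro C_k_add Suc.IH) (simp_all add: pd_def[symmetric])
 qed
qed

lemmas C_k_scaleR = C_k_bilinear[OF bounded_bilinear_scaleR]
 and C_k_mult = C_k_bilinear[OF bounded_bilinear_mult]

lemma C_k_compose:
 fixes f :: "real^2 \<Rightarrow> real"
 shows "Cr k h \<Longrightarrow> C_k k f \<Longrightarrow> C_k k (\<lambda>x. h (f x))"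
proof (induction k arbitrary: f h)
 case 0
 then show ?case by (auto intro: continuous_on_compose2)
next
 case (Suc k)
 obtain h' where h': "\<And>x. (h has_real_derivative h' x) (at x)" "Cr k h'"
  using Suc.prems(1) unfolding Cr.simps by blast
 show ?case
 proof (rule C_k_SucI)
  show "((\<lambda>x. h (f x)) has_derivative (\<lambda>v. frechet_derivative f (at x) v * h' (f x))) (at x)" for x
   by (rule DERIV_compose_FDERIV[of h "h' (f x)" f x, OF h'(1) C_k_Suc_derivative[OF Suc.prems(2)]])
  show "C_k k (\<lambda>x. frechet_derivative f (at x) (axis i 1) * h' (f x))" for i
   using Suc.prems C_k_Suc_imp[OF Suc.prems(2)] h'
   by (intro C_k_mult Suc.IH[of h' f]) (auto simp: pd_def[symmetric])
 qed
qed

lemma C_k_shift: "C_k k f \<Longrightarrow> C_k k (\<lambda>x. f (x - a))"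
proof (induction k arbitrary: f)
 case 0
 then show ?case by (auto intro!: continuous_on_compose2[of UNIV f] continuous_intros)
next
 case (Suc k)
 show ?case
 proof (rule C_k_SucI)
  show "((\<lambda>x. f (x - a)) has_derivative frechet_derivative f (at (x - a))) (at x)" for x
  proof -
   have "((\<lambda>x. x - a) has_derivative (\<lambda>h. h)) (at x)" by (auto intro!: derivative_eq_intros)
   from has_derivative_compose[OF this C_k_Suc_derivative[OF Suc.prems]] show ?thesis .
  qed
  show "C_k k (\<lambda>x. frechet_derivative f (at (x - a)) (axis i 1))" for i using Suc by (simp add: pd_def[symmetric])
 qed
qed

lemma C_k_nth: "C_k k (\<lambda>x. x $ i)"
proof (cases k)
 case 0
 then show ?thesis by (auto intro: continuous_intros)
next
 case (Suc j)
 have "C_k (Suc j) (\<lambda>x. x $ i)"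
 proof (rule C_k_SucI)
  show "((\<lambda>x. x $ i) has_derivative (\<lambda>h. h $ i)) (at x)" for x :: "real^2"
   by (intro bounded_linear_imp_has_derivative bounded_linear_vec_nth)
 qed (rule C_k_const)
 with Suc show ?thesis by simp
qed

section \<open>Closure properties and uniform estimates for test functions\<close>

lemma test_fun_C_k: "test_fun U \<phi> \<Longrightarrow> C_k k \<phi>" by (simp add: test_fun_def)

lemma test_fun_derivative: "test_fun U \<phi> \<Longrightarrow> (\<phi> has_derivative frechet_derivative \<phi> (at x)) (at x)"
 by (intro C_k_Suc_derivative[where k = 0] test_fun_C_k)

lemma test_fun_differentiable: "test_fun U \<phi> \<Longrightarrow> \<phi> differentiable (at x)"
 using test_fun_derivative differentiable_def by blast

lemma test_fun_continuous: "test_fun U \<phi> \<Longrightarrow> continuous_on UNIV \<phi>" using test_fun_C_k[of U \<phi> 0] by simp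

lemma test_fun_support:
 assumes "test_fun U \<phi>"
 obtains K where "compact K" "K \<subseteq> U" "\<And>x. x \<notin> K \<Longrightarrow> \<phi> x = 0" using assms unfolding test_fun_def by blast

lemma test_funI:
 "(\<And>k. C_k k \<phi>) \<Longrightarrow> compact K \<Longrightarrow> K \<subseteq> U \<Longrightarrow> (\<And>x. x \<notin> K \<Longrightarrow> \<phi> x = 0) \<Longrightarrow> test_fun U \<phi>" unfolding test_fun_def by blast

lemma test_fun_outside: "test_fun U \<phi> \<Longrightarrow> x \<notin> U \<Longrightarrow> \<phi> x = 0" by (elim test_fun_support) blast

lemma test_fun_subset: "test_fun V \<phi> \<Longrightarrow> V \<subseteq> U \<Longrightarrow> test_fun U \<phi>" unfolding test_fun_def by blast

lemma test_fun_zero: "test_fun U (\<lambda>x. 0)" by (rule test_funI[where K = "{}"]) (auto intro: C_k_const)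

lemma test_fun_add:
 assumes "test_fun U f" "test_fun U g"
 shows "test_fun U (\<lambda>x. f x + g x)"
proof -
 obtain K L where "compact K" "K \<subseteq> U" "\<And>x. x \<notin> K \<Longrightarrow> f x = 0"
  "compact L" "L \<subseteq> U" "\<And>x. x \<notin> L \<Longrightarrow> g x = 0" using assms by (meson test_fun_support)
 then show ?thesis by (intro test_funI[where K = "K \<union> L"] C_k_add[OF assms[THEN test_fun_C_k]]) auto
qed

lemma test_fun_bounded_linear:
 assumes "bounded_linear L" "test_fun U f"
 shows "test_fun U (\<lambda>x. L (f x))"
proof -
 obtain K where "compact K" "K \<subseteq> U" "\<And>x. x \<notin> K \<Longrightarrow> f x = 0" using assms(2) by (meson test_fun_support)
 moreover have "L 0 = 0" by (rule linear_0[OF bounded_linear.linear[OF assms(1)]])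
 ultimately show ?thesis
  by (intro test_funI[where K = K] C_k_bounded_linear[OF assms(1) test_fun_C_k[OF assms(2)]]) auto
qed

lemmas test_fun_inner = test_fun_bounded_linear[OF bounded_linear_inner_left]
 and test_fun_nth = test_fun_bounded_linear[OF bounded_linear_vec_nth]
 and test_fun_cscaleR = test_fun_bounded_linear[OF bounded_linear_scaleR_right]
 and test_fun_scaleR_const = test_fun_bounded_linear[OF bounded_linear_scaleR_left]

lemma test_fun_minus: "test_fun U f \<Longrightarrow> test_fun U (\<lambda>x. - f x)" using test_fun_cscaleR[of U f "-1"] by simp

lemma test_fun_diff: "test_fun U f \<Longrightarrow> test_fun U g \<Longrightarrow> test_fun U (\<lambda>x. f x - g x)"
 using test_fun_add[of U f "\<lambda>x. - g x"] test_fun_minus[of U g] by simp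

lemma test_fun_sum: "(\<And>i. i \<in> I \<Longrightarrow> test_fun U (f i)) \<Longrightarrow> test_fun U (\<lambda>x. \<Sum>i\<in>I. f i x)"
 by (induction I rule: infinite_finite_induct) (auto intro: test_fun_add test_fun_zero)

lemma test_fun_scaleR:
 assumes "test_fun U f" "\<And>k. C_k k g"
 shows "test_fun U (\<lambda>x. g x *\<^sub>R f x)"
proof -
 obtain K where "compact K" "K \<subseteq> U" "\<And>x. x \<notin> K \<Longrightarrow> f x = 0" using assms(1) by (meson test_fun_support)
 then show ?thesis by (intro test_funI[where K = K] C_k_scaleR[OF assms(2) test_fun_C_k[OF assms(1)]]) auto
qed

lemma test_fun_mult:
 "test_fun U f \<Longrightarrow> (\<And>k. C_k k g) \<Longrightarrow> test_fun U (\<lambda>x. g x * f x :: real)" using test_fun_scaleR[of U f g] by simp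

lemma test_fun_compose:
 fixes f :: "real^2 \<Rightarrow> real"
 assumes "test_fun U f" "smooth h" "h 0 = 0"
 shows "test_fun U (\<lambda>x. h (f x))"
proof -
 obtain K where "compact K" "K \<subseteq> U" "\<And>x. x \<notin> K \<Longrightarrow> f x = 0" using assms(1) by (meson test_fun_support)
 then show ?thesis using assms(2,3)
  by (intro test_funI[where K = K] C_k_compose[OF _ test_fun_C_k[OF assms(1)]]) (auto simp: smooth_def)
qed

lemma pd_outside_support:
 assumes "closed K" "\<And>x. x \<notin> K \<Longrightarrow> f x = 0" "x \<notin> K"
 shows "pd i f x = 0"
proof (rule pd_eq)
 show "(f has_derivative (\<lambda>h. 0)) (at x)"
  by (rule has_derivative_transform_within_open[OF has_derivative_const[of 0], where s = "-K"]) (use assms in auto)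
qed

lemma test_fun_pd:
 assumes "test_fun U f"
 shows "test_fun U (pd i f)"
proof -
 obtain K where K: "compact K" "K \<subseteq> U" "\<And>x. x \<notin> K \<Longrightarrow> f x = 0" using assms by (meson test_fun_support)
 moreover have "C_k k (pd i f)" for k using test_fun_C_k[OF assms, of "Suc k"] by simp
 ultimately show ?thesis
  using pd_outside_support[of K f] by (intro test_funI[where K = K]) (auto simp: compact_imp_closed)
qed

lemma pd_bilinear:
 assumes "bounded_bilinear pr" "f differentiable (at x)" "g differentiable (at x)"
 shows "pd i (\<lambda>x. pr (f x) (g x)) x = pr (f x) (pd i g x) + pr (pd i f x) (g x)" unfolding pd_def
 by (subst frechet_derivative_at[OF bounded_bilinear.FDERIV[OF assms(1)], symmetric])
   (use assms in \<open>auto simp: frechet_derivative_works\<close>)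

lemma pd_scaleR:
 "f differentiable (at x) \<Longrightarrow> g differentiable (at x) \<Longrightarrow>
  pd i (\<lambda>x. f x *\<^sub>R g x) x = f x *\<^sub>R pd i g x + pd i f x *\<^sub>R g x" by (rule pd_bilinear[OF bounded_bilinear_scaleR])

lemma pd_bounded_linear:
 assumes "bounded_linear L" "f differentiable (at x)"
 shows "pd i (\<lambda>x. L (f x)) x = L (pd i f x)" unfolding pd_def
 by (subst frechet_derivative_at[OF bounded_linear.has_derivative[OF assms(1)], symmetric])
   (use assms in \<open>auto simp: frechet_derivative_works\<close>)

lemma pd_compose:
 assumes "(h has_real_derivative h') (at (f x))" "f differentiable (at x)"
 shows "pd i (\<lambda>x. h (f x)) x = h' * pd i f x"
proof -
 have "((\<lambda>x. h (f x)) has_derivative (\<lambda>v. frechet_derivative f (at x) v * h')) (at x)"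
  by (rule DERIV_compose_FDERIV[of h h' f x, OF assms(1)]) (use assms(2) in \<open>simp add: frechet_derivative_works\<close>)
 from pd_eq[OF this] show ?thesis by (simp add: pd_def)
qed

lemma pd_shift:
 assumes "f differentiable (at (x - a))"
 shows "pd i (\<lambda>x. f (x - a)) x = pd i f (x - a)"
proof -
 have "((\<lambda>x. x - a) has_derivative (\<lambda>h. h)) (at x)" by (auto intro!: derivative_eq_intros)
 from has_derivative_compose[OF this] assms
 have "((\<lambda>x. f (x - a)) has_derivative frechet_derivative f (at (x - a))) (at x)"
  by (simp add: frechet_derivative_works)
 from pd_eq[OF this] show ?thesis by (simp add: pd_def)
qed

lemma test_fun_bounded:
 assumes "test_fun U f"
 obtains C where "C > 0" "\<And>x. norm (f x) \<le> C"
proof -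
 obtain K where K: "compact K" "\<And>x. x \<notin> K \<Longrightarrow> f x = 0" using assms by (meson test_fun_support)
 have "bounded (f ` K)"
  by (intro compact_imp_bounded compact_continuous_image K continuous_on_subset[OF test_fun_continuous[OF assms]]) auto
 then obtain C where C: "C > 0" "\<And>x. x \<in> K \<Longrightarrow> norm (f x) \<le> C" unfolding bounded_pos by auto
 have "norm (f x) \<le> C" for x using C K(2)[of x] by (cases "x \<in> K") auto
 with C(1) that show ?thesis by blast
qed

lemma test_fun_uniformly_continuous:
 assumes "test_fun U f"
 shows "uniformly_continuous_on UNIV f"
proof -
 obtain K where K: "compact K" "\<And>x. x \<notin> K \<Longrightarrow> f x = 0" using assms by (meson test_fun_support)
 obtain R where R: "\<And>x. x \<in> K \<Longrightarrow> norm x \<le> R" using compact_imp_bounded[OF K(1)] unfolding bounded_iff by blast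
 \<comment> \<open>The radius is enlarged by 1 so that two points at distance below 1, one of them
   in the support, both lie in the ball.\<close>
 have "uniformly_continuous_on (cball 0 (R + 1)) f"
  by (intro compact_uniformly_continuous continuous_on_subset[OF test_fun_continuous[OF assms]]) auto
 show ?thesis unfolding uniformly_continuous_on_def
 proof (intro allI impI)
  fix e :: real assume e: "e > 0"
  obtain d where d: "d > 0"
   "\<And>x y. x \<in> cball 0 (R + 1) \<Longrightarrow> y \<in> cball 0 (R + 1) \<Longrightarrow> dist y x < d \<Longrightarrow> dist (f y) (f x) < e"
   using \<open>uniformly_continuous_on (cball 0 (R + 1)) f\<close> e unfolding uniformly_continuous_on_def by metis
  show "\<exists>d>0. \<forall>x\<in>UNIV. \<forall>x'\<in>UNIV. dist x' x < d \<longrightarrow> dist (f x') (f x) < e"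
  proof (intro exI[of _ "min d 1"] conjI ballI impI)
   fix x y :: "real^2" assume xy: "dist y x < min d 1"
   show "dist (f y) (f x) < e"
   proof (cases "x \<in> K \<or> y \<in> K")
    case True
    have "norm x \<le> norm y + dist y x" "norm y \<le> norm x + dist y x"
     by (metis dist_commute dist_norm norm_triangle_sub)+
    with True xy R have "x \<in> cball 0 (R + 1)" "y \<in> cball 0 (R + 1)" by (force dest: R)+
    then show ?thesis using d xy by auto
   next
    case False
    then show ?thesis using K(2) e by simp
   qed
  qed (use d in auto)
 qed
qed

text \<open>Uniform continuity of the partial derivatives makes the linearization error uniform in
  \<open>x\<close>, by the mean value inequality for \<open>f\<close> minus its linearization.
  Uniformity allows difference quotients to be estimated under the integral.\<close>

lemma test_fun_uniformly_differentiable: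
 assumes f: "test_fun U f" and e: "e > 0"
 obtains d where "d > 0"
  "\<And>x h. norm h < d \<Longrightarrow> norm (f (x + h) - f x - frechet_derivative f (at x) h) \<le> e * norm h"
proof -
 have "\<exists>d>0. \<forall>x y. dist y x < d \<longrightarrow> dist (pd i f y) (pd i f x) < e / 2" for i
  using test_fun_uniformly_continuous[OF test_fun_pd[OF f, of i]] e
  unfolding uniformly_continuous_on_def by (metis UNIV_I half_gt_zero)
 then obtain \<delta> where \<delta>: "\<And>i. \<delta> i > 0" "\<And>i x y. dist y x < \<delta> i \<Longrightarrow> dist (pd i f y) (pd i f x) < e / 2" by metis
 define d where "d = min (\<delta> 1) (\<delta> 2)"
 have d: "d > 0" "\<And>i x y. dist y x < d \<Longrightarrow> dist (pd i f y) (pd i f x) < e / 2"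
  using \<delta> by (auto simp: d_def) (metis exhaust_2)
 let ?D = "\<lambda>x. frechet_derivative f (at x)"
 show ?thesis
 proof (rule that[OF d(1)])
  fix x h :: "real^2" assume h: "norm h < d"
  have lin: "bounded_linear (?D y)" for y using test_fun_derivative[OF f] has_derivative_bounded_linear by blast
  have "norm ((f (x + h) - ?D x (x + h)) - (f x - ?D x x)) \<le> e * norm (x + h - x)"
  proof (rule differentiable_bound[where S = "ball x d" and f' = "\<lambda>y v. ?D y v - ?D x v"])
   show "((\<lambda>y. f y - ?D x y) has_derivative (\<lambda>v. ?D y v - ?D x v)) (at y within ball x d)" for y
    by (intro has_derivative_diff has_derivative_at_withinI[OF test_fun_derivative[OF f]]
      bounded_linear_imp_has_derivative lin)
   show "onorm (\<lambda>v. ?D y v - ?D x v) \<le> e" if y: "y \<in> ball x d" for y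
   proof (rule onorm_le)
    fix v :: "real^2"
    have "?D y v - ?D x v = (\<Sum>i\<in>UNIV. v $ i *\<^sub>R (pd i f y - pd i f x))"
     by (simp add: frechet_derivative_pd[OF test_fun_differentiable[OF f]] sum_subtractf scaleR_diff_right)
    also have "norm \<dots> \<le> (\<Sum>i\<in>(UNIV::2 set). norm v * (e / 2))"
    proof (rule sum_norm_le)
     fix i :: 2 assume "i \<in> UNIV"
     have "norm (pd i f y - pd i f x) \<le> e / 2"
      using d(2)[of y x i] y by (simp add: dist_norm norm_minus_commute dist_commute)
     then show "norm (v $ i *\<^sub>R (pd i f y - pd i f x)) \<le> norm v * (e / 2)"
      unfolding norm_scaleR using component_le_norm_cart[of v i] e by (intro mult_mono) auto
    qed
    finally show "norm (?D y v - ?D x v) \<le> e * norm v" by (simp add: sum_2 algebra_simps)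
   qed
  qed (use d h in \<open>auto simp: dist_norm\<close>)
  moreover have "?D x (x + h) = ?D x x + ?D x h" using lin by (simp add: linear_simps)
  ultimately show "norm (f (x + h) - f x - ?D x h) \<le> e * norm h" by (simp add: algebra_simps)
 qed
qed

text \<open>Finitely many bumps equal to 1 on balls that cover \<open>K\<close> are combined as one
  minus the product of their complements: this stays between 0 and 1 and equals 1 wherever some bump
  does.\<close>

lemma smooth_Urysohn:
 fixes K U :: "(real^2) set"
 assumes K: "compact K" and U: "open U" "K \<subseteq> U"
 obtains \<phi> :: "real^2 \<Rightarrow> real"
 where "test_fun U \<phi>" "\<And>x. 0 \<le> \<phi> x" "\<And>x. \<phi> x \<le> 1" "\<And>x. x \<in> K \<Longrightarrow> \<phi> x = 1"
proof -
 \<comment> \<open>Equal to 1 on [-1, 1] and to 0 outside (-2, 2); products of two of these are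
   bumps on squares.\<close>
 define plateau where "plateau y = step (2 + y) * step (2 - y)" for y :: real
 have plateau: "0 \<le> plateau y" "plateau y \<le> 1" "\<bar>y\<bar> \<le> 1 \<Longrightarrow> plateau y = 1" "\<bar>y\<bar> \<ge> 2 \<Longrightarrow> plateau y = 0" for y
  using step_nonneg[of "2 + y"] step_nonneg[of "2 - y"] step_le_1[of "2 + y"] step_le_1[of "2 - y"]
  by (auto simp: plateau_def step_eq_1 mult_le_one abs_if split: if_splits intro: step_eq_0)
 have sm: "smooth (\<lambda>y. plateau ((y - c) * d))" for c d unfolding plateau_def
  by (intro smooth_mult smooth_compose[OF smooth_step] smooth_add smooth_diff smooth_const smooth_ident)
 define b where "b c r x = plateau ((x $ 1 - c $ 1) * inverse r) * plateau ((x $ 2 - c $ 2) * inverse r)"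
  for c x :: "real^2" and r :: real
 have b_C: "C_k k (b c r)" for k c r
 proof -
  have "C_k k (\<lambda>x. plateau ((x $ i - c $ i) * inverse r))" for i
   using C_k_compose[OF _ C_k_nth, of k "\<lambda>y. plateau ((y - c $ i) * inverse r)" i] sm unfolding smooth_def by blast
  then show ?thesis unfolding b_def[abs_def] by (intro C_k_mult)
 qed
 have b_range: "0 \<le> b c r x" "b c r x \<le> 1" for c r x using plateau(1,2) by (auto simp: b_def intro!: mult_le_one)
 have b_1: "b c r x = 1" if "x \<in> ball c r" for c r x
 proof -
  have "r > 0" using that by (metis mem_ball le_less_trans zero_le_dist)
  have "\<bar>(x $ i - c $ i) * inverse r\<bar> \<le> 1" for i
  proof -
   have "\<bar>x $ i - c $ i\<bar> \<le> r"
    using component_le_norm_cart[of "x - c" i] that by (simp add: dist_norm norm_minus_commute)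
   then show ?thesis using \<open>r > 0\<close> by (simp add: abs_mult field_simps)
  qed
  then show ?thesis by (simp add: b_def plateau(3))
 qed
 \<comment> \<open>The factor 4 compares squares with discs: if both coordinates of
   \<open>x - c\<close> are below \<open>2 * r\<close> in modulus, the sum of the moduli bounds the
   norm by \<open>4 * r\<close>.\<close>
 have b_0: "b c r x = 0" if "x \<notin> cball c (4 * r)" "r > 0" for c r x
 proof -
  have "\<exists>i. \<bar>x $ i - c $ i\<bar> \<ge> 2 * r"
  proof (rule ccontr)
   assume "\<nexists>i. \<bar>x $ i - c $ i\<bar> \<ge> 2 * r"
   then have "(\<Sum>i\<in>UNIV. \<bar>(x - c) $ i\<bar>) \<le> (\<Sum>i\<in>(UNIV::2 set). 2 * r)"
    by (intro sum_mono) (auto simp: not_le less_imp_le)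
   then have "norm (x - c) \<le> 4 * r" using norm_le_l1_cart[of "x - c"] by (simp add: sum_2)
   with that show False by (simp add: dist_norm norm_minus_commute)
  qed
  then obtain i where "\<bar>x $ i - c $ i\<bar> \<ge> 2 * r" by blast
  then have "\<bar>(x $ i - c $ i) * inverse r\<bar> \<ge> 2" using \<open>r > 0\<close> by (simp add: abs_mult field_simps)
  then have "plateau ((x $ i - c $ i) * inverse r) = 0" by (rule plateau(4))
  then show ?thesis using exhaust_2[of i] by (auto simp: b_def)
 qed
 have "\<exists>r>0. cball x (4 * r) \<subseteq> U" if "x \<in> K" for x
 proof -
  have "x \<in> U" using U that by auto
  then obtain e where "e > 0" "cball x e \<subseteq> U" using U(1) unfolding open_contains_cball by auto
  then show ?thesis by (intro exI[of _ "e / 4"]) auto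
 qed
 then obtain r where r: "\<And>x. x \<in> K \<Longrightarrow> r x > 0" "\<And>x. x \<in> K \<Longrightarrow> cball x (4 * r x) \<subseteq> U" by metis
 obtain I where I: "I \<subseteq> K" "finite I" "K \<subseteq> (\<Union>c\<in>I. ball c (r c))"
  by (rule compactE_image[OF K, of K "\<lambda>c. ball c (r c)"]) (use r(1) in auto)
 have prod_C: "C_k k (\<lambda>x. \<Prod>c\<in>J. 1 - b c (r c) x)" for k J
 proof (induction J rule: infinite_finite_induct)
  case (insert c J)
  have "C_k k (\<lambda>x. (1 + (- 1) * b c (r c) x) * (\<Prod>c\<in>J. 1 - b c (r c) x))"
   by (intro C_k_mult C_k_add C_k_const b_C insert.IH)
  with insert show ?case by simp
 qed (auto intro: C_k_const)
 define \<phi> where "\<phi> x = 1 + (- 1) * (\<Prod>c\<in>I. 1 - b c (r c) x)" for x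
 show ?thesis
 proof (rule that)
  show "test_fun U \<phi>"
  proof (rule test_funI)
   show "C_k k \<phi>" for k unfolding \<phi>_def[abs_def] by (intro C_k_mult C_k_add C_k_const prod_C)
   show "compact (\<Union>c\<in>I. cball c (4 * r c))" using I by auto
   show "(\<Union>c\<in>I. cball c (4 * r c)) \<subseteq> U" using I r by blast
   show "\<phi> x = 0" if "x \<notin> (\<Union>c\<in>I. cball c (4 * r c))" for x
   proof -
    have "b c (r c) x = 0" if "c \<in> I" for c using \<open>x \<notin> _\<close> that I r by (intro b_0) auto
    then show ?thesis by (simp add: \<phi>_def)
   qed
  qed
  show "0 \<le> \<phi> x" for x using b_range by (simp add: \<phi>_def prod_le_1)
  show "\<phi> x \<le> 1" for x using b_range by (simp add: \<phi>_def prod_nonneg)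
  show "\<phi> x = 1" if xK: "x \<in> K" for x
  proof -
   obtain c where "c \<in> I" "x \<in> ball c (r c)" using xK I by blast
   then have "\<exists>c\<in>I. 1 - b c (r c) x = 0" using b_1 by auto
   then show ?thesis using I(2) by (simp add: \<phi>_def)
  qed
 qed
qed

section \<open>Density of test functions and duality in the square integrable functions\<close>

locale bounded_open =
 fixes U :: "(real^2) set"
 assumes open_dom: "open U" and bounded_dom: "bounded U"
begin

abbreviation "\<mu> \<equiv> lebesgue_on U"
abbreviation "nrm \<equiv> L2_norm U"
abbreviation "dst \<equiv> L2_dist U"

lemma dom_sets [measurable, simp]: "U \<in> sets lebesgue" using open_dom by simp

lemma emeasure_dom: "emeasure lebesgue U < \<infinity>"
 using bounded_dom open_dom by (metis bounded_set_imp_lmeasurable dom_sets fmeasurableD2 less_top infinity_ennreal_def)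

lemma finite_measure_dom: "finite_measure \<mu>"
 using emeasure_dom by (intro finite_measureI) (simp add: emeasure_restrict_space)

lemma integrable_const_dom: "integrable \<mu> (\<lambda>x. c :: 'b::{banach, second_countable_topology})"
 by (rule finite_measure.integrable_const[OF finite_measure_dom])

lemma L2_bounded:
 assumes "f \<in> borel_measurable \<mu>" "AE x in \<mu>. norm (f x) \<le> C"
 shows "L2 U f"
proof (rule L2_dominated(1)[where f = "\<lambda>x. 1::real" and K = C])
 show "L2 U (\<lambda>x. 1::real)" unfolding L2_def using integrable_const_dom by auto
qed (use assms in auto)

lemma L2_const: "L2 U (\<lambda>x. c)" by (rule L2_bounded[where C = "norm c"]) auto

lemma continuous_measurable_dom: "continuous_on UNIV f \<Longrightarrow> f \<in> borel_measurable \<mu>"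
 by (rule continuous_imp_measurable_on_sets_lebesgue) (auto intro: continuous_on_subset)

lemma L2_test_fun:
 assumes "test_fun V \<phi>"
 shows "L2 U \<phi>"
proof -
 obtain C where "\<And>x. norm (\<phi> x) \<le> C" using test_fun_bounded[OF assms] by blast
 then show ?thesis by (intro L2_bounded continuous_measurable_dom test_fun_continuous[OF assms]) auto
qed

lemma L2_imp_integrable: "L2 U f \<Longrightarrow> integrable \<mu> f"
proof (rule Bochner_Integration.integrable_bound)
 assume f: "L2 U f"
 show "integrable \<mu> (\<lambda>x. norm (f x) \<bullet> 1)" by (rule L2_integrable_inner[OF L2_norm[OF f] L2_const])
 show "f \<in> borel_measurable \<mu>" using f by (rule L2_measurable)
qed auto

text \<open>Regularity of Lebesgue measure puts \<open>A\<close> between a closed \<open>K\<close>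
  and an open \<open>N\<close>. A cutoff that is 1 on \<open>K\<close> and supported in
  \<open>N\<close> differs from the indicator only on the small set between them.\<close>

lemma approx_indicator:
 fixes y :: "'a::euclidean_space"
 assumes A: "A \<in> sets \<mu>" and e: "e > 0"
 obtains \<phi> where "test_fun U \<phi>" "nrm (\<lambda>x. indicat_real A x *\<^sub>R y - \<phi> x) < e"
proof -
 have A': "A \<in> sets lebesgue" "A \<subseteq> U" using A by (auto simp: sets_restrict_space_iff)
 \<comment> \<open>The exceptional set \<open>E\<close> has measure below \<open>2 * d\<close>, so
   its indicator has norm below \<open>e / (1 + norm y)\<close>; the 1 covers
   \<open>y = 0\<close>.\<close>
 define d where "d = (e / (1 + norm y))\<^sup>2 / 4"
 have "1 + norm y > 0" by (simp add: add_pos_nonneg)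
 then have d: "d > 0" using e by (simp add: d_def)
 obtain K where K: "closed K" "K \<subseteq> A" "A - K \<in> lmeasurable" "emeasure lebesgue (A - K) < ennreal d"
  using sets_lebesgue_inner_closed[OF A'(1) d] by blast
 obtain N where N: "open N" "A \<subseteq> N" "N - A \<in> lmeasurable" "emeasure lebesgue (N - A) < ennreal d"
  using sets_lebesgue_outer_open[OF A'(1) d] by blast
 have "compact K" using K A' bounded_subset[OF bounded_dom, of K] by (auto simp: compact_eq_bounded_closed)
 then obtain \<phi> :: "real^2 \<Rightarrow> real" where \<phi>: "test_fun (N \<inter> U) \<phi>" "\<And>x. 0 \<le> \<phi> x" "\<And>x. \<phi> x \<le> 1"
  "\<And>x. x \<in> K \<Longrightarrow> \<phi> x = 1" using smooth_Urysohn[of K "N \<inter> U"] N(1,2) K A' open_dom by blast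
 define E where "E = (A - K) \<union> (N - A)"
 have E: "E \<in> lmeasurable" using K N by (auto simp: E_def)
 have "emeasure lebesgue E \<le> emeasure lebesgue (A - K) + emeasure lebesgue (N - A)"
  unfolding E_def by (rule emeasure_subadditive) (use K N in auto)
 also have "\<dots> < ennreal d + ennreal d" using K(4) N(4) by (rule add_strict_mono)
 also have "\<dots> = ennreal (2 * d)" using d by (simp flip: ennreal_plus)
 finally have mE: "measure lebesgue E < 2 * d" using d E by (simp add: emeasure_eq_measure2 ennreal_less_iff)
 have le: "\<bar>indicat_real A x - \<phi> x\<bar> \<le> indicat_real E x" if "x \<in> U" for x
 proof (cases "x \<in> E")
  case True
  then show ?thesis using \<phi>(2,3)[of x] by (auto simp: indicator_def abs_le_iff)
 next
  case False
  then have "x \<in> K \<or> x \<notin> N" "x \<in> A \<longleftrightarrow> x \<in> K" using K N by (auto simp: E_def)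
  then show ?thesis using \<phi>(4)[of x] test_fun_outside[OF \<phi>(1), of x] by (auto simp: indicator_def)
 qed
 note [measurable] = continuous_measurable_dom[OF test_fun_continuous[OF \<phi>(1)]] A
 have [measurable]: "indicat_real E \<in> borel_measurable \<mu>"
  using E by (intro borel_measurable_indicator') (auto simp: sets_restrict_space_iff)
 have L2E: "L2 U (indicat_real E)" by (rule L2_bounded[where C = 1]) auto
 have "(nrm (indicat_real E))\<^sup>2 = (LINT x|\<mu>. indicat_real E x)"
  unfolding L2_norm_sq ip_def by (intro Bochner_Integration.integral_cong) (auto simp: indicator_def)
 also have "\<dots> = measure lebesgue (E \<inter> U)" by (simp add: measure_restrict_space)
 also have "\<dots> \<le> measure lebesgue E" using E by (intro measure_mono_fmeasurable) auto
 finally have "(nrm (indicat_real E))\<^sup>2 < 4 * d" using mE d by simp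
 then have "(nrm (indicat_real E))\<^sup>2 < (e / (1 + norm y))\<^sup>2" by (simp add: d_def)
 then have NE: "nrm (indicat_real E) < e / (1 + norm y)"
  by (rule power_less_imp_less_base) (use e in \<open>simp add: add_nonneg_nonneg\<close>)
 have "nrm (\<lambda>x. indicat_real A x *\<^sub>R y - \<phi> x *\<^sub>R y) \<le> norm y * nrm (indicat_real E)"
 proof (rule L2_dominated(2)[OF L2E])
  show "(\<lambda>x. indicat_real A x *\<^sub>R y - \<phi> x *\<^sub>R y) \<in> borel_measurable \<mu>" by measurable
  show "AE x in \<mu>. norm (indicat_real A x *\<^sub>R y - \<phi> x *\<^sub>R y) \<le> norm y * norm (indicat_real E x)"
  proof (rule AE_I2)
   fix x assume "x \<in> space \<mu>"
   then have "\<bar>indicat_real A x - \<phi> x\<bar> * norm y \<le> indicat_real E x * norm y"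
    using le by (intro mult_right_mono) auto
   then show "norm (indicat_real A x *\<^sub>R y - \<phi> x *\<^sub>R y) \<le> norm y * norm (indicat_real E x)"
    by (simp add: scaleR_diff_left[symmetric] mult.commute)
  qed
 qed auto
 also have "\<dots> \<le> norm y * (e / (1 + norm y))" using NE by (intro mult_left_mono) auto
 also have "\<dots> < e" using e \<open>1 + norm y > 0\<close> by (simp add: divide_less_eq algebra_simps)
 finally have "nrm (\<lambda>x. indicat_real A x *\<^sub>R y - \<phi> x *\<^sub>R y) < e" .
 moreover have "test_fun U (\<lambda>x. \<phi> x *\<^sub>R y)" by (intro test_fun_scaleR_const test_fun_subset[OF \<phi>(1)]) auto
 ultimately show ?thesis using that by blast
qed

text \<open>Simple functions bounded by twice the norm of \<open>f\<close> converge to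
  \<open>f\<close> in \<open>L2\<close>; each level set of one of them is then replaced by a test
  function.\<close>

proposition test_fun_dense:
 fixes f :: "real^2 \<Rightarrow> 'a::euclidean_space"
 assumes f: "L2 U f" and e: "e > 0"
 obtains \<phi> where "test_fun U \<phi>" "dst f \<phi> < e"
proof -
 obtain F where F: "\<And>i. simple_function \<mu> (F i)"
  "\<And>x. x \<in> space \<mu> \<Longrightarrow> (\<lambda>i. F i x) \<longlonglongrightarrow> f x"
  "\<And>i x. x \<in> space \<mu> \<Longrightarrow> dist (F i x) 0 \<le> 2 * dist (f x) 0"
  using borel_measurable_implies_sequence_metric[OF L2_measurable[OF f], of 0] by blast
 have mF: "F i \<in> borel_measurable \<mu>" for i using F(1) by (rule borel_measurable_simple_function)
 have F_le: "AE x in \<mu>. norm (F i x) \<le> norm (2 *\<^sub>R f x)" for i using F(3) by (intro AE_I2) simp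
 have F_lim: "AE x in \<mu>. (\<lambda>i. F i x) \<longlonglongrightarrow> f x" using F(2) by (intro AE_I2) simp
 have "L2_lim U F f" and LF: "\<And>i. L2 U (F i)"
  by (rule L2_dominated_convergence[OF mF L2_measurable[OF f] L2_scaleR[OF f, of 2] F_le F_lim])+
 from this(1) have "\<forall>\<^sub>F i in sequentially. dst (F i) f < e / 2" using order_tendstoD(2) e half_gt_zero by blast
 then obtain i where i: "dst (F i) f < e / 2" by (auto simp: eventually_sequentially)
 define R where "R = F i ` U"
 have R: "finite R" using F(1)[of i] by (simp add: R_def simple_function_def)
 \<comment> \<open>The tolerance is shared among the values in \<open>R\<close>; adding 1 keeps the
   denominator positive and the sum strictly below \<open>e / 2\<close>.\<close>
 define d where "d = e / 2 / (1 + card R)"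
 have d: "d > 0" using e by (simp add: d_def add_pos_nonneg)
 define A where "A y = F i -` {y} \<inter> U" for y
 have A: "A y \<in> sets \<mu>" for y using F(1)[of i, THEN simple_functionD(2), of "{y}"] by (simp add: A_def)
 have "\<exists>\<phi>. test_fun U \<phi> \<and> nrm (\<lambda>x. indicat_real (A y) x *\<^sub>R y - \<phi> x) < d" for y
  using approx_indicator[OF A d] by metis
 then obtain \<phi> where \<phi>: "\<And>y. test_fun U (\<phi> y)"
  "\<And>y. nrm (\<lambda>x. indicat_real (A y) x *\<^sub>R y - \<phi> y x) < d" by metis
 have LA: "L2 U (\<lambda>x. indicat_real (A y) x *\<^sub>R y)" for y
  by (rule L2_bounded[where C = "norm y"]) (use A in \<open>auto simp: indicator_def\<close>)
 have "nrm (\<lambda>x. F i x - (\<Sum>y\<in>R. \<phi> y x)) = nrm (\<lambda>x. \<Sum>y\<in>R. indicat_real (A y) x *\<^sub>R y - \<phi> y x)"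
 proof (rule L2_norm_cong_AE)
  have "F i x = (\<Sum>y\<in>R. indicat_real (A y) x *\<^sub>R y)" if "x \<in> U" for x
  proof -
   have "(\<Sum>y\<in>R. indicat_real (A y) x *\<^sub>R y) = (\<Sum>y\<in>R. if y = F i x then y else 0)"
    using that by (intro sum.cong) (auto simp: A_def indicator_def)
   then show ?thesis using that R by (simp add: R_def)
  qed
  then show "AE x in \<mu>. F i x - (\<Sum>y\<in>R. \<phi> y x) = (\<Sum>y\<in>R. indicat_real (A y) x *\<^sub>R y - \<phi> y x)"
   by (intro AE_I2) (simp add: sum_subtractf)
 qed (auto intro!: L2_diff[OF LF L2_sum[OF L2_test_fun[OF \<phi>(1)]]])
 also have "\<dots> \<le> (\<Sum>y\<in>R. nrm (\<lambda>x. indicat_real (A y) x *\<^sub>R y - \<phi> y x))"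
  by (intro L2_norm_sum L2_diff LA L2_test_fun[OF \<phi>(1)])
 also have "\<dots> \<le> (\<Sum>y\<in>R. d)" using \<phi>(2) by (intro sum_mono less_imp_le)
 also have "\<dots> < e / 2" using e by (simp add: d_def field_simps)
 finally have *: "nrm (\<lambda>x. F i x - (\<Sum>y\<in>R. \<phi> y x)) < e / 2" .
 have t: "test_fun U (\<lambda>x. \<Sum>y\<in>R. \<phi> y x)" by (intro test_fun_sum \<phi>)
 have "nrm (\<lambda>x. f x - (\<Sum>y\<in>R. \<phi> y x)) \<le>
  dst f (F i) + nrm (\<lambda>x. F i x - (\<Sum>y\<in>R. \<phi> y x))" by (rule L2_norm_triangle3[OF f LF L2_test_fun[OF t]])
 also have "\<dots> < e" using i * by (simp add: L2_norm_minus_commute[of U f])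
 finally show ?thesis using that t by blast
qed

lemma test_fun_dense_seq:
 fixes f :: "real^2 \<Rightarrow> 'a::euclidean_space"
 assumes f: "L2 U f"
 obtains \<Phi> where "\<And>j::nat. test_fun U (\<Phi> j)" "L2_lim U \<Phi> f"
proof -
 have "\<exists>\<phi>. test_fun U \<phi> \<and> dst f \<phi> < inverse (real (Suc j))" for j
  using test_fun_dense[OF f, of "inverse (real (Suc j))"] by (metis inverse_positive_iff_positive of_nat_0_less_iff zero_less_Suc)
 then obtain \<Phi> where \<Phi>: "\<And>j. test_fun U (\<Phi> j)" "\<And>j. dst f (\<Phi> j) < inverse (real (Suc j))" by metis
 show ?thesis
 proof (rule that[OF \<Phi>(1)])
  show "L2_lim U \<Phi> f" by (rule tendsto_sandwich[OF _ _ tendsto_const LIMSEQ_inverse_real_of_nat])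
     (use \<Phi>(2) in \<open>auto simp: L2_norm_minus_commute[of U _ f] intro!: always_eventually less_imp_le\<close>)
 qed
qed

text \<open>Testing with an approximation of \<open>f\<close> itself gives the square of the norm on
  the left. The lemma turns weak estimates, in which derivatives fall on the test function, into
  norm bounds.\<close>

lemma L2_norm_le_by_duality:
 fixes f :: "real^2 \<Rightarrow> 'a::euclidean_space"
 assumes f: "L2 U f" and "0 \<le> M" and M: "\<And>\<phi>. test_fun U \<phi> \<Longrightarrow> \<bar>ip U f \<phi>\<bar> \<le> M * nrm \<phi>"
 shows "nrm f \<le> M"
proof -
 obtain \<Phi> where \<Phi>: "\<And>j::nat. test_fun U (\<Phi> j)" "L2_lim U \<Phi> f" using test_fun_dense_seq[OF f] by blast
 have "(\<lambda>j. \<bar>ip U f (\<Phi> j)\<bar>) \<longlonglongrightarrow> \<bar>ip U f f\<bar>" by (intro tendsto_rabs tendsto_ip_right f L2_test_fun[OF \<Phi>(1)] \<Phi>(2))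
 moreover have "(\<lambda>j. M * nrm (\<Phi> j)) \<longlonglongrightarrow> M * nrm f"
  by (intro tendsto_mult_left tendsto_L2_norm f L2_test_fun[OF \<Phi>(1)] \<Phi>(2))
 ultimately have "\<bar>ip U f f\<bar> \<le> M * nrm f" by (rule LIMSEQ_le) (auto intro: M \<Phi>)
 then have *: "nrm f * nrm f \<le> M * nrm f" by (simp add: L2_norm_sq[symmetric] power2_eq_square)
 show ?thesis
 proof (cases "nrm f = 0")
  case True
  with \<open>0 \<le> M\<close> show ?thesis by simp
 next
  case False
  then have "nrm f > 0" using L2_norm_nonneg[of U f] by linarith
  with * show ?thesis by simp
 qed
qed

end

section \<open>Weak derivatives\<close>

context bounded_open
begin

lemma integral_test_fun_lborel:
 fixes \<phi> :: "real^2 \<Rightarrow> 'a::euclidean_space"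
 assumes \<phi>: "test_fun U \<phi>"
 shows "integrable lborel \<phi>" "(LINT x|\<mu>. \<phi> x) = (LINT x|lborel. \<phi> x)"
proof -
 obtain K where K: "compact K" "K \<subseteq> U" "\<And>x. x \<notin> K \<Longrightarrow> \<phi> x = 0" using \<phi> by (meson test_fun_support)
 have "integrable lborel (\<lambda>x. indicator K x *\<^sub>R \<phi> x)"
  by (intro borel_integrable_compact K continuous_on_subset[OF test_fun_continuous[OF \<phi>]]) auto
 moreover have "(\<lambda>x. indicator K x *\<^sub>R \<phi> x) = \<phi>" using K(3) by (auto simp: indicator_def fun_eq_iff)
 ultimately show "integrable lborel \<phi>" by simp
 have "(LINT x|\<mu>. \<phi> x) = (LINT x|lebesgue. indicator U x *\<^sub>R \<phi> x)" by (simp add: integral_restrict_space)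
 also have "(\<lambda>x. indicator U x *\<^sub>R \<phi> x) = \<phi>" using test_fun_outside[OF \<phi>] by (auto simp: indicator_def fun_eq_iff)
 also have "(LINT x|lebesgue. \<phi> x) = (LINT x|lborel. \<phi> x)"
  using borel_measurable_continuous_onI[OF test_fun_continuous[OF \<phi>]] by (intro integral_completion) simp
 finally show "(LINT x|\<mu>. \<phi> x) = (LINT x|lborel. \<phi> x)" .
qed

text \<open>Translation invariance replaces iterated integration: \<phi>(x+h) - \<phi>(x) has
  integral 0 and differs from \<open>t\<close> times the partial derivative by a uniformly small
  multiple of \<open>t\<close>, so the integral of the derivative is arbitrarily small.\<close>

lemma integral_pd_eq_0:
 fixes \<phi> :: "real^2 \<Rightarrow> 'a::euclidean_space"
 assumes \<phi>: "test_fun U \<phi>"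
 shows "(LINT x|\<mu>. pd i \<phi> x) = 0"
proof -
 obtain K where K: "compact K" "K \<subseteq> U" "\<And>x. x \<notin> K \<Longrightarrow> \<phi> x = 0" using \<phi> by (meson test_fun_support)
 obtain R where R: "\<And>x. x \<in> K \<Longrightarrow> norm x \<le> R" using compact_imp_bounded[OF K(1)] unfolding bounded_iff by blast
 \<comment> \<open>Shifts of length at most 1 keep the support inside this ball, whose measure is
   therefore the right factor for the uniform remainder.\<close>
 define m where "m = measure lborel (cball (0::real^2) (R + 1))"
 have int: "integrable lborel \<phi>" "integrable lborel (pd i \<phi>)"
  using integral_test_fun_lborel(1) \<phi> test_fun_pd by blast+
 have le: "norm (LINT x|lborel. pd i \<phi> x) \<le> e * m" if e: "e > 0" for e
 proof -
  obtain d where d: "d > 0" "\<And>x h. norm h < d \<Longrightarrow>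
    norm (\<phi> (x + h) - \<phi> x - frechet_derivative \<phi> (at x) h) \<le> e * norm h"
   using test_fun_uniformly_differentiable[OF \<phi> e] by blast
  define t where "t = min (d / 2) 1"
  have t: "t > 0" "t < d" "t \<le> 1" using d(1) by (auto simp: t_def)
  define h where "h = t *\<^sub>R (axis i 1 :: real^2)"
  have h: "norm h = t" using t by (simp add: h_def)
  have Dh: "frechet_derivative \<phi> (at x) h = t *\<^sub>R pd i \<phi> x" for x
   using has_derivative_bounded_linear[OF test_fun_derivative[OF \<phi>, of x]] by (simp add: h_def pd_def linear_simps)
  have "Measure_Space.distr lborel borel ((+) h) = (lborel :: (real^2) measure)" by (rule lborel_distr_plus)
  then have shift: "integrable lborel (\<lambda>x. \<phi> (h + x))" "(LINT x|lborel. \<phi> (h + x)) = (LINT x|lborel. \<phi> x)"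
   using int(1) integrable_distr[of "(+) h" lborel borel \<phi>] integral_distr[of "(+) h" lborel borel \<phi>]
    borel_measurable_continuous_onI[OF test_fun_continuous[OF \<phi>]] by auto
  have "norm (LINT x|lborel. t *\<^sub>R pd i \<phi> x) = norm (LINT x|lborel. \<phi> (h + x) - \<phi> x - t *\<^sub>R pd i \<phi> x)"
   using int shift by simp
  also have "\<dots> \<le> (LINT x|lborel. e * t * indicator (cball (0::real^2) (R + 1)) x)"
  proof (rule order_trans[OF integral_norm_bound], rule integral_mono)
   show "integrable lborel (\<lambda>x. norm (\<phi> (h + x) - \<phi> x - t *\<^sub>R pd i \<phi> x))"
    using int shift by (intro integrable_norm Bochner_Integration.integrable_diff) auto
   show "integrable lborel (\<lambda>x. e * t * indicator (cball (0::real^2) (R + 1)) x)"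
    by (intro integrable_mult_right integrable_real_indicator) (use emeasure_bounded_finite[OF bounded_cball, of "0::real^2"] in auto)
   show "norm (\<phi> (h + x) - \<phi> x - t *\<^sub>R pd i \<phi> x) \<le> e * t * indicator (cball 0 (R + 1)) x" for x
   proof (cases "x \<in> cball 0 (R + 1)")
    case True
    then show ?thesis using d(2)[of h x] h t by (simp add: Dh add.commute)
   next
    case False
    then have "x \<notin> K" using R[of x] by auto
    moreover have "h + x \<notin> K" using R[of "h + x"] False h t norm_triangle_ineq2[of x "- h"]
     by (auto simp: add.commute)
    ultimately show ?thesis using False K(3) pd_outside_support[of K \<phi> x i] compact_imp_closed[OF K(1)] by auto
   qed
  qed
  also have "\<dots> = e * t * m" by (simp add: m_def)
  finally show ?thesis using t by simp
 qed
 have "norm (LINT x|lborel. pd i \<phi> x) \<le> 0"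
 proof (rule field_le_epsilon)
  fix e :: real assume e: "e > 0"
  have m: "m \<ge> 0" by (simp add: m_def)
  then have "e / (m + 1) * m \<le> e" using e by (simp add: field_simps)
  with le[of "e / (m + 1)"] e m show "norm (LINT x|lborel. pd i \<phi> x) \<le> 0 + e" by simp
 qed
 then show ?thesis using integral_test_fun_lborel(2)[OF test_fun_pd[OF \<phi>]] by simp
qed

lemma L2_test_scaleR:
 assumes \<theta>: "test_fun V \<theta>" and f: "L2 U f"
 shows "L2 U (\<lambda>x. \<theta> x *\<^sub>R f x)"
proof -
 obtain C where C: "\<And>x. norm (\<theta> x) \<le> C" using test_fun_bounded[OF \<theta>] by blast
 show ?thesis
 proof (rule L2_dominated(1)[OF f])
  show "(\<lambda>x. \<theta> x *\<^sub>R f x) \<in> borel_measurable \<mu>"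
   using continuous_measurable_dom[OF test_fun_continuous[OF \<theta>]] L2_measurable[OF f] by measurable
  show "AE x in \<mu>. norm (\<theta> x *\<^sub>R f x) \<le> C * norm (f x)" using C by (intro AE_I2) (auto intro: mult_right_mono)
 qed
qed

text \<open>The definition pairs a field with scalar test functions and compares vectors; here test
  fields of the same type are paired by the inner product. The two forms are exchanged by taking
  components along basis vectors.\<close>

proposition has_weak_pd_iff:
 fixes f g :: "real^2 \<Rightarrow> 'a::euclidean_space"
 shows "has_weak_pd U i f g \<longleftrightarrow>
  L2 U f \<and> L2 U g \<and> (\<forall>\<phi>. test_fun U \<phi> \<longrightarrow> ip U f (pd i \<phi>) = - ip U g \<phi>)"
proof (intro iffI conjI allI impI)
 assume w: "has_weak_pd U i f g"
 then show L: "L2 U f" "L2 U g" by (auto simp: has_weak_pd_def)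
 fix \<phi> :: "real^2 \<Rightarrow> 'a" assume \<phi>: "test_fun U \<phi>"
 have *: "(LINT x|\<mu>. (f x \<bullet> b) * (pd i \<phi> x \<bullet> b)) = - (LINT x|\<mu>. (g x \<bullet> b) * (\<phi> x \<bullet> b))" for b
 proof (cases "b = 0")
  case False
  have t: "test_fun U (\<lambda>x. \<phi> x \<bullet> b)" using \<phi> by (rule test_fun_inner)
  have pd: "pd i (\<lambda>x. \<phi> x \<bullet> b) x = pd i \<phi> x \<bullet> b" for x
   by (rule pd_bounded_linear[OF bounded_linear_inner_left test_fun_differentiable[OF \<phi>]])
  have 1: "integrable \<mu> (\<lambda>x. (pd i \<phi> x \<bullet> b) *\<^sub>R f x)"
   using L2_imp_integrable[OF L2_test_scaleR[OF test_fun_pd[OF t, of i] L(1)]] by (simp add: pd)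
  have 2: "integrable \<mu> (\<lambda>x. (\<phi> x \<bullet> b) *\<^sub>R g x)" by (rule L2_imp_integrable[OF L2_test_scaleR[OF t L(2)]])
  have "(LINT x|\<mu>. (pd i \<phi> x \<bullet> b) *\<^sub>R f x) = - (LINT x|\<mu>. (\<phi> x \<bullet> b) *\<^sub>R g x)"
   using w[unfolded has_weak_pd_def, THEN conjunct2, THEN conjunct2, rule_format, OF t] by (simp add: pd)
  then have "(LINT x|\<mu>. (pd i \<phi> x \<bullet> b) *\<^sub>R f x) \<bullet> b = - ((LINT x|\<mu>. (\<phi> x \<bullet> b) *\<^sub>R g x) \<bullet> b)" by simp
  then show ?thesis
   using integral_inner_left[OF 1, of b] integral_inner_left[OF 2, of b] False by (simp add: mult.commute)
 qed simp
 have e: "ip U h k = (\<Sum>b\<in>Basis. LINT x|\<mu>. (h x \<bullet> b) * (k x \<bullet> b))"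
  if "L2 U h" "L2 U k" for h k :: "real^2 \<Rightarrow> 'a" unfolding ip_def by (subst euclidean_inner)
    (use that L2_integrable_inner[OF L2_inner[OF that(1)] L2_inner[OF that(2)]] in
     \<open>auto intro!: Bochner_Integration.integral_sum\<close>)
 show "ip U f (pd i \<phi>) = - ip U g \<phi>" using L \<phi> by (simp add: e L2_test_fun[OF test_fun_pd] L2_test_fun * sum_negf)
next
 assume R: "L2 U f \<and> L2 U g \<and> (\<forall>\<phi>. test_fun U \<phi> \<longrightarrow> ip U f (pd i \<phi>) = - ip U g \<phi>)"
 then have L: "L2 U f" "L2 U g" by auto
 show "has_weak_pd U i f g" unfolding has_weak_pd_def
 proof (intro conjI allI impI L)
  fix \<theta> :: "real^2 \<Rightarrow> real" assume \<theta>: "test_fun U \<theta>"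
  have 1: "integrable \<mu> (\<lambda>x. pd i \<theta> x *\<^sub>R f x)"
   by (rule L2_imp_integrable[OF L2_test_scaleR[OF test_fun_pd[OF \<theta>] L(1)]])
  have 2: "integrable \<mu> (\<lambda>x. \<theta> x *\<^sub>R g x)" by (rule L2_imp_integrable[OF L2_test_scaleR[OF \<theta> L(2)]])
  show "(LINT x|\<mu>. pd i \<theta> x *\<^sub>R f x) = - (LINT x|\<mu>. \<theta> x *\<^sub>R g x)"
  proof (rule euclidean_eqI)
   fix b :: 'a assume b: "b \<in> Basis"
   have "test_fun U (\<lambda>x. \<theta> x *\<^sub>R b)" using \<theta> by (rule test_fun_scaleR_const)
   then have "ip U f (pd i (\<lambda>x. \<theta> x *\<^sub>R b)) = - ip U g (\<lambda>x. \<theta> x *\<^sub>R b)" using R by blast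
   moreover have "pd i (\<lambda>x. \<theta> x *\<^sub>R b) x = pd i \<theta> x *\<^sub>R b" for x
    by (rule pd_bounded_linear[OF bounded_linear_scaleR_left test_fun_differentiable[OF \<theta>]])
   ultimately show "(LINT x|\<mu>. pd i \<theta> x *\<^sub>R f x) \<bullet> b = - (LINT x|\<mu>. \<theta> x *\<^sub>R g x) \<bullet> b"
    using integral_inner_left[OF 1, of b] integral_inner_left[OF 2, of b] nonzero_Basis[OF b]
    by (simp add: ip_def)
  qed
 qed
qed

lemma has_weak_pd_L2: "has_weak_pd U i f g \<Longrightarrow> L2 U f" "has_weak_pd U i f g \<Longrightarrow> L2 U g" by (auto simp: has_weak_pd_def)

lemma has_weak_pd_ip: "has_weak_pd U i f g \<Longrightarrow> test_fun U \<phi> \<Longrightarrow> ip U f (pd i \<phi>) = - ip U g \<phi>"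
 by (simp add: has_weak_pd_iff)

lemma L2_zero_by_duality:
 fixes f :: "real^2 \<Rightarrow> 'a::euclidean_space"
 assumes "L2 U f" "\<And>\<phi>. test_fun U \<phi> \<Longrightarrow> ip U f \<phi> = 0"
 shows "AE x in \<mu>. f x = 0"
proof -
 have "nrm f \<le> 0" using assms by (intro L2_norm_le_by_duality) auto
 then have "nrm f = 0" using L2_norm_nonneg[of U f] by linarith
 with assms(1) show ?thesis by (simp add: L2_norm_eq_0_iff)
qed

lemma L2_eq_by_duality:
 fixes f :: "real^2 \<Rightarrow> 'a::euclidean_space"
 assumes "L2 U f" "L2 U g" "\<And>\<phi>. test_fun U \<phi> \<Longrightarrow> ip U f \<phi> = ip U g \<phi>"
 shows "AE x in \<mu>. f x = g x"
 using L2_zero_by_duality[of "\<lambda>x. f x - g x"] assms by (simp add: L2_diff ip_simps L2_test_fun)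

lemma has_weak_pd_unique:
 fixes f g h :: "real^2 \<Rightarrow> 'a::euclidean_space"
 assumes "has_weak_pd U i f g" "has_weak_pd U i f h"
 shows "AE x in \<mu>. g x = h x"
proof (rule L2_eq_by_duality)
 fix \<phi> :: "real^2 \<Rightarrow> 'a" assume "test_fun U \<phi>"
 with assms[THEN has_weak_pd_ip] show "ip U g \<phi> = ip U h \<phi>" by (metis minus_minus)
qed (use assms in \<open>auto simp: has_weak_pd_def\<close>)

lemma has_weak_pd_weak_pd: "has_weak_pd U i f g \<Longrightarrow> has_weak_pd U i f (weak_pd U i f)"
 unfolding weak_pd_def by (rule someI[of _ g])

lemma weak_pd_eq: "has_weak_pd U i f g \<Longrightarrow> AE x in \<mu>. weak_pd U i f x = g x"
 by (rule has_weak_pd_unique[OF has_weak_pd_weak_pd])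

lemma has_weak_pd_add:
 assumes "has_weak_pd U i f f'" "has_weak_pd U i g g'"
 shows "has_weak_pd U i (\<lambda>x. f x + g x) (\<lambda>x. f' x + g' x)"
 using assms by (auto simp: has_weak_pd_iff ip_add_left L2_add L2_test_fun[OF test_fun_pd] L2_test_fun)

lemma has_weak_pd_scaleR:
 "has_weak_pd U i f f' \<Longrightarrow> has_weak_pd U i (\<lambda>x. c *\<^sub>R f x) (\<lambda>x. c *\<^sub>R f' x)"
 by (auto simp: has_weak_pd_iff ip_scaleR_left L2_scaleR)

lemma has_weak_pd_mult:
 "has_weak_pd U i f f' \<Longrightarrow> has_weak_pd U i (\<lambda>x. c * f x :: real) (\<lambda>x. c * f' x)"
 using has_weak_pd_scaleR[of i f f' c] by simp

lemma has_weak_pd_diff: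
 assumes "has_weak_pd U i f f'" "has_weak_pd U i g g'"
 shows "has_weak_pd U i (\<lambda>x. f x - g x) (\<lambda>x. f' x - g' x)"
 using has_weak_pd_add[OF assms(1) has_weak_pd_scaleR[OF assms(2), of "-1"]] by simp

lemma has_weak_pd_cong_AE:
 assumes "has_weak_pd U i f g" "AE x in \<mu>. f x = f' x" "AE x in \<mu>. g x = g' x"
 shows "has_weak_pd U i f' g'"
proof -
 have L: "L2 U f" "L2 U g" using assms(1) by (rule has_weak_pd_L2)+
 show ?thesis unfolding has_weak_pd_iff
 proof (intro conjI allI impI)
  show "L2 U f'" "L2 U g'" using L2_cong_AE[OF dom_sets L(1) assms(2)] L2_cong_AE[OF dom_sets L(2) assms(3)] by auto
  fix \<phi> :: "real^2 \<Rightarrow> 'a" assume \<phi>: "test_fun U \<phi>"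
  have "ip U f' (pd i \<phi>) = ip U f (pd i \<phi>)" by (rule ip_cong_AE[OF dom_sets _ _ assms(2), symmetric])
     (auto intro: L2_measurable L L2_test_fun[OF test_fun_pd[OF \<phi>]])
  moreover have "ip U g' \<phi> = ip U g \<phi>" by (rule ip_cong_AE[OF dom_sets _ _ assms(3), symmetric])
     (auto intro: L2_measurable L L2_test_fun[OF \<phi>])
  ultimately show "ip U f' (pd i \<phi>) = - ip U g' \<phi>" using has_weak_pd_ip[OF assms(1) \<phi>] by simp
 qed
qed

lemma has_weak_pd_scaleR_test:
 fixes f g :: "real^2 \<Rightarrow> 'a::euclidean_space"
 assumes f: "has_weak_pd U i f g" and \<theta>: "test_fun V \<theta>"
 shows "has_weak_pd U i (\<lambda>x. \<theta> x *\<^sub>R f x) (\<lambda>x. \<theta> x *\<^sub>R g x + pd i \<theta> x *\<^sub>R f x)"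
proof -
 have L: "L2 U f" "L2 U g" using f by (rule has_weak_pd_L2)+
 show ?thesis unfolding has_weak_pd_iff
 proof (intro conjI allI impI)
  show L1: "L2 U (\<lambda>x. \<theta> x *\<^sub>R f x)" by (rule L2_test_scaleR[OF \<theta> L(1)])
  have L2: "L2 U (\<lambda>x. \<theta> x *\<^sub>R g x)" by (rule L2_test_scaleR[OF \<theta> L(2)])
  have L3: "L2 U (\<lambda>x. pd i \<theta> x *\<^sub>R f x)" by (rule L2_test_scaleR[OF test_fun_pd[OF \<theta>] L(1)])
  show "L2 U (\<lambda>x. \<theta> x *\<^sub>R g x + pd i \<theta> x *\<^sub>R f x)" by (intro L2_add L2 L3)
  fix \<phi> :: "real^2 \<Rightarrow> 'a" assume \<phi>: "test_fun U \<phi>"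
  have t: "test_fun U (\<lambda>x. \<theta> x *\<^sub>R \<phi> x)" using \<phi> test_fun_C_k[OF \<theta>] by (rule test_fun_scaleR)
  have pd: "pd i (\<lambda>x. \<theta> x *\<^sub>R \<phi> x) x = \<theta> x *\<^sub>R pd i \<phi> x + pd i \<theta> x *\<^sub>R \<phi> x" for x
   by (rule pd_scaleR[OF test_fun_differentiable[OF \<theta>] test_fun_differentiable[OF \<phi>]])
  have "ip U f (pd i (\<lambda>x. \<theta> x *\<^sub>R \<phi> x)) = - ip U g (\<lambda>x. \<theta> x *\<^sub>R \<phi> x)" by (rule has_weak_pd_ip[OF f t])
  moreover have "ip U f (pd i (\<lambda>x. \<theta> x *\<^sub>R \<phi> x)) =
    ip U (\<lambda>x. \<theta> x *\<^sub>R f x) (pd i \<phi>) + ip U (\<lambda>x. pd i \<theta> x *\<^sub>R f x) \<phi>"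
   using L2_integrable_inner[OF L1 L2_test_fun[OF test_fun_pd[OF \<phi>, of i]]]
    L2_integrable_inner[OF L3 L2_test_fun[OF \<phi>]] by (simp add: ip_def pd inner_add_right)
  moreover have "ip U g (\<lambda>x. \<theta> x *\<^sub>R \<phi> x) = ip U (\<lambda>x. \<theta> x *\<^sub>R g x) \<phi>" by (simp add: ip_def)
  ultimately show "ip U (\<lambda>x. \<theta> x *\<^sub>R f x) (pd i \<phi>) = - ip U (\<lambda>x. \<theta> x *\<^sub>R g x + pd i \<theta> x *\<^sub>R f x) \<phi>"
   using L2 L3 L2_test_fun[OF \<phi>] by (simp add: ip_add_left)
 qed
qed

lemma has_weak_pd_test_fun:
 fixes \<theta> :: "real^2 \<Rightarrow> 'a::euclidean_space"
 assumes \<theta>: "test_fun U \<theta>"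
 shows "has_weak_pd U i \<theta> (pd i \<theta>)" unfolding has_weak_pd_iff
proof (intro conjI allI impI)
 show L: "L2 U \<theta>" "L2 U (pd i \<theta>)" using L2_test_fun \<theta> test_fun_pd by blast+
 fix \<phi> :: "real^2 \<Rightarrow> 'a" assume \<phi>: "test_fun U \<phi>"
 have t: "test_fun U (\<lambda>x. \<theta> x \<bullet> \<phi> x)"
 proof -
  obtain K where K: "compact K" "K \<subseteq> U" "\<And>x. x \<notin> K \<Longrightarrow> \<phi> x = 0" using \<phi> by (meson test_fun_support)
  show ?thesis
   by (rule test_funI[OF C_k_bilinear[OF bounded_bilinear_inner test_fun_C_k[OF \<theta>] test_fun_C_k[OF \<phi>]] K(1,2)])
     (simp add: K(3))
 qed
 have pd: "pd i (\<lambda>x. \<theta> x \<bullet> \<phi> x) x = \<theta> x \<bullet> pd i \<phi> x + pd i \<theta> x \<bullet> \<phi> x" for x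
  by (rule pd_bilinear[OF bounded_bilinear_inner test_fun_differentiable[OF \<theta>] test_fun_differentiable[OF \<phi>]])
 show "ip U \<theta> (pd i \<phi>) = - ip U (pd i \<theta>) \<phi>"
  using integral_pd_eq_0[OF t, of i] L2_integrable_inner[OF L(1) L2_test_fun[OF test_fun_pd[OF \<phi>, of i]]]
   L2_integrable_inner[OF L(2) L2_test_fun[OF \<phi>]] by (simp add: ip_def pd)
qed

lemma has_weak_pd_limit:
 fixes f g :: "real^2 \<Rightarrow> 'a::euclidean_space"
 assumes F: "\<And>j::nat. has_weak_pd U i (F j) (G j)" and f: "L2 U f" and g: "L2 U g"
  and limF: "L2_lim U F f"
  and limG: "L2_lim U G g"
 shows "has_weak_pd U i f g" unfolding has_weak_pd_iff
proof (intro conjI allI impI f g)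
 fix \<phi> :: "real^2 \<Rightarrow> 'a" assume \<phi>: "test_fun U \<phi>"
 have "(\<lambda>j. ip U (F j) (pd i \<phi>)) \<longlonglongrightarrow> ip U f (pd i \<phi>)"
  by (intro tendsto_ip_left has_weak_pd_L2(1)[OF F] f limF L2_test_fun[OF test_fun_pd[OF \<phi>]])
 moreover have "(\<lambda>j. - ip U (G j) \<phi>) \<longlonglongrightarrow> - ip U g \<phi>"
  by (intro tendsto_minus tendsto_ip_left has_weak_pd_L2(2)[OF F] g limG L2_test_fun[OF \<phi>])
 ultimately show "ip U f (pd i \<phi>) = - ip U g \<phi>" using has_weak_pd_ip[OF F \<phi>] LIMSEQ_unique by simp
qed

lemma has_weak_pd_bounded_linear:
 fixes L :: "'a::euclidean_space \<Rightarrow> 'b::euclidean_space"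
 assumes L: "bounded_linear L" and w: "has_weak_pd U i f g"
 shows "has_weak_pd U i (\<lambda>x. L (f x)) (\<lambda>x. L (g x))"
proof -
 obtain C where C: "\<And>x. norm (L x) \<le> C * norm x" using bounded_linear.bounded[OF L] by (metis mult.commute)
 have LL: "L2 U (\<lambda>x. L (h x))" if "L2 U h" for h by (rule L2_dominated(1)[OF that, where K = C])
    (use C L2_measurable[OF that] bounded_linear.continuous_on[OF L continuous_on_id, of UNIV] in
     \<open>auto intro: borel_measurable_continuous_on[where f = L]\<close>)
 show ?thesis unfolding has_weak_pd_def
 proof (intro conjI allI impI LL has_weak_pd_L2[OF w])
  fix \<phi> :: "real^2 \<Rightarrow> real" assume \<phi>: "test_fun U \<phi>"
  have 1: "integrable \<mu> (\<lambda>x. pd i \<phi> x *\<^sub>R f x)"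
   by (rule L2_imp_integrable[OF L2_test_scaleR[OF test_fun_pd[OF \<phi>] has_weak_pd_L2(1)[OF w]]])
  have 2: "integrable \<mu> (\<lambda>x. \<phi> x *\<^sub>R g x)"
   by (rule L2_imp_integrable[OF L2_test_scaleR[OF \<phi> has_weak_pd_L2(2)[OF w]]])
  have "L (LINT x|\<mu>. pd i \<phi> x *\<^sub>R f x) = L (- (LINT x|\<mu>. \<phi> x *\<^sub>R g x))" using w \<phi> by (simp add: has_weak_pd_def)
  then show "(LINT x|\<mu>. pd i \<phi> x *\<^sub>R L (f x)) = - (LINT x|\<mu>. \<phi> x *\<^sub>R L (g x))"
   using integral_bounded_linear[OF L 1] integral_bounded_linear[OF L 2]
   by (simp add: bounded_linear.linear[OF L] linear_cmul linear_neg)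
 qed
qed

lemma has_weak_pd_nth:
 "has_weak_pd U i f g \<Longrightarrow> has_weak_pd U i (\<lambda>x. f x $ k) (\<lambda>x. (g :: real^2 \<Rightarrow> real^2) x $ k)"
 by (rule has_weak_pd_bounded_linear[OF bounded_linear_vec_nth])

lemma weak_pd_nth:
 fixes f g :: "real^2 \<Rightarrow> real^2"
 assumes "has_weak_pd U i f g"
 shows "AE x in \<mu>. weak_pd U i (\<lambda>x. f x $ k) x = weak_pd U i f x $ k"
 using weak_pd_eq[OF has_weak_pd_nth[OF assms]] weak_pd_eq[OF assms] by eventually_elim simp

end

section \<open>Sobolev fields of order one and zero traces\<close>

context bounded_open
begin

lemma sobolev_1_iff:
 fixes f :: "real^2 \<Rightarrow> 'a::euclidean_space"
 shows "sobolev U 1 f \<longleftrightarrow> (\<forall>i. has_weak_pd U i f (weak_pd U i f))"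
 unfolding One_nat_def sobolev.simps using has_weak_pd_weak_pd[of _ f] has_weak_pd_L2[of _ f] by blast

lemma sobolev_1I:
 fixes f :: "real^2 \<Rightarrow> 'a::euclidean_space"
 shows "(\<And>i. has_weak_pd U i f (g i)) \<Longrightarrow> sobolev U 1 f" using has_weak_pd_weak_pd sobolev_1_iff by blast

lemma sobolev_1D:
 fixes f :: "real^2 \<Rightarrow> 'a::euclidean_space"
 shows "sobolev U 1 f \<Longrightarrow> has_weak_pd U i f (weak_pd U i f)" by (simp only: sobolev_1_iff)

lemma sobolev_1_L2:
 fixes f :: "real^2 \<Rightarrow> 'a::euclidean_space"
 shows "sobolev U 1 f \<Longrightarrow> L2 U f" "sobolev U 1 f \<Longrightarrow> L2 U (weak_pd U i f)"
 using sobolev_1D[of f i] by (auto simp: has_weak_pd_def)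

text \<open>The representative chosen by \<open>weak_pd\<close> need not be the one that
  \<open>sobolev\<close> supplies, and regularity is stated for the latter; hence the equality
  almost everywhere.\<close>

lemma sobolev_SucD:
 fixes f :: "real^2 \<Rightarrow> 'a::euclidean_space"
 assumes "sobolev U (Suc k) f"
 shows "has_weak_pd U i f (weak_pd U i f)" "\<exists>g. (AE x in \<mu>. weak_pd U i f x = g x) \<and> sobolev U k g"
 using assms weak_pd_eq[of i f] has_weak_pd_weak_pd[of i f] by fastforce+

lemma sobolev_norm_Suc_bounds:
 shows "nrm f \<le> sobolev_norm U (Suc k) f"
  and "sobolev_norm U k (weak_pd U i f) \<le> sobolev_norm U (Suc k) f"
proof -
 have nonneg: "sobolev_norm U k g \<ge> 0" for k and g :: "real^2 \<Rightarrow> 'a::euclidean_space"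
  by (cases k) (auto intro!: add_nonneg_nonneg sum_nonneg)
 show "nrm f \<le> sobolev_norm U (Suc k) f" by (auto intro!: real_le_rsqrt sum_nonneg)
 have "(sobolev_norm U k (weak_pd U i f))\<^sup>2 \<le> (\<Sum>i\<in>UNIV. (sobolev_norm U k (weak_pd U i f))\<^sup>2)"
  by (rule member_le_sum) auto
 then show "sobolev_norm U k (weak_pd U i f) \<le> sobolev_norm U (Suc k) f"
  by (auto intro!: real_le_rsqrt add_increasing)
qed

lemma sobolev_norm_1_bounds:
 shows "nrm f \<le> sobolev_norm U 1 f" "nrm (weak_pd U i f) \<le> sobolev_norm U 1 f"
 using sobolev_norm_Suc_bounds[where k = 0 and f = f] by (simp_all add: One_nat_def del: sobolev_norm.simps(2))

lemma sobolev_norm_1_le: "sobolev_norm U 1 f \<le> nrm f + nrm (weak_pd U 1 f) + nrm (weak_pd U 2 f)"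
proof -
 have "sqrt (a\<^sup>2 + (b\<^sup>2 + c\<^sup>2)) \<le> a + b + c" if "a \<ge> 0" "b \<ge> 0" "c \<ge> 0" for a b c :: real
  using that by (intro real_le_lsqrt) (auto simp: power2_eq_square algebra_simps)
 then show ?thesis by (simp add: sum_2 One_nat_def)
qed

lemma grad_norm_sq: "(grad_norm U f)\<^sup>2 = (\<Sum>i\<in>UNIV. (nrm (weak_pd U i f))\<^sup>2)" by (simp add: grad_norm_def sum_nonneg)

lemma grad_norm_nonneg: "0 \<le> grad_norm U f" by (simp add: grad_norm_def sum_nonneg)

lemma L2_norm_weak_pd_le_grad_norm: "nrm (weak_pd U i f) \<le> grad_norm U f"
proof (rule power2_le_imp_le)
 show "(nrm (weak_pd U i f))\<^sup>2 \<le> (grad_norm U f)\<^sup>2" unfolding grad_norm_sq by (rule member_le_sum) auto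
qed (rule grad_norm_nonneg)

lemma zero_trace_sobolev: "zero_trace U f \<Longrightarrow> sobolev U 1 f" by (simp add: zero_trace_def)

lemma zero_trace_approx:
 fixes f :: "real^2 \<Rightarrow> 'a::euclidean_space"
 assumes "zero_trace U f"
 obtains \<Phi> where "\<And>j::nat. test_fun U (\<Phi> j)" "L2_lim U \<Phi> f"
  "\<And>i. (\<lambda>j. dst (pd i (\<Phi> j)) (weak_pd U i f)) \<longlonglongrightarrow> 0"
proof -
 obtain \<Phi> where \<Phi>: "\<And>j::nat. test_fun U (\<Phi> j)" "(\<lambda>j. sobolev_norm U 1 (\<lambda>x. f x - \<Phi> j x)) \<longlonglongrightarrow> 0"
  using assms by (auto simp: zero_trace_def)
 have f: "sobolev U 1 f" using assms by (rule zero_trace_sobolev)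
 have eq: "dst (pd i (\<Phi> j)) (weak_pd U i f) = nrm (weak_pd U i (\<lambda>x. f x - \<Phi> j x))" for i j
 proof -
  have w: "has_weak_pd U i (\<lambda>x. f x - \<Phi> j x) (\<lambda>x. weak_pd U i f x - pd i (\<Phi> j) x)"
   by (intro has_weak_pd_diff sobolev_1D f has_weak_pd_test_fun \<Phi>)
  show ?thesis using L2_norm_cong_AE[OF dom_sets has_weak_pd_L2(2)[OF has_weak_pd_weak_pd[OF w]] weak_pd_eq[OF w]]
   by (subst L2_norm_minus_commute) simp
 qed
 show ?thesis
 proof (rule that[OF \<Phi>(1)])
  show "L2_lim U \<Phi> f" by (rule tendsto_sandwich[OF _ _ tendsto_const \<Phi>(2)])
     (simp_all only: L2_norm_minus_commute[of U _ f] L2_norm_nonneg eventually_True sobolev_norm_1_bounds)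
  show "(\<lambda>j. dst (pd i (\<Phi> j)) (weak_pd U i f)) \<longlonglongrightarrow> 0" for i
   unfolding eq by (rule tendsto_sandwich[OF _ _ tendsto_const \<Phi>(2)])
     (simp_all only: L2_norm_nonneg eventually_True sobolev_norm_1_bounds)
 qed
qed

lemma zero_traceI:
 fixes f :: "real^2 \<Rightarrow> 'a::euclidean_space"
 assumes w: "\<And>i. has_weak_pd U i f (g i)" and \<Phi>: "\<And>j::nat. test_fun U (\<Phi> j)"
  and lim: "L2_lim U \<Phi> f"
   "\<And>i. (\<lambda>j. dst (pd i (\<Phi> j)) (g i)) \<longlonglongrightarrow> 0"
 shows "zero_trace U f" unfolding zero_trace_def
proof (intro conjI exI allI)
 show "sobolev U 1 f" by (rule sobolev_1I[OF w])
 show "test_fun U (\<Phi> j)" for j by (rule \<Phi>)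
 have eq: "nrm (weak_pd U i (\<lambda>x. f x - \<Phi> j x)) = dst (pd i (\<Phi> j)) (g i)" for i j
 proof -
  have w: "has_weak_pd U i (\<lambda>x. f x - \<Phi> j x) (\<lambda>x. g i x - pd i (\<Phi> j) x)"
   by (intro has_weak_pd_diff w has_weak_pd_test_fun \<Phi>)
  show ?thesis using L2_norm_cong_AE[OF dom_sets has_weak_pd_L2(2)[OF has_weak_pd_weak_pd[OF w]] weak_pd_eq[OF w]]
   by (subst L2_norm_minus_commute) simp
 qed
 show "(\<lambda>j. sobolev_norm U 1 (\<lambda>x. f x - \<Phi> j x)) \<longlonglongrightarrow> 0"
 proof (rule tendsto_sandwich[OF _ _ tendsto_const])
  show "\<forall>\<^sub>F j in sequentially. sobolev_norm U 1 (\<lambda>x. f x - \<Phi> j x) \<le>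
    dst (\<Phi> j) f + dst (pd 1 (\<Phi> j)) (g 1) + dst (pd 2 (\<Phi> j)) (g 2)"
  proof (intro always_eventually allI)
   fix j
   show "sobolev_norm U 1 (\<lambda>x. f x - \<Phi> j x) \<le>
    dst (\<Phi> j) f + dst (pd 1 (\<Phi> j)) (g 1) + dst (pd 2 (\<Phi> j)) (g 2)"
    using sobolev_norm_1_le[of "\<lambda>x. f x - \<Phi> j x"] L2_norm_minus_commute[of U f "\<Phi> j"] by (simp add: eq)
  qed
  have "(\<lambda>j. dst (\<Phi> j) f + dst (pd 1 (\<Phi> j)) (g 1) + dst (pd 2 (\<Phi> j)) (g 2)) \<longlonglongrightarrow> 0 + 0 + 0" by (intro tendsto_add lim)
  then show "(\<lambda>j. dst (\<Phi> j) f + dst (pd 1 (\<Phi> j)) (g 1) + dst (pd 2 (\<Phi> j)) (g 2)) \<longlonglongrightarrow> 0" by simp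
  show "\<forall>\<^sub>F j in sequentially. 0 \<le> sobolev_norm U 1 (\<lambda>x. f x - \<Phi> j x)"
   by (intro always_eventually allI order_trans[OF L2_norm_nonneg sobolev_norm_1_bounds(1)])
 qed
qed

text \<open>Diagonal argument: each \<open>F j\<close> is replaced by a test function within
  \<open>1 / (j + 1)\<close> of it together with both derivatives. This closedness carries the
  boundary condition of the velocity to exceptional times.\<close>

lemma zero_trace_limit:
 fixes f :: "real^2 \<Rightarrow> 'a::euclidean_space"
 assumes F: "\<And>j::nat. zero_trace U (F j)" and w: "\<And>i. has_weak_pd U i f (g i)"
  and lim: "L2_lim U F f"
   "\<And>i. (\<lambda>j. dst (weak_pd U i (F j)) (g i)) \<longlonglongrightarrow> 0"
 shows "zero_trace U f"
proof -
 have "\<exists>\<phi>. test_fun U \<phi> \<and> dst \<phi> (F j) < inverse (real (Suc j)) \<and>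
   (\<forall>i. dst (pd i \<phi>) (weak_pd U i (F j)) < inverse (real (Suc j)))" for j
 proof -
  obtain \<Phi> where \<Phi>: "\<And>k::nat. test_fun U (\<Phi> k)" "L2_lim U \<Phi> (F j)"
   "\<And>i. (\<lambda>k. dst (pd i (\<Phi> k)) (weak_pd U i (F j))) \<longlonglongrightarrow> 0" using zero_trace_approx[OF F[of j]] by blast
  have pos: "inverse (real (Suc j)) > 0" by simp
  have "\<forall>\<^sub>F k in sequentially. dst (\<Phi> k) (F j) < inverse (real (Suc j)) \<and>
    (\<forall>i\<in>UNIV. dst (pd i (\<Phi> k)) (weak_pd U i (F j)) < inverse (real (Suc j)))"
   by (intro eventually_conj eventually_ball_finite ballI order_tendstoD(2)[OF \<Phi>(2) pos]
     order_tendstoD(2)[OF \<Phi>(3) pos]) auto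
  then obtain k where "dst (\<Phi> k) (F j) < inverse (real (Suc j)) \<and>
    (\<forall>i\<in>UNIV. dst (pd i (\<Phi> k)) (weak_pd U i (F j)) < inverse (real (Suc j)))"
   unfolding eventually_sequentially by blast
  with \<Phi>(1) show ?thesis by blast
 qed
 then obtain \<Psi> where \<Psi>: "\<And>j. test_fun U (\<Psi> j)" "\<And>j. dst (\<Psi> j) (F j) < inverse (real (Suc j))"
   "\<And>i j. dst (pd i (\<Psi> j)) (weak_pd U i (F j)) < inverse (real (Suc j))" by metis
 have squeeze: "L2_lim U P q"
  if P: "\<And>j. L2 U (P j)" "\<And>j. L2 U (Q j)" "L2 U q"
   and le: "\<And>j. dst (P j) (Q j) < inverse (real (Suc j))"
   and lim: "L2_lim U Q q"
  for P Q :: "nat \<Rightarrow> real^2 \<Rightarrow> 'a" and q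
 proof (rule tendsto_sandwich[OF _ _ tendsto_const])
  show "\<forall>\<^sub>F j in sequentially. dst (P j) q \<le> inverse (real (Suc j)) + dst (Q j) q"
  proof (intro always_eventually allI)
   fix j
   show "dst (P j) q \<le> inverse (real (Suc j)) + dst (Q j) q"
    using L2_norm_triangle3[OF P(1)[of j] P(2)[of j] P(3)] le[of j] by linarith
  qed
  show "(\<lambda>j. inverse (real (Suc j)) + dst (Q j) q) \<longlonglongrightarrow> 0" using tendsto_add[OF LIMSEQ_inverse_real_of_nat lim] by simp
 qed auto
 have LF: "L2 U (F j)" "L2 U (weak_pd U i (F j))" for i j using sobolev_1_L2[OF zero_trace_sobolev[OF F]] by auto
 show ?thesis
 proof (rule zero_traceI[OF w \<Psi>(1)])
  show "L2_lim U \<Psi> f" by (rule squeeze[OF L2_test_fun[OF \<Psi>(1)] LF(1) has_weak_pd_L2(1)[OF w] \<Psi>(2) lim(1)])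
  show "(\<lambda>j. dst (pd i (\<Psi> j)) (g i)) \<longlonglongrightarrow> 0" for i
   by (rule squeeze[OF L2_test_fun[OF test_fun_pd[OF \<Psi>(1)]] LF(2) has_weak_pd_L2(2)[OF w] \<Psi>(3) lim(2)])
 qed
qed

lemma zero_trace_diff:
 fixes f g :: "real^2 \<Rightarrow> 'a::euclidean_space"
 assumes "zero_trace U f" "zero_trace U g"
 shows "zero_trace U (\<lambda>x. f x - g x)"
proof -
 obtain \<Phi> where \<Phi>: "\<And>j::nat. test_fun U (\<Phi> j)" "L2_lim U \<Phi> f"
  "\<And>i. (\<lambda>j. dst (pd i (\<Phi> j)) (weak_pd U i f)) \<longlonglongrightarrow> 0" using zero_trace_approx[OF assms(1)] by blast
 obtain \<Psi> where \<Psi>: "\<And>j::nat. test_fun U (\<Psi> j)" "L2_lim U \<Psi> g"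
  "\<And>i. (\<lambda>j. dst (pd i (\<Psi> j)) (weak_pd U i g)) \<longlonglongrightarrow> 0" using zero_trace_approx[OF assms(2)] by blast
 note s = zero_trace_sobolev[OF assms(1)] zero_trace_sobolev[OF assms(2)]
 have lim: "(\<lambda>j. nrm (\<lambda>x. (P j x - Q j x) - (p x - q x))) \<longlonglongrightarrow> 0"
  if P: "\<And>j. L2 U (P j)" "\<And>j. L2 U (Q j)" "L2 U p" "L2 U q"
   and lim: "L2_lim U P p" "L2_lim U Q q"
  for P Q :: "nat \<Rightarrow> real^2 \<Rightarrow> 'a" and p q
 proof (rule tendsto_0_le)
  fix j :: nat
  have "(\<lambda>x. (P j x - Q j x) - (p x - q x)) = (\<lambda>x. (P j x - p x) - (Q j x - q x))" by (auto simp: algebra_simps)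
  then show "nrm (\<lambda>x. (P j x - Q j x) - (p x - q x)) \<le>
    dst (P j) p + dst (Q j) q"
   using L2_norm_triangle_diff[OF L2_diff[OF P(1)[of j] P(3)] L2_diff[OF P(2)[of j] P(4)]] by simp
 next
  show "(\<lambda>j. dst (P j) p + dst (Q j) q) \<longlonglongrightarrow> 0" using tendsto_add[OF lim] by simp
 qed auto
 have pd: "pd i (\<lambda>x. \<Phi> j x - \<Psi> j x) = (\<lambda>x. pd i (\<Phi> j) x - pd i (\<Psi> j) x)" for i j
 proof
  fix x
  have "((\<lambda>x. \<Phi> j x - \<Psi> j x) has_derivative
   (\<lambda>h. frechet_derivative (\<Phi> j) (at x) h - frechet_derivative (\<Psi> j) (at x) h)) (at x)"
   by (intro has_derivative_diff test_fun_derivative[OF \<Phi>(1)] test_fun_derivative[OF \<Psi>(1)])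
  from pd_eq[OF this, of i] show "pd i (\<lambda>x. \<Phi> j x - \<Psi> j x) x = pd i (\<Phi> j) x - pd i (\<Psi> j) x" by (simp add: pd_def)
 qed
 show ?thesis
 proof (rule zero_traceI[where \<Phi> = "\<lambda>j x. \<Phi> j x - \<Psi> j x" and g = "\<lambda>i x. weak_pd U i f x - weak_pd U i g x"])
  show "has_weak_pd U i (\<lambda>x. f x - g x) (\<lambda>x. weak_pd U i f x - weak_pd U i g x)" for i
   by (intro has_weak_pd_diff sobolev_1D s)
  show "test_fun U (\<lambda>x. \<Phi> j x - \<Psi> j x)" for j by (intro test_fun_diff \<Phi> \<Psi>)
  show "(\<lambda>j. nrm (\<lambda>x. (\<Phi> j x - \<Psi> j x) - (f x - g x))) \<longlonglongrightarrow> 0"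
   by (intro lim L2_test_fun[OF \<Phi>(1)] L2_test_fun[OF \<Psi>(1)] sobolev_1_L2 s \<Phi>(2) \<Psi>(2))
  show "(\<lambda>j. nrm (\<lambda>x. pd i (\<lambda>x. \<Phi> j x - \<Psi> j x) x - (weak_pd U i f x - weak_pd U i g x))) \<longlonglongrightarrow> 0" for i unfolding pd
   by (intro lim L2_test_fun[OF test_fun_pd[OF \<Phi>(1)]] L2_test_fun[OF test_fun_pd[OF \<Psi>(1)]] sobolev_1_L2 s \<Phi>(3) \<Psi>(3))
 qed
qed

lemma L2_norm_nth_le:
 fixes f :: "real^2 \<Rightarrow> real^2"
 assumes "L2 U f"
 shows "nrm (\<lambda>x. f x $ k) \<le> nrm f"
 using L2_dominated(2)[OF assms L2_measurable[OF L2_nth[OF assms]], where K = 1] component_le_norm_cart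
 by (auto intro: AE_I2)

lemma zero_trace_nth:
 fixes f :: "real^2 \<Rightarrow> real^2"
 assumes "zero_trace U f"
 shows "zero_trace U (\<lambda>x. f x $ k)"
proof -
 obtain \<Phi> where \<Phi>: "\<And>j::nat. test_fun U (\<Phi> j)" "L2_lim U \<Phi> f"
  "\<And>i. (\<lambda>j. dst (pd i (\<Phi> j)) (weak_pd U i f)) \<longlonglongrightarrow> 0" using zero_trace_approx[OF assms] by blast
 note s = zero_trace_sobolev[OF assms]
 have lim: "(\<lambda>j. nrm (\<lambda>x. P j x $ k - p x $ k)) \<longlonglongrightarrow> 0"
  if "\<And>j. L2 U (P j)" "L2 U p" "L2_lim U P p"
  for P :: "nat \<Rightarrow> real^2 \<Rightarrow> real^2" and p
 proof (rule tendsto_sandwich[OF _ _ tendsto_const that(3)])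
  show "\<forall>\<^sub>F j in sequentially. nrm (\<lambda>x. P j x $ k - p x $ k) \<le> dst (P j) p"
   using L2_norm_nth_le[OF L2_diff[OF that(1,2)], of _ k] by simp
 qed auto
 have pd: "pd i (\<lambda>x. \<Phi> j x $ k) = (\<lambda>x. pd i (\<Phi> j) x $ k)" for i j
  using pd_bounded_linear[OF bounded_linear_vec_nth test_fun_differentiable[OF \<Phi>(1)]] by blast
 show ?thesis
 proof (rule zero_traceI[where \<Phi> = "\<lambda>j x. \<Phi> j x $ k" and g = "\<lambda>i x. weak_pd U i f x $ k"])
  show "has_weak_pd U i (\<lambda>x. f x $ k) (\<lambda>x. weak_pd U i f x $ k)" for i by (intro has_weak_pd_nth sobolev_1D s)
  show "test_fun U (\<lambda>x. \<Phi> j x $ k)" for j by (intro test_fun_nth \<Phi>)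
  show "(\<lambda>j. nrm (\<lambda>x. \<Phi> j x $ k - f x $ k)) \<longlonglongrightarrow> 0" by (intro lim L2_test_fun[OF \<Phi>(1)] sobolev_1_L2 s \<Phi>(2))
  show "(\<lambda>j. nrm (\<lambda>x. pd i (\<lambda>x. \<Phi> j x $ k) x - weak_pd U i f x $ k)) \<longlonglongrightarrow> 0" for i unfolding pd
   by (intro lim L2_test_fun[OF test_fun_pd[OF \<Phi>(1)]] sobolev_1_L2 s \<Phi>(3))
 qed
qed

end

section \<open>Composition with smooth functions and bounded truncations\<close>

context bounded_open
begin

text \<open>The error of the derivative splits into \<open>h'\<close> at \<open>\<Phi> j\<close>
  times the error of the derivative of \<open>\<Phi> j\<close>, controlled by \<open>C\<close>, and
  the change of \<open>h'\<close> times \<open>g\<close>. The latter tends to 0 by dominated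
  convergence, which is where convergence almost everywhere enters.\<close>

lemma compose_limit:
 fixes f :: "real^2 \<Rightarrow> real" and g :: "2 \<Rightarrow> real^2 \<Rightarrow> real"
 assumes h: "smooth h" "h 0 = 0" "\<And>y. (h has_real_derivative h' y) (at y)" "\<And>y. \<bar>h' y\<bar> \<le> C"
  "continuous_on UNIV h'"
  and \<Phi>: "\<And>j::nat. test_fun U (\<Phi> j)" and f: "L2 U f" and g: "\<And>i. L2 U (g i)"
  and lim: "L2_lim U \<Phi> f"
   "\<And>i. (\<lambda>j. dst (pd i (\<Phi> j)) (g i)) \<longlonglongrightarrow> 0"
   "AE x in \<mu>. (\<lambda>j. \<Phi> j x) \<longlonglongrightarrow> f x"
 shows "L2 U (\<lambda>x. h (f x))" "L2 U (\<lambda>x. h' (f x) * g i x)"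
  "(\<lambda>j. nrm (\<lambda>x. h (\<Phi> j x) - h (f x))) \<longlonglongrightarrow> 0"
  "(\<lambda>j. nrm (\<lambda>x. pd i (\<lambda>x. h (\<Phi> j x)) x - h' (f x) * g i x)) \<longlonglongrightarrow> 0"
proof -
 have C: "C \<ge> 0" using order_trans[OF abs_ge_zero h(4)] .
 have lip: "\<bar>h a - h b\<bar> \<le> C * \<bar>a - b\<bar>" for a b
  using field_differentiable_bound[OF convex_UNIV, of h h' C a b] h(3,4) by auto
 have ch: "continuous_on UNIV h" using h(3) by (intro continuous_at_imp_continuous_on ballI DERIV_isCont) auto
 note [measurable] = L2_measurable[OF f] L2_measurable[OF g] L2_measurable[OF L2_test_fun[OF \<Phi>]]
  L2_measurable[OF L2_test_fun[OF test_fun_pd[OF \<Phi>]]]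
  borel_measurable_continuous_onI[OF ch] borel_measurable_continuous_onI[OF h(5)]
 show Lhf: "L2 U (\<lambda>x. h (f x))" by (rule L2_dominated(1)[OF f, where K = C]) (use lip[of _ 0] h(2) in auto)
 show "(\<lambda>j. nrm (\<lambda>x. h (\<Phi> j x) - h (f x))) \<longlonglongrightarrow> 0"
 proof (rule tendsto_0_le)
  fix j :: nat
  show "nrm (\<lambda>x. h (\<Phi> j x) - h (f x)) \<le> C * dst (\<Phi> j) f"
   by (rule L2_dominated(2)[OF L2_diff[OF L2_test_fun[OF \<Phi>] f] _ _ C]) (use lip in auto)
 next
  show "(\<lambda>j. C * dst (\<Phi> j) f) \<longlonglongrightarrow> 0" using tendsto_mult_left[OF lim(1), of C] by simp
 qed auto
 have Lg: "L2 U (\<lambda>x. h' (\<Phi> j x) * g i x)" for j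
  by (rule L2_dominated(1)[OF g[of i], where K = C]) (auto simp: abs_mult intro!: mult_right_mono h(4))
 have Lp: "L2 U (\<lambda>x. pd i (\<Phi> j) x - g i x)" for j by (intro L2_diff L2_test_fun[OF test_fun_pd[OF \<Phi>]] g)
 have Lhp: "L2 U (\<lambda>x. h' (\<Phi> j x) * (pd i (\<Phi> j) x - g i x))" for j
  by (rule L2_dominated(1)[OF Lp[of j], where K = C]) (auto simp: abs_mult intro!: mult_right_mono h(4))
 have Lhp_le: "nrm (\<lambda>x. h' (\<Phi> j x) * (pd i (\<Phi> j) x - g i x)) \<le> C * dst (pd i (\<Phi> j)) (g i)" for j
  by (rule L2_dominated(2)[OF Lp[of j] _ _ C]) (auto simp: abs_mult intro!: mult_right_mono h(4))
 have dom: "AE x in \<mu>. norm (h' (\<Phi> j x) * g i x) \<le> norm (C * g i x)" for j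
  using C by (auto simp: abs_mult intro!: mult_right_mono h(4))
 have conv: "AE x in \<mu>. (\<lambda>j. h' (\<Phi> j x) * g i x) \<longlonglongrightarrow> h' (f x) * g i x" using lim(3)
 proof eventually_elim
  case (elim x)
  show ?case by (intro tendsto_mult tendsto_const continuous_on_tendsto_compose[OF h(5) elim]) auto
 qed
 have meas: "(\<lambda>x. h' (\<Phi> j x) * g i x) \<in> borel_measurable \<mu>"
  "(\<lambda>x. h' (f x) * g i x) \<in> borel_measurable \<mu>" for j by measurable
 note dc = L2_dominated_convergence[OF meas L2_mult[OF g[of i], of C] dom conv]
 show Lhg: "L2 U (\<lambda>x. h' (f x) * g i x)" by (rule dc(1))
 have pd: "pd i (\<lambda>x. h (\<Phi> j x)) x = h' (\<Phi> j x) * pd i (\<Phi> j) x" for j x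
  by (rule pd_compose[OF h(3) test_fun_differentiable[OF \<Phi>]])
 show "(\<lambda>j. nrm (\<lambda>x. pd i (\<lambda>x. h (\<Phi> j x)) x - h' (f x) * g i x)) \<longlonglongrightarrow> 0"
 proof (rule tendsto_0_le)
  fix j :: nat
  have "(\<lambda>x. pd i (\<lambda>x. h (\<Phi> j x)) x - h' (f x) * g i x) =
    (\<lambda>x. h' (\<Phi> j x) * (pd i (\<Phi> j) x - g i x) + (h' (\<Phi> j x) * g i x - h' (f x) * g i x))"
   by (auto simp: pd algebra_simps)
  then show "nrm (\<lambda>x. pd i (\<lambda>x. h (\<Phi> j x)) x - h' (f x) * g i x) \<le>
    C * dst (pd i (\<Phi> j)) (g i) + nrm (\<lambda>x. h' (\<Phi> j x) * g i x - h' (f x) * g i x)"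
   using L2_norm_triangle[OF Lhp[of j] L2_diff[OF Lg[of j] Lhg]] Lhp_le[of j] by simp
 next
  show "(\<lambda>j. C * dst (pd i (\<Phi> j)) (g i) + nrm (\<lambda>x. h' (\<Phi> j x) * g i x - h' (f x) * g i x)) \<longlonglongrightarrow> 0"
   using tendsto_add[OF tendsto_mult_left[OF lim(2)[of i], of C] dc(3)] by simp
 qed auto
qed

lemma zero_trace_approx_AE:
 fixes f :: "real^2 \<Rightarrow> 'a::euclidean_space"
 assumes f: "zero_trace U f"
 obtains \<Phi> where "\<And>j::nat. test_fun U (\<Phi> j)" "L2_lim U \<Phi> f"
  "\<And>i. (\<lambda>j. dst (pd i (\<Phi> j)) (weak_pd U i f)) \<longlonglongrightarrow> 0"
  "AE x in \<mu>. (\<lambda>j. \<Phi> j x) \<longlonglongrightarrow> f x"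
proof -
 obtain \<Phi> where \<Phi>: "\<And>j::nat. test_fun U (\<Phi> j)" "L2_lim U \<Phi> f"
  "\<And>i. (\<lambda>j. dst (pd i (\<Phi> j)) (weak_pd U i f)) \<longlonglongrightarrow> 0" using zero_trace_approx[OF f] by blast
 obtain r where r: "strict_mono r" "AE x in \<mu>. (\<lambda>j. \<Phi> (r j) x) \<longlonglongrightarrow> f x"
  using L2_AE_subseq[OF L2_test_fun[OF \<Phi>(1)] sobolev_1_L2(1)[OF zero_trace_sobolev[OF f]] \<Phi>(2)] by blast
 show ?thesis by (rule that[of "\<lambda>j. \<Phi> (r j)"]) (use \<Phi> r LIMSEQ_subseq_LIMSEQ[OF _ r(1)] in \<open>auto simp: o_def\<close>)
qed

lemma zero_trace_compose:
 fixes f :: "real^2 \<Rightarrow> real"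
 assumes h: "smooth h" "h 0 = 0" "\<And>y. (h has_real_derivative h' y) (at y)" "\<And>y. \<bar>h' y\<bar> \<le> C"
  "continuous_on UNIV h'" and f: "zero_trace U f"
 shows "has_weak_pd U i (\<lambda>x. h (f x)) (\<lambda>x. h' (f x) * weak_pd U i f x)"
proof -
 obtain \<Phi> where \<Phi>: "\<And>j::nat. test_fun U (\<Phi> j)" "L2_lim U \<Phi> f"
  "\<And>i. (\<lambda>j. dst (pd i (\<Phi> j)) (weak_pd U i f)) \<longlonglongrightarrow> 0"
  "AE x in \<mu>. (\<lambda>j. \<Phi> j x) \<longlonglongrightarrow> f x" using zero_trace_approx_AE[OF f] by blast
 note s = sobolev_1_L2[OF zero_trace_sobolev[OF f]]
 note cl = compose_limit[OF h \<Phi>(1) s \<Phi>(2-4)]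
 show ?thesis by (rule has_weak_pd_limit[OF has_weak_pd_test_fun[OF test_fun_compose[OF \<Phi>(1) h(1,2)]] cl])
qed

lemma L2_vec:
 fixes f :: "2 \<Rightarrow> real^2 \<Rightarrow> real"
 assumes "\<And>k. L2 U (f k)"
 shows "L2 U (\<lambda>x. \<chi> k. f k x)" using assms by (intro L2_componentwise) simp

lemma L2_norm_vec_le:
 fixes f :: "2 \<Rightarrow> real^2 \<Rightarrow> real"
 assumes "\<And>k. L2 U (f k)"
 shows "nrm (\<lambda>x. \<chi> k. f k x) \<le> nrm (f 1) + nrm (f 2)"
proof -
 have "(\<lambda>x. \<chi> k. f k x) = (\<lambda>x. f 1 x *\<^sub>R axis 1 1 + f 2 x *\<^sub>R (axis 2 1 :: real^2))"
  by (auto simp: vec_eq_iff forall_2 axis_def)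
 moreover have "nrm (\<lambda>x. f k x *\<^sub>R (axis k 1 :: real^2)) = nrm (f k)" for k by (simp add: L2_norm_def)
 ultimately show ?thesis using L2_norm_triangle[OF L2_scaleR_right[OF assms[of 1]] L2_scaleR_right[OF assms[of 2]],
    of "axis 1 1 :: real^2" "axis 2 1"] by simp
qed

lemma test_fun_vec:
 fixes f :: "2 \<Rightarrow> real^2 \<Rightarrow> real"
 assumes "\<And>k. test_fun U (f k)"
 shows "test_fun U (\<lambda>x. \<chi> k. f k x)" "pd i (\<lambda>x. \<chi> k. f k x) = (\<lambda>x. \<chi> k. pd i (f k) x)"
proof -
 have eq: "(\<lambda>x. \<chi> k. f k x) = (\<lambda>x. f 1 x *\<^sub>R axis 1 1 + f 2 x *\<^sub>R (axis 2 1 :: real^2))"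
  by (auto simp: vec_eq_iff forall_2 axis_def)
 show t: "test_fun U (\<lambda>x. \<chi> k. f k x)" unfolding eq by (intro test_fun_add test_fun_scaleR_const assms)
 have "pd i (\<lambda>x. \<chi> k. f k x) x $ m = pd i (f m) x" for x m
  using pd_bounded_linear[OF bounded_linear_vec_nth test_fun_differentiable[OF t], of i m x] by simp
 then show "pd i (\<lambda>x. \<chi> k. f k x) = (\<lambda>x. \<chi> k. pd i (f k) x)" by (auto simp: vec_eq_iff)
qed

text \<open>A Sobolev field need not be bounded, so it cannot always be inserted as a test field in a term with an $L^2$ coefficient.
The bounded field with components $K\sin(w_k/K)$ can, it tends to $w$ as $K\to\infty$, and its derivative is given by \<open>dtrunc\<close>.\<close>

abbreviation trunc :: "real \<Rightarrow> real^2 \<Rightarrow> real^2" where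
 "trunc K w \<equiv> \<chi> k. K * sin (w $ k / K)"

abbreviation dtrunc :: "real \<Rightarrow> real^2 \<Rightarrow> real^2 \<Rightarrow> real^2" where
 "dtrunc K w z \<equiv> \<chi> k. cos (w $ k / K) * z $ k"

lemma divide_Suc_tendsto_0: "(\<lambda>n. y / real (Suc n)) \<longlonglongrightarrow> 0" for y :: real
 using tendsto_mult_right_zero[OF LIMSEQ_inverse_real_of_nat, of y] by (simp add: divide_inverse)

lemma trunc_tendsto: "(\<lambda>n. real (Suc n) * sin (y / real (Suc n))) \<longlonglongrightarrow> y" for y :: real
proof (cases "y = 0")
 case False
 have "((\<lambda>h. sin h / h) \<longlongrightarrow> 1) (at (0::real))" using DERIV_sin[of "0::real"] by (simp add: DERIV_def)
 then have "(\<lambda>n. sin (y / real (Suc n)) / (y / real (Suc n))) \<longlonglongrightarrow> 1"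
  by (rule filterlim_compose) (use divide_Suc_tendsto_0 False in \<open>auto simp: filterlim_at\<close>)
 then have "(\<lambda>n. y * (sin (y / real (Suc n)) / (y / real (Suc n)))) \<longlonglongrightarrow> y * 1" by (rule tendsto_mult_left)
 moreover have "y * (sin (y / real (Suc n)) / (y / real (Suc n))) = real (Suc n) * sin (y / real (Suc n))" for n
  using False by (simp del: of_nat_Suc)
 ultimately show ?thesis by simp
qed simp

lemma trunc_bounds:
 fixes K y :: real
 assumes "K > 0"
 shows "\<bar>K * sin (y / K)\<bar> \<le> K" "\<bar>K * sin (y / K)\<bar> \<le> \<bar>y\<bar>"
proof -
 show "\<bar>K * sin (y / K)\<bar> \<le> K" using assms abs_sin_le_one[of "y / K"] by (simp add: abs_mult)
 have "\<bar>K * sin (y / K)\<bar> \<le> K * \<bar>y / K\<bar>"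
  using assms mult_left_mono[OF abs_sin_x_le_abs_x, of K "y / K"] by (simp add: abs_mult)
 also have "K * \<bar>y / K\<bar> = \<bar>y\<bar>" using assms by simp
 finally show "\<bar>K * sin (y / K)\<bar> \<le> \<bar>y\<bar>" .
qed

lemma smooth_trunc:
 fixes K :: real
 assumes "K > 0"
 shows "smooth (\<lambda>y. K * sin (y / K))" "smooth (\<lambda>y. K\<^sup>2 * (1 - cos (y / K)))"
proof -
 have "smooth (\<lambda>y. K * sin (y * inverse K))" "smooth (\<lambda>y. K\<^sup>2 * (1 - cos (y * inverse K)))"
  by (intro smooth_mult smooth_diff smooth_const smooth_ident smooth_compose[OF smooth_sin] smooth_compose[OF smooth_cos])+
 then show "smooth (\<lambda>y. K * sin (y / K))" "smooth (\<lambda>y. K\<^sup>2 * (1 - cos (y / K)))" by (simp_all add: divide_inverse)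
qed

lemma trunc_derivatives:
 fixes K y :: real
 assumes "K > 0"
 shows "((\<lambda>y. K * sin (y / K)) has_real_derivative cos (y / K)) (at y)"
  "((\<lambda>y. K\<^sup>2 * (1 - cos (y / K))) has_real_derivative K * sin (y / K)) (at y)"
 using assms by (auto intro!: derivative_eq_intros simp: power2_eq_square)

text \<open>The truncation is applied to the approximating test functions, component by component.
  The approximations of the truncated field are then bounded by \<open>K\<close> uniformly in
  \<open>j\<close>, so limits may be taken in pairings whose coefficient is only integrable.\<close>

lemma zero_trace_trunc_approx:
 fixes e :: "real^2 \<Rightarrow> real^2"
 assumes e: "zero_trace U e" and K: "K > 0"
 obtains \<Psi> where "\<And>j::nat. test_fun U (\<Psi> j)" "\<And>j x k. \<bar>\<Psi> j x $ k\<bar> \<le> K"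
  "(\<lambda>j. nrm (\<lambda>x. \<Psi> j x - (trunc K (e x)))) \<longlonglongrightarrow> 0"
  "\<And>i. (\<lambda>j. nrm (\<lambda>x. pd i (\<Psi> j) x - (dtrunc K (e x) (weak_pd U i e x)))) \<longlonglongrightarrow> 0"
  "AE x in \<mu>. (\<lambda>j. \<Psi> j x) \<longlonglongrightarrow> (trunc K (e x))"
  "L2 U (\<lambda>x. trunc K (e x))" "\<And>i. L2 U (\<lambda>x. dtrunc K (e x) (weak_pd U i e x))"
proof -
 let ?h = "\<lambda>y. K * sin (y / K)" and ?h' = "\<lambda>y. cos (y / K)"
 have h: "smooth ?h" "?h 0 = 0" "\<And>y. (?h has_real_derivative ?h' y) (at y)" "\<And>y. \<bar>?h' y\<bar> \<le> 1"
  "continuous_on UNIV ?h'" using smooth_trunc(1)[OF K] trunc_derivatives(1)[OF K] K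
  by (auto intro!: continuous_intros)
 have "\<forall>k. \<exists>\<Phi>. (\<forall>j::nat. test_fun U (\<Phi> j)) \<and> (\<lambda>j. nrm (\<lambda>x. \<Phi> j x - e x $ k)) \<longlonglongrightarrow> 0 \<and>
  (\<forall>i. (\<lambda>j. nrm (\<lambda>x. pd i (\<Phi> j) x - weak_pd U i (\<lambda>x. e x $ k) x)) \<longlonglongrightarrow> 0) \<and>
  (AE x in \<mu>. (\<lambda>j. \<Phi> j x) \<longlonglongrightarrow> e x $ k)" by (rule allI, rule zero_trace_approx_AE[OF zero_trace_nth[OF e]]) blast
 from choice[OF this] obtain \<Phi> where \<Phi>: "\<And>k j::nat. test_fun U (\<Phi> k j)" "\<And>k. (\<lambda>j. nrm (\<lambda>x. \<Phi> k j x - e x $ k)) \<longlonglongrightarrow> 0"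
  "\<And>k i. (\<lambda>j. nrm (\<lambda>x. pd i (\<Phi> k j) x - weak_pd U i (\<lambda>x. e x $ k) x)) \<longlonglongrightarrow> 0"
  "\<And>k. AE x in \<mu>. (\<lambda>j. \<Phi> k j x) \<longlonglongrightarrow> e x $ k" by blast
 have s: "L2 U (\<lambda>x. e x $ k)" "L2 U (weak_pd U i e)" "L2 U (\<lambda>x. weak_pd U i e x $ k)" for k i
  using sobolev_1_L2[OF zero_trace_sobolev[OF e]] by (auto intro: L2_nth)
 have wp: "AE x in \<mu>. weak_pd U i (\<lambda>x. e x $ k) x = weak_pd U i e x $ k" for i k
  by (rule weak_pd_nth[OF sobolev_1D[OF zero_trace_sobolev[OF e]]])
 have \<Phi>3: "(\<lambda>j. nrm (\<lambda>x. pd i (\<Phi> k j) x - weak_pd U i e x $ k)) \<longlonglongrightarrow> 0" for k i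
 proof -
  have "nrm (\<lambda>x. pd i (\<Phi> k j) x - weak_pd U i e x $ k) = nrm (\<lambda>x. pd i (\<Phi> k j) x - weak_pd U i (\<lambda>x. e x $ k) x)" for j
  proof (rule L2_norm_cong_AE[OF dom_sets])
   show "AE x in \<mu>. pd i (\<Phi> k j) x - weak_pd U i e x $ k = pd i (\<Phi> k j) x - weak_pd U i (\<lambda>x. e x $ k) x"
    using wp[of i k] by eventually_elim simp
  qed (intro L2_diff L2_test_fun[OF test_fun_pd[OF \<Phi>(1)]] s)
  then show ?thesis using \<Phi>(3) by simp
 qed
 note cl = compose_limit[OF h \<Phi>(1) s(1) s(3) \<Phi>(2) \<Phi>3 \<Phi>(4)]
 define \<Psi> where "\<Psi> j x = (\<chi> k. ?h (\<Phi> k j x))" for j x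
 have t: "test_fun U (\<lambda>x. ?h (\<Phi> k j x))" for k j by (rule test_fun_compose[OF \<Phi>(1) h(1,2)])
 have pd: "pd i (\<Psi> j) = (\<lambda>x. \<chi> k. pd i (\<lambda>x. ?h (\<Phi> k j x)) x)" for i j
  unfolding \<Psi>_def[abs_def] by (rule test_fun_vec(2)[OF t])
 have lim: "(\<lambda>j. nrm (\<lambda>x. (\<chi> k. P k j x) - (\<chi> k. p k x))) \<longlonglongrightarrow> 0"
  if P: "\<And>k j. L2 U (P k j)" "\<And>k. L2 U (p k)" and lim: "\<And>k. (\<lambda>j. dst (P k j) (p k)) \<longlonglongrightarrow> 0"
  for P :: "2 \<Rightarrow> nat \<Rightarrow> real^2 \<Rightarrow> real" and p
 proof (rule tendsto_0_le)
  fix j :: nat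
  have "(\<lambda>x. (\<chi> k. P k j x) - (\<chi> k. p k x)) = (\<lambda>x. \<chi> k. P k j x - p k x)" by (simp add: fun_eq_iff vec_eq_iff)
  then show "nrm (\<lambda>x. (\<chi> k. P k j x) - (\<chi> k. p k x)) \<le>
   dst (P 1 j) (p 1) + dst (P 2 j) (p 2)" using L2_norm_vec_le[of "\<lambda>k x. P k j x - p k x"] P by (simp add: L2_diff)
 next
  show "(\<lambda>j. dst (P 1 j) (p 1) + dst (P 2 j) (p 2)) \<longlonglongrightarrow> 0" using tendsto_add[OF lim[of 1] lim[of 2]] by simp
 qed auto
 show ?thesis
 proof (rule that[of \<Psi>])
  show "test_fun U (\<Psi> j)" for j unfolding \<Psi>_def[abs_def] by (rule test_fun_vec(1)[OF t])
  show "\<bar>\<Psi> j x $ k\<bar> \<le> K" for j x k using trunc_bounds(1)[OF K] by (simp add: \<Psi>_def)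
  show "(\<lambda>j. nrm (\<lambda>x. \<Psi> j x - (trunc K (e x)))) \<longlonglongrightarrow> 0" unfolding \<Psi>_def by (rule lim[OF L2_test_fun[OF t] cl(1,3)])
  show "(\<lambda>j. nrm (\<lambda>x. pd i (\<Psi> j) x - (dtrunc K (e x) (weak_pd U i e x)))) \<longlonglongrightarrow> 0" for i
   unfolding pd by (rule lim[OF L2_test_fun[OF test_fun_pd[OF t]] cl(2,4)])
  show "L2 U (\<lambda>x. trunc K (e x))" by (rule L2_vec[OF cl(1)])
  show "L2 U (\<lambda>x. dtrunc K (e x) (weak_pd U i e x))" for i by (rule L2_vec[OF cl(2)])
  have "AE x in \<mu>. \<forall>k\<in>UNIV. (\<lambda>j. \<Phi> k j x) \<longlonglongrightarrow> e x $ k" using \<Phi>(4) by (intro AE_finite_allI) auto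
  then show "AE x in \<mu>. (\<lambda>j. \<Psi> j x) \<longlonglongrightarrow> (trunc K (e x))"
  proof eventually_elim
   case (elim x)
   then show ?case unfolding \<Psi>_def using K by (intro tendsto_vec_lambda tendsto_intros) auto
  qed
 qed
qed

text \<open>Truncation shrinks the components of the field, and the cosine factor those of its
  derivatives, so the original field and derivatives are dominating functions.\<close>

lemma trunc_limit:
 fixes e :: "real^2 \<Rightarrow> real^2"
 assumes e: "zero_trace U e"
 shows "(\<lambda>n. nrm (\<lambda>x. (trunc (real (Suc n)) (e x)) - e x)) \<longlonglongrightarrow> 0"
  "(\<lambda>n. nrm (\<lambda>x. (dtrunc (real (Suc n)) (e x) (weak_pd U i e x)) - weak_pd U i e x)) \<longlonglongrightarrow> 0"
proof -
 note s = sobolev_1_L2[OF zero_trace_sobolev[OF e]]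
 have [measurable]: "(\<lambda>x. e x $ k) \<in> borel_measurable \<mu>"
  "(\<lambda>x. weak_pd U i e x $ k) \<in> borel_measurable \<mu>" for k using L2_measurable[OF L2_nth] s by blast+
 have vec_le: "norm (a :: real^2) \<le> norm b" if "\<And>k. \<bar>a $ k\<bar> \<le> \<bar>b $ k\<bar>" for a b
  using that by (intro norm_le_componentwise_cart) auto
 show "(\<lambda>n. nrm (\<lambda>x. (trunc (real (Suc n)) (e x)) - e x)) \<longlonglongrightarrow> 0"
 proof (rule L2_dominated_convergence(3)[OF borel_measurable_vec L2_measurable[OF s(1)] s(1)])
  show "AE x in \<mu>. norm (trunc (real (Suc n)) (e x)) \<le> norm (e x)" for n
   using trunc_bounds(2)[of "real (Suc n)"] by (intro AE_I2 vec_le) (simp del: of_nat_Suc)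
  show "AE x in \<mu>. (\<lambda>n. \<chi> k. real (Suc n) * sin (e x $ k / real (Suc n))) \<longlonglongrightarrow> e x"
  proof (rule AE_I2)
   fix x
   have "(\<lambda>n. \<chi> k. real (Suc n) * sin (e x $ k / real (Suc n))) \<longlonglongrightarrow> (\<chi> k. e x $ k)"
    by (rule tendsto_vec_lambda) (rule trunc_tendsto)
   then show "(\<lambda>n. \<chi> k. real (Suc n) * sin (e x $ k / real (Suc n))) \<longlonglongrightarrow> e x" by simp
  qed
 qed measurable
 show "(\<lambda>n. nrm (\<lambda>x. (dtrunc (real (Suc n)) (e x) (weak_pd U i e x)) - weak_pd U i e x)) \<longlonglongrightarrow> 0"
 proof (rule L2_dominated_convergence(3)[OF borel_measurable_vec L2_measurable[OF s(2)] s(2)])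
  show "AE x in \<mu>. norm (dtrunc (real (Suc n)) (e x) (weak_pd U i e x)) \<le> norm (weak_pd U i e x)" for n
   using abs_cos_le_one by (intro AE_I2 vec_le) (auto simp: abs_mult intro!: mult_left_le_one_le)
  show "AE x in \<mu>. (\<lambda>n. \<chi> k. cos (e x $ k / real (Suc n)) * weak_pd U i e x $ k) \<longlonglongrightarrow> weak_pd U i e x"
  proof (rule AE_I2)
   fix x
   have "(\<lambda>n. cos (e x $ k / real (Suc n)) * weak_pd U i e x $ k) \<longlonglongrightarrow> cos 0 * weak_pd U i e x $ k" for k
    by (intro tendsto_intros divide_Suc_tendsto_0)
   then have "(\<lambda>n. \<chi> k. cos (e x $ k / real (Suc n)) * weak_pd U i e x $ k) \<longlonglongrightarrow> (\<chi> k. weak_pd U i e x $ k)"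
    by (intro tendsto_vec_lambda) simp
   then show "(\<lambda>n. \<chi> k. cos (e x $ k / real (Suc n)) * weak_pd U i e x $ k) \<longlonglongrightarrow> weak_pd U i e x" by simp
  qed
 qed measurable
qed

end

context bounded_open
begin

lemma L2_inner_bounded:
 fixes f g :: "real^2 \<Rightarrow> 'a::euclidean_space"
 assumes f: "L2 U f" and g: "g \<in> borel_measurable \<mu>" "AE x in \<mu>. norm (g x) \<le> C"
 shows "L2 U (\<lambda>x. f x \<bullet> g x)" "C \<ge> 0 \<Longrightarrow> nrm (\<lambda>x. f x \<bullet> g x) \<le> C * nrm f"
proof -
 note [measurable] = L2_measurable[OF f] g(1)
 have "AE x in \<mu>. norm (f x \<bullet> g x) \<le> C * norm (f x)" using g(2)
 proof eventually_elim
  case (elim x)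
  have "norm (f x \<bullet> g x) \<le> norm (f x) * norm (g x)" by (simp add: Cauchy_Schwarz_ineq2)
  also have "\<dots> \<le> norm (f x) * C" using elim by (intro mult_left_mono) auto
  finally show ?case by (simp add: mult.commute)
 qed
 then show "L2 U (\<lambda>x. f x \<bullet> g x)" "C \<ge> 0 \<Longrightarrow> nrm (\<lambda>x. f x \<bullet> g x) \<le> C * nrm f"
  using L2_dominated[OF f, of "\<lambda>x. f x \<bullet> g x" C] by auto
qed

lemma L2_inner_test:
 fixes f \<phi> :: "real^2 \<Rightarrow> 'a::euclidean_space"
 assumes "L2 U f" "test_fun V \<phi>"
 shows "L2 U (\<lambda>x. f x \<bullet> \<phi> x)"
proof -
 obtain C where "\<And>x. norm (\<phi> x) \<le> C" using test_fun_bounded[OF assms(2)] by blast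
 then show ?thesis by (intro L2_inner_bounded(1)[OF assms(1) L2_measurable[OF L2_test_fun[OF assms(2)]], of C]) auto
qed

lemma inner_vec2: "(a :: real^2) \<bullet> b = a $ 1 * b $ 1 + a $ 2 * b $ 2" by (simp add: inner_vec_def sum_2)

lemma L2_vector2:
 assumes "L2 U a" "L2 U b"
 shows "L2 U (\<lambda>x. vector [a x, b x] :: real^2)"
proof (rule L2_componentwise)
 fix i :: 2
 show "L2 U (\<lambda>x. (vector [a x, b x] :: real^2) $ i)" using exhaust_2[of i] assms by auto
qed

subsection \<open>Divergence\<close>

lemma has_weak_div_iff:
 "has_weak_div U v d \<longleftrightarrow> L2 U v \<and> L2 U d \<and>
  (\<forall>\<phi>. test_fun U \<phi> \<longrightarrow> ip U v (\<lambda>x. \<chi> i. pd i \<phi> x) = - ip U d \<phi>)" by (simp add: has_weak_div_def ip_def)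

lemma L2_grad_test: "test_fun V (\<phi> :: real^2 \<Rightarrow> real) \<Longrightarrow> L2 U (\<lambda>x. \<chi> i. pd i \<phi> x)"
 by (intro L2_vec L2_test_fun[OF test_fun_pd])

lemma has_weak_div_unique:
 assumes "has_weak_div U v d" "has_weak_div U v d'"
 shows "AE x in \<mu>. d x = d' x" by (rule L2_eq_by_duality) (use assms in \<open>auto simp: has_weak_div_iff\<close>)

lemma div_free_diff: "div_free U v \<Longrightarrow> div_free U w \<Longrightarrow> div_free U (\<lambda>x. v x - w x)"
 by (auto simp: has_weak_div_iff ip_diff_left L2_grad_test L2_diff)

lemma div_free_cong_AE:
 assumes "div_free U v" "AE x in \<mu>. v x = w x"
 shows "div_free U w"
proof -
 have L: "L2 U v" using assms(1) by (simp add: has_weak_div_iff)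
 have "ip U v g = ip U w g" if "L2 U g" for g
  by (rule ip_cong_AE[OF dom_sets L2_measurable[OF L] L2_measurable[OF that] assms(2)]) simp
 then show ?thesis using assms(1) L2_cong_AE[OF dom_sets L assms(2)] L2_grad_test by (auto simp: has_weak_div_iff)
qed

lemma has_weak_div_weak_pd:
 assumes w: "\<And>i. has_weak_pd U i v (v' i)"
 shows "has_weak_div U v (\<lambda>x. v' 1 x $ 1 + v' 2 x $ 2)" unfolding has_weak_div_iff
proof (intro conjI allI impI)
 have L: "L2 U (\<lambda>x. v x $ k)" "L2 U (\<lambda>x. v' i x $ k)" for i k using has_weak_pd_L2[OF w] by (auto intro: L2_nth)
 show "L2 U v" using has_weak_pd_L2(1)[OF w] .
 show "L2 U (\<lambda>x. v' 1 x $ 1 + v' 2 x $ 2)" by (intro L2_add L)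
 fix \<phi> :: "real^2 \<Rightarrow> real" assume \<phi>: "test_fun U \<phi>"
 have "ip U v (\<lambda>x. \<chi> i. pd i \<phi> x) = ip U (\<lambda>x. v x $ 1) (pd 1 \<phi>) + ip U (\<lambda>x. v x $ 2) (pd 2 \<phi>)"
  using L2_integrable_inner[OF L(1) L2_test_fun[OF test_fun_pd[OF \<phi>]]] by (simp add: ip_def inner_vec2)
 also have "\<dots> = - ip U (\<lambda>x. v' 1 x $ 1 + v' 2 x $ 2) \<phi>"
  using has_weak_pd_ip[OF has_weak_pd_nth[OF w] \<phi>] by (simp add: ip_add_left L L2_test_fun[OF \<phi>])
 finally show "ip U v (\<lambda>x. \<chi> i. pd i \<phi> x) = - ip U (\<lambda>x. v' 1 x $ 1 + v' 2 x $ 2) \<phi>" .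
qed

lemma L2_grad: "(\<And>i. has_weak_pd U i (q :: real^2 \<Rightarrow> real) (g i)) \<Longrightarrow> L2 U (\<lambda>x. \<chi> i. g i x)"
 by (intro L2_vec has_weak_pd_L2(2))

lemma weak_grad_eq:
 assumes "\<And>i. has_weak_pd U i q (g i)"
 shows "AE x in \<mu>. weak_grad U q x = (\<chi> i. g i x)"
proof -
 have "AE x in \<mu>. \<forall>i\<in>UNIV. weak_pd U i q x = g i x" using weak_pd_eq[OF assms] by (intro AE_finite_allI) auto
 then show ?thesis by eventually_elim (simp add: weak_grad_def)
qed

lemma L2_weak_grad: "sobolev U 1 q \<Longrightarrow> L2 U (weak_grad U q)"
 using L2_grad[OF sobolev_1D] by (simp add: weak_grad_def[abs_def])

lemma zero_normal_trace_orthogonal: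
 assumes v: "zero_normal_trace U v" "div_free U v" and q: "\<And>i. has_weak_pd U i q (g i)"
 shows "ip U v (\<lambda>x. \<chi> i. g i x) = 0"
proof -
 obtain d where d: "has_weak_div U v d"
  "\<And>q. sobolev U 1 q \<Longrightarrow> (LINT x|\<mu>. v x \<bullet> weak_grad U q x + d x * q x) = 0"
  using v(1) by (auto simp: zero_normal_trace_def)
 have L: "L2 U v" "L2 U d" "L2 U q" "L2 U (weak_grad U q)"
  using d(1) L2_weak_grad[OF sobolev_1I[OF q]] has_weak_pd_L2(1)[OF q] by (auto simp: has_weak_div_iff)
 have "0 = (LINT x|\<mu>. v x \<bullet> weak_grad U q x + d x * q x)" using d(2)[OF sobolev_1I[OF q]] by simp
 also have "\<dots> = ip U v (weak_grad U q) + ip U d q"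
  using L2_integrable_inner[OF L(1,4)] L2_integrable_inner[OF L(2,3)] by (simp add: ip_def)
 also have "ip U v (weak_grad U q) = ip U v (\<lambda>x. \<chi> i. g i x)"
  by (rule ip_cong_AE[OF dom_sets L2_measurable[OF L(1)] L2_measurable[OF L(4)] _ weak_grad_eq[OF q]]) simp
 also have "ip U d q = ip U (\<lambda>x. 0) q"
  by (rule ip_cong_AE[OF dom_sets L2_measurable[OF L(2)] L2_measurable[OF L(3)] has_weak_div_unique[OF d(1) v(2)]]) simp
 finally show ?thesis by simp
qed

lemma zero_normal_trace_diff:
 assumes "zero_normal_trace U v" "div_free U v" "zero_normal_trace U w" "div_free U w"
 shows "zero_normal_trace U (\<lambda>x. v x - w x)" unfolding zero_normal_trace_def
proof (intro exI[of _ "\<lambda>x. 0"] conjI allI impI div_free_diff assms)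
 fix q :: "real^2 \<Rightarrow> real" assume q: "sobolev U 1 q"
 have L: "L2 U v" "L2 U w" using assms by (auto simp: has_weak_div_iff)
 have "ip U (\<lambda>x. v x - w x) (weak_grad U q) = 0" using zero_normal_trace_orthogonal[OF assms(1,2) sobolev_1D[OF q]]
   zero_normal_trace_orthogonal[OF assms(3,4) sobolev_1D[OF q]] L L2_weak_grad[OF q]
  by (simp add: ip_diff_left weak_grad_def[abs_def])
 then show "(LINT x|\<mu>. (v x - w x) \<bullet> weak_grad U q x + 0 * q x) = 0" by (simp add: ip_def)
qed

lemma zero_normal_trace_cong_AE:
 assumes "zero_normal_trace U v" "div_free U v" "AE x in \<mu>. v x = w x"
 shows "zero_normal_trace U w" unfolding zero_normal_trace_def
proof (intro exI[of _ "\<lambda>x. 0"] conjI allI impI div_free_cong_AE[OF assms(2,3)])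
 fix q :: "real^2 \<Rightarrow> real" assume q: "sobolev U 1 q"
 have L: "L2 U v" using assms by (auto simp: has_weak_div_iff)
 have "ip U v (weak_grad U q) = 0"
  using zero_normal_trace_orthogonal[OF assms(1,2) sobolev_1D[OF q]] by (simp add: weak_grad_def[abs_def])
 moreover have "ip U v (weak_grad U q) = ip U w (weak_grad U q)"
  by (rule ip_cong_AE[OF dom_sets L2_measurable[OF L] L2_measurable[OF L2_weak_grad[OF q]] assms(3)]) simp
 ultimately show "(LINT x|\<mu>. w x \<bullet> weak_grad U q x + 0 * q x) = 0" by (simp add: ip_def)
qed

text \<open>The approximating test fields are not divergence free, so Green's formula is first
  written with their partial derivatives; only the limit is expressed by the divergence of
  \<open>v\<close>, which vanishes.\<close>

lemma zero_trace_imp_zero_normal_trace: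
 assumes v: "zero_trace U v" "div_free U v"
 shows "zero_normal_trace U v" unfolding zero_normal_trace_def
proof (intro exI[of _ "\<lambda>x. 0"] conjI allI impI v(2))
 fix q :: "real^2 \<Rightarrow> real" assume q: "sobolev U 1 q"
 obtain \<Phi> where \<Phi>: "\<And>j::nat. test_fun U (\<Phi> j)" "L2_lim U \<Phi> v"
  "\<And>i. (\<lambda>j. dst (pd i (\<Phi> j)) (weak_pd U i v)) \<longlonglongrightarrow> 0" using zero_trace_approx[OF v(1)] by blast
 note s = sobolev_1_L2[OF zero_trace_sobolev[OF v(1)]]
 note sq = sobolev_1_L2[OF q]
 have eq: "ip U (\<Phi> j) (weak_grad U q) = - (ip U (pd 1 (\<Phi> j)) (\<lambda>x. q x *\<^sub>R axis 1 1) + ip U (pd 2 (\<Phi> j)) (\<lambda>x. q x *\<^sub>R axis 2 1))" for j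
 proof -
  have c: "ip U (\<lambda>x. \<Phi> j x $ k) (weak_pd U k q) = - ip U (pd k (\<Phi> j)) (\<lambda>x. q x *\<^sub>R axis k 1)" for k
  proof -
   have pd: "pd k (\<lambda>x. \<Phi> j x $ k) x = pd k (\<Phi> j) x $ k" for x
    by (rule pd_bounded_linear[OF bounded_linear_vec_nth test_fun_differentiable[OF \<Phi>(1)]])
   have "ip U q (pd k (\<lambda>x. \<Phi> j x $ k)) = - ip U (weak_pd U k q) (\<lambda>x. \<Phi> j x $ k)"
    by (rule has_weak_pd_ip[OF sobolev_1D[OF q] test_fun_nth[OF \<Phi>(1)]])
   then show ?thesis by (simp add: ip_def pd inner_axis mult.commute)
  qed
  have "ip U (\<Phi> j) (weak_grad U q) = ip U (\<lambda>x. \<Phi> j x $ 1) (weak_pd U 1 q) + ip U (\<lambda>x. \<Phi> j x $ 2) (weak_pd U 2 q)"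
   using L2_integrable_inner[OF L2_nth[OF L2_test_fun[OF \<Phi>(1)]] sq(2)]
   by (simp add: ip_def inner_vec2 weak_grad_def)
  then show ?thesis unfolding c by simp
 qed
 have "(\<lambda>j. ip U (\<Phi> j) (weak_grad U q)) \<longlonglongrightarrow> ip U v (weak_grad U q)"
  by (intro tendsto_ip_left L2_test_fun[OF \<Phi>(1)] s L2_weak_grad[OF q] \<Phi>(2))
 moreover have "(\<lambda>j. - (ip U (pd 1 (\<Phi> j)) (\<lambda>x. q x *\<^sub>R axis 1 1) + ip U (pd 2 (\<Phi> j)) (\<lambda>x. q x *\<^sub>R axis 2 1)))
   \<longlonglongrightarrow> - (ip U (weak_pd U 1 v) (\<lambda>x. q x *\<^sub>R axis 1 1) + ip U (weak_pd U 2 v) (\<lambda>x. q x *\<^sub>R axis 2 1))"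
  by (intro tendsto_minus tendsto_add tendsto_ip_left L2_test_fun[OF test_fun_pd[OF \<Phi>(1)]] s L2_scaleR_right sq(1) \<Phi>(3))
 ultimately have "ip U v (weak_grad U q) =
   - (ip U (weak_pd U 1 v) (\<lambda>x. q x *\<^sub>R axis 1 1) + ip U (weak_pd U 2 v) (\<lambda>x. q x *\<^sub>R axis 2 1))"
  unfolding eq by (rule LIMSEQ_unique)
 also have "\<dots> = - ip U (\<lambda>x. weak_pd U 1 v x $ 1 + weak_pd U 2 v x $ 2) q"
  using L2_integrable_inner[OF L2_nth[OF s(2)] sq(1)] by (simp add: ip_def inner_axis mult.commute distrib_left)
 also have "ip U (\<lambda>x. weak_pd U 1 v x $ 1 + weak_pd U 2 v x $ 2) q = ip U (\<lambda>x. 0) q"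
 proof (rule ip_cong_AE[OF dom_sets])
  show "AE x in \<mu>. weak_pd U 1 v x $ 1 + weak_pd U 2 v x $ 2 = 0"
   by (rule has_weak_div_unique[OF has_weak_div_weak_pd[OF sobolev_1D[OF zero_trace_sobolev[OF v(1)]]] v(2)])
  show "(\<lambda>x. weak_pd U 1 v x $ 1 + weak_pd U 2 v x $ 2) \<in> borel_measurable \<mu>"
   by (intro L2_measurable[OF L2_add[OF L2_nth L2_nth]] s)
 qed (auto intro: L2_measurable[OF sq(1)])
 finally show "(LINT x|\<mu>. v x \<bullet> weak_grad U q x + 0 * q x) = 0" by (simp add: ip_def)
qed

subsection \<open>Curl\<close>

lemma has_weak_curl_iff:
 "has_weak_curl U v c \<longleftrightarrow> L2 U v \<and> L2 U c \<and>
  (\<forall>\<phi>. test_fun U \<phi> \<longrightarrow> ip U v (\<lambda>x. vector [pd 2 \<phi> x, - pd 1 \<phi> x]) = ip U c \<phi>)"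
 by (simp add: has_weak_curl_def ip_def)

lemma L2_curl_test: "test_fun V (\<phi> :: real^2 \<Rightarrow> real) \<Longrightarrow> L2 U (\<lambda>x. vector [pd 2 \<phi> x, - pd 1 \<phi> x] :: real^2)"
 by (intro L2_vector2 L2_minus L2_test_fun[OF test_fun_pd])

lemma has_weak_curl_unique:
 assumes "has_weak_curl U v c" "has_weak_curl U v c'"
 shows "AE x in \<mu>. c x = c' x" by (rule L2_eq_by_duality) (use assms in \<open>auto simp: has_weak_curl_iff\<close>)

lemma has_weak_curl_weak_curl: "has_weak_curl U v c \<Longrightarrow> has_weak_curl U v (weak_curl U v)"
 unfolding weak_curl_def by (rule someI[of _ c])

lemma weak_curl_eq: "has_weak_curl U v c \<Longrightarrow> AE x in \<mu>. weak_curl U v x = c x"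
 by (rule has_weak_curl_unique[OF has_weak_curl_weak_curl])

lemma has_weak_curl_diff:
 "has_weak_curl U v c \<Longrightarrow> has_weak_curl U w d \<Longrightarrow> has_weak_curl U (\<lambda>x. v x - w x) (\<lambda>x. c x - d x)"
 by (auto simp: has_weak_curl_iff ip_diff_left L2_diff L2_curl_test L2_test_fun)

lemma has_weak_curl_weak_pd:
 assumes w: "\<And>i. has_weak_pd U i v (v' i)"
 shows "has_weak_curl U v (\<lambda>x. v' 1 x $ 2 - v' 2 x $ 1)" unfolding has_weak_curl_iff
proof (intro conjI allI impI)
 have L: "L2 U (\<lambda>x. v x $ k)" "L2 U (\<lambda>x. v' i x $ k)" for i k using has_weak_pd_L2[OF w] by (auto intro: L2_nth)
 show "L2 U v" using has_weak_pd_L2(1)[OF w] .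
 show "L2 U (\<lambda>x. v' 1 x $ 2 - v' 2 x $ 1)" by (intro L2_diff L)
 fix \<phi> :: "real^2 \<Rightarrow> real" assume \<phi>: "test_fun U \<phi>"
 have "ip U v (\<lambda>x. vector [pd 2 \<phi> x, - pd 1 \<phi> x]) = ip U (\<lambda>x. v x $ 1) (pd 2 \<phi>) - ip U (\<lambda>x. v x $ 2) (pd 1 \<phi>)"
  using L2_integrable_inner[OF L(1) L2_test_fun[OF test_fun_pd[OF \<phi>]]] by (simp add: ip_def inner_vec2)
 also have "\<dots> = ip U (\<lambda>x. v' 1 x $ 2 - v' 2 x $ 1) \<phi>"
  using has_weak_pd_ip[OF has_weak_pd_nth[OF w] \<phi>] by (simp add: ip_diff_left L L2_test_fun[OF \<phi>])
 finally show "ip U v (\<lambda>x. vector [pd 2 \<phi> x, - pd 1 \<phi> x]) = ip U (\<lambda>x. v' 1 x $ 2 - v' 2 x $ 1) \<phi>" .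
qed

lemma zero_tangential_trace_weak_curl: "zero_tangential_trace U v \<Longrightarrow> has_weak_curl U v (weak_curl U v)"
 unfolding zero_tangential_trace_def using has_weak_curl_weak_curl by blast

text \<open>Frees the trace condition from the representatives chosen by \<open>weak_pd\<close>: any
  weak derivatives \<open>g\<close> of \<open>q\<close> may be inserted, in particular ones given by
  an equation.\<close>

lemma zero_tangential_trace_iff:
 "zero_tangential_trace U v \<longleftrightarrow> (\<exists>c. has_weak_curl U v c \<and>
   (\<forall>q g. (\<forall>i. has_weak_pd U i q (g i)) \<longrightarrow> ip U v (\<lambda>x. vector [g 2 x, - g 1 x]) = ip U c q))"
proof -
 have "(LINT x|\<mu>. v x \<bullet> weak_curl_s U q x - c x * q x) = ip U v (\<lambda>x. vector [g 2 x, - g 1 x]) - ip U c q"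
  if c: "has_weak_curl U v c" and q: "\<And>i. has_weak_pd U i q (g i)" for c q g
 proof -
  have L: "L2 U v" "L2 U c" "L2 U q" "L2 U (weak_curl_s U q)"
   using c has_weak_pd_L2(1)[OF q] sobolev_1_L2(2)[OF sobolev_1I[OF q]]
   by (auto simp: has_weak_curl_iff weak_curl_s_def[abs_def] intro!: L2_vector2 L2_minus)
  have "AE x in \<mu>. weak_curl_s U q x = vector [g 2 x, - g 1 x]"
   using weak_pd_eq[OF q, of 1] weak_pd_eq[OF q, of 2] by eventually_elim (simp add: weak_curl_s_def)
  then have "ip U v (weak_curl_s U q) = ip U v (\<lambda>x. vector [g 2 x, - g 1 x])"
   by (intro ip_cong_AE[OF dom_sets L2_measurable[OF L(1)] L2_measurable[OF L(4)]]) auto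
  then show ?thesis using L2_integrable_inner[OF L(1,4)] L2_integrable_inner[OF L(2,3)] by (simp add: ip_def)
 qed
 note eq = this
 show ?thesis unfolding zero_tangential_trace_def
 proof (intro iffI; elim exE conjE)
  fix c assume c: "has_weak_curl U v c"
   and q: "\<forall>q. sobolev U 1 q \<longrightarrow> (LINT x|\<mu>. v x \<bullet> weak_curl_s U q x - c x * q x) = 0"
  show "\<exists>c. has_weak_curl U v c \<and>
   (\<forall>q g. (\<forall>i. has_weak_pd U i q (g i)) \<longrightarrow> ip U v (\<lambda>x. vector [g 2 x, - g 1 x]) = ip U c q)"
  proof (intro exI[of _ c] conjI c allI impI)
   fix q :: "real^2 \<Rightarrow> real" and g assume "\<forall>i. has_weak_pd U i q (g i)"
   then show "ip U v (\<lambda>x. vector [g 2 x, - g 1 x]) = ip U c q" using eq[OF c, of q g] q sobolev_1I[of q g] by auto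
  qed
 next
  fix c assume c: "has_weak_curl U v c"
   and q: "\<forall>q g. (\<forall>i. has_weak_pd U i q (g i)) \<longrightarrow> ip U v (\<lambda>x. vector [g 2 x, - g 1 x]) = ip U c q"
  show "\<exists>c. has_weak_curl U v c \<and>
   (\<forall>q. sobolev U 1 q \<longrightarrow> (LINT x|\<mu>. v x \<bullet> weak_curl_s U q x - c x * q x) = 0)"
  proof (intro exI[of _ c] conjI c allI impI)
   fix q :: "real^2 \<Rightarrow> real" assume s: "sobolev U 1 q"
   have "ip U v (\<lambda>x. vector [weak_pd U 2 q x, - weak_pd U 1 q x]) = ip U c q"
    using q[rule_format, of q "\<lambda>i. weak_pd U i q"] sobolev_1D[OF s] by blast
   then show "(LINT x|\<mu>. v x \<bullet> weak_curl_s U q x - c x * q x) = 0" using eq[OF c sobolev_1D[OF s]] by simp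
  qed
 qed
qed

lemma zero_tangential_trace_ip:
 assumes v: "zero_tangential_trace U v" "has_weak_curl U v c" and q: "\<And>i. has_weak_pd U i q (g i)"
 shows "ip U v (\<lambda>x. vector [g 2 x, - g 1 x]) = ip U c q"
proof -
 obtain c' where c': "has_weak_curl U v c'"
   "\<And>q g. (\<And>i. has_weak_pd U i q (g i)) \<Longrightarrow> ip U v (\<lambda>x. vector [g 2 x, - g 1 x]) = ip U c' q"
  using v(1) unfolding zero_tangential_trace_iff by blast
 have "ip U c' q = ip U c q"
 proof (rule ip_cong_AE[OF dom_sets])
  show "AE x in \<mu>. c' x = c x" by (rule has_weak_curl_unique[OF c'(1) v(2)])
  show "c' \<in> borel_measurable \<mu>" using c'(1) by (simp add: has_weak_curl_iff L2_measurable)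
 qed (use has_weak_pd_L2(1)[OF q] in \<open>auto intro: L2_measurable\<close>)
 then show ?thesis using c'(2)[OF q] by simp
qed

lemma zero_tangential_trace_diff:
 assumes v: "zero_tangential_trace U v" and w: "zero_tangential_trace U w"
 shows "zero_tangential_trace U (\<lambda>x. v x - w x)" unfolding zero_tangential_trace_iff
proof (intro exI conjI allI impI)
 note c = zero_tangential_trace_weak_curl[OF v] zero_tangential_trace_weak_curl[OF w]
 show "has_weak_curl U (\<lambda>x. v x - w x) (\<lambda>x. weak_curl U v x - weak_curl U w x)" by (intro has_weak_curl_diff c)
 fix q :: "real^2 \<Rightarrow> real" and g assume q: "\<forall>i. has_weak_pd U i q (g i)"
 have g: "L2 U q" "L2 U (g i)" for i using has_weak_pd_L2[of i q "g i"] q by auto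
 have L: "L2 U v" "L2 U w" "L2 U (weak_curl U v)" "L2 U (weak_curl U w)" "L2 U q"
  "L2 U (\<lambda>x. vector [g 2 x, - g 1 x] :: real^2)"
  using c g by (auto simp: has_weak_curl_iff intro!: L2_vector2 L2_minus)
 then show "ip U (\<lambda>x. v x - w x) (\<lambda>x. vector [g 2 x, - g 1 x]) = ip U (\<lambda>x. weak_curl U v x - weak_curl U w x) q"
  using zero_tangential_trace_ip[OF v c(1), of q g] zero_tangential_trace_ip[OF w c(2), of q g] q
  by (simp add: ip_diff_left)
qed

text \<open>Both the weak curl and the trace condition are identities linear in the pair of field
  and curl, so they survive convergence of that pair.\<close>

lemma zero_tangential_trace_limit:
 assumes F: "\<And>j::nat. zero_tangential_trace U (F j)" "\<And>j. has_weak_curl U (F j) (C j)" and L: "L2 U f" "L2 U c"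
  and lim: "L2_lim U F f" "L2_lim U C c"
 shows "zero_tangential_trace U f" "has_weak_curl U f c"
proof -
 have LF: "L2 U (F j)" "L2 U (C j)" for j using F(2)[of j] by (auto simp: has_weak_curl_iff)
 have id: "ip U f a = ip U c b" if "L2 U a" "L2 U b" "\<And>j. ip U (F j) a = ip U (C j) b" for a b
 proof (rule LIMSEQ_unique)
  show "(\<lambda>j. ip U (F j) a) \<longlonglongrightarrow> ip U f a" by (intro tendsto_ip_left LF L lim that)
  show "(\<lambda>j. ip U (F j) a) \<longlonglongrightarrow> ip U c b" unfolding that(3) by (intro tendsto_ip_left LF L lim that)
 qed
 show c: "has_weak_curl U f c" unfolding has_weak_curl_iff
 proof (intro conjI allI impI L)
  fix \<phi> :: "real^2 \<Rightarrow> real" assume \<phi>: "test_fun U \<phi>"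
  show "ip U f (\<lambda>x. vector [pd 2 \<phi> x, - pd 1 \<phi> x]) = ip U c \<phi>"
   using F(2) \<phi> by (intro id[OF L2_curl_test[OF \<phi>] L2_test_fun[OF \<phi>]]) (auto simp: has_weak_curl_iff)
 qed
 show "zero_tangential_trace U f" unfolding zero_tangential_trace_iff
 proof (intro exI[of _ c] conjI allI impI)
  show "has_weak_curl U f c" by fact
  fix q :: "real^2 \<Rightarrow> real" and g assume q: "\<forall>i. has_weak_pd U i q (g i)"
  have g: "L2 U q" "L2 U (g i)" for i using has_weak_pd_L2[of i q "g i"] q by auto
  show "ip U f (\<lambda>x. vector [g 2 x, - g 1 x]) = ip U c q"
   using q by (intro id[OF L2_vector2[OF g(2) L2_minus[OF g(2)]] g(1)] zero_tangential_trace_ip[OF F]) auto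
 qed
qed

subsection \<open>The convective term\<close>

text \<open>The product rule makes the two integrands add up to the gradient of the scalar product
  of \<open>f\<close> and \<open>\<phi>\<close>, to which \<open>w\<close> is orthogonal. The
  boundary term is removed by the normal trace of \<open>w\<close>, so \<open>\<phi>\<close> may
  have its support in any \<open>V\<close>.\<close>

lemma convection_by_parts:
 fixes f :: "real^2 \<Rightarrow> real^2"
 assumes w: "zero_normal_trace U w" "div_free U w" and f: "\<And>i. has_weak_pd U i f (f' i)"
  and \<phi>: "test_fun V \<phi>"
 shows "ip U w (\<lambda>x. \<chi> i. f' i x \<bullet> \<phi> x) = - ip U w (\<lambda>x. \<chi> i. f x \<bullet> pd i \<phi> x)"
proof -
 have pd: "pd i (\<lambda>x. \<phi> x $ k) x = pd i \<phi> x $ k" for i k x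
  by (rule pd_bounded_linear[OF bounded_linear_vec_nth test_fun_differentiable[OF \<phi>]])
 have wk: "has_weak_pd U i (\<lambda>x. \<phi> x $ k * f x $ k) (\<lambda>x. \<phi> x $ k * f' i x $ k + pd i \<phi> x $ k * f x $ k)" for i k
  using has_weak_pd_scaleR_test[OF has_weak_pd_nth[OF f] test_fun_nth[OF \<phi>]] by (simp add: pd)
 have "has_weak_pd U i (\<lambda>x. f x \<bullet> \<phi> x) (\<lambda>x. f' i x \<bullet> \<phi> x + f x \<bullet> pd i \<phi> x)" for i
  using has_weak_pd_add[OF wk[of i 1] wk[of i 2]] by (simp add: inner_vec2 algebra_simps)
 from zero_normal_trace_orthogonal[OF w this]
 have "ip U w (\<lambda>x. \<chi> i. f' i x \<bullet> \<phi> x + f x \<bullet> pd i \<phi> x) = 0" .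
 moreover have "(\<lambda>x. \<chi> i. f' i x \<bullet> \<phi> x + f x \<bullet> pd i \<phi> x) = (\<lambda>x. (\<chi> i. f' i x \<bullet> \<phi> x) + (\<chi> i. f x \<bullet> pd i \<phi> x))"
  by (simp add: fun_eq_iff vec_eq_iff)
 moreover have "L2 U w" using w(2) by (simp add: has_weak_div_iff)
 moreover have "L2 U (\<lambda>x. \<chi> i. f' i x \<bullet> \<phi> x)" "L2 U (\<lambda>x. \<chi> i. f x \<bullet> pd i \<phi> x)"
  by (intro L2_vec L2_inner_test[OF has_weak_pd_L2(2)[OF f] \<phi>],
    intro L2_vec L2_inner_test[OF has_weak_pd_L2(1)[OF f] test_fun_pd[OF \<phi>]])
 ultimately show ?thesis by (simp add: ip_add_right)
qed

text \<open>The function K sin(y/K) has the primitive K squared times (1 - cos(y/K)), which is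
  smooth, has bounded derivative and vanishes at 0. So the integrand is again a gradient, and no
  integrability of \<open>v\<close> beyond \<open>L2\<close> is required.\<close>

lemma convection_skew_trunc:
 fixes e :: "real^2 \<Rightarrow> real^2"
 assumes v: "zero_normal_trace U v" "div_free U v" and e: "zero_trace U e" and K: "K > 0"
 shows "ip U v (\<lambda>x. \<chi> i. weak_pd U i e x \<bullet> (trunc K (e x))) = 0"
proof -
 let ?T = "\<lambda>k x. K * sin (e x $ k / K)"
 have s: "L2 U (\<lambda>x. e x $ k)" "L2 U (weak_pd U i e)" "L2 U (\<lambda>x. weak_pd U i e x $ k)" for k i
  using sobolev_1_L2[OF zero_trace_sobolev[OF e]] by (auto intro: L2_nth)
 have wp: "AE x in \<mu>. weak_pd U i (\<lambda>x. e x $ k) x = weak_pd U i e x $ k" for i k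
  by (rule weak_pd_nth[OF sobolev_1D[OF zero_trace_sobolev[OF e]]])
 have w: "has_weak_pd U i (\<lambda>x. K\<^sup>2 * (1 - cos (e x $ k / K))) (\<lambda>x. ?T k x * weak_pd U i e x $ k)" for i k
 proof (rule has_weak_pd_cong_AE)
  show "has_weak_pd U i (\<lambda>x. K\<^sup>2 * (1 - cos (e x $ k / K))) (\<lambda>x. ?T k x * weak_pd U i (\<lambda>x. e x $ k) x)"
   by (rule zero_trace_compose[where h = "\<lambda>y. K\<^sup>2 * (1 - cos (y / K))" and h' = "\<lambda>y. K * sin (y / K)" and C = K])
     (use K smooth_trunc(2)[OF K] trunc_derivatives(2)[OF K] trunc_bounds(1)[OF K] zero_trace_nth[OF e] in
      \<open>auto intro!: continuous_intros\<close>)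
  show "AE x in \<mu>. ?T k x * weak_pd U i (\<lambda>x. e x $ k) x = ?T k x * weak_pd U i e x $ k"
   using wp[of i k] by eventually_elim simp
 qed simp
 have "has_weak_pd U i (\<lambda>x. K\<^sup>2 * (1 - cos (e x $ 1 / K)) + K\<^sup>2 * (1 - cos (e x $ 2 / K)))
   (\<lambda>x. weak_pd U i e x \<bullet> (\<chi> k. ?T k x))" for i
  using has_weak_pd_add[OF w[of i 1] w[of i 2]] by (simp add: inner_vec2 mult.commute)
 from zero_normal_trace_orthogonal[OF v this] show ?thesis .
qed

end

section \<open>Sobolev embeddings on Lipschitz domains\<close>

text \<open>Identifies integration over pairs of reals with integration over \<open>real^2\<close>,
  by comparison on boxes; iterated integrals can then be transformed by linear maps of the
  plane.\<close>

lemma distr_vector_lborel: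
 "Measure_Space.distr (lborel \<Otimes>\<^sub>M lborel) borel (\<lambda>(s, t). vector [s, t] :: real^2) = lborel"
proof (rule lborel_eqI[symmetric])
 have meas: "(\<lambda>(s, t). vector [s, t] :: real^2) \<in> borel_measurable (lborel \<Otimes>\<^sub>M (lborel :: real measure))"
 proof -
  have "(\<lambda>p. vector [fst p, snd p] :: real^2) = (\<lambda>p. fst p *\<^sub>R axis 1 1 + snd p *\<^sub>R axis 2 1)"
   by (auto simp: fun_eq_iff vec_eq_iff forall_2 axis_def)
  then show ?thesis by (simp add: case_prod_beta')
 qed
 fix l u :: "real^2" assume le: "\<And>b. b \<in> Basis \<Longrightarrow> l \<bullet> b \<le> u \<bullet> b"
 have le': "l $ i \<le> u $ i" for i using le[of "axis i 1"] by (simp add: inner_axis axis_in_Basis_iff)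
 have "(\<lambda>(s, t). vector [s, t] :: real^2) -` box l u \<inter> space (lborel \<Otimes>\<^sub>M (lborel :: real measure))
   = {l $ 1<..<u $ 1} \<times> {l $ 2<..<u $ 2}" by (auto simp: mem_box_cart forall_2 space_pair_measure)
 then have "emeasure (Measure_Space.distr (lborel \<Otimes>\<^sub>M lborel) borel (\<lambda>(s, t). vector [s, t])) (box l u)
   = emeasure (lborel \<Otimes>\<^sub>M lborel) ({l $ 1<..<u $ 1} \<times> {l $ 2<..<u $ 2})" using meas by (subst emeasure_distr) auto
 also have "\<dots> = ennreal ((u $ 1 - l $ 1) * (u $ 2 - l $ 2))"
  using le' by (simp add: lborel.emeasure_pair_measure_Times ennreal_mult)
 also have "(u $ 1 - l $ 1) * (u $ 2 - l $ 2) = (\<Prod>b\<in>Basis. (u - l) \<bullet> b)"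
 proof -
  have inj: "inj (\<lambda>i::2. axis i (1::real))" by (auto simp: inj_def axis_eq_axis)
  have "(\<Prod>b\<in>Basis. (u - l) \<bullet> b) = (\<Prod>b\<in>range (\<lambda>i::2. axis i (1::real)). (u - l) \<bullet> b)"
   by (intro prod.cong) (auto simp: Basis_vec_def)
  also have "\<dots> = (\<Prod>i\<in>UNIV. (u - l) $ i)" by (subst prod.reindex[OF inj]) (simp add: inner_axis)
  finally show ?thesis by (simp add: UNIV_2)
 qed
 finally show "emeasure (Measure_Space.distr (lborel \<Otimes>\<^sub>M lborel) borel (\<lambda>(s, t). vector [s, t])) (box l u)
   = ennreal (\<Prod>b\<in>Basis. (u - l) \<bullet> b)" .
qed simp

text \<open>Linear change of variables from (s, t) to the point of the plane, invertible because
  \<open>a\<close> and \<open>b\<close> are independent. Translation invariance eliminates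
  \<open>x\<close>, and an upper bound suffices.\<close>

lemma nn_integral_parallelogram:
 fixes a b :: "real^2"
 assumes indep: "cross_vv a b \<noteq> 0"
 obtains C :: real where "C > 0"
  "\<And>h. h \<in> borel_measurable borel \<Longrightarrow>
   (\<integral>\<^sup>+s. \<integral>\<^sup>+t. h (x - s *\<^sub>R a - t *\<^sub>R b) \<partial>lborel \<partial>lborel) \<le> ennreal C * (\<integral>\<^sup>+z. h z \<partial>lborel)"
proof -
 define D where "D = a $ 1 * b $ 2 - a $ 2 * b $ 1"
 have D: "D \<noteq> 0" using indep by (simp add: D_def cross_vv_def)
 define A where "A z = - (z $ 1 *\<^sub>R a + z $ 2 *\<^sub>R b)" for z :: "real^2"
 \<comment> \<open>The inverse of \<open>A\<close> by Cramer's rule.\<close>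
 define A' where "A' w = (vector [(w $ 2 * b $ 1 - w $ 1 * b $ 2) / D, (a $ 2 * w $ 1 - a $ 1 * w $ 2) / D] :: real^2)"
  for w :: "real^2"
 have AA': "A (A' w) = w" for w
 proof -
  have "- ((w $ 2 * b $ 1 - w $ 1 * b $ 2) * a $ i + (a $ 2 * w $ 1 - a $ 1 * w $ 2) * b $ i) = D * w $ i" for i
   using exhaust_2[of i] by (auto simp: D_def algebra_simps)
  then have "A (A' w) $ i = w $ i" for i
   using D by (simp add: A_def A'_def add_divide_distrib[symmetric] minus_divide_left[symmetric] del: minus_add_distrib)
     (metis (no_types, lifting) nonzero_mult_div_cancel_left minus_divide_left)
  then show ?thesis by (simp add: vec_eq_iff)
 qed
 have A'A: "A' (A z) = z" for z
  using D by (auto simp: A_def A'_def vec_eq_iff forall_2 field_simps) (auto simp: D_def algebra_simps)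
 have linA': "linear A'"
  by (rule linearI) (auto simp: A'_def vec_eq_iff forall_2 field_simps add_divide_distrib diff_divide_distrib)
 have contA: "continuous_on UNIV A" unfolding A_def by (intro continuous_intros)
 have measA [measurable]: "A \<in> borel_measurable borel" by (rule borel_measurable_continuous_onI[OF contA])
 \<comment> \<open>Adding 1 makes the constant positive without a discussion of the determinant;
   then sets of infinite measure satisfy the bound trivially.\<close>
 define C where "C = \<bar>det (matrix A')\<bar> + 1"
 have C: "C > 0" by (simp add: C_def)
 have le: "emeasure (Measure_Space.distr lborel borel A) S \<le> emeasure (scale_measure (ennreal C) lborel) S"
  if S: "S \<in> sets borel" for S
 proof (cases "emeasure lborel S = \<infinity>")
  case True
  then show ?thesis using C by (simp add: ennreal_mult_top)
 next
  case False
  then have lm: "S \<in> lmeasurable" using S by (auto simp: fmeasurable_def less_top)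
  have pre: "A -` S = A' ` S" using AA' A'A by (auto simp: image_iff) metis
  have "emeasure (Measure_Space.distr lborel borel A) S = emeasure lborel (A -` S)"
   using S by (simp add: emeasure_distr)
  also have "\<dots> = emeasure lebesgue (A' ` S)" using measurable_sets[OF measA S] pre by simp
  also have "\<dots> = ennreal (measure lebesgue (A' ` S))"
   by (rule emeasure_eq_measure2[OF measurable_linear_image[OF linA' lm]])
  also have "\<dots> = ennreal (\<bar>det (matrix A')\<bar> * measure lebesgue S)" by (simp add: measure_linear_image[OF linA' lm])
  also have "\<dots> \<le> ennreal (C * measure lebesgue S)" by (intro ennreal_leI mult_right_mono) (auto simp: C_def)
  also have "\<dots> = ennreal C * emeasure lebesgue S" using C lm by (simp add: ennreal_mult emeasure_eq_measure2)
  finally show ?thesis using S by simp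
 qed
 have "(\<integral>\<^sup>+s. \<integral>\<^sup>+t. h (x - s *\<^sub>R a - t *\<^sub>R b) \<partial>lborel \<partial>lborel) \<le> ennreal C * (\<integral>\<^sup>+z. h z \<partial>lborel)"
  if [measurable]: "h \<in> borel_measurable borel" for h
 proof -
  have vm: "(\<lambda>(s, t). vector [s, t] :: real^2) \<in> borel_measurable (lborel \<Otimes>\<^sub>M (lborel :: real measure))"
  proof -
   have "(\<lambda>p. vector [fst p, snd p] :: real^2) = (\<lambda>p. fst p *\<^sub>R axis 1 1 + snd p *\<^sub>R axis 2 1)"
    by (auto simp: fun_eq_iff vec_eq_iff forall_2 axis_def)
   then show ?thesis by (simp add: case_prod_beta')
  qed
  have "(\<integral>\<^sup>+s. \<integral>\<^sup>+t. h (x - s *\<^sub>R a - t *\<^sub>R b) \<partial>lborel \<partial>lborel)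
    = (\<integral>\<^sup>+s. \<integral>\<^sup>+t. (\<lambda>(s, t). h (x + A (vector [s, t]))) (s, t) \<partial>lborel \<partial>lborel)"
   by (simp add: A_def algebra_simps)
  also have "\<dots> = (\<integral>\<^sup>+p. (\<lambda>(s, t). h (x + A (vector [s, t]))) p \<partial>(lborel \<Otimes>\<^sub>M lborel))"
  proof (rule lborel.nn_integral_fst)
   have "(\<lambda>p. h (x + A p)) \<in> borel_measurable borel" by measurable
   from measurable_compose[OF vm this]
   show "(\<lambda>(s, t). h (x + A (vector [s, t]))) \<in> borel_measurable (lborel \<Otimes>\<^sub>M lborel)"
    by (simp add: case_prod_beta')
  qed
  also have "\<dots> = (\<integral>\<^sup>+z. h (x + A z) \<partial>Measure_Space.distr (lborel \<Otimes>\<^sub>M lborel) borel (\<lambda>(s, t). vector [s, t] :: real^2))"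
   using vm by (subst nn_integral_distr) (auto simp: case_prod_beta')
  also have "\<dots> = (\<integral>\<^sup>+z. h (x + A z) \<partial>lborel)" by (simp add: distr_vector_lborel)
  also have "\<dots> = (\<integral>\<^sup>+z. h (x + z) \<partial>Measure_Space.distr lborel borel A)" by (subst nn_integral_distr) auto
  also have "\<dots> \<le> (\<integral>\<^sup>+z. h (x + z) \<partial>scale_measure (ennreal C) lborel)"
   using le by (intro nn_integral_mono_measure) (auto simp: le_measure)
  also have "\<dots> = ennreal C * (\<integral>\<^sup>+z. h (x + z) \<partial>lborel)" by (rule nn_integral_scale_measure) measurable
  also have "(\<integral>\<^sup>+z. h (x + z) \<partial>lborel) = (\<integral>\<^sup>+z. h z \<partial>Measure_Space.distr lborel borel ((+) x))"
   by (subst nn_integral_distr) auto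
  also have "\<dots> = (\<integral>\<^sup>+z. h z \<partial>lborel)" by (simp add: lborel_distr_plus)
  finally show ?thesis .
 qed
 with C that show ?thesis by blast
qed

text \<open>The one-dimensional Sobolev inequality: \<open>\<bar>H 0\<bar>\<close> is at most
  \<open>\<bar>H s\<bar>\<close> plus the integral of \<open>\<bar>H'\<bar>\<close>, averaged over
  \<open>s\<close>. It is stated with extended nonnegative integrals so that it can be iterated in
  two directions.\<close>

lemma nn_integral_unit_interval_bound:
 fixes H H' :: "real \<Rightarrow> real"
 assumes der: "\<And>s. s \<in> {0..1} \<Longrightarrow> (H has_real_derivative H' s) (at s)" and cont: "continuous_on {0..1} H'"
 shows "ennreal \<bar>H 0\<bar> \<le> (\<integral>\<^sup>+s. ennreal (\<bar>H s\<bar> + \<bar>H' s\<bar>) * indicator {0..1} s \<partial>lborel)"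
proof -
 have cH: "continuous_on {0..1} H" using der by (intro continuous_at_imp_continuous_on ballI DERIV_isCont) auto
 let ?J = "integral {0..1} (\<lambda>s. \<bar>H' s\<bar>)"
 have int: "(\<lambda>s. \<bar>H s\<bar>) integrable_on {0..1}" "(\<lambda>s. \<bar>H' s\<bar>) integrable_on {0..1}"
  by (intro integrable_continuous_interval continuous_intros cH cont)+
 have le: "\<bar>H 0\<bar> \<le> \<bar>H s\<bar> + ?J" if s: "s \<in> {0..1}" for s
 proof -
  have "(H' has_integral H s - H 0) {0..s}"
  proof (rule fundamental_theorem_of_calculus)
   show "0 \<le> s" using s by simp
   show "(H has_vector_derivative H' r) (at r within {0..s})" if "r \<in> {0..s}" for r using der[of r] that s
    by (auto simp: has_real_derivative_iff_has_vector_derivative intro: has_vector_derivative_at_within)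
  qed
  moreover have "(\<lambda>s. \<bar>H' s\<bar>) integrable_on {0..s}"
   by (intro integrable_continuous_interval continuous_intros continuous_on_subset[OF cont]) (use s in auto)
  ultimately have "\<bar>H s - H 0\<bar> \<le> integral {0..s} (\<lambda>s. \<bar>H' s\<bar>)"
   using integral_norm_bound_integral[of H' "{0..s}" "\<lambda>s. \<bar>H' s\<bar>"] by (auto simp: has_integral_iff)
  also have "\<dots> \<le> ?J" by (intro integral_subset_le int) (use s \<open>(\<lambda>s. \<bar>H' s\<bar>) integrable_on {0..s}\<close> in auto)
  finally show ?thesis by linarith
 qed
 have "\<bar>H 0\<bar> = integral {0..1} (\<lambda>s::real. \<bar>H 0\<bar>)" by simp
 also have "\<dots> \<le> integral {0..1} (\<lambda>s. \<bar>H s\<bar> + ?J)" using le by (intro integral_le integrable_add int) auto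
 also have "\<dots> = integral {0..1} (\<lambda>s. \<bar>H s\<bar>) + ?J" using int by (subst integral_add) auto
 also have "\<dots> = integral {0..1} (\<lambda>s. \<bar>H s\<bar> + \<bar>H' s\<bar>)" by (rule integral_add[OF int, symmetric])
 finally have "ennreal \<bar>H 0\<bar> \<le> ennreal (integral {0..1} (\<lambda>s. \<bar>H s\<bar> + \<bar>H' s\<bar>))" by (rule ennreal_leI)
 also have "\<dots> = (\<integral>\<^sup>+s. ennreal (indicator {0..1} s *\<^sub>R (\<bar>H s\<bar> + \<bar>H' s\<bar>)) \<partial>lborel)"
 proof -
  have si: "set_integrable lborel {0..1} (\<lambda>s. \<bar>H s\<bar> + \<bar>H' s\<bar>)"
   by (intro borel_integrable_atLeastAtMost' continuous_intros cH cont)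
  then have "integrable lborel (\<lambda>s. indicator {0..1} s *\<^sub>R (\<bar>H s\<bar> + \<bar>H' s\<bar>))" by (simp add: set_integrable_def)
  then show ?thesis using set_borel_integral_eq_integral(2)[OF si]
   by (subst nn_integral_eq_integral) (auto simp: set_lebesgue_integral_def)
 qed
 also have "\<dots> = (\<integral>\<^sup>+s. ennreal (\<bar>H s\<bar> + \<bar>H' s\<bar>) * indicator {0..1} s \<partial>lborel)"
  by (intro nn_integral_cong) (auto simp: indicator_def)
 finally show ?thesis .
qed

context bounded_open
begin

text \<open>In contrast to \<open>has_weak_pd\<close>, the function and its derivative are only required to be integrable.\<close>

definition has_dir_deriv :: "real^2 \<Rightarrow> (real^2 \<Rightarrow> real) \<Rightarrow> (real^2 \<Rightarrow> real) \<Rightarrow> bool" where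
 "has_dir_deriv a f g \<longleftrightarrow> integrable \<mu> f \<and> integrable \<mu> g \<and>
   (\<forall>\<phi>. test_fun U \<phi> \<longrightarrow>
    (LINT x|\<mu>. f x * frechet_derivative \<phi> (at x) a) = - (LINT x|\<mu>. g x * \<phi> x))"

text \<open>The translation is put on the test function: the pairing is then differentiable in
  \<open>c\<close> for every integrable \<open>f\<close>, although \<open>f\<close> has no values
  along a given segment.\<close>

definition shift_pairing :: "(real^2 \<Rightarrow> real) \<Rightarrow> (real^2 \<Rightarrow> real) \<Rightarrow> real^2 \<Rightarrow> real" where
 "shift_pairing \<phi> f c = (LINT x|\<mu>. f x * \<phi> (x - c))"

lemma integrable_mult_test:
 assumes "integrable \<mu> f" "test_fun V (\<phi> :: real^2 \<Rightarrow> real)"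
 shows "integrable \<mu> (\<lambda>x. f x * \<phi> (x - c))"
proof -
 obtain C where C: "\<And>x. norm (\<phi> x) \<le> C" using test_fun_bounded[OF assms(2)] by blast
 have [measurable]: "(\<lambda>x. \<phi> (x - c)) \<in> borel_measurable \<mu>"
  by (intro continuous_measurable_dom continuous_on_compose2[OF test_fun_continuous[OF assms(2)]] continuous_intros) auto
 note [measurable] = borel_measurable_integrable[OF assms(1)]
 show ?thesis
 proof (rule Bochner_Integration.integrable_bound)
  show "integrable \<mu> (\<lambda>x. C * f x)" using assms(1) by simp
  have "C \<ge> 0" using C[of 0] norm_ge_zero order_trans by blast
  then show "AE x in \<mu>. norm (f x * \<phi> (x - c)) \<le> norm (C * f x)"
   using C by (intro AE_I2) (auto simp: abs_mult mult.commute[of C] intro!: mult_left_mono)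
 qed measurable
qed

text \<open>The remainder in the expansion of the test function is uniform in \<open>x\<close>, so
  against \<open>f\<close> it costs only the integral of \<open>\<bar>f\<bar>\<close>.\<close>

lemma shift_pairing_derivative:
 assumes f: "integrable \<mu> f" and \<phi>: "test_fun V \<phi>"
 shows "((\<lambda>s. shift_pairing \<phi> f (c + s *\<^sub>R a)) has_real_derivative
  - (LINT x|\<mu>. f x * frechet_derivative \<phi> (at (x - (c + s *\<^sub>R a))) a)) (at s)"
proof -
 define N where "N = (LINT x|\<mu>. \<bar>f x\<bar>)"
 have N: "N \<ge> 0" by (simp add: N_def)
 let ?D = "LINT x|\<mu>. f x * frechet_derivative \<phi> (at (x - (c + s *\<^sub>R a))) a"
 have D_test: "test_fun V (\<lambda>x. frechet_derivative \<phi> (at x) a)"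
  unfolding frechet_derivative_pd[OF test_fun_differentiable[OF \<phi>]]
  by (intro test_fun_sum test_fun_cscaleR test_fun_pd \<phi>)
 have lin: "bounded_linear (frechet_derivative \<phi> (at x))" for x
  using has_derivative_bounded_linear[OF test_fun_derivative[OF \<phi>]] .
 show ?thesis unfolding DERIV_def LIM_eq
 proof (intro allI impI)
  fix r :: real assume r: "r > 0"
  \<comment> \<open>Chosen so that \<open>e * norm a * N\<close> is at most \<open>r / 2\<close>;
    the two added ones cover \<open>N = 0\<close> and \<open>a = 0\<close>.\<close>
  define e where "e = r / 2 / ((N + 1) * (norm a + 1))"
  have pos: "(N + 1) * (norm a + 1) > 0" using N by (intro mult_pos_pos) (auto intro: add_nonneg_pos)
  then have e: "e > 0" using r by (simp add: e_def)
  have e_le: "e * norm a * N < r"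
  proof -
   have "e * norm a * N \<le> e * ((N + 1) * (norm a + 1))" using e N by (simp add: mult.assoc algebra_simps)
   also have "\<dots> = r / 2" using pos unfolding e_def by (metis nonzero_eq_divide_eq order_less_irrefl)
   finally show ?thesis using r by simp
  qed
  obtain d where d: "d > 0" "\<And>x h. norm h < d \<Longrightarrow>
    norm (\<phi> (x + h) - \<phi> x - frechet_derivative \<phi> (at x) h) \<le> e * norm h"
   using test_fun_uniformly_differentiable[OF \<phi> e] by blast
  show "\<exists>d>0. \<forall>h. h \<noteq> 0 \<and> norm (h - 0) < d \<longrightarrow>
    norm ((shift_pairing \<phi> f (c + (s + h) *\<^sub>R a) - shift_pairing \<phi> f (c + s *\<^sub>R a)) / h - - ?D) < r"
  proof (intro exI[of _ "d / (norm a + 1)"] conjI allI impI; (elim conjE)?)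
   have na: "norm a + 1 > 0" by (simp add: add_nonneg_pos)
   show "0 < d / (norm a + 1)" using d na by simp
   fix h :: real assume h: "h \<noteq> 0" "norm (h - 0) < d / (norm a + 1)"
   have ha: "norm (- h *\<^sub>R a) < d"
   proof -
    have "\<bar>h\<bar> * norm a \<le> \<bar>h\<bar> * (norm a + 1)" by (intro mult_left_mono) auto
    also have "\<dots> < d" using h(2) na by (simp add: pos_less_divide_eq)
    finally show ?thesis by simp
   qed
   let ?R = "\<lambda>x. \<phi> (x - (c + (s + h) *\<^sub>R a)) - \<phi> (x - (c + s *\<^sub>R a)) + h * frechet_derivative \<phi> (at (x - (c + s *\<^sub>R a))) a"
   have R: "\<bar>?R x\<bar> \<le> e * (\<bar>h\<bar> * norm a)" for x
    using d(2)[OF ha, of "x - (c + s *\<^sub>R a)"] lin[of "x - (c + s *\<^sub>R a)"]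
    by (simp add: linear_simps algebra_simps)
   have int: "integrable \<mu> (\<lambda>x. f x * \<phi> (x - (c + (s + h) *\<^sub>R a)))"
    "integrable \<mu> (\<lambda>x. f x * \<phi> (x - (c + s *\<^sub>R a)))"
    "integrable \<mu> (\<lambda>x. f x * frechet_derivative \<phi> (at (x - (c + s *\<^sub>R a))) a)"
    by (rule integrable_mult_test[OF f \<phi>] integrable_mult_test[OF f D_test])+
   have eq: "shift_pairing \<phi> f (c + (s + h) *\<^sub>R a) - shift_pairing \<phi> f (c + s *\<^sub>R a) + h * ?D
     = (LINT x|\<mu>. f x * ?R x)"
   proof -
    have "(LINT x|\<mu>. f x * ?R x) = (LINT x|\<mu>. f x * \<phi> (x - (c + (s + h) *\<^sub>R a))
      - f x * \<phi> (x - (c + s *\<^sub>R a)) + h * (f x * frechet_derivative \<phi> (at (x - (c + s *\<^sub>R a))) a))"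
     by (simp add: algebra_simps)
    also have "\<dots> = shift_pairing \<phi> f (c + (s + h) *\<^sub>R a) - shift_pairing \<phi> f (c + s *\<^sub>R a) + h * ?D"
     using int by (simp add: shift_pairing_def)
    finally show ?thesis by simp
   qed
   have "\<bar>LINT x|\<mu>. f x * ?R x\<bar> \<le> (LINT x|\<mu>. e * (\<bar>h\<bar> * norm a) * \<bar>f x\<bar>)"
   proof (rule order_trans[OF integral_abs_bound], rule integral_mono')
    show "integrable \<mu> (\<lambda>x. e * (\<bar>h\<bar> * norm a) * \<bar>f x\<bar>)" using f by simp
    show "\<bar>f x * ?R x\<bar> \<le> e * (\<bar>h\<bar> * norm a) * \<bar>f x\<bar>" for x
     using mult_left_mono[OF R[of x], of "\<bar>f x\<bar>"] by (simp add: abs_mult mult_ac)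
   qed (use e in auto)
   also have "\<dots> = \<bar>h\<bar> * (e * norm a * N)" by (simp add: N_def)
   also have "\<dots> < \<bar>h\<bar> * r" using e_le h(1) by simp
   finally have "\<bar>shift_pairing \<phi> f (c + (s + h) *\<^sub>R a) - shift_pairing \<phi> f (c + s *\<^sub>R a) + h * ?D\<bar> < \<bar>h\<bar> * r"
    unfolding eq .
   moreover have "(shift_pairing \<phi> f (c + (s + h) *\<^sub>R a) - shift_pairing \<phi> f (c + s *\<^sub>R a)) / h - - ?D
    = (shift_pairing \<phi> f (c + (s + h) *\<^sub>R a) - shift_pairing \<phi> f (c + s *\<^sub>R a) + h * ?D) / h"
    using h(1) by (simp add: field_simps)
   ultimately show "norm ((shift_pairing \<phi> f (c + (s + h) *\<^sub>R a) - shift_pairing \<phi> f (c + s *\<^sub>R a)) / h - - ?D) < r"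
    using h(1) by (simp add: pos_divide_less_eq mult.commute)
  qed
 qed
qed

lemma test_fun_shift:
 assumes \<phi>: "test_fun V \<phi>" and sub: "\<And>x. x \<in> V \<Longrightarrow> x + c \<in> U"
 shows "test_fun U (\<lambda>x. \<phi> (x - c))"
proof -
 obtain K where K: "compact K" "K \<subseteq> V" "\<And>x. x \<notin> K \<Longrightarrow> \<phi> x = 0" using \<phi> by (meson test_fun_support)
 show ?thesis
 proof (rule test_funI)
  show "C_k k (\<lambda>x. \<phi> (x - c))" for k by (rule C_k_shift[OF test_fun_C_k[OF \<phi>]])
  show "compact ((\<lambda>x. x + c) ` K)" using K(1) by (intro compact_continuous_image continuous_intros)
  show "(\<lambda>x. x + c) ` K \<subseteq> U" using K(2) sub by auto
  show "\<phi> (x - c) = 0" if "x \<notin> (\<lambda>x. x + c) ` K" for x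
  proof (rule K(3), rule)
   assume "x - c \<in> K"
   then have "x - c + c \<in> (\<lambda>x. x + c) ` K" by (rule imageI)
   with that show False by simp
  qed
 qed
qed

text \<open>As long as the translated support remains in the domain, the translated function is an
  admissible test function and the derivative falls on \<open>f\<close>. This is where the geometry
  of corners is needed.\<close>

lemma shift_pairing_dir_deriv:
 assumes fg: "has_dir_deriv a f g" and \<phi>: "test_fun V \<phi>" and sub: "\<And>x. x \<in> V \<Longrightarrow> x + (c + s *\<^sub>R a) \<in> U"
 shows "((\<lambda>s. shift_pairing \<phi> f (c + s *\<^sub>R a)) has_real_derivative shift_pairing \<phi> g (c + s *\<^sub>R a)) (at s)"
proof -
 let ?c = "c + s *\<^sub>R a"
 have t: "test_fun U (\<lambda>x. \<phi> (x - ?c))" by (rule test_fun_shift[OF \<phi> sub])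
 have "frechet_derivative (\<lambda>x. \<phi> (x - ?c)) (at x) a = frechet_derivative \<phi> (at (x - ?c)) a" for x
  by (simp add: frechet_derivative_pd test_fun_differentiable[OF t] test_fun_differentiable[OF \<phi>] pd_shift)
 then have "(LINT x|\<mu>. f x * frechet_derivative \<phi> (at (x - ?c)) a) = - shift_pairing \<phi> g ?c"
  using fg t by (auto simp: has_dir_deriv_def shift_pairing_def)
 then show ?thesis using shift_pairing_derivative[OF _ \<phi>, of f c a s] fg by (simp add: has_dir_deriv_def)
qed

abbreviation smear where
 "smear a b G \<phi> \<equiv> \<integral>\<^sup>+s. \<integral>\<^sup>+t. (\<integral>\<^sup>+x. ennreal (\<bar>G x :: real\<bar> * \<bar>\<phi> (x - s *\<^sub>R a - t *\<^sub>R b) :: real\<bar>) \<partial>\<mu>) \<partial>lborel \<partial>lborel"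

text \<open>By Tonelli the shifts are integrated first; for each \<open>x\<close> this gives at most
  \<open>C\<close> times the integral of \<open>\<bar>\<phi>\<bar>\<close>, independently of
  \<open>x\<close>. Letting the shifts range over the whole plane instead of the unit square does no
  harm to upper bounds.\<close>

lemma nn_integral_shift_pairing:
 assumes indep: "cross_vv a b \<noteq> 0"
 obtains C where "C > 0"
  "\<And>V \<phi> G. test_fun V \<phi> \<Longrightarrow> integrable \<mu> G \<Longrightarrow>
   smear a b G \<phi>
   \<le> ennreal (C * (LINT x|\<mu>. \<bar>G x\<bar>) * (LINT x|lborel. \<bar>\<phi> x\<bar>))"
proof -
 obtain C where C: "C > 0" "\<And>x h. h \<in> borel_measurable borel \<Longrightarrow>
   (\<integral>\<^sup>+s. \<integral>\<^sup>+t. h (x - s *\<^sub>R a - t *\<^sub>R b) \<partial>lborel \<partial>lborel) \<le> ennreal C * (\<integral>\<^sup>+z. h z \<partial>lborel)"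
 proof -
  obtain C where C: "C > 0" "\<And>h. h \<in> borel_measurable borel \<Longrightarrow>
   (\<integral>\<^sup>+s. \<integral>\<^sup>+t. h (0 - s *\<^sub>R a - t *\<^sub>R b) \<partial>lborel \<partial>lborel) \<le> ennreal C * (\<integral>\<^sup>+z. h z \<partial>lborel)"
   using nn_integral_parallelogram[OF indep, of 0] by blast
  have "(\<integral>\<^sup>+s. \<integral>\<^sup>+t. h (x - s *\<^sub>R a - t *\<^sub>R b) \<partial>lborel \<partial>lborel) \<le> ennreal C * (\<integral>\<^sup>+z. h z \<partial>lborel)"
   if [measurable]: "h \<in> borel_measurable borel" for x h
  proof -
   have "(\<integral>\<^sup>+s. \<integral>\<^sup>+t. h (x - s *\<^sub>R a - t *\<^sub>R b) \<partial>lborel \<partial>lborel) \<le> ennreal C * (\<integral>\<^sup>+z. h (x + z) \<partial>lborel)"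
    using C(2)[of "\<lambda>z. h (x + z)"] by (simp add: algebra_simps)
   also have "(\<integral>\<^sup>+z. h (x + z) \<partial>lborel) = (\<integral>\<^sup>+z. h z \<partial>Measure_Space.distr lborel borel ((+) x))"
    by (subst nn_integral_distr) auto
   also have "\<dots> = (\<integral>\<^sup>+z. h z \<partial>lborel)" by (simp add: lborel_distr_plus)
   finally show ?thesis .
  qed
  with C(1) that show ?thesis by blast
 qed
 interpret L: finite_measure "\<mu>" by (rule finite_measure_dom)
 interpret P1: pair_sigma_finite "\<mu>" "lborel :: real measure" ..
 have "smear a b G \<phi>
   \<le> ennreal (C * (LINT x|\<mu>. \<bar>G x\<bar>) * (LINT x|lborel. \<bar>\<phi> x\<bar>))"
  if \<phi>: "test_fun V \<phi>" and G: "integrable \<mu> G" for V \<phi> G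
 proof -
  note [measurable] = borel_measurable_integrable[OF G] borel_measurable_continuous_onI[OF test_fun_continuous[OF \<phi>]]
  have [measurable]: "(\<lambda>x. x) \<in> borel_measurable \<mu>" by (intro continuous_measurable_dom continuous_intros)
  have int\<phi>: "integrable lborel (\<lambda>x. \<bar>\<phi> x\<bar>)"
  proof -
   obtain K where K: "compact K" "\<And>x. x \<notin> K \<Longrightarrow> \<phi> x = 0" using \<phi> by (meson test_fun_support)
   have "integrable lborel (\<lambda>x. indicator K x *\<^sub>R \<phi> x)"
    by (intro borel_integrable_compact K continuous_on_subset[OF test_fun_continuous[OF \<phi>]]) auto
   moreover have "(\<lambda>x. indicator K x *\<^sub>R \<phi> x) = \<phi>" using K(2) by (auto simp: indicator_def fun_eq_iff)
   ultimately show ?thesis by simp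
  qed
  have "smear a b G \<phi>
   = (\<integral>\<^sup>+s. (\<integral>\<^sup>+x. (\<integral>\<^sup>+t. ennreal (\<bar>G x\<bar> * \<bar>\<phi> (x - s *\<^sub>R a - t *\<^sub>R b)\<bar>) \<partial>lborel) \<partial>\<mu>) \<partial>lborel)"
   by (intro nn_integral_cong P1.Fubini') measurable
  also have "\<dots> = (\<integral>\<^sup>+x. (\<integral>\<^sup>+s. (\<integral>\<^sup>+t. ennreal (\<bar>G x\<bar> * \<bar>\<phi> (x - s *\<^sub>R a - t *\<^sub>R b)\<bar>) \<partial>lborel) \<partial>lborel) \<partial>\<mu>)"
   by (rule P1.Fubini') measurable
  also have "\<dots> = (\<integral>\<^sup>+x. ennreal \<bar>G x\<bar> * (\<integral>\<^sup>+s. (\<integral>\<^sup>+t. ennreal \<bar>\<phi> (x - s *\<^sub>R a - t *\<^sub>R b)\<bar> \<partial>lborel) \<partial>lborel) \<partial>\<mu>)"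
   by (simp add: ennreal_mult nn_integral_cmult)
  also have "\<dots> \<le> (\<integral>\<^sup>+x. ennreal \<bar>G x\<bar> * (ennreal C * (\<integral>\<^sup>+z. ennreal \<bar>\<phi> z\<bar> \<partial>lborel)) \<partial>\<mu>)"
   by (intro nn_integral_mono mult_left_mono C(2)) auto
  also have "\<dots> = (\<integral>\<^sup>+x. ennreal \<bar>G x\<bar> \<partial>\<mu>) * (ennreal C * (\<integral>\<^sup>+z. ennreal \<bar>\<phi> z\<bar> \<partial>lborel))"
   by (rule nn_integral_multc) measurable
  also have "(\<integral>\<^sup>+x. ennreal \<bar>G x\<bar> \<partial>\<mu>) = ennreal (LINT x|\<mu>. \<bar>G x\<bar>)" using G by (intro nn_integral_eq_integral) auto
  also have "(\<integral>\<^sup>+z. ennreal \<bar>\<phi> z\<bar> \<partial>lborel) = ennreal (LINT x|lborel. \<bar>\<phi> x\<bar>)"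
   using int\<phi> by (intro nn_integral_eq_integral) auto
  finally show ?thesis using C(1) by (simp add: ennreal_mult[symmetric] mult_ac)
 qed
 with C(1) that show ?thesis by blast
qed

end

context bounded_open
begin

text \<open>The interior cone condition of Lipschitz domains, with parallelograms in place of cones.\<close>

definition corner :: "(real^2) set \<Rightarrow> real^2 \<Rightarrow> real^2 \<Rightarrow> bool" where
 "corner N a b \<longleftrightarrow> open N \<and> cross_vv a b \<noteq> 0 \<and>
   (\<forall>x\<in>N \<inter> U. \<forall>s\<in>{0..1}. \<forall>t\<in>{0..1}. x + (s *\<^sub>R a + t *\<^sub>R b) \<in> U)"

lemma shift_pairing_le:
 assumes g: "integrable \<mu> g" and \<phi>: "test_fun V \<phi>"
 shows "ennreal \<bar>shift_pairing \<phi> g c\<bar> \<le> (\<integral>\<^sup>+x. ennreal (\<bar>g x\<bar> * \<bar>\<phi> (x - c)\<bar>) \<partial>\<mu>)"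
proof -
 note int = integrable_mult_test[OF g \<phi>, of c]
 have "ennreal \<bar>shift_pairing \<phi> g c\<bar> \<le> ennreal (LINT x|\<mu>. \<bar>g x * \<phi> (x - c)\<bar>)"
  unfolding shift_pairing_def by (intro ennreal_leI integral_abs_bound)
 also have "\<dots> = (\<integral>\<^sup>+x. ennreal \<bar>g x * \<phi> (x - c)\<bar> \<partial>\<mu>)" using int by (intro nn_integral_eq_integral[symmetric]) auto
 finally show ?thesis by (simp add: abs_mult)
qed

lemma continuous_shift_pairing:
 assumes "integrable \<mu> g" "test_fun V \<phi>"
 shows "continuous_on S (\<lambda>s. shift_pairing \<phi> g (c + s *\<^sub>R a))" using shift_pairing_derivative[OF assms, of c a]
 by (intro continuous_at_imp_continuous_on ballI DERIV_isCont) blast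

text \<open>The one-dimensional inequality is used along \<open>a\<close> and then along
  \<open>b\<close>, so only the mixed second derivative enters. A pairing bounded by the integral of
  \<open>\<bar>\<phi>\<bar>\<close> amounts to a pointwise bound on \<open>f\<close>.\<close>

lemma pairing_bound_Linf:
 assumes ab: "corner N a b"
 obtains C where "C > 0"
  "\<And>f fa fb fab \<phi>. has_dir_deriv a f fa \<Longrightarrow> has_dir_deriv b f fb \<Longrightarrow> has_dir_deriv b fa fab \<Longrightarrow>
    test_fun (N \<inter> U) \<phi> \<Longrightarrow>
    \<bar>LINT x|\<mu>. f x * \<phi> x\<bar> \<le>
     C * (LINT x|\<mu>. \<bar>f x\<bar> + \<bar>fb x\<bar> + \<bar>fa x\<bar> + \<bar>fab x\<bar>) * (LINT x|lborel. \<bar>\<phi> x\<bar>)"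
proof -
 obtain C where C: "C > 0"
  "\<And>V \<phi> G. test_fun V \<phi> \<Longrightarrow> integrable \<mu> G \<Longrightarrow>
   smear a b G \<phi>
   \<le> ennreal (C * (LINT x|\<mu>. \<bar>G x\<bar>) * (LINT x|lborel. \<bar>\<phi> x\<bar>))"
  using nn_integral_shift_pairing ab unfolding corner_def by blast
 show ?thesis
 proof (rule that[OF C(1)])
  fix f fa fb fab \<phi> :: "real^2 \<Rightarrow> real"
  assume d: "has_dir_deriv a f fa" "has_dir_deriv b f fb" "has_dir_deriv b fa fab" and \<phi>: "test_fun (N \<inter> U) \<phi>"
  have int: "integrable \<mu> f" "integrable \<mu> fa"
   "integrable \<mu> fb" "integrable \<mu> fab" using d by (auto simp: has_dir_deriv_def)
  let ?S = "\<lambda>g s t. \<bar>shift_pairing \<phi> g (s *\<^sub>R a + t *\<^sub>R b)\<bar>"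
  let ?G = "\<lambda>x. \<bar>f x\<bar> + \<bar>fb x\<bar> + \<bar>fa x\<bar> + \<bar>fab x\<bar>"
  let ?I = "indicator {0..1} :: real \<Rightarrow> ennreal"
  have sub: "x + (s *\<^sub>R a + t *\<^sub>R b) \<in> U" if "s \<in> {0..1}" "t \<in> {0..1}" "x \<in> N \<inter> U" for x s t
   using ab that unfolding corner_def by blast
  have db: "((\<lambda>t. shift_pairing \<phi> g (s *\<^sub>R a + t *\<^sub>R b)) has_real_derivative shift_pairing \<phi> gb (s *\<^sub>R a + t *\<^sub>R b)) (at t)"
   if "has_dir_deriv b g gb" "s \<in> {0..1}" "t \<in> {0..1}" for g gb s t
   by (rule shift_pairing_dir_deriv[OF that(1) \<phi>]) (rule sub[OF that(2,3)])
  have da: "((\<lambda>s. shift_pairing \<phi> f (s *\<^sub>R a)) has_real_derivative shift_pairing \<phi> fa (s *\<^sub>R a)) (at s)"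
   if "s \<in> {0..1}" for s using shift_pairing_dir_deriv[OF d(1) \<phi>, of 0 s] sub[OF that, of 0] by simp
  have meas [measurable]: "(\<lambda>t. shift_pairing \<phi> g (s *\<^sub>R a + t *\<^sub>R b)) \<in> borel_measurable borel"
   if "integrable \<mu> g" for g s by (intro borel_measurable_continuous_onI continuous_shift_pairing[OF that \<phi>])
  note [measurable] = meas[OF int(1)] meas[OF int(2)] meas[OF int(3)] meas[OF int(4)]
  have "ennreal \<bar>shift_pairing \<phi> f 0\<bar> \<le>
   (\<integral>\<^sup>+s. ennreal (\<bar>shift_pairing \<phi> f (s *\<^sub>R a)\<bar> + \<bar>shift_pairing \<phi> fa (s *\<^sub>R a)\<bar>) * ?I s \<partial>lborel)"
   using nn_integral_unit_interval_bound[of "\<lambda>s. shift_pairing \<phi> f (s *\<^sub>R a)" "\<lambda>s. shift_pairing \<phi> fa (s *\<^sub>R a)"]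
    da continuous_shift_pairing[OF int(2) \<phi>, of "{0..1}" 0 a] by simp
  also have "\<dots> \<le> smear a b ?G \<phi>"
  proof (rule nn_integral_mono)
   fix s :: real
   show "ennreal (\<bar>shift_pairing \<phi> f (s *\<^sub>R a)\<bar> + \<bar>shift_pairing \<phi> fa (s *\<^sub>R a)\<bar>) * ?I s \<le>
     (\<integral>\<^sup>+t. (\<integral>\<^sup>+x. ennreal (\<bar>?G x\<bar> * \<bar>\<phi> (x - s *\<^sub>R a - t *\<^sub>R b)\<bar>) \<partial>\<mu>) \<partial>lborel)"
   proof (cases "s \<in> {0..1}")
    case True
    have b1: "ennreal \<bar>shift_pairing \<phi> g (s *\<^sub>R a)\<bar> \<le> (\<integral>\<^sup>+t. ennreal (?S g s t + ?S gb s t) * ?I t \<partial>lborel)"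
     if "has_dir_deriv b g gb" for g gb
     using nn_integral_unit_interval_bound[of "\<lambda>t. shift_pairing \<phi> g (s *\<^sub>R a + t *\<^sub>R b)"
       "\<lambda>t. shift_pairing \<phi> gb (s *\<^sub>R a + t *\<^sub>R b)"] db[OF that True]
      continuous_shift_pairing[OF _ \<phi>, of gb "{0..1}" "s *\<^sub>R a" b] that by (auto simp: has_dir_deriv_def)
    have "ennreal (\<bar>shift_pairing \<phi> f (s *\<^sub>R a)\<bar> + \<bar>shift_pairing \<phi> fa (s *\<^sub>R a)\<bar>) * ?I s
     = ennreal \<bar>shift_pairing \<phi> f (s *\<^sub>R a)\<bar> + ennreal \<bar>shift_pairing \<phi> fa (s *\<^sub>R a)\<bar>" using True by simp
    also have "\<dots> \<le> (\<integral>\<^sup>+t. ennreal (?S f s t + ?S fb s t) * ?I t \<partial>lborel) + (\<integral>\<^sup>+t. ennreal (?S fa s t + ?S fab s t) * ?I t \<partial>lborel)"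
     by (intro add_mono b1 d)
    also have "\<dots> = (\<integral>\<^sup>+t. ennreal (?S f s t + ?S fb s t) * ?I t + ennreal (?S fa s t + ?S fab s t) * ?I t \<partial>lborel)"
     by (rule nn_integral_add[symmetric]) measurable
    also have "\<dots> \<le> (\<integral>\<^sup>+t. (\<integral>\<^sup>+x. ennreal (\<bar>?G x\<bar> * \<bar>\<phi> (x - s *\<^sub>R a - t *\<^sub>R b)\<bar>) \<partial>\<mu>) \<partial>lborel)"
    proof (rule nn_integral_mono)
     fix t :: real
     let ?c = "s *\<^sub>R a + t *\<^sub>R b"
     have m: "(\<lambda>x. ennreal (\<bar>g x\<bar> * \<bar>\<phi> (x - ?c)\<bar>)) \<in> borel_measurable \<mu>"
      if "integrable \<mu> g" for g using borel_measurable_integrable[OF integrable_mult_test[OF that \<phi>, of ?c]]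
      by (simp add: abs_mult[symmetric])
     have "ennreal (?S f s t + ?S fb s t) * ?I t + ennreal (?S fa s t + ?S fab s t) * ?I t
      \<le> ennreal (?S f s t + ?S fb s t) + ennreal (?S fa s t + ?S fab s t)" by (simp add: indicator_def)
     also have "\<dots> = ennreal (?S f s t) + ennreal (?S fb s t) + (ennreal (?S fa s t) + ennreal (?S fab s t))"
      by simp
     also have "\<dots> \<le> (\<integral>\<^sup>+x. ennreal (\<bar>f x\<bar> * \<bar>\<phi> (x - ?c)\<bar>) \<partial>\<mu>) + (\<integral>\<^sup>+x. ennreal (\<bar>fb x\<bar> * \<bar>\<phi> (x - ?c)\<bar>) \<partial>\<mu>)
       + ((\<integral>\<^sup>+x. ennreal (\<bar>fa x\<bar> * \<bar>\<phi> (x - ?c)\<bar>) \<partial>\<mu>) + (\<integral>\<^sup>+x. ennreal (\<bar>fab x\<bar> * \<bar>\<phi> (x - ?c)\<bar>) \<partial>\<mu>))"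
      by (intro add_mono shift_pairing_le[OF int(1) \<phi>] shift_pairing_le[OF int(2) \<phi>] shift_pairing_le[OF int(3) \<phi>] shift_pairing_le[OF int(4) \<phi>])
     also have "\<dots> = (\<integral>\<^sup>+x. ennreal (\<bar>f x\<bar> * \<bar>\<phi> (x - ?c)\<bar>) + ennreal (\<bar>fb x\<bar> * \<bar>\<phi> (x - ?c)\<bar>)
       + (ennreal (\<bar>fa x\<bar> * \<bar>\<phi> (x - ?c)\<bar>) + ennreal (\<bar>fab x\<bar> * \<bar>\<phi> (x - ?c)\<bar>)) \<partial>\<mu>)"
      using m[OF int(1)] m[OF int(2)] m[OF int(3)] m[OF int(4)] by (simp add: nn_integral_add)
     also have "\<dots> = (\<integral>\<^sup>+x. ennreal (\<bar>?G x\<bar> * \<bar>\<phi> (x - s *\<^sub>R a - t *\<^sub>R b)\<bar>) \<partial>\<mu>)"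
      by (intro nn_integral_cong) (simp add: ennreal_plus[symmetric] distrib_right diff_diff_eq add.assoc del: ennreal_plus)
     finally show "ennreal (?S f s t + ?S fb s t) * ?I t + ennreal (?S fa s t + ?S fab s t) * ?I t \<le>
      (\<integral>\<^sup>+x. ennreal (\<bar>?G x\<bar> * \<bar>\<phi> (x - s *\<^sub>R a - t *\<^sub>R b)\<bar>) \<partial>\<mu>)" .
    qed
    finally show ?thesis .
   qed simp
  qed
  also have "\<dots> \<le> ennreal (C * (LINT x|\<mu>. \<bar>?G x\<bar>) * (LINT x|lborel. \<bar>\<phi> x\<bar>))" using int by (intro C(2)[OF \<phi>]) auto
  finally have "\<bar>shift_pairing \<phi> f 0\<bar> \<le> C * (LINT x|\<mu>. \<bar>?G x\<bar>) * (LINT x|lborel. \<bar>\<phi> x\<bar>)"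
   using C(1) by (subst (asm) ennreal_le_iff) auto
  then show "\<bar>LINT x|\<mu>. f x * \<phi> x\<bar> \<le>
     C * (LINT x|\<mu>. \<bar>f x\<bar> + \<bar>fb x\<bar> + \<bar>fa x\<bar> + \<bar>fab x\<bar>) * (LINT x|lborel. \<bar>\<phi> x\<bar>)" by (simp add: shift_pairing_def)
 qed
qed

text \<open>A translation within the parallelogram changes the pairing by at most \<open>B\<close>,
  through the square integrable derivatives. Averaging over translations bounds the rest by the
  integral of \<open>\<bar>f\<bar>\<close>; \<open>f\<close> itself need not be square
  integrable.\<close>

lemma pairing_bound_L2:
 assumes ab: "corner N a b"
 obtains C where "C > 0"
  "\<And>f fa fb \<phi>. has_dir_deriv a f fa \<Longrightarrow> has_dir_deriv b f fb \<Longrightarrow> L2 U fa \<Longrightarrow> L2 U fb \<Longrightarrow>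
    test_fun (N \<inter> U) \<phi> \<Longrightarrow>
    \<bar>LINT x|\<mu>. f x * \<phi> x\<bar> \<le>
     C * (LINT x|\<mu>. \<bar>f x\<bar>) * (LINT x|lborel. \<bar>\<phi> x\<bar>)
     + (nrm fa + nrm fb) * nrm \<phi>"
proof -
 obtain C where C: "C > 0"
  "\<And>V \<phi> G. test_fun V \<phi> \<Longrightarrow> integrable \<mu> G \<Longrightarrow>
   smear a b G \<phi>
   \<le> ennreal (C * (LINT x|\<mu>. \<bar>G x\<bar>) * (LINT x|lborel. \<bar>\<phi> x\<bar>))"
  using nn_integral_shift_pairing ab unfolding corner_def by blast
 show ?thesis
 proof (rule that[OF C(1)])
  fix f fa fb \<phi> :: "real^2 \<Rightarrow> real"
  assume d: "has_dir_deriv a f fa" "has_dir_deriv b f fb" and L: "L2 U fa" "L2 U fb" and \<phi>: "test_fun (N \<inter> U) \<phi>"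
  have int: "integrable \<mu> f" using d by (auto simp: has_dir_deriv_def)
  have \<phi>U: "test_fun U \<phi>" by (rule test_fun_subset[OF \<phi>]) auto
  let ?I = "indicator {0..1} :: real \<Rightarrow> ennreal"
  have sub: "x + (s *\<^sub>R a + t *\<^sub>R b) \<in> U" if "s \<in> {0..1}" "t \<in> {0..1}" "x \<in> N \<inter> U" for x s t
   using ab that unfolding corner_def by blast
  have N\<phi>: "nrm (\<lambda>x. \<phi> (x - (s *\<^sub>R a + t *\<^sub>R b))) = nrm \<phi>"
   "L2 U (\<lambda>x. \<phi> (x - (s *\<^sub>R a + t *\<^sub>R b)))"
   if st: "s \<in> {0..1}" "t \<in> {0..1}" for s t
  proof -
   let ?c = "s *\<^sub>R a + t *\<^sub>R b"
   have t: "test_fun U (\<lambda>x. \<phi> (x - ?c))" by (rule test_fun_shift[OF \<phi> sub[OF st]])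
   then show "L2 U (\<lambda>x. \<phi> (x - ?c))" by (rule L2_test_fun)
   have "test_fun U (\<lambda>x. \<phi> (x - ?c) * \<phi> (x - ?c))" by (rule test_fun_mult[OF t test_fun_C_k[OF t]])
   then have "ip U (\<lambda>x. \<phi> (x - ?c)) (\<lambda>x. \<phi> (x - ?c)) = (LINT x|lborel. \<phi> (x - ?c) * \<phi> (x - ?c))"
    by (simp add: ip_def integral_test_fun_lborel)
   also have "\<dots> = (LINT x|Measure_Space.distr lborel borel ((+) (- ?c)). \<phi> x * \<phi> x)"
    using borel_measurable_continuous_onI[OF test_fun_continuous[OF \<phi>]]
    by (subst integral_distr) (auto simp: algebra_simps)
   also have "\<dots> = (LINT x|lborel. \<phi> x * \<phi> x)" by (simp only: lborel_distr_plus)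
   also have "\<dots> = ip U \<phi> \<phi>"
    using integral_test_fun_lborel(2)[OF test_fun_mult[OF \<phi>U test_fun_C_k[OF \<phi>U]]] by (simp add: ip_def)
   finally have "(nrm (\<lambda>x. \<phi> (x - ?c)))\<^sup>2 = (nrm \<phi>)\<^sup>2" by (simp only: L2_norm_sq)
   then show "nrm (\<lambda>x. \<phi> (x - ?c)) = nrm \<phi>" by simp
  qed
  have bd: "\<bar>shift_pairing \<phi> g (s *\<^sub>R a + t *\<^sub>R b)\<bar> \<le> nrm g * nrm \<phi>"
   if "L2 U g" "s \<in> {0..1}" "t \<in> {0..1}" for g s t
   using ip_Cauchy_Schwarz[OF that(1) N\<phi>(2)[OF that(2,3)]] N\<phi>(1)[OF that(2,3)]
   by (simp add: ip_def shift_pairing_def)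
  define B where "B = (nrm fa + nrm fb) * nrm \<phi>"
  have lip: "\<bar>shift_pairing \<phi> f 0\<bar> \<le> \<bar>shift_pairing \<phi> f (s *\<^sub>R a + t *\<^sub>R b)\<bar> + B"
   if s: "s \<in> {0..1}" and t: "t \<in> {0..1}" for s t
  proof -
   have "norm (shift_pairing \<phi> f (s *\<^sub>R a + t *\<^sub>R b) - shift_pairing \<phi> f (s *\<^sub>R a + 0 *\<^sub>R b))
     \<le> (nrm fb * nrm \<phi>) * norm (t - 0)"
   proof (rule field_differentiable_bound[where S = "{0..1}"])
    show "((\<lambda>t. shift_pairing \<phi> f (s *\<^sub>R a + t *\<^sub>R b)) has_field_derivative shift_pairing \<phi> fb (s *\<^sub>R a + r *\<^sub>R b)) (at r within {0..1})"
     if "r \<in> {0..1}" for r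
     by (rule has_field_derivative_at_within, rule shift_pairing_dir_deriv[OF d(2) \<phi>], rule sub[OF s that])
    show "norm (shift_pairing \<phi> fb (s *\<^sub>R a + r *\<^sub>R b)) \<le> nrm fb * nrm \<phi>" if "r \<in> {0..1}" for r
     using bd[OF L(2) s that] by simp
   qed (use t in auto)
   also have "\<dots> \<le> (nrm fb * nrm \<phi>) * 1" using t by (intro mult_left_mono) auto
   finally have 1: "\<bar>shift_pairing \<phi> f (s *\<^sub>R a + t *\<^sub>R b) - shift_pairing \<phi> f (s *\<^sub>R a)\<bar> \<le> nrm fb * nrm \<phi>" by simp
   have "norm (shift_pairing \<phi> f (0 + s *\<^sub>R a) - shift_pairing \<phi> f (0 + 0 *\<^sub>R a))
     \<le> (nrm fa * nrm \<phi>) * norm (s - 0)"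
   proof (rule field_differentiable_bound[where S = "{0..1}"])
    show "((\<lambda>t. shift_pairing \<phi> f (0 + t *\<^sub>R a)) has_field_derivative shift_pairing \<phi> fa (0 + r *\<^sub>R a)) (at r within {0..1})"
     if "r \<in> {0..1}" for r by (rule has_field_derivative_at_within, rule shift_pairing_dir_deriv[OF d(1) \<phi>])
       (use sub[OF that, of 0] in simp)
    show "norm (shift_pairing \<phi> fa (0 + r *\<^sub>R a)) \<le> nrm fa * nrm \<phi>" if "r \<in> {0..1}" for r
     using bd[OF L(1) that, of 0] by simp
   qed (use s in auto)
   also have "\<dots> \<le> (nrm fa * nrm \<phi>) * 1" using s by (intro mult_left_mono) auto
   finally have 2: "\<bar>shift_pairing \<phi> f (s *\<^sub>R a) - shift_pairing \<phi> f 0\<bar> \<le> nrm fa * nrm \<phi>" by simp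
   from 1 2 show ?thesis by (simp add: B_def distrib_right)
  qed
  have "ennreal (\<bar>shift_pairing \<phi> f 0\<bar> - B) = (\<integral>\<^sup>+s. (\<integral>\<^sup>+t. ennreal (\<bar>shift_pairing \<phi> f 0\<bar> - B) * ?I t \<partial>lborel) * ?I s \<partial>lborel)"
   by (simp add: nn_integral_cmult_indicator)
  also have "\<dots> \<le> smear a b f \<phi>"
  proof (rule nn_integral_mono)
   fix s :: real
   show "(\<integral>\<^sup>+t. ennreal (\<bar>shift_pairing \<phi> f 0\<bar> - B) * ?I t \<partial>lborel) * ?I s \<le>
    (\<integral>\<^sup>+t. (\<integral>\<^sup>+x. ennreal (\<bar>f x\<bar> * \<bar>\<phi> (x - s *\<^sub>R a - t *\<^sub>R b)\<bar>) \<partial>\<mu>) \<partial>lborel)"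
   proof (cases "s \<in> {0..1}")
    case True
    have "(\<integral>\<^sup>+t. ennreal (\<bar>shift_pairing \<phi> f 0\<bar> - B) * ?I t \<partial>lborel) \<le>
     (\<integral>\<^sup>+t. (\<integral>\<^sup>+x. ennreal (\<bar>f x\<bar> * \<bar>\<phi> (x - s *\<^sub>R a - t *\<^sub>R b)\<bar>) \<partial>\<mu>) \<partial>lborel)"
    proof (rule nn_integral_mono)
     fix t :: real
     show "ennreal (\<bar>shift_pairing \<phi> f 0\<bar> - B) * ?I t \<le> (\<integral>\<^sup>+x. ennreal (\<bar>f x\<bar> * \<bar>\<phi> (x - s *\<^sub>R a - t *\<^sub>R b)\<bar>) \<partial>\<mu>)"
     proof (cases "t \<in> {0..1}")
      case t: True
      have "ennreal (\<bar>shift_pairing \<phi> f 0\<bar> - B) \<le> ennreal \<bar>shift_pairing \<phi> f (s *\<^sub>R a + t *\<^sub>R b)\<bar>"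
       using lip[OF True t] by (intro ennreal_leI) simp
      also have "\<dots> \<le> (\<integral>\<^sup>+x. ennreal (\<bar>f x\<bar> * \<bar>\<phi> (x - s *\<^sub>R a - t *\<^sub>R b)\<bar>) \<partial>\<mu>)"
       using shift_pairing_le[OF int \<phi>, of "s *\<^sub>R a + t *\<^sub>R b"] by (simp add: diff_diff_eq)
      finally show ?thesis using t by simp
     qed simp
    qed
    with True show ?thesis by simp
   qed simp
  qed
  also have "\<dots> \<le> ennreal (C * (LINT x|\<mu>. \<bar>f x\<bar>) * (LINT x|lborel. \<bar>\<phi> x\<bar>))" by (rule C(2)[OF \<phi> int])
  finally have "\<bar>shift_pairing \<phi> f 0\<bar> - B \<le> C * (LINT x|\<mu>. \<bar>f x\<bar>) * (LINT x|lborel. \<bar>\<phi> x\<bar>)"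
   using C(1) by (subst (asm) ennreal_le_iff) auto
  then show "\<bar>LINT x|\<mu>. f x * \<phi> x\<bar> \<le>
     C * (LINT x|\<mu>. \<bar>f x\<bar>) * (LINT x|lborel. \<bar>\<phi> x\<bar>)
     + (nrm fa + nrm fb) * nrm \<phi>" by (simp add: shift_pairing_def B_def)
 qed
qed

lemma integral_test_subset:
 fixes f :: "real^2 \<Rightarrow> real"
 assumes "V \<in> sets lebesgue" "V \<subseteq> U" "test_fun V \<phi>"
 shows "(LINT x|\<mu>. f x * \<phi> x) = (LINT x|lebesgue_on V. f x * \<phi> x)"
proof -
 have "(LINT x|\<mu>. f x * \<phi> x) = (LINT x|lebesgue. indicator U x *\<^sub>R (f x * \<phi> x))"
  by (rule integral_restrict_space) simp
 also have "\<dots> = (LINT x|lebesgue. indicator V x *\<^sub>R (f x * \<phi> x))" using test_fun_outside[OF assms(3)] assms(2)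
  by (intro Bochner_Integration.integral_cong) (auto simp: indicator_def)
 also have "\<dots> = (LINT x|lebesgue_on V. f x * \<phi> x)" using assms(1) by (intro integral_restrict_space[symmetric]) simp
 finally show ?thesis .
qed

lemma L2_subset:
 assumes "L2 U f" "V \<in> sets lebesgue" "V \<subseteq> U"
 shows "L2 V f" unfolding L2_def
proof
 have eq: "restrict_space \<mu> V = lebesgue_on V" using assms by (simp add: restrict_restrict_space Int_absorb1)
 show "f \<in> borel_measurable (lebesgue_on V)"
  using measurable_restrict_space1[OF L2_measurable[OF assms(1)], of V] by (simp add: eq)
 have "integrable \<mu> (\<lambda>x. indicator V x *\<^sub>R (norm (f x))\<^sup>2)"
  using assms by (intro integrable_mult_indicator L2_integrable_norm_sq) (auto simp: sets_restrict_space_iff)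
 then have "integrable (restrict_space \<mu> V) (\<lambda>x. (norm (f x))\<^sup>2)"
  using assms by (subst integrable_restrict_space) (auto simp: sets_restrict_space_iff Int_absorb2)
 then show "integrable (lebesgue_on V) (\<lambda>x. (norm (f x))\<^sup>2)" by (simp add: eq)
qed

lemma integral_abs_test_fun:
 assumes \<phi>: "test_fun U (\<phi> :: real^2 \<Rightarrow> real)"
 shows "(LINT x|lborel. \<bar>\<phi> x\<bar>) = (LINT x|\<mu>. \<bar>\<phi> x\<bar>)"
proof -
 have "(LINT x|\<mu>. \<bar>\<phi> x\<bar>) = (LINT x|lebesgue. indicator U x *\<^sub>R \<bar>\<phi> x\<bar>)" by (rule integral_restrict_space) simp
 also have "\<dots> = (LINT x|lebesgue. \<bar>\<phi> x\<bar>)"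
  using test_fun_outside[OF \<phi>] by (intro Bochner_Integration.integral_cong) (auto simp: indicator_def)
 also have "\<dots> = (LINT x|lborel. \<bar>\<phi> x\<bar>)"
  using borel_measurable_continuous_onI[OF test_fun_continuous[OF \<phi>]] by (intro integral_completion) simp
 finally show ?thesis ..
qed

text \<open>Test with approximations of the indicator of the set where \<open>f\<close> exceeds
  \<open>C\<close>; the excess then has integral at most 0 there. Taking moduli does not increase
  the distance of the approximations to the indicator.\<close>

lemma AE_le_by_duality:
 fixes f :: "real^2 \<Rightarrow> real"
 assumes f: "L2 U f" and bd: "\<And>\<phi>. test_fun U \<phi> \<Longrightarrow> (LINT x|\<mu>. f x * \<phi> x) \<le> C * (LINT x|lborel. \<bar>\<phi> x\<bar>)"
 shows "AE x in \<mu>. f x \<le> C"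
proof -
 define A where "A = {x \<in> space \<mu>. C < f x}"
 note [measurable] = L2_measurable[OF f]
 have A [measurable]: "A \<in> sets \<mu>" unfolding A_def by measurable
 have L1: "L2 U (indicat_real A)" by (rule L2_bounded[where C = 1]) auto
 obtain \<Phi> where \<Phi>: "\<And>j::nat. test_fun U (\<Phi> j)" "L2_lim U \<Phi> (indicat_real A)" using test_fun_dense_seq[OF L1] by blast
 have L\<Phi>: "L2 U (\<Phi> j)" "L2 U (\<lambda>x. \<bar>\<Phi> j x\<bar>)" for j
  using L2_test_fun[OF \<Phi>(1)] L2_norm[OF L2_test_fun[OF \<Phi>(1)]] by simp_all
 have abs_lim: "(\<lambda>j. nrm (\<lambda>x. \<bar>\<Phi> j x\<bar> - indicat_real A x)) \<longlonglongrightarrow> 0"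
 proof (rule tendsto_sandwich[OF _ _ tendsto_const \<Phi>(2)])
  show "\<forall>\<^sub>F j in sequentially. nrm (\<lambda>x. \<bar>\<Phi> j x\<bar> - indicat_real A x) \<le> dst (\<Phi> j) (indicat_real A)"
  proof (intro always_eventually allI)
   fix j
   have "nrm (\<lambda>x. \<bar>\<Phi> j x\<bar> - indicat_real A x) \<le> 1 * dst (\<Phi> j) (indicat_real A)"
   proof (rule L2_dominated(2)[OF L2_diff[OF L\<Phi>(1) L1] L2_measurable[OF L2_diff[OF L\<Phi>(2) L1]]])
    show "AE x in \<mu>. norm (\<bar>\<Phi> j x\<bar> - indicat_real A x) \<le> 1 * norm (\<Phi> j x - indicat_real A x)"
     by (intro AE_I2) (auto simp: indicator_def)
   qed simp
   then show "nrm (\<lambda>x. \<bar>\<Phi> j x\<bar> - indicat_real A x) \<le> dst (\<Phi> j) (indicat_real A)" by simp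
  qed
 qed auto
 have "ip U f (indicat_real A) \<le> C * ip U (indicat_real A) (\<lambda>x. 1)"
 proof (rule LIMSEQ_le)
  show "(\<lambda>j. ip U f (\<Phi> j)) \<longlonglongrightarrow> ip U f (indicat_real A)" by (intro tendsto_ip_right L\<Phi> L1 f \<Phi>(2))
  show "(\<lambda>j. C * ip U (\<lambda>x. \<bar>\<Phi> j x\<bar>) (\<lambda>x. 1)) \<longlonglongrightarrow> C * ip U (indicat_real A) (\<lambda>x. 1)"
   by (intro tendsto_mult_left tendsto_ip_left L\<Phi> L1 L2_const abs_lim)
  have "(LINT x|lborel. \<bar>\<Phi> j x\<bar>) = ip U (\<lambda>x. \<bar>\<Phi> j x\<bar>) (\<lambda>x. 1)" for j
   using integral_abs_test_fun[OF \<Phi>(1)] by (simp add: ip_def)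
  then show "\<exists>N. \<forall>j\<ge>N. ip U f (\<Phi> j) \<le> C * ip U (\<lambda>x. \<bar>\<Phi> j x\<bar>) (\<lambda>x. 1)" using bd[OF \<Phi>(1)] by (simp add: ip_def)
 qed
 then have "ip U (\<lambda>x. f x - C) (indicat_real A) \<le> 0"
  using f L1 L2_const[of C] by (simp add: ip_diff_left) (simp add: ip_def mult.commute)
 moreover have "0 \<le> ip U (\<lambda>x. f x - C) (indicat_real A)"
  unfolding ip_def by (rule integral_nonneg_AE) (auto simp: A_def indicator_def)
 ultimately have "ip U (\<lambda>x. f x - C) (indicat_real A) = 0" by simp
 moreover have "AE x in \<mu>. 0 \<le> (f x - C) \<bullet> indicat_real A x" by (intro AE_I2) (auto simp: A_def indicator_def)
 ultimately have "AE x in \<mu>. (f x - C) \<bullet> indicat_real A x = 0"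
  using integral_nonneg_eq_0_iff_AE[OF L2_integrable_inner[OF L2_diff[OF f L2_const[of C]] L1]]
  by (simp add: ip_def)
 then show ?thesis using AE_space by eventually_elim (auto simp: A_def indicator_def split: if_splits)
qed

end

context bounded_open
begin

lemma L1_le_L2:
 assumes "L2 U (g :: real^2 \<Rightarrow> real)"
 shows "(LINT x|\<mu>. \<bar>g x\<bar>) \<le> nrm (\<lambda>x. 1::real) * nrm g"
 using ip_Cauchy_Schwarz[OF L2_const[of "1::real"] L2_norm[OF assms]] L2_norm_norm[of U g] by (simp add: ip_def)

text \<open>Since \<open>f\<close> is only integrable, it cannot be approximated by test functions
  in norm. The bounded cutoffs \<open>r k\<close> can, and the sine truncation keeps the
  approximations bounded, so dominated convergence applies against \<open>f\<close>. The resulting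
  bound on all \<open>r k\<close> passes to \<open>f\<close> by monotone convergence.\<close>

lemma L2_by_duality:
 fixes f :: "real^2 \<Rightarrow> real"
 assumes f: "integrable \<mu> f" and C: "C \<ge> 0"
  and bd: "\<And>\<phi>. test_fun U \<phi> \<Longrightarrow> \<bar>LINT x|\<mu>. f x * \<phi> x\<bar> \<le> C * nrm \<phi>"
 shows "L2 U f"
proof -
 note [measurable] = borel_measurable_integrable[OF f]
 \<comment> \<open>Large values are set to 0 instead of being clamped, so that
   \<open>f x * r k x\<close> is the square of \<open>r k x\<close>.\<close>
 define r where "r k x = (if \<bar>f x\<bar> \<le> real k then f x else 0)" for k x
 have mr [measurable]: "r k \<in> borel_measurable \<mu>" for k unfolding r_def by measurable
 have r_le: "\<bar>r k x\<bar> \<le> real k" for k x by (simp add: r_def)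
 have Lr: "L2 U (r k)" for k by (rule L2_bounded[where C = "real k"]) (use r_le in auto)
 have bd_trunc: "\<bar>LINT x|\<mu>. f x * (K * sin (r k x / K))\<bar> \<le> C * nrm (r k)"
  if K: "K > 0" for K k
 proof -
  obtain \<Phi> where \<Phi>: "\<And>j::nat. test_fun U (\<Phi> j)" "L2_lim U \<Phi> (r k)" using test_fun_dense_seq[OF Lr] by blast
  obtain \<sigma> where \<sigma>: "strict_mono \<sigma>" "AE x in \<mu>. (\<lambda>j. \<Phi> (\<sigma> j) x) \<longlonglongrightarrow> r k x"
   using L2_AE_subseq[OF L2_test_fun[OF \<Phi>(1)] Lr \<Phi>(2)] by blast
  note m [measurable] = L2_measurable[OF L2_test_fun[OF \<Phi>(1)]]
  have t: "test_fun U (\<lambda>x. K * sin (\<Phi> j x / K))" for j using test_fun_compose[OF \<Phi>(1) smooth_trunc(1)[OF K]] by simp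
  have "(\<lambda>j. LINT x|\<mu>. f x * (K * sin (\<Phi> (\<sigma> j) x / K))) \<longlonglongrightarrow>
    (LINT x|\<mu>. f x * (K * sin (r k x / K)))"
  proof (rule integral_dominated_convergence[where w = "\<lambda>x. K * \<bar>f x\<bar>"])
   show "AE x in \<mu>. (\<lambda>j. f x * (K * sin (\<Phi> (\<sigma> j) x / K))) \<longlonglongrightarrow> f x * (K * sin (r k x / K))"
    using \<sigma>(2) by eventually_elim (use K in \<open>auto intro!: tendsto_intros\<close>)
   show "AE x in \<mu>. norm (f x * (K * sin (\<Phi> (\<sigma> j) x / K))) \<le> K * \<bar>f x\<bar>" for j
    using trunc_bounds(1)[OF K] by (intro AE_I2) (simp only: real_norm_def abs_mult[of "f _"] mult.commute[of K "\<bar>f _\<bar>"] mult_left_mono abs_ge_zero)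
  qed (use f in auto)
  moreover have "(\<lambda>j. C * nrm (\<Phi> (\<sigma> j))) \<longlonglongrightarrow> C * nrm (r k)"
   using LIMSEQ_subseq_LIMSEQ[OF tendsto_L2_norm[OF L2_test_fun[OF \<Phi>(1)] Lr \<Phi>(2)] \<sigma>(1)]
   by (intro tendsto_mult_left) (simp add: o_def)
  moreover have "\<bar>LINT x|\<mu>. f x * (K * sin (\<Phi> j x / K))\<bar> \<le> C * nrm (\<Phi> j)" for j
  proof -
   have "nrm (\<lambda>x. K * sin (\<Phi> j x / K)) \<le> 1 * nrm (\<Phi> j)"
    by (rule L2_dominated(2)[OF L2_test_fun[OF \<Phi>(1)] L2_measurable[OF L2_test_fun[OF t]]])
      (use trunc_bounds(2)[OF K] in auto)
   then have "C * nrm (\<lambda>x. K * sin (\<Phi> j x / K)) \<le> C * nrm (\<Phi> j)" using C by (intro mult_left_mono) auto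
   with bd[OF t[of j]] show ?thesis by simp
  qed
  ultimately show ?thesis by (intro LIMSEQ_le[OF tendsto_rabs]) auto
 qed
 have norm_r: "nrm (r k) \<le> C" for k
 proof -
  have "(\<lambda>n. LINT x|\<mu>. f x * (real (Suc n) * sin (r k x / real (Suc n)))) \<longlonglongrightarrow> (LINT x|\<mu>. f x * r k x)"
  proof (rule integral_dominated_convergence[where w = "\<lambda>x. real k * \<bar>f x\<bar>"])
   show "AE x in \<mu>. (\<lambda>n. f x * (real (Suc n) * sin (r k x / real (Suc n)))) \<longlonglongrightarrow> f x * r k x"
    by (intro AE_I2 tendsto_mult_left trunc_tendsto)
   show "AE x in \<mu>. norm (f x * (real (Suc n) * sin (r k x / real (Suc n)))) \<le> real k * \<bar>f x\<bar>" for n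
   proof (rule AE_I2)
    fix x
    have "\<bar>real (Suc n) * sin (r k x / real (Suc n))\<bar> \<le> real k"
     by (rule order_trans[OF trunc_bounds(2) r_le]) simp
    then show "norm (f x * (real (Suc n) * sin (r k x / real (Suc n)))) \<le> real k * \<bar>f x\<bar>"
     by (simp only: real_norm_def abs_mult[of "f x"] mult.commute[of "real k"] mult_left_mono abs_ge_zero)
   qed
  qed (use f in auto)
  then have "\<bar>LINT x|\<mu>. f x * r k x\<bar> \<le> C * nrm (r k)"
   by (intro LIMSEQ_le_const2[OF tendsto_rabs]) (use bd_trunc in auto)
  moreover have "(LINT x|\<mu>. f x * r k x) = (nrm (r k))\<^sup>2"
   unfolding L2_norm_sq ip_def by (intro Bochner_Integration.integral_cong) (auto simp: r_def)
  ultimately have "nrm (r k) * nrm (r k) \<le> C * nrm (r k)" by (simp add: power2_eq_square)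
  then show ?thesis using C L2_norm_nonneg[of U "r k"] by (cases "nrm (r k) = 0") (auto dest: mult_right_le_imp_le)
 qed
 have "(\<integral>\<^sup>+x. ennreal ((f x)\<^sup>2) \<partial>\<mu>) = (\<integral>\<^sup>+x. (SUP k. ennreal ((r k x)\<^sup>2)) \<partial>\<mu>)"
 proof (rule nn_integral_cong)
  fix x
  show "ennreal ((f x)\<^sup>2) = (SUP k. ennreal ((r k x)\<^sup>2))"
  proof (rule antisym)
   obtain k where "\<bar>f x\<bar> \<le> real k" using real_arch_simple by blast
   then have "ennreal ((f x)\<^sup>2) = ennreal ((r k x)\<^sup>2)" by (simp add: r_def)
   also have "\<dots> \<le> (SUP k. ennreal ((r k x)\<^sup>2))" by (rule SUP_upper) simp
   finally show "ennreal ((f x)\<^sup>2) \<le> (SUP k. ennreal ((r k x)\<^sup>2))" .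
   show "(SUP k. ennreal ((r k x)\<^sup>2)) \<le> ennreal ((f x)\<^sup>2)" by (rule SUP_least) (auto simp: r_def)
  qed
 qed
 also have "\<dots> = (SUP k. \<integral>\<^sup>+x. ennreal ((r k x)\<^sup>2) \<partial>\<mu>)" by (intro nn_integral_monotone_convergence_SUP)
    (auto simp: incseq_Suc_iff le_fun_def r_def)
 also have "\<dots> \<le> ennreal (C\<^sup>2)"
 proof (rule SUP_least)
  fix k
  have "(\<integral>\<^sup>+x. ennreal ((r k x)\<^sup>2) \<partial>\<mu>) = ennreal (LINT x|\<mu>. (r k x)\<^sup>2)"
   using L2_integrable_norm_sq[OF Lr] by (intro nn_integral_eq_integral) auto
  also have "(LINT x|\<mu>. (r k x)\<^sup>2) = (nrm (r k))\<^sup>2" by (simp only: L2_norm_sq) (simp add: ip_def power2_eq_square)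
  also have "\<dots> \<le> C\<^sup>2" using norm_r by (intro power_mono) auto
  finally show "(\<integral>\<^sup>+x. ennreal ((r k x)\<^sup>2) \<partial>\<mu>) \<le> ennreal (C\<^sup>2)" by (simp add: ennreal_leI)
 qed
 finally have "(\<integral>\<^sup>+x. ennreal (norm ((f x)\<^sup>2)) \<partial>\<mu>) < \<infinity>" by (simp add: order_le_less_trans)
 then have "integrable \<mu> (\<lambda>x. (f x)\<^sup>2)" by (intro integrableI_bounded) auto
 then show ?thesis by (simp add: L2_def)
qed

lemma has_dir_derivI:
 assumes f: "integrable \<mu> f" and g: "\<And>i. integrable \<mu> (g i)"
  and eq: "\<And>i \<phi>. test_fun U \<phi> \<Longrightarrow> (LINT x|\<mu>. f x * pd i \<phi> x) = - (LINT x|\<mu>. g i x * \<phi> x)"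
 shows "has_dir_deriv a f (\<lambda>x. a $ 1 * g 1 x + a $ 2 * g 2 x)" unfolding has_dir_deriv_def
proof (intro conjI allI impI f)
 show "integrable \<mu> (\<lambda>x. a $ 1 * g 1 x + a $ 2 * g 2 x)" using g by simp
 fix \<phi> :: "real^2 \<Rightarrow> real" assume \<phi>: "test_fun U \<phi>"
 have int: "integrable \<mu> (\<lambda>x. f x * pd i \<phi> x)" "integrable \<mu> (\<lambda>x. g i x * \<phi> x)" for i
  using integrable_mult_test[OF f test_fun_pd[OF \<phi>, of i], where c = 0] integrable_mult_test[OF g \<phi>, of i, where c = 0] by auto
 have "(LINT x|\<mu>. f x * frechet_derivative \<phi> (at x) a)
   = (LINT x|\<mu>. a $ 1 * (f x * pd 1 \<phi> x) + a $ 2 * (f x * pd 2 \<phi> x))"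
  by (simp add: frechet_derivative_pd[OF test_fun_differentiable[OF \<phi>]] sum_2 algebra_simps)
 also have "\<dots> = - (LINT x|\<mu>. a $ 1 * (g 1 x * \<phi> x) + a $ 2 * (g 2 x * \<phi> x))" using int by (simp add: eq[OF \<phi>])
 finally show "(LINT x|\<mu>. f x * frechet_derivative \<phi> (at x) a)
   = - (LINT x|\<mu>. (a $ 1 * g 1 x + a $ 2 * g 2 x) * \<phi> x)" by (simp add: algebra_simps)
qed

lemma has_dir_deriv_weak_pd:
 assumes "\<And>i. has_weak_pd U i f (g i)"
 shows "has_dir_deriv a f (\<lambda>x. a $ 1 * g 1 x + a $ 2 * g 2 x)" using has_weak_pd_ip[OF assms]
 by (intro has_dir_derivI L2_imp_integrable has_weak_pd_L2[OF assms]) (auto simp: ip_def)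

end

text \<open>Corners are required at interior points as well: compactness of the closure then yields
  a finite cover of the whole domain, and local estimates add up.\<close>

locale lipschitz_open = bounded_open +
 assumes corners: "\<And>x. x \<in> closure U \<Longrightarrow> \<exists>N a b. x \<in> N \<and> corner N a b"

lemma planar_expansion:
 fixes e1 e2 v :: "real^2"
 assumes e: "norm e1 = 1" "norm e2 = 1" "e1 \<bullet> e2 = 0"
 shows "cross_vv e1 e2 \<noteq> 0" "v = (v \<bullet> e1) *\<^sub>R e1 + (v \<bullet> e2) *\<^sub>R e2"
proof -
 have n: "e1 \<bullet> e1 = 1" "e2 \<bullet> e2 = 1" using e by (simp_all add: dot_square_norm)
 have "(cross_vv e1 e2)\<^sup>2 = (e1 \<bullet> e1) * (e2 \<bullet> e2) - (e1 \<bullet> e2)\<^sup>2"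
  by (simp add: cross_vv_def inner_vec_def sum_2 power2_eq_square algebra_simps)
 then show X: "cross_vv e1 e2 \<noteq> 0" using n e by auto
 define w where "w = v - ((v \<bullet> e1) *\<^sub>R e1 + (v \<bullet> e2) *\<^sub>R e2)"
 have "w \<bullet> e1 = 0" "w \<bullet> e2 = 0" using n e by (simp_all add: w_def inner_simps inner_commute[of e2 e1])
 moreover have "cross_vv e1 e2 * w $ 1 = e2 $ 2 * (w \<bullet> e1) - e1 $ 2 * (w \<bullet> e2)"
  "cross_vv e1 e2 * w $ 2 = e1 $ 1 * (w \<bullet> e2) - e2 $ 1 * (w \<bullet> e1)"
  by (simp_all add: cross_vv_def inner_vec_def sum_2 algebra_simps)
 ultimately have "w = 0" using X by (simp add: vec_eq_iff forall_2)
 then show "v = (v \<bullet> e1) *\<^sub>R e1 + (v \<bullet> e2) *\<^sub>R e2" by (simp add: w_def)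
qed

text \<open>In a boundary chart both edges of the parallelogram point below the graph, more steeply
  than the graph can fall. A combination of them lowers a point by \<open>d * (s + t)\<close> and
  moves it sideways by at most \<open>d * k * (s + t)\<close>, over which the graph drops by no more
  than the point did.\<close>

proposition lipschitz_domain_imp_lipschitz_open:
 assumes "lipschitz_domain U"
 shows "lipschitz_open U"
proof -
 interpret bounded_open U using assms by unfold_locales (auto simp: lipschitz_domain_def)
 have chart: "\<exists>e1 e2 r h L g.
    norm e1 = 1 \<and> norm e2 = 1 \<and> e1 \<bullet> e2 = 0 \<and> 0 < r \<and> 0 < h \<and>
    L-lipschitz_on {-r<..<r} g \<and>
    (\<forall>a b. \<bar>a\<bar> < r \<and> \<bar>b\<bar> < h \<longrightarrow> (x0 + a *\<^sub>R e1 + b *\<^sub>R e2 \<in> U \<longleftrightarrow> b < g a))" if "x0 \<in> frontier U" for x0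
  using assms that unfolding lipschitz_domain_def by blast
 show ?thesis
 proof (unfold_locales)
  fix x0 assume x0: "x0 \<in> closure U"
  show "\<exists>N a b. x0 \<in> N \<and> corner N a b"
  proof (cases "x0 \<in> U")
   case True
   then obtain e where e: "e > 0" "ball x0 e \<subseteq> U" using open_dom unfolding open_contains_ball by auto
   let ?a = "(e / 4) *\<^sub>R axis 1 1 :: real^2" and ?b = "(e / 4) *\<^sub>R axis 2 1 :: real^2"
   have "corner (ball x0 (e / 2)) ?a ?b" unfolding corner_def
   proof (intro conjI ballI)
    show "cross_vv ?a ?b \<noteq> 0" using e by (simp add: cross_vv_def axis_def)
    fix x and s t :: real assume x: "x \<in> ball x0 (e / 2) \<inter> U" and st: "s \<in> {0..1}" "t \<in> {0..1}"
    have "norm (s *\<^sub>R ?a + t *\<^sub>R ?b) \<le> s * (e / 4) + t * (e / 4)"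
     using st e by (intro order_trans[OF norm_triangle_ineq]) auto
    also have "\<dots> \<le> 1 * (e / 4) + 1 * (e / 4)" using st e by (intro add_mono mult_right_mono) auto
    finally have "norm (s *\<^sub>R ?a + t *\<^sub>R ?b) \<le> e / 2" by simp
    moreover have "dist x0 (x + (s *\<^sub>R ?a + t *\<^sub>R ?b)) \<le> dist x0 x + norm (s *\<^sub>R ?a + t *\<^sub>R ?b)"
     using norm_triangle_ineq4[of "x0 - x" "s *\<^sub>R ?a + t *\<^sub>R ?b"] by (simp add: dist_norm diff_diff_eq)
    ultimately show "x + (s *\<^sub>R ?a + t *\<^sub>R ?b) \<in> U" using x e(2) by auto
   qed simp
   then show ?thesis using e by (intro exI[of _ "ball x0 (e / 2)"] exI) auto
  next
   case False
   then have "x0 \<in> frontier U" using x0 open_dom by (simp add: frontier_def interior_open)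
   from chart[OF this] obtain e1 e2 r h L g where
    e: "norm e1 = 1" "norm e2 = 1" "e1 \<bullet> e2 = 0" and rh: "0 < r" "0 < h" and
    g: "L-lipschitz_on {-r<..<r} g" and
    chart: "\<And>a b. \<bar>a\<bar> < r \<Longrightarrow> \<bar>b\<bar> < h \<Longrightarrow> (x0 + a *\<^sub>R e1 + b *\<^sub>R e2 \<in> U \<longleftrightarrow> b < g a)" by blast
   have L: "L \<ge> 0" using g by (rule lipschitz_on_nonneg)
   \<comment> \<open>Makes \<open>L * k\<close> at most 1, also for \<open>L = 0\<close>.\<close>
   define k where "k = 1 / (L + 1)"
   have k: "k > 0" "k \<le> 1" "L * k \<le> 1" using L by (auto simp: k_def field_simps)
   \<comment> \<open>Shifts have size at most \<open>2 * d\<close> in each chart direction, so a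
     point in the inner half of the chart stays inside the chart.\<close>
   define d where "d = min (r / 4) (h / 4)"
   have d: "d > 0" "d \<le> r / 4" "d \<le> h / 4" using rh by (auto simp: d_def)
   define N where "N = {x. \<bar>(x - x0) \<bullet> e1\<bar> < r / 2 \<and> \<bar>(x - x0) \<bullet> e2\<bar> < h / 2}"
   define a where "a = d *\<^sub>R (k *\<^sub>R e1 - e2)"
   define b where "b = d *\<^sub>R (- k *\<^sub>R e1 - e2)"
   have "corner N a b" unfolding corner_def
   proof (intro conjI ballI)
    show "open N" unfolding N_def by (intro open_Collect_conj open_Collect_less continuous_intros)
    have "cross_vv a b = - 2 * d\<^sup>2 * k * cross_vv e1 e2"
     by (simp add: cross_vv_def a_def b_def power2_eq_square algebra_simps)
    then show "cross_vv a b \<noteq> 0" using d k planar_expansion(1)[OF e] by simp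
    fix x and s t :: real assume x: "x \<in> N \<inter> U" and st: "s \<in> {0..1}" "t \<in> {0..1}"
    define \<alpha> where "\<alpha> = (x - x0) \<bullet> e1"
    define \<beta> where "\<beta> = (x - x0) \<bullet> e2"
    have x_eq: "x = x0 + \<alpha> *\<^sub>R e1 + \<beta> *\<^sub>R e2"
     using planar_expansion(2)[OF e, of "x - x0"] by (simp add: \<alpha>_def \<beta>_def algebra_simps)
    have ab: "\<bar>\<alpha>\<bar> < r / 2" "\<bar>\<beta>\<bar> < h / 2" using x by (auto simp: N_def \<alpha>_def \<beta>_def)
    have "\<beta> < g \<alpha>" using chart[of \<alpha> \<beta>] x ab rh by (simp add: x_eq[symmetric])
    define \<alpha>' where "\<alpha>' = \<alpha> + d * k * (s - t)"
    define \<beta>' where "\<beta>' = \<beta> - d * (s + t)"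
    have shift: "\<bar>d * k * (s - t)\<bar> \<le> d * k * (s + t)" using d k st by (auto simp: abs_mult)
    have "d * k * (s + t) \<le> d * 1 * 2" using d k st by (intro mult_mono) auto
    then have \<alpha>': "\<bar>\<alpha>'\<bar> < r" using shift ab d unfolding \<alpha>'_def by linarith
    have "0 \<le> d * (s + t)" "d * (s + t) \<le> d * 2" using d st by (auto intro!: mult_left_mono)
    then have \<beta>': "\<bar>\<beta>'\<bar> < h" using ab d unfolding \<beta>'_def by linarith
    have "dist (g \<alpha>) (g \<alpha>') \<le> L * dist \<alpha> \<alpha>'" by (rule lipschitz_onD[OF g]) (use ab rh \<alpha>' in auto)
    also have "dist \<alpha> \<alpha>' = \<bar>d * k * (s - t)\<bar>" by (simp add: dist_real_def \<alpha>'_def)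
    also have "L * \<bar>d * k * (s - t)\<bar> \<le> L * (d * k * (s + t))" using L shift by (intro mult_left_mono)
    also have "\<dots> = (L * k) * (d * (s + t))" by simp
    also have "\<dots> \<le> 1 * (d * (s + t))" using k d st by (intro mult_right_mono) auto
    finally have "g \<alpha> - g \<alpha>' \<le> d * (s + t)" by (simp add: dist_real_def)
    then have "\<beta>' < g \<alpha>'" using \<open>\<beta> < g \<alpha>\<close> by (simp add: \<beta>'_def)
    then have "x0 + \<alpha>' *\<^sub>R e1 + \<beta>' *\<^sub>R e2 \<in> U" using chart[OF \<alpha>' \<beta>'] by simp
    moreover have "x + (s *\<^sub>R a + t *\<^sub>R b) = x0 + \<alpha>' *\<^sub>R e1 + \<beta>' *\<^sub>R e2"
     by (simp add: x_eq \<alpha>'_def \<beta>'_def a_def b_def algebra_simps)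
    ultimately show "x + (s *\<^sub>R a + t *\<^sub>R b) \<in> U" by simp
   qed
   moreover have "x0 \<in> N" using rh by (simp add: N_def)
   ultimately show ?thesis by blast
  qed
 qed
qed

context lipschitz_open
begin

lemma finite_corners:
 obtains I where "finite I" "\<And>N a b. (N, a, b) \<in> I \<Longrightarrow> corner N a b" "U \<subseteq> (\<Union>(N, a, b)\<in>I. N)"
proof -
 obtain F where F: "\<And>x. x \<in> closure U \<Longrightarrow> x \<in> fst (F x) \<and> corner (fst (F x)) (fst (snd (F x))) (snd (snd (F x)))"
 proof -
  have "\<forall>x\<in>closure U. \<exists>p. x \<in> fst p \<and> corner (fst p) (fst (snd p)) (snd (snd p))" using corners by fastforce
  from bchoice[OF this] that show ?thesis by blast
 qed
 have "compact (closure U)" using bounded_dom by (simp add: compact_closure)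
 then obtain J where J: "J \<subseteq> closure U" "finite J" "closure U \<subseteq> (\<Union>x\<in>J. fst (F x))"
  by (rule compactE_image[of "closure U" "closure U" "\<lambda>x. fst (F x)"]) (use F in \<open>auto simp: corner_def\<close>)
 show ?thesis
 proof (rule that[of "F ` J"])
  show "finite (F ` J)" using J(2) by simp
  show "corner N a b" if mem: "(N, a, b) \<in> F ` J" for N a b
  proof -
   obtain x where "x \<in> J" "(N, a, b) = F x" using mem by (elim imageE)
   then show ?thesis using F[of x] J(1) by (metis fst_conv snd_conv subsetD)
  qed
  show "U \<subseteq> (\<Union>(N, a, b)\<in>F ` J. N)" using J(3) closure_subset by (fastforce simp: case_prod_beta')
 qed
qed

text \<open>Made for products of two square integrable fields, which are a priori only integrable.
  Near each corner the integral of \<open>\<bar>\<phi>\<bar>\<close> in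
  \<open>pairing_bound_L2\<close> is bounded by the norm of \<open>\<phi>\<close>, because the
  domain is bounded; duality gives local square integrability, and finitely many corners
  suffice.\<close>

proposition L2_of_L2_gradient:
 fixes f :: "real^2 \<Rightarrow> real"
 assumes f: "integrable \<mu> f" and g: "\<And>i. L2 U (g i)"
  and eq: "\<And>i \<phi>. test_fun U \<phi> \<Longrightarrow> (LINT x|\<mu>. f x * pd i \<phi> x) = - (LINT x|\<mu>. g i x * \<phi> x)"
 shows "has_weak_pd U i f (g i)"
proof -
 have dir: "has_dir_deriv a f (\<lambda>x. a $ 1 * g 1 x + a $ 2 * g 2 x)" "L2 U (\<lambda>x. a $ 1 * g 1 x + a $ 2 * g 2 x)" for a
  by (rule has_dir_derivI[OF f L2_imp_integrable[OF g] eq], simp) (intro L2_add L2_mult g)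
 have local: "L2 (N \<inter> U) f" if c: "corner N a b" for N a b
 proof -
  have N: "open N" using c by (simp add: corner_def)
  interpret V: bounded_open "N \<inter> U" using N open_dom bounded_dom by unfold_locales (auto intro: bounded_subset)
  obtain C where C: "C > 0"
   "\<And>f fa fb \<phi>. has_dir_deriv a f fa \<Longrightarrow> has_dir_deriv b f fb \<Longrightarrow> L2 U fa \<Longrightarrow> L2 U fb \<Longrightarrow>
    test_fun (N \<inter> U) \<phi> \<Longrightarrow>
    \<bar>LINT x|\<mu>. f x * \<phi> x\<bar> \<le>
     C * (LINT x|\<mu>. \<bar>f x\<bar>) * (LINT x|lborel. \<bar>\<phi> x\<bar>)
     + (nrm fa + nrm fb) * nrm \<phi>" using pairing_bound_L2[OF c] by blast
  define B where "B = C * (LINT x|\<mu>. \<bar>f x\<bar>) * nrm (\<lambda>x. 1::real)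
   + (nrm (\<lambda>x. a $ 1 * g 1 x + a $ 2 * g 2 x) + nrm (\<lambda>x. b $ 1 * g 1 x + b $ 2 * g 2 x))"
  show ?thesis
  proof (rule V.L2_by_duality)
   have eqr: "restrict_space \<mu> (N \<inter> U) = lebesgue_on (N \<inter> U)" by (simp add: restrict_restrict_space Int_ac)
   have "integrable \<mu> (\<lambda>x. indicator (N \<inter> U) x *\<^sub>R f x)"
    by (intro integrable_mult_indicator f) (auto simp: sets_restrict_space_iff)
   then have "integrable (restrict_space \<mu> (N \<inter> U)) f"
    by (subst integrable_restrict_space) (auto simp: sets_restrict_space_iff Int_ac)
   then show "integrable (lebesgue_on (N \<inter> U)) f" by (simp add: eqr)
   show "0 \<le> B" using C(1) by (simp add: B_def)
   fix \<phi> :: "real^2 \<Rightarrow> real" assume \<phi>: "test_fun (N \<inter> U) \<phi>"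
   have \<phi>U: "test_fun U \<phi>" by (rule test_fun_subset[OF \<phi>]) auto
   have n: "nrm \<phi> = L2_norm (N \<inter> U) \<phi>"
    using integral_test_subset[OF V.dom_sets _ \<phi>, of \<phi>] by (simp add: L2_norm_def power2_eq_square)
   have "\<bar>LINT x|\<mu>. f x * \<phi> x\<bar> \<le> C * (LINT x|\<mu>. \<bar>f x\<bar>) * (LINT x|lborel. \<bar>\<phi> x\<bar>)
     + (nrm (\<lambda>x. a $ 1 * g 1 x + a $ 2 * g 2 x) + nrm (\<lambda>x. b $ 1 * g 1 x + b $ 2 * g 2 x)) * nrm \<phi>"
    by (rule C(2)[OF dir(1) dir(1) dir(2) dir(2) \<phi>])
   also have "\<dots> \<le> C * (LINT x|\<mu>. \<bar>f x\<bar>) * (nrm (\<lambda>x. 1::real) * nrm \<phi>)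
     + (nrm (\<lambda>x. a $ 1 * g 1 x + a $ 2 * g 2 x) + nrm (\<lambda>x. b $ 1 * g 1 x + b $ 2 * g 2 x)) * nrm \<phi>"
    using C(1) L1_le_L2[OF L2_test_fun[OF \<phi>U]]
    by (intro add_right_mono mult_left_mono) (auto simp: integral_abs_test_fun[OF \<phi>U])
   also have "\<dots> = B * L2_norm (N \<inter> U) \<phi>" by (simp add: B_def n algebra_simps)
   finally show "\<bar>LINT x|lebesgue_on (N \<inter> U). f x * \<phi> x\<bar> \<le> B * L2_norm (N \<inter> U) \<phi>"
    using integral_test_subset[OF V.dom_sets _ \<phi>, of f] by simp
  qed
 qed
 obtain I where I: "finite I" "\<And>N a b. (N, a, b) \<in> I \<Longrightarrow> corner N a b" "U \<subseteq> (\<Union>(N, a, b)\<in>I. N)"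
  using finite_corners by blast
 have "L2 U f" unfolding L2_def
 proof
  note m [measurable] = borel_measurable_integrable[OF f]
  show "f \<in> borel_measurable \<mu>" by (rule m)
  have fin: "(\<integral>\<^sup>+x. ennreal ((norm (f x))\<^sup>2) * indicator (fst p) x \<partial>\<mu>) < \<infinity>" if "p \<in> I" for p
  proof -
   obtain N a b where p: "p = (N, a, b)" by (cases p)
   then have "corner N a b" using I(2) that by simp
   then have N: "open N" "L2 (N \<inter> U) f" using local by (simp add: corner_def, blast)
   have eqr: "restrict_space \<mu> (N \<inter> U) = lebesgue_on (N \<inter> U)"
    using N(1) open_dom by (simp add: restrict_restrict_space Int_ac)
   have "(\<integral>\<^sup>+x. ennreal ((norm (f x))\<^sup>2) * indicator (fst p) x \<partial>\<mu>)
     = (\<integral>\<^sup>+x. ennreal ((norm (f x))\<^sup>2) * indicator (N \<inter> U) x \<partial>\<mu>)"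
    by (intro nn_integral_cong) (auto simp: p indicator_def)
   also have "\<dots> = (\<integral>\<^sup>+x. ennreal ((norm (f x))\<^sup>2) \<partial>restrict_space \<mu> (N \<inter> U))"
    using N open_dom by (intro nn_integral_restrict_space[symmetric]) (auto simp: sets_restrict_space_iff Int_ac)
   also have "\<dots> < \<infinity>" using L2_integrable_norm_sq[OF N(2)] by (simp add: eqr integrable_iff_bounded)
   finally show ?thesis .
  qed
  have "(\<integral>\<^sup>+x. ennreal ((norm (f x))\<^sup>2) \<partial>\<mu>) \<le> (\<integral>\<^sup>+x. (\<Sum>p\<in>I. ennreal ((norm (f x))\<^sup>2) * indicator (fst p) x) \<partial>\<mu>)"
  proof (rule nn_integral_mono)
   fix x assume "x \<in> space \<mu>"
   then obtain p where p: "p \<in> I" "x \<in> fst p" using I(3) by (auto simp: case_prod_beta')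
   then have "ennreal ((norm (f x))\<^sup>2) = ennreal ((norm (f x))\<^sup>2) * indicator (fst p) x" by simp
   also have "\<dots> \<le> (\<Sum>p\<in>I. ennreal ((norm (f x))\<^sup>2) * indicator (fst p) x)"
    using p I(1) by (intro member_le_sum) auto
   finally show "ennreal ((norm (f x))\<^sup>2) \<le> (\<Sum>p\<in>I. ennreal ((norm (f x))\<^sup>2) * indicator (fst p) x)" .
  qed
  also have "\<dots> = (\<Sum>p\<in>I. \<integral>\<^sup>+x. ennreal ((norm (f x))\<^sup>2) * indicator (fst p) x \<partial>\<mu>)"
  proof (rule nn_integral_sum)
   fix p assume "p \<in> I"
   then have "open (fst p)" using I(2) by (cases p) (auto simp: corner_def)
   then have "fst p \<inter> U \<in> sets \<mu>" using open_dom by (auto simp: sets_restrict_space_iff)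
   then have "(\<lambda>x. ennreal ((norm (f x))\<^sup>2) * indicator (fst p \<inter> U) x) \<in> borel_measurable \<mu>" by measurable
   then show "(\<lambda>x. ennreal ((norm (f x))\<^sup>2) * indicator (fst p) x) \<in> borel_measurable \<mu>"
    by (rule measurable_cong[THEN iffD1, rotated]) (auto simp: indicator_def)
  qed
  also have "\<dots> < \<infinity>" using fin I(1) by (simp add: less_top)
  finally show "integrable \<mu> (\<lambda>x. (norm (f x))\<^sup>2)" by (intro integrableI_bounded) auto
 qed
 then show ?thesis unfolding has_weak_pd_def using g eq by (simp add: mult.commute)
qed

text \<open>The planar embedding of second order Sobolev functions into bounded functions.
  Derivatives are passed as arbitrary representatives \<open>g\<close>, \<open>h\<close>, so that
  derivatives given by an equation can be inserted.\<close>

proposition Linf_embedding: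
 obtains C where "C > 0"
  "\<And>f g h M. (\<And>i. has_weak_pd U i f (g i)) \<Longrightarrow> (\<And>i j. has_weak_pd U j (g i) (h i j)) \<Longrightarrow>
    nrm f \<le> M \<Longrightarrow> (\<And>i. nrm (g i) \<le> M) \<Longrightarrow> (\<And>i j. nrm (h i j) \<le> M) \<Longrightarrow>
    AE x in \<mu>. \<bar>f x :: real\<bar> \<le> C * M"
proof -
 define K where "K = nrm (\<lambda>x. 1::real)"
 have K: "K \<ge> 0" by (simp add: K_def)
 let ?P = "\<lambda>N C. \<forall>f g h M. (\<forall>i. has_weak_pd U i f (g i)) \<longrightarrow> (\<forall>i j. has_weak_pd U j (g i) (h i j)) \<longrightarrow>
    nrm f \<le> M \<longrightarrow> (\<forall>i. nrm (g i) \<le> M) \<longrightarrow> (\<forall>i j. nrm (h i j) \<le> M) \<longrightarrow>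
    (AE x in \<mu>. x \<in> N \<longrightarrow> \<bar>f x :: real\<bar> \<le> C * M)"
 have local: "\<exists>C\<ge>0. ?P N C" if c: "corner N a b" for N a b
 proof -
  have N: "open N" using c by (simp add: corner_def)
  interpret V: bounded_open "N \<inter> U" using N open_dom bounded_dom by unfold_locales (auto intro: bounded_subset)
  obtain C where C: "C > 0"
   "\<And>f fa fb fab \<phi>. has_dir_deriv a f fa \<Longrightarrow> has_dir_deriv b f fb \<Longrightarrow> has_dir_deriv b fa fab \<Longrightarrow>
    test_fun (N \<inter> U) \<phi> \<Longrightarrow>
    \<bar>LINT x|\<mu>. f x * \<phi> x\<bar> \<le>
     C * (LINT x|\<mu>. \<bar>f x\<bar> + \<bar>fb x\<bar> + \<bar>fa x\<bar> + \<bar>fab x\<bar>) * (LINT x|lborel. \<bar>\<phi> x\<bar>)"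
   using pairing_bound_Linf[OF c] by blast
  define A where "A = \<bar>a $ 1\<bar> + \<bar>a $ 2\<bar>"
  define B where "B = \<bar>b $ 1\<bar> + \<bar>b $ 2\<bar>"
  have AB: "A \<ge> 0" "B \<ge> 0" by (auto simp: A_def B_def)
  \<comment> \<open>The four summands belong to \<open>f\<close>, \<open>fb\<close>,
    \<open>fa\<close> and \<open>fab\<close>; \<open>A\<close> and \<open>B\<close> are the
    coefficient sums of the directional derivatives, and \<open>K\<close> bounds integrals by
    norms.\<close>
  define D where "D = C * (K * (1 + B + A + B * A))"
  have "?P N D"
  proof (intro allI impI)
   fix f :: "real^2 \<Rightarrow> real" and g :: "2 \<Rightarrow> real^2 \<Rightarrow> real" and h :: "2 \<Rightarrow> 2 \<Rightarrow> real^2 \<Rightarrow> real" and M :: real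
   assume g: "\<forall>i. has_weak_pd U i f (g i)" and h: "\<forall>i j. has_weak_pd U j (g i) (h i j)"
    and M: "nrm f \<le> M" "\<forall>i. nrm (g i) \<le> M" "\<forall>i j. nrm (h i j) \<le> M"
   define fa where "fa x = a $ 1 * g 1 x + a $ 2 * g 2 x" for x
   define fb where "fb x = b $ 1 * g 1 x + b $ 2 * g 2 x" for x
   define ha where "ha j x = a $ 1 * h 1 j x + a $ 2 * h 2 j x" for j x
   define fab where "fab x = b $ 1 * ha 1 x + b $ 2 * ha 2 x" for x
   have comb: "nrm (\<lambda>x. c $ 1 * p x + c $ 2 * q x) \<le> (\<bar>c $ 1\<bar> + \<bar>c $ 2\<bar>) * m"
    if "L2 U p" "L2 U q" "nrm p \<le> m" "nrm q \<le> m" for c :: "real^2" and p q m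
   proof -
    have "nrm (\<lambda>x. c $ 1 * p x + c $ 2 * q x) \<le> \<bar>c $ 1\<bar> * nrm p + \<bar>c $ 2\<bar> * nrm q"
     using L2_norm_triangle[OF L2_mult[OF that(1)] L2_mult[OF that(2)]] by (simp add: L2_norm_mult)
    also have "\<dots> \<le> \<bar>c $ 1\<bar> * m + \<bar>c $ 2\<bar> * m" using that by (intro add_mono mult_left_mono) auto
    finally show ?thesis by (simp add: distrib_right)
   qed
   have L: "L2 U f" "L2 U (g i)" "L2 U (h i j)" for i j
    using has_weak_pd_L2[of i f "g i"] has_weak_pd_L2[of j "g i" "h i j"] g h by auto
   have Lc: "L2 U fa" "L2 U fb" "L2 U (ha j)" "L2 U fab" for j
    unfolding fa_def[abs_def] fb_def[abs_def] fab_def[abs_def] ha_def[abs_def] by (intro L2_add L2_mult L)+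
   have na: "nrm fa \<le> A * M" "nrm fb \<le> B * M" "nrm (ha j) \<le> A * M" "nrm fab \<le> B * (A * M)" for j
   proof -
    show "nrm fa \<le> A * M" "nrm fb \<le> B * M"
     unfolding fa_def[abs_def] fb_def[abs_def] A_def B_def using M by (auto intro!: comb L)
    show ha: "nrm (ha j) \<le> A * M" for j unfolding ha_def[abs_def] A_def using M by (auto intro!: comb L)
    show "nrm fab \<le> B * (A * M)" unfolding fab_def[abs_def] B_def by (intro comb Lc ha)
   qed
   have dir: "has_dir_deriv a f fa" "has_dir_deriv b f fb" "has_dir_deriv b fa fab"
   proof -
    show "has_dir_deriv a f fa" "has_dir_deriv b f fb"
     unfolding fa_def[abs_def] fb_def[abs_def] using g by (auto intro!: has_dir_deriv_weak_pd)
    have "has_weak_pd U j fa (ha j)" for j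
     unfolding fa_def[abs_def] ha_def[abs_def] using h by (intro has_weak_pd_add has_weak_pd_mult) auto
    then show "has_dir_deriv b fa fab" unfolding fab_def[abs_def] by (rule has_dir_deriv_weak_pd)
   qed
   have intG: "(LINT x|\<mu>. \<bar>f x\<bar> + \<bar>fb x\<bar> + \<bar>fa x\<bar> + \<bar>fab x\<bar>) \<le> K * (1 + B + A + B * A) * M"
   proof -
    have "(LINT x|\<mu>. \<bar>f x\<bar> + \<bar>fb x\<bar> + \<bar>fa x\<bar> + \<bar>fab x\<bar>)
     = (LINT x|\<mu>. \<bar>f x\<bar>) + (LINT x|\<mu>. \<bar>fb x\<bar>) + (LINT x|\<mu>. \<bar>fa x\<bar>) + (LINT x|\<mu>. \<bar>fab x\<bar>)"
     using L(1) Lc by (simp add: L2_imp_integrable)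
    also have "\<dots> \<le> K * nrm f + K * nrm fb + K * nrm fa + K * nrm fab"
     unfolding K_def by (intro add_mono L1_le_L2 L Lc)
    also have "\<dots> \<le> K * M + K * (B * M) + K * (A * M) + K * (B * (A * M))"
     using K M na by (intro add_mono mult_left_mono) auto
    finally show ?thesis by (simp add: algebra_simps)
   qed
   have bd: "\<bar>LINT x|lebesgue_on (N \<inter> U). f x * \<phi> x\<bar> \<le> D * M * (LINT x|lborel. \<bar>\<phi> x\<bar>)"
    if \<phi>: "test_fun (N \<inter> U) \<phi>" for \<phi>
   proof -
    have "\<bar>LINT x|\<mu>. f x * \<phi> x\<bar> \<le>
      C * (LINT x|\<mu>. \<bar>f x\<bar> + \<bar>fb x\<bar> + \<bar>fa x\<bar> + \<bar>fab x\<bar>) * (LINT x|lborel. \<bar>\<phi> x\<bar>)" by (rule C(2)[OF dir \<phi>])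
    also have "\<dots> \<le> C * (K * (1 + B + A + B * A) * M) * (LINT x|lborel. \<bar>\<phi> x\<bar>)"
     using C(1) intG by (intro mult_right_mono mult_left_mono) auto
    finally show ?thesis using integral_test_subset[OF V.dom_sets _ \<phi>, of f] by (simp add: D_def mult_ac)
   qed
   have Lf: "L2 (N \<inter> U) f" by (rule L2_subset[OF L(1)]) auto
   have "AE x in lebesgue_on (N \<inter> U). f x \<le> D * M"
    using bd by (intro V.AE_le_by_duality[OF Lf]) (auto simp: abs_le_iff)
   moreover have "AE x in lebesgue_on (N \<inter> U). - f x \<le> D * M"
    using bd by (intro V.AE_le_by_duality[OF L2_minus[OF Lf]]) (auto simp: abs_le_iff)
   ultimately have "AE x in lebesgue_on (N \<inter> U). \<bar>f x\<bar> \<le> D * M" by eventually_elim (simp add: abs_le_iff)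
   then show "AE x in \<mu>. x \<in> N \<longrightarrow> \<bar>f x\<bar> \<le> D * M" by (simp add: AE_restrict_space_iff) (auto elim: eventually_mono)
  qed
  moreover have "D \<ge> 0" using C(1) K AB by (simp add: D_def)
  ultimately show ?thesis by blast
 qed
 obtain I where I: "finite I" "\<And>N a b. (N, a, b) \<in> I \<Longrightarrow> corner N a b" "U \<subseteq> (\<Union>(N, a, b)\<in>I. N)"
  using finite_corners by blast
 have "\<forall>p\<in>I. \<exists>C\<ge>0. ?P (fst p) C"
 proof
  fix p assume "p \<in> I"
  then have "corner (fst p) (fst (snd p)) (snd (snd p))" using I(2) by simp
  then show "\<exists>C\<ge>0. ?P (fst p) C" by (rule local)
 qed
 from bchoice[OF this] obtain c where c0: "\<forall>p\<in>I. c p \<ge> 0 \<and> ?P (fst p) (c p)" by (elim exE)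
 have c: "c p \<ge> 0" "?P (fst p) (c p)" if "p \<in> I" for p
  by (rule bspec[OF c0 that, THEN conjunct1], rule bspec[OF c0 that, THEN conjunct2])
 show ?thesis
 proof (rule that)
  have "(\<Sum>p\<in>I. c p) \<ge> 0" using c(1) by (rule sum_nonneg)
  then show "(\<Sum>p\<in>I. c p) + 1 > 0" by simp
  fix f :: "real^2 \<Rightarrow> real" and g :: "2 \<Rightarrow> real^2 \<Rightarrow> real" and h :: "2 \<Rightarrow> 2 \<Rightarrow> real^2 \<Rightarrow> real" and M :: real
  assume g: "\<And>i. has_weak_pd U i f (g i)" and h: "\<And>i j. has_weak_pd U j (g i) (h i j)"
    and M: "nrm f \<le> M" "\<And>i. nrm (g i) \<le> M" "\<And>i j. nrm (h i j) \<le> M"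
  have M0: "M \<ge> 0" using M(1) L2_norm_nonneg order_trans by blast
  have "AE x in \<mu>. \<forall>p\<in>I. x \<in> fst p \<longrightarrow> \<bar>f x\<bar> \<le> c p * M"
  proof (rule AE_finite_allI[OF I(1)])
   fix p assume "p \<in> I"
   from c(2)[OF this, rule_format, OF g h M]
   show "AE x in \<mu>. x \<in> fst p \<longrightarrow> \<bar>f x\<bar> \<le> c p * M" by simp
  qed
  then show "AE x in \<mu>. \<bar>f x\<bar> \<le> ((\<Sum>p\<in>I. c p) + 1) * M" using AE_space
  proof eventually_elim
   case (elim x)
   then obtain p where p: "p \<in> I" "x \<in> fst p" using I(3) by (auto simp: case_prod_beta')
   then have "\<bar>f x\<bar> \<le> c p * M" using elim by blast
   also have "\<dots> \<le> ((\<Sum>p\<in>I. c p) + 1) * M"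
    using member_le_sum[of p I c] p(1) c(1) I(1) M0 by (intro mult_right_mono) auto
   finally show ?case .
  qed
 qed
qed

end

section \<open>Weak time derivatives\<close>

text \<open>The derivative of \<open>step\<close> is a one-sided mollifier: supported in [0, 1] and,
  as \<open>step\<close> rises from 0 to 1, of total mass 1.\<close>

lemma step_derivative:
 obtains \<sigma> C where "\<And>x. (step has_real_derivative \<sigma> x) (at x)" "continuous_on UNIV \<sigma>" "C > 0"
  "\<And>x. \<bar>\<sigma> x\<bar> \<le> C" "\<And>x. x \<notin> {0..1} \<Longrightarrow> \<sigma> x = 0"
proof -
 have "Cr (Suc 0) step" using smooth_step unfolding smooth_def by blast
 then obtain \<sigma> where \<sigma>: "\<And>x. (step has_real_derivative \<sigma> x) (at x)" "continuous_on UNIV \<sigma>" by auto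
 have zero: "\<sigma> x = 0" if "x \<notin> {0..1}" for x
 proof -
  consider "x < 0" | "x > 1" using \<open>x \<notin> {0..1}\<close> by fastforce
  then show ?thesis
  proof cases
   case 1
   have "\<forall>\<^sub>F y in nhds x. step y = 0"
    using 1 eventually_nhds_in_open[of "{..<0}" x] by (auto elim!: eventually_mono simp: step_eq_0)
   then have "(step has_real_derivative 0) (at x)" using 1 by (subst DERIV_cong_ev[of x x step "\<lambda>_. 0" 0 0]) auto
   with \<sigma>(1) show ?thesis by (rule DERIV_unique)
  next
   case 2
   have "\<forall>\<^sub>F y in nhds x. step y = 1"
    using 2 eventually_nhds_in_open[of "{1<..}" x] by (auto elim!: eventually_mono simp: step_eq_1)
   then have "(step has_real_derivative 0) (at x)" using 2 by (subst DERIV_cong_ev[of x x step "\<lambda>_. 1" 0 0]) auto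
   with \<sigma>(1) show ?thesis by (rule DERIV_unique)
  qed
 qed
 have "bounded (\<sigma> ` {0..1})"
  by (intro compact_imp_bounded compact_continuous_image continuous_on_subset[OF \<sigma>(2)]) auto
 then obtain C where C: "C > 0" "\<And>x. x \<in> {0..1} \<Longrightarrow> \<bar>\<sigma> x\<bar> \<le> C" unfolding bounded_pos by auto
 have "\<bar>\<sigma> x\<bar> \<le> C" for x using C zero[of x] by (cases "x \<in> {0..1}") auto
 with \<sigma> C(1) zero that show ?thesis by blast
qed

lemma finite_measure_interval: "finite_measure (lebesgue_on {0<..<T::real})"
proof -
 have "bounded {0<..<T}" by (rule bounded_subset[OF bounded_closed_interval[of 0 T]]) auto
 from emeasure_bounded_finite[OF this] show ?thesis by (intro finite_measureI) (simp add: emeasure_restrict_space)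
qed

lemma indicator_measurable_lebesgue_on: "A \<in> sets lebesgue \<Longrightarrow> indicat_real A \<in> borel_measurable (lebesgue_on S)"
 by (intro measurable_restrict_space1) auto

text \<open>The kernels live on intervals of length \<open>1 / (n + 1)\<close> to the right of
  \<open>r\<close>; their mass is 1 by the fundamental theorem of calculus once the interval fits
  below \<open>T\<close>.\<close>

lemma approximate_identity:
 fixes F \<sigma> :: "real \<Rightarrow> real"
 assumes \<sigma>: "\<And>x. (step has_real_derivative \<sigma> x) (at x)" "continuous_on UNIV \<sigma>" "C > 0"
  "\<And>x. \<bar>\<sigma> x\<bar> \<le> C" "\<And>x. x \<notin> {0..1} \<Longrightarrow> \<sigma> x = 0"
  and F: "continuous_on {0..T} F" and r: "0 < r" "r < T"
 shows "\<And>n. integrable (lebesgue_on {0<..<T}) (\<lambda>s. real (Suc n) * \<sigma> (real (Suc n) * (s - r)) * F s)"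
  "(\<lambda>n. LINT s|lebesgue_on {0<..<T}. real (Suc n) * \<sigma> (real (Suc n) * (s - r)) * F s) \<longlonglongrightarrow> F r"
proof -
 let ?M = "lebesgue_on {0<..<T}"
 let ?k = "\<lambda>n s. real (Suc n) * \<sigma> (real (Suc n) * (s - r))"
 note fin = finite_measure_interval[of T]
 have meas: "f \<in> borel_measurable ?M" if "continuous_on {0..T} f" for f :: "real \<Rightarrow> real"
  by (rule continuous_imp_measurable_on_sets_lebesgue) (auto intro: continuous_on_subset[OF that])
 have int: "integrable ?M f" if c: "continuous_on {0..T} f" for f :: "real \<Rightarrow> real"
 proof -
  have "bounded (f ` {0..T})" by (intro compact_imp_bounded compact_continuous_image c) auto
  then obtain B where "\<forall>y\<in>f ` {0..T}. norm y \<le> B" unfolding bounded_iff by blast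
  then have B: "\<bar>f x\<bar> \<le> B" if "x \<in> {0..T}" for x using that by auto
  show ?thesis
  proof (rule Bochner_Integration.integrable_bound)
   show "integrable ?M (\<lambda>_. B)" by (rule finite_measure.integrable_const[OF fin])
   show "AE x in ?M. norm (f x) \<le> norm B"
   proof (rule AE_I2)
    fix x assume "x \<in> space ?M"
    then have "\<bar>f x\<bar> \<le> B" by (intro B) auto
    then show "norm (f x) \<le> norm B" by simp
   qed
  qed (rule meas[OF c])
 qed
 have ck: "continuous_on S (?k n)" for n S by (intro continuous_intros continuous_on_compose2[OF \<sigma>(2)]) auto
 show intk: "integrable ?M (\<lambda>s. ?k n s * F s)" for n by (intro int continuous_on_mult ck F)
 have k1: "(LINT s|?M. ?k n s) = 1" if n: "inverse (real (Suc n)) < T - r" for n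
 proof -
  have "(?k n has_integral step (real (Suc n) * (T - r)) - step (real (Suc n) * (0 - r))) {0..T}"
  proof (rule fundamental_theorem_of_calculus)
   show "0 \<le> T" using r by simp
   fix s
   have "((\<lambda>s. step (real (Suc n) * (s - r))) has_real_derivative \<sigma> (real (Suc n) * (s - r)) * real (Suc n)) (at s)"
    by (rule DERIV_chain2[OF \<sigma>(1)]) (auto intro!: derivative_eq_intros)
   then show "((\<lambda>s. step (real (Suc n) * (s - r))) has_vector_derivative ?k n s) (at s within {0..T})"
    by (auto simp: has_real_derivative_iff_has_vector_derivative mult.commute intro: has_vector_derivative_at_within)
  qed
  moreover have "step (real (Suc n) * (T - r)) = 1"
  proof (rule step_eq_1)
   have "real (Suc n) * inverse (real (Suc n)) \<le> real (Suc n) * (T - r)" using n by (intro mult_left_mono) auto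
   then show "1 \<le> real (Suc n) * (T - r)" by simp
  qed
  moreover have "step (real (Suc n) * (0 - r)) = 0" using r by (intro step_eq_0) (auto simp: mult_le_0_iff)
  ultimately have "(?k n has_integral 1 - 0) {0..T}" by (simp only:)
  then have "integral {0..T} (?k n) = 1" unfolding diff_zero by (rule integral_unique)
  moreover have "(LINT s|?M. ?k n s) = integral {0<..<T} (?k n)"
   by (rule lebesgue_integral_eq_integral[OF int[OF ck]]) auto
  ultimately show ?thesis by (simp only: integral_open_interval_real)
 qed
 show "(\<lambda>n. LINT s|?M. ?k n s * F s) \<longlonglongrightarrow> F r"
 proof (rule LIMSEQ_I)
  fix e :: real assume e: "e > 0"
  \<comment> \<open>The kernel is at most \<open>(n + 1) * C\<close> on an interval of length
    \<open>1 / (n + 1)\<close>, so an oscillation \<open>e'\<close> of \<open>F\<close> contributes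
    at most \<open>C * e'\<close>.\<close>
  define e' where "e' = e / (2 * C)"
  have e': "e' > 0" "C * e' < e" using e \<sigma>(3) by (auto simp: e'_def)
  obtain d where d: "d > 0" "\<And>s. s \<in> {0..T} \<Longrightarrow> \<bar>s - r\<bar> < d \<Longrightarrow> \<bar>F s - F r\<bar> < e'"
   using F r e'(1) unfolding continuous_on_iff dist_real_def by (metis atLeastAtMost_iff less_imp_le)
  have "(\<lambda>n. inverse (real (Suc n))) \<longlonglongrightarrow> 0" by (rule LIMSEQ_inverse_real_of_nat)
  from order_tendstoD(2)[OF this, of "min d (T - r)"] d r
  obtain n0 where n0: "\<And>n. n \<ge> n0 \<Longrightarrow> inverse (real (Suc n)) < min d (T - r)" by (auto simp: eventually_sequentially)
  show "\<exists>n0. \<forall>n\<ge>n0. norm ((LINT s|?M. ?k n s * F s) - F r) < e"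
  proof (intro exI[of _ n0] allI impI)
   fix n assume "n \<ge> n0"
   then have n: "inverse (real (Suc n)) < d" "inverse (real (Suc n)) < T - r" using n0 by auto
   let ?J = "{0<..<T} \<inter> {r..r + inverse (real (Suc n))}"
   have eq: "(LINT s|?M. ?k n s * F s) - F r = (LINT s|?M. ?k n s * F s - ?k n s * F r)"
    using k1[OF n(2)] intk[of n] int[OF ck, of n] by simp
   have "\<bar>(LINT s|?M. ?k n s * F s) - F r\<bar> \<le> (LINT s|?M. real (Suc n) * C * e' * indicator ?J s)" unfolding eq
   proof (rule order_trans[OF integral_abs_bound], rule integral_mono)
    show "integrable ?M (\<lambda>s. \<bar>?k n s * F s - ?k n s * F r\<bar>)" by (intro int continuous_intros ck F)
    show "integrable ?M (\<lambda>s. real (Suc n) * C * e' * indicator ?J s)"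
     using fin by (intro integrable_mult_right integrable_real_indicator)
      (auto simp: sets_restrict_space_iff finite_measure.emeasure_finite less_top[symmetric])
    fix s assume "s \<in> space ?M"
    then have s: "s \<in> {0..T}" by auto
    show "\<bar>?k n s * F s - ?k n s * F r\<bar> \<le> real (Suc n) * C * e' * indicator ?J s"
    proof (cases "s \<in> ?J")
     case True
     have "\<bar>?k n s * F s - ?k n s * F r\<bar> = \<bar>?k n s\<bar> * \<bar>F s - F r\<bar>"
      by (simp add: right_diff_distrib[symmetric] abs_mult)
     also have "\<dots> \<le> (real (Suc n) * C) * e'"
     proof (rule mult_mono)
      show "\<bar>?k n s\<bar> \<le> real (Suc n) * C" unfolding abs_mult using \<sigma>(4) by (intro mult_mono) auto
      show "\<bar>F s - F r\<bar> \<le> e'" using d(2)[OF s] True n by (intro less_imp_le) auto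
     qed (use \<sigma>(3) in auto)
     finally show ?thesis using True by simp
    next
     case False
     then have F: "s \<notin> {r..r + inverse (real (Suc n))}" using \<open>s \<in> space ?M\<close> by auto
     have "\<sigma> (real (Suc n) * (s - r)) = 0"
     proof (rule \<sigma>(5), rule)
      assume *: "real (Suc n) * (s - r) \<in> {0..1}"
      then have "s \<ge> r" by (simp add: zero_le_mult_iff)
      moreover have "s - r \<le> inverse (real (Suc n))"
       using * by (simp add: inverse_eq_divide pos_le_divide_eq mult.commute)
      ultimately show False using F by auto
     qed
     then show ?thesis using False by simp
    qed
   qed
   also have "\<dots> = real (Suc n) * C * e' * measure lebesgue ?J"
   proof -
    have "integral\<^sup>L ?M (indicat_real ?J) = measure ?M (?J \<inter> space ?M)" by (rule Bochner_Integration.integral_indicator)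
    also have "?J \<inter> space ?M = ?J" by auto
    also have "measure ?M ?J = measure lebesgue ?J" by (rule measure_restrict_space) auto
    finally show ?thesis by (simp only: integral_mult_right_zero)
   qed
   also have "\<dots> \<le> real (Suc n) * C * e' * inverse (real (Suc n))"
   proof (rule mult_left_mono)
    have "measure lebesgue ?J \<le> measure lebesgue {r..r + inverse (real (Suc n))}"
     by (intro measure_mono_fmeasurable) auto
    then show "measure lebesgue ?J \<le> inverse (real (Suc n))" by simp
   qed (use \<sigma>(3) e' in auto)
   also have "\<dots> = C * e'" by simp
   also have "\<dots> < e" by (rule e'(2))
   finally show "norm ((LINT s|?M. ?k n s * F s) - F r) < e" unfolding real_norm_def .
  qed
 qed
qed

text \<open>Tested with the difference of two steep steps, which tends to the indicator of the
  interval while its derivative tends to the difference of point masses at \<open>r\<close> and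
  \<open>t\<close>. Continuity of \<open>F\<close> gives the point values.\<close>

lemma weak_derivative_increment:
 fixes F G :: "real \<Rightarrow> real"
 assumes F: "continuous_on {0..T} F" and G: "integrable (lebesgue_on {0<..<T}) G"
  and eq: "\<And>\<theta>. time_test T \<theta> \<Longrightarrow>
   (LINT s|lebesgue_on {0<..<T}. deriv \<theta> s * F s) = - (LINT s|lebesgue_on {0<..<T}. \<theta> s * G s)"
  and rt: "0 < r" "r < t" "t < T"
 shows "F t - F r = (LINT s|lebesgue_on {0<..<T}. indicator {r<..t} s * G s)"
proof -
 let ?M = "lebesgue_on {0<..<T}"
 obtain \<sigma> C where \<sigma>: "\<And>x. (step has_real_derivative \<sigma> x) (at x)" "continuous_on UNIV \<sigma>" "C > 0"
  "\<And>x. \<bar>\<sigma> x\<bar> \<le> C" "\<And>x. x \<notin> {0..1} \<Longrightarrow> \<sigma> x = 0" using step_derivative by blast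
 let ?k = "\<lambda>n r s. real (Suc n) * \<sigma> (real (Suc n) * (s - r))"
 define \<theta> where "\<theta> n s = step (real (Suc n) * (s - r)) - step (real (Suc n) * (s - t))" for n s
 have sm: "smooth (\<theta> n)" for n unfolding \<theta>_def[abs_def]
  by (intro smooth_diff smooth_compose[OF smooth_step] smooth_mult smooth_const smooth_ident)
 have d\<theta>: "deriv (\<theta> n) s = ?k n r s - ?k n t s" for n s
 proof (rule DERIV_imp_deriv)
  have "((\<lambda>s. step (real (Suc n) * (s - r))) has_real_derivative \<sigma> (real (Suc n) * (s - r)) * real (Suc n)) (at s)" for r
   by (rule DERIV_chain2[OF \<sigma>(1)]) (auto intro!: derivative_eq_intros)
  from DERIV_diff[OF this[of r] this[of t]]
  show "(\<theta> n has_real_derivative ?k n r s - ?k n t s) (at s)" by (simp add: \<theta>_def[abs_def] mult.commute)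
 qed
 \<comment> \<open>Admissible only for large \<open>n\<close>: the second step must be completed
   before \<open>T\<close>.\<close>
 have test: "time_test T (\<theta> n)" if n: "inverse (real (Suc n)) < T - t" for n unfolding time_test_def
 proof
  show "\<forall>k s. (deriv ^^ k) (\<theta> n) field_differentiable (at s)" using smooth_higher_deriv[OF sm] by blast
  have zero: "\<theta> n s = 0" if "s \<notin> {r..t + inverse (real (Suc n))}" for s
  proof -
  from that consider "s < r" | "s > t + inverse (real (Suc n))" by fastforce
  then show "\<theta> n s = 0"
  proof cases
   case 1
   then have "real (Suc n) * (s - r) \<le> 0" "real (Suc n) * (s - t) \<le> 0" using rt by (auto simp: mult_le_0_iff)
   then show ?thesis by (simp add: \<theta>_def step_eq_0)
  next
   case 2
   have "1 \<le> real (Suc n) * (s - a)" if "a \<le> t" for a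
   proof -
    have "real (Suc n) * inverse (real (Suc n)) \<le> real (Suc n) * (s - a)"
     using 2 that by (intro mult_left_mono) auto
    then show ?thesis by simp
   qed
   then show ?thesis using rt by (simp add: \<theta>_def step_eq_1)
  qed
  qed
  show "\<exists>a b. 0 < a \<and> b < T \<and> (\<forall>s. s \<notin> {a..b} \<longrightarrow> \<theta> n s = 0)"
  proof (rule exI[of _ r], rule exI[of _ "t + inverse (real (Suc n))"], intro conjI allI impI)
   show "\<theta> n s = 0" if "s \<notin> {r..t + inverse (real (Suc n))}" for s by (rule zero[OF that])
  qed (use rt n in auto)
 qed
 have ai: "integrable ?M (\<lambda>s. ?k n r s * F s)" "(\<lambda>n. LINT s|?M. ?k n r s * F s) \<longlonglongrightarrow> F r"
  if "0 < r" "r < T" for n r using approximate_identity[where \<sigma> = \<sigma> and C = C, OF _ _ _ _ _ F that] \<sigma> by blast+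
 have "(\<lambda>n. (LINT s|?M. ?k n r s * F s) - (LINT s|?M. ?k n t s * F s)) \<longlonglongrightarrow> F r - F t"
  using rt by (intro tendsto_diff ai(2)) auto
 moreover have "(LINT s|?M. ?k n r s * F s) - (LINT s|?M. ?k n t s * F s) = (LINT s|?M. deriv (\<theta> n) s * F s)" for n
 proof -
  have "0 < r" "r < T" "0 < t" using rt by auto
  note i = ai(1)[OF this(1,2), of n] ai(1)[OF this(3) rt(3), of n]
  show ?thesis unfolding d\<theta> left_diff_distrib by (rule Bochner_Integration.integral_diff[OF i, symmetric])
 qed
 ultimately have L: "(\<lambda>n. LINT s|?M. deriv (\<theta> n) s * F s) \<longlonglongrightarrow> F r - F t" by simp
 have R: "(\<lambda>n. - (LINT s|?M. \<theta> n s * G s)) \<longlonglongrightarrow> - (LINT s|?M. indicator {r<..t} s * G s)"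
 proof (intro tendsto_minus integral_dominated_convergence[where w = "\<lambda>s. \<bar>G s\<bar>"])
  note [measurable] = borel_measurable_integrable[OF G]
  show "(\<lambda>s. indicator {r<..t} s * G s) \<in> borel_measurable ?M" 
   by (intro borel_measurable_times indicator_measurable_lebesgue_on borel_measurable_integrable[OF G]) auto
  show "(\<lambda>s. \<theta> n s * G s) \<in> borel_measurable ?M" for n
  proof -
   have "continuous_on UNIV (\<theta> n)" using sm[of n] unfolding smooth_def by (metis Cr.simps(1))
   then have "\<theta> n \<in> borel_measurable ?M"
    by (intro continuous_imp_measurable_on_sets_lebesgue) (auto intro: continuous_on_subset)
   then show ?thesis by measurable
  qed
  show "integrable ?M (\<lambda>s. \<bar>G s\<bar>)" using G by simp
  show "AE s in ?M. norm (\<theta> n s * G s) \<le> \<bar>G s\<bar>" for n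
  proof (rule AE_I2)
   fix s
   have "\<bar>\<theta> n s\<bar> \<le> 1" using step_nonneg[of "real (Suc n) * (s - r)"] step_le_1[of "real (Suc n) * (s - r)"]
     step_nonneg[of "real (Suc n) * (s - t)"] step_le_1[of "real (Suc n) * (s - t)"] unfolding \<theta>_def by linarith
   then show "norm (\<theta> n s * G s) \<le> \<bar>G s\<bar>" by (simp add: abs_mult mult_left_le_one_le)
  qed
  show "AE s in ?M. (\<lambda>n. \<theta> n s * G s) \<longlonglongrightarrow> indicator {r<..t} s * G s"
  proof (intro AE_I2 tendsto_mult_right)
   fix s
   have st: "(\<lambda>n. step (real (Suc n) * x)) \<longlonglongrightarrow> (if x > 0 then 1 else 0)" for x
   proof (cases "x > 0")
    case True
    obtain n0 where n0: "inverse (real (Suc n0)) < x" using reals_Archimedean[OF True] by blast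
    have "step (real (Suc n) * x) = 1" if "n \<ge> n0" for n
    proof (rule step_eq_1)
     have "inverse (real (Suc n)) \<le> inverse (real (Suc n0))" using that by (intro le_imp_inverse_le) auto
     then have "inverse (real (Suc n)) \<le> x" using n0 by linarith
     then have "real (Suc n) * inverse (real (Suc n)) \<le> real (Suc n) * x" by (intro mult_left_mono) auto
     then show "1 \<le> real (Suc n) * x" by simp
    qed
    then have "\<forall>\<^sub>F n in sequentially. step (real (Suc n) * x) = 1" unfolding eventually_sequentially by blast
    then show ?thesis using True by (simp add: tendsto_eventually)
   next
    case False
    then have "step (real (Suc n) * x) = 0" for n by (intro step_eq_0) (auto simp: mult_le_0_iff)
    with False show ?thesis by simp
   qed
   have "(\<lambda>n. \<theta> n s) \<longlonglongrightarrow> (if s - r > 0 then 1 else 0) - (if s - t > 0 then 1 else 0)"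
    unfolding \<theta>_def by (intro tendsto_diff st)
   moreover have "(if s - r > 0 then 1 else 0) - (if s - t > 0 then 1 else 0) = indicat_real {r<..t} s"
    using rt by (auto simp: indicator_def)
   ultimately show "(\<lambda>n. \<theta> n s) \<longlonglongrightarrow> indicat_real {r<..t} s" by simp
  qed
 qed
 have ev: "\<forall>\<^sub>F n in sequentially. (LINT s|?M. deriv (\<theta> n) s * F s) = - (LINT s|?M. \<theta> n s * G s)"
  using rt by (intro eventually_mono[OF order_tendstoD(2)[OF LIMSEQ_inverse_real_of_nat, of "T - t"]] eq test) auto
 have "(\<lambda>n. LINT s|?M. deriv (\<theta> n) s * F s) \<longlonglongrightarrow> - (LINT s|?M. indicator {r<..t} s * G s)"
  using R ev by (rule Lim_transform_eventually[OF _ eventually_mono]) auto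
 from LIMSEQ_unique[OF L this] show ?thesis by simp
qed

text \<open>With \<open>F = 0\<close> in the previous lemma all integrals of \<open>G\<close> over
  intervals vanish, and by dominated convergence those over half-lines too. Half-lines determine
  finite measures.\<close>

lemma AE_zero_of_weak_derivative_zero:
 fixes G :: "real \<Rightarrow> real"
 assumes G: "integrable (lebesgue_on {0<..<T}) G"
  and eq: "\<And>\<theta>. time_test T \<theta> \<Longrightarrow> (LINT s|lebesgue_on {0<..<T}. \<theta> s * G s) = 0"
 shows "AE s in lebesgue_on {0<..<T}. G s = 0"
proof (cases "T > 0")
 case T: True
 let ?M = "lebesgue_on {0<..<T}"
 have inc: "(LINT s|?M. indicator {r<..t} s * G s) = 0" if "0 < r" "t < T" for r t
 proof (cases "r < t")
  case True
  then show ?thesis using weak_derivative_increment[OF _ G, of "\<lambda>_. 0" r t] eq that by simp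
 qed simp
 have half: "(LINT s|?M. indicator {x<..} s * G s) = 0" for x
 proof -
  let ?r = "\<lambda>n. max x (T * inverse (real (Suc n)))" and ?t = "\<lambda>n. T - T * inverse (real (Suc n))"
  have lim: "(\<lambda>n. T * inverse (real (Suc n))) \<longlonglongrightarrow> 0" by (rule tendsto_mult_right_zero[OF LIMSEQ_inverse_real_of_nat])
  have "(\<lambda>n. LINT s|?M. indicator {?r n<..?t n} s * G s) \<longlonglongrightarrow> (LINT s|?M. indicator {x<..} s * G s)"
  proof (rule integral_dominated_convergence[where w = "\<lambda>s. \<bar>G s\<bar>"])
   note [measurable] = borel_measurable_integrable[OF G]
   show "(\<lambda>s. indicator {x<..} s * G s) \<in> borel_measurable ?M"
    "(\<lambda>s. indicator {?r n<..?t n} s * G s) \<in> borel_measurable ?M" for n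
    by (intro borel_measurable_times indicator_measurable_lebesgue_on borel_measurable_integrable[OF G]; simp)+
   show "AE s in ?M. (\<lambda>n. indicator {?r n<..?t n} s * G s) \<longlonglongrightarrow> indicator {x<..} s * G s"
   proof (intro AE_I2 tendsto_mult_right)
    fix s assume "s \<in> space ?M"
    then have s: "0 < s" "s < T" by auto
    have "\<forall>\<^sub>F n in sequentially. T * inverse (real (Suc n)) < s" "\<forall>\<^sub>F n in sequentially. T * inverse (real (Suc n)) < T - s"
     using order_tendstoD(2)[OF lim] s by auto
    then have "\<forall>\<^sub>F n in sequentially. indicat_real {?r n<..?t n} s = indicat_real {x<..} s"
     by eventually_elim (auto simp: indicator_def)
    then show "(\<lambda>n. indicat_real {?r n<..?t n} s) \<longlonglongrightarrow> indicat_real {x<..} s" by (rule tendsto_eventually)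
   qed
  qed (use G in \<open>auto simp: indicator_def\<close>)
  moreover have "(LINT s|?M. indicator {?r n<..?t n} s * G s) = 0" for n
   using T by (intro inc) (auto simp: less_max_iff_disj)
  ultimately show ?thesis using LIMSEQ_unique[OF _ tendsto_const] by simp
 qed
 define g where "g s = indicat_real {0<..<T} s * G s" for s
 have ig: "integrable lebesgue g" using G by (simp add: g_def[abs_def] integrable_restrict_space)
 \<comment> \<open>A Borel version is needed because the comparison of measures takes place on Borel
   sets.\<close>
 obtain g' where g': "g' \<in> borel_measurable lborel" "AE s in lborel. g s = g' s"
  using completion_ex_borel_measurable_real[OF borel_measurable_integrable[OF ig]] by blast
 note [measurable] = g'(1)
 have ig': "integrable lborel g'"
 proof -
  have "integrable lebesgue g'" using ig
  proof (rule integrable_cong_AE_imp)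
   show "g' \<in> borel_measurable lebesgue" by (rule measurable_completion[OF g'(1)])
   show "AE s in lebesgue. g s = g' s" by (rule AE_completion[OF g'(2)])
  qed
  then show ?thesis using g'(1) by (simp add: integrable_completion)
 qed
 have half': "(LINT s|lborel. indicat_real {x<..} s * g' s) = 0" for x
 proof -
  have "(LINT s|lborel. indicat_real {x<..} s * g' s) = (LINT s|lebesgue. indicat_real {x<..} s * g' s)"
   by (rule integral_completion[symmetric]) measurable
  also have "\<dots> = (LINT s|lebesgue. indicat_real {x<..} s * g s)"
  proof (rule integral_cong_AE)
   show "(\<lambda>s. indicat_real {x<..} s * g' s) \<in> borel_measurable lebesgue"
    by (intro borel_measurable_times borel_measurable_indicator measurable_completion g'(1)) simp
   show "(\<lambda>s. indicat_real {x<..} s * g s) \<in> borel_measurable lebesgue"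
    by (intro borel_measurable_times borel_measurable_indicator borel_measurable_integrable[OF ig]) simp
   show "AE s in lebesgue. indicat_real {x<..} s * g' s = indicat_real {x<..} s * g s"
    using AE_completion[OF g'(2)] by eventually_elim simp
  qed
  also have "\<dots> = (LINT s|lebesgue. indicator {0<..<T} s *\<^sub>R (indicator {x<..} s * G s))"
   by (simp add: g_def mult_ac)
  also have "\<dots> = (LINT s|?M. indicator {x<..} s * G s)" by (rule integral_restrict_space[symmetric]) simp
  finally show ?thesis by (simp add: half)
 qed
 \<comment> \<open>As \<open>ennreal\<close> cuts off negative values, these are the measures with
   the positive and the negative part of \<open>g'\<close> as densities; equality forces both parts
   to vanish.\<close>
 have "density lborel (\<lambda>s. ennreal (g' s)) = density lborel (\<lambda>s. ennreal (- g' s))"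
 proof (rule measure_eqI_lessThan)
  fix x :: real
  have int: "integrable lborel (\<lambda>s. indicat_real {x<..} s * g' s)"
   using integrable_mult_indicator[OF _ ig', of "{x<..}"] by simp
  have e: "emeasure (density lborel (\<lambda>s. ennreal (h s))) {x<..} = (\<integral>\<^sup>+s. ennreal (indicat_real {x<..} s * h s) \<partial>lborel)"
   if [measurable]: "h \<in> borel_measurable lborel" for h :: "real \<Rightarrow> real"
   by (subst emeasure_density) (auto intro!: nn_integral_cong simp: indicator_def)
  have f: "(\<integral>\<^sup>+s. ennreal (indicat_real {x<..} s * g' s) \<partial>lborel) \<noteq> \<infinity>"
   "(\<integral>\<^sup>+s. ennreal (- (indicat_real {x<..} s * g' s)) \<partial>lborel) \<noteq> \<infinity>" using int by (auto simp: real_integrable_def)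
  show "emeasure (density lborel (\<lambda>s. ennreal (g' s))) {x<..} < \<infinity>" using f(1) by (simp add: e less_top)
  have "enn2real (\<integral>\<^sup>+s. ennreal (indicat_real {x<..} s * g' s) \<partial>lborel)
    = enn2real (\<integral>\<^sup>+s. ennreal (- (indicat_real {x<..} s * g' s)) \<partial>lborel)"
   using half'[of x] real_lebesgue_integral_def[OF int] by simp
  moreover have "a = b" if "enn2real a = enn2real b" "a \<noteq> \<infinity>" "b \<noteq> \<infinity>" for a b
   using that by (metis ennreal_enn2real infinity_ennreal_def less_top)
  ultimately have "(\<integral>\<^sup>+s. ennreal (indicat_real {x<..} s * g' s) \<partial>lborel) = (\<integral>\<^sup>+s. ennreal (- (indicat_real {x<..} s * g' s)) \<partial>lborel)"
   using f by presburger
  then show "emeasure (density lborel (\<lambda>s. ennreal (g' s))) {x<..} = emeasure (density lborel (\<lambda>s. ennreal (- g' s))) {x<..}"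
   by (simp add: e)
 qed simp_all
 then have "AE s in lborel. ennreal (g' s) = ennreal (- g' s)"
  by (subst (asm) sigma_finite_measure.density_unique_iff[OF sigma_finite_lborel]) auto
 then have "AE s in lborel. g' s = 0"
 proof eventually_elim
  case (elim s)
  then show ?case by (cases "g' s \<ge> 0") (auto simp: ennreal_neg ennreal_eq_0_iff)
 qed
 with g'(2) have "AE s in lborel. g s = 0" by eventually_elim simp
 then have "AE s in lebesgue. g s = 0" by (rule AE_completion)
 then show ?thesis by (subst AE_restrict_space_iff) (auto elim!: eventually_mono simp: g_def)
qed (simp add: AE_restrict_space_iff)

context bounded_open
begin

lemma L2_H_L2:
 assumes "L2_H U T k f"
 shows "AE t in lebesgue_on {0<..<T}. L2 U (f t)"
proof -
 have "AE t in lebesgue_on {0<..<T}. sobolev U k (f t)"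
  using assms unfolding L2_H_def bochner_measurable_def by (auto elim!: eventually_mono)
 then show ?thesis
 proof eventually_elim
  case (elim t)
  then show ?case by (cases k) auto
 qed
qed

lemma ip_time_integrable:
 fixes f :: "real \<Rightarrow> real^2 \<Rightarrow> 'a::euclidean_space"
 assumes f: "L2_H U T 0 f" and \<psi>: "L2 U \<psi>"
 shows "integrable (lebesgue_on {0<..<T}) (\<lambda>t. ip U (f t) \<psi>)"
proof -
 let ?M = "lebesgue_on {0<..<T}"
 obtain S where S: "\<And>j. simple_function ?M (S j)" "\<And>j t. t \<in> {0<..<T} \<Longrightarrow> L2 U (S j t)"
  "AE t in ?M. L2 U (f t) \<and> (\<lambda>j. dst (S j t) (f t)) \<longlonglongrightarrow> 0"
  using f unfolding L2_H_def bochner_measurable_def sobolev.simps sobolev_norm.simps by blast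
 show ?thesis
 proof (rule Bochner_Integration.integrable_bound)
  show "integrable ?M (\<lambda>t. (sobolev_norm U 0 (f t))\<^sup>2 + (nrm \<psi>)\<^sup>2)"
  proof (rule Bochner_Integration.integrable_add)
   show "integrable ?M (\<lambda>t. (sobolev_norm U 0 (f t))\<^sup>2)" using f by (simp add: L2_H_def)
   note finite_measure_interval[of T]
   then show "integrable ?M (\<lambda>t. (nrm \<psi>)\<^sup>2)" by (rule finite_measure.integrable_const)
  qed
  show "(\<lambda>t. ip U (f t) \<psi>) \<in> borel_measurable ?M"
  proof (rule borel_measurable_lebesgue_on_LIMSEQ_AE)
   show "(\<lambda>t. ip U (S j t) \<psi>) \<in> borel_measurable ?M" for j
    using simple_function_compose[OF S(1), of "\<lambda>F. ip U F \<psi>" j]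
    by (intro borel_measurable_simple_function) (simp add: o_def)
   show "AE t in ?M. (\<lambda>j. ip U (S j t) \<psi>) \<longlonglongrightarrow> ip U (f t) \<psi>" using S(3) AE_space
   proof eventually_elim
    case (elim t)
    then show ?case by (intro tendsto_ip_left S(2) \<psi>) auto
   qed
  qed simp
  show "AE t in ?M. norm (ip U (f t) \<psi>) \<le> norm ((sobolev_norm U 0 (f t))\<^sup>2 + (nrm \<psi>)\<^sup>2)" using S(3)
  proof eventually_elim
   case (elim t)
   have "\<bar>ip U (f t) \<psi>\<bar> \<le> nrm (f t) * nrm \<psi>" using elim by (intro ip_Cauchy_Schwarz \<psi>) auto
   also have "\<dots> \<le> (nrm (f t))\<^sup>2 + (nrm \<psi>)\<^sup>2" using sum_squares_bound[of "nrm (f t)" "nrm \<psi>"]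
     mult_nonneg_nonneg[OF L2_norm_nonneg L2_norm_nonneg, of U "f t" U \<psi>] by linarith
   finally show ?case by simp
  qed
 qed
qed

lemma C_L2_continuous:
 fixes f :: "real \<Rightarrow> real^2 \<Rightarrow> 'a::euclidean_space"
 assumes f: "C_L2 U T f" and \<psi>: "L2 U \<psi>"
 shows "continuous_on {0..T} (\<lambda>t. ip U (f t) \<psi>)" unfolding continuous_on_def
proof
 fix t assume t: "t \<in> {0..T}"
 show "((\<lambda>t. ip U (f t) \<psi>) \<longlongrightarrow> ip U (f t) \<psi>) (at t within {0..T})"
 proof (rule LIM_zero_cancel, rule Lim_null_comparison)
  have "\<forall>\<^sub>F r in at t within {0..T}. r \<in> {0..T}" by (simp add: eventually_at_filter)
  then show "\<forall>\<^sub>F r in at t within {0..T}. norm (ip U (f r) \<psi> - ip U (f t) \<psi>) \<le> dst (f r) (f t) * nrm \<psi>"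
  proof eventually_elim
   case (elim r)
   then have "L2 U (f r)" "L2 U (f t)" using f t by (auto simp: C_L2_def)
   then show ?case using ip_Cauchy_Schwarz[OF L2_diff \<psi>, of "f r" "f t"] \<psi> by (simp add: ip_diff_left)
  qed
  show "((\<lambda>r. dst (f r) (f t) * nrm \<psi>) \<longlongrightarrow> 0) (at t within {0..T})"
   using f t tendsto_mult_left_zero unfolding C_L2_def by blast
 qed
qed

proposition time_increment_bound:
 fixes f g :: "real \<Rightarrow> real^2 \<Rightarrow> 'a::euclidean_space"
 assumes T: "T > 0" and f: "C_L2 U T f" and fg: "has_time_deriv U T f g" and \<psi>: "L2 U \<psi>"
  and rt: "0 \<le> r" "r \<le> t" "t \<le> T"
  and bd: "AE s in lebesgue_on {0<..<T}. s \<in> {r<..<t} \<longrightarrow> \<bar>ip U (g s) \<psi> + A\<bar> \<le> B"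
 shows "\<bar>ip U (f t) \<psi> - ip U (f r) \<psi> + (t - r) * A\<bar> \<le> (t - r) * B"
proof (cases "r = t")
 case False
 then have "r < t" using rt by simp
 let ?M = "lebesgue_on {0<..<T}" and ?F = "\<lambda>t. ip U (f t) \<psi>" and ?G = "\<lambda>t. ip U (g t) \<psi>"
 have cF: "continuous_on {0..T} ?F" by (rule C_L2_continuous[OF f \<psi>])
 have iG: "integrable ?M ?G" using fg ip_time_integrable[OF _ \<psi>] by (auto simp: has_time_deriv_def)
 have eq: "(LINT s|?M. deriv \<theta> s * ?F s) = - (LINT s|?M. \<theta> s * ?G s)" if "time_test T \<theta>" for \<theta>
  using fg that \<psi> unfolding has_time_deriv_def ip_def by blast
 have inner: "\<bar>?F t' - ?F r' + (t' - r') * A\<bar> \<le> (t' - r') * B" if r't': "r < r'" "r' < t'" "t' < t" for r' t'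
 proof -
  have inc: "?F t' - ?F r' = (LINT s|?M. indicator {r'<..t'} s * ?G s)"
   using weak_derivative_increment[OF cF iG eq, of r' t'] rt r't' by simp
  have len: "(LINT s|?M. indicat_real {r'<..t'} s) = t' - r'"
  proof -
   have "(LINT s|?M. indicat_real {r'<..t'} s) = measure lebesgue ({r'<..t'} \<inter> {0<..<T})"
    by (simp add: measure_restrict_space)
   also have "{r'<..t'} \<inter> {0<..<T} = {r'<..t'}" using rt r't' by auto
   finally show ?thesis using r't' by simp
  qed
  have iI: "integrable ?M (\<lambda>s. indicat_real {r'<..t'} s)"
  proof -
   note finite_measure_interval[of T]
   then show ?thesis using r't' rt by (intro integrable_real_indicator)
     (auto simp: sets_restrict_space_iff finite_measure.emeasure_finite less_top[symmetric])
  qed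
  have iIG: "integrable ?M (\<lambda>s. indicat_real {r'<..t'} s * ?G s)"
  proof -
   have "{r'<..t'} \<in> sets ?M" using rt r't' by (auto simp: sets_restrict_space_iff)
   from integrable_mult_indicator[OF this iG] show ?thesis by simp
  qed
  have eq': "?F t' - ?F r' + (t' - r') * A = (LINT s|?M. indicat_real {r'<..t'} s * (?G s + A))"
   using iI iIG len by (simp add: inc distrib_left)
  have "\<bar>?F t' - ?F r' + (t' - r') * A\<bar> \<le> (LINT s|?M. indicat_real {r'<..t'} s * B)" unfolding eq'
  proof (rule order_trans[OF integral_abs_bound], rule integral_mono_AE)
   show "integrable ?M (\<lambda>s. \<bar>indicat_real {r'<..t'} s * (?G s + A)\<bar>)"
    using iI iIG by (intro integrable_abs) (simp add: distrib_left)
   show "integrable ?M (\<lambda>s. indicat_real {r'<..t'} s * B)" using iI by simp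
   show "AE s in ?M. \<bar>indicat_real {r'<..t'} s * (?G s + A)\<bar> \<le> indicat_real {r'<..t'} s * B"
    using bd by eventually_elim (use r't' in \<open>auto simp: indicator_def\<close>)
  qed
  also have "\<dots> = (t' - r') * B" by (simp only: integral_mult_left_zero len)
  finally show ?thesis .
 qed
 let ?m = "(r + t) / 2"
 let ?r = "\<lambda>n. r + (t - r) / 3 * inverse (real (Suc n))" and ?t = "\<lambda>n. t - (t - r) / 3 * inverse (real (Suc n))"
 have z: "(\<lambda>n. (t - r) / 3 * inverse (real (Suc n))) \<longlonglongrightarrow> 0"
  by (rule tendsto_mult_right_zero[OF LIMSEQ_inverse_real_of_nat])
 have lr: "?r \<longlonglongrightarrow> r" using tendsto_add[OF tendsto_const z, of r] by simp
 have lt: "?t \<longlonglongrightarrow> t" using tendsto_diff[OF tendsto_const z, of t] by simp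
 have e: "0 < (t - r) / 3 * inverse (real (Suc n))" "(t - r) / 3 * inverse (real (Suc n)) \<le> (t - r) / 3" for n
 proof -
  show "0 < (t - r) / 3 * inverse (real (Suc n))" using \<open>r < t\<close> by simp
  have "inverse (real (Suc n)) \<le> 1" by (simp add: inverse_le_1_iff)
  then have "(t - r) / 3 * inverse (real (Suc n)) \<le> (t - r) / 3 * 1" using \<open>r < t\<close> by (intro mult_left_mono) auto
  then show "(t - r) / 3 * inverse (real (Suc n)) \<le> (t - r) / 3" by simp
 qed
 have le: "r < ?r n" "?r n < ?t n" "?t n < t" for n
 proof -
  have "0 < (t - r) / 3" using \<open>r < t\<close> by simp
  moreover have "t - r = 3 * ((t - r) / 3)" by simp
  ultimately show "r < ?r n" "?r n < ?t n" "?t n < t" using e[of n] by linarith+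
 qed
 have lF: "(\<lambda>n. ?F (?r n)) \<longlonglongrightarrow> ?F r" "(\<lambda>n. ?F (?t n)) \<longlonglongrightarrow> ?F t"
 proof -
  have "?r n \<in> {0..T}" "?t n \<in> {0..T}" for n using le[of n] rt by auto
  moreover have "r \<in> {0..T}" "t \<in> {0..T}" using rt by auto
  ultimately show "(\<lambda>n. ?F (?r n)) \<longlonglongrightarrow> ?F r" "(\<lambda>n. ?F (?t n)) \<longlonglongrightarrow> ?F t"
   by (intro continuous_on_tendsto_compose[OF cF lr] continuous_on_tendsto_compose[OF cF lt] always_eventually; simp)+
 qed
 show ?thesis
 proof (rule LIMSEQ_le)
  show "(\<lambda>n. \<bar>?F (?t n) - ?F (?r n) + (?t n - ?r n) * A\<bar>) \<longlonglongrightarrow> \<bar>?F t - ?F r + (t - r) * A\<bar>"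
   by (intro tendsto_intros lF lr lt)
  show "(\<lambda>n. (?t n - ?r n) * B) \<longlonglongrightarrow> (t - r) * B" by (intro tendsto_intros lr lt)
  show "\<exists>N. \<forall>n\<ge>N. \<bar>?F (?t n) - ?F (?r n) + (?t n - ?r n) * A\<bar> \<le> (?t n - ?r n) * B" using inner[OF le] by blast
 qed
qed simp

text \<open>For each fixed \<psi> the exceptional set of times is null, so countably many \<psi>
  must suffice for all times at once.\<close>

proposition has_time_deriv_unique:
 fixes f g1 g2 :: "real \<Rightarrow> real^2 \<Rightarrow> 'a::euclidean_space"
 assumes g1: "has_time_deriv U T f g1" and g2: "has_time_deriv U T f g2"
 shows "AE t in lebesgue_on {0<..<T}. AE x in \<mu>. g1 t x = g2 t x"
proof -
 let ?M = "lebesgue_on {0<..<T}"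
 have L: "L2_H U T 0 g1" "L2_H U T 0 g2" using g1 g2 by (auto simp: has_time_deriv_def)
 obtain S1 where S1: "\<And>j. simple_function ?M (S1 j)" "\<And>j t. t \<in> {0<..<T} \<Longrightarrow> L2 U (S1 j t)"
  "AE t in ?M. L2 U (g1 t) \<and> (\<lambda>j. dst (S1 j t) (g1 t)) \<longlonglongrightarrow> 0"
  using L(1) unfolding L2_H_def bochner_measurable_def sobolev.simps sobolev_norm.simps by blast
 obtain S2 where S2: "\<And>j. simple_function ?M (S2 j)" "\<And>j t. t \<in> {0<..<T} \<Longrightarrow> L2 U (S2 j t)"
  "AE t in ?M. L2 U (g2 t) \<and> (\<lambda>j. dst (S2 j t) (g2 t)) \<longlonglongrightarrow> 0"
  using L(2) unfolding L2_H_def bochner_measurable_def sobolev.simps sobolev_norm.simps by blast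
 \<comment> \<open>Differences of values of the simple approximants: countably many, yet at almost
   every time they approximate \<open>g1 t - g2 t\<close> itself, which makes separability of
   \<open>L2\<close> unnecessary.\<close>
 define D where "D = (\<Union>j. (\<lambda>(a, b) x. a x - b x) ` (S1 j ` {0<..<T} \<times> S2 j ` {0<..<T}))"
 have "countable (S1 j ` {0<..<T})" "countable (S2 j ` {0<..<T})" for j
  using S1(1)[of j] S2(1)[of j] by (auto simp: simple_function_def intro: countable_finite)
 then have "countable D" unfolding D_def by (intro countable_UN countable_image[OF countable_SIGMA]) auto
 have LD: "L2 U \<psi>" if "\<psi> \<in> D" for \<psi> using that S1(2) S2(2) by (auto simp: D_def intro!: L2_diff)
 have "AE t in ?M. \<forall>\<psi>\<in>D. ip U (g1 t) \<psi> - ip U (g2 t) \<psi> = 0"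
 proof (subst AE_ball_countable[OF \<open>countable D\<close>], intro ballI)
  fix \<psi> assume "\<psi> \<in> D"
  then have \<psi>: "L2 U \<psi>" by (rule LD)
  have i: "integrable ?M (\<lambda>t. ip U (g1 t) \<psi>)" "integrable ?M (\<lambda>t. ip U (g2 t) \<psi>)"
   using ip_time_integrable L \<psi> by blast+
  show "AE t in ?M. ip U (g1 t) \<psi> - ip U (g2 t) \<psi> = 0"
  proof (rule AE_zero_of_weak_derivative_zero)
   show "integrable ?M (\<lambda>t. ip U (g1 t) \<psi> - ip U (g2 t) \<psi>)" using i by simp
   fix \<theta> assume \<theta>: "time_test T \<theta>"
   have "(LINT t|?M. \<theta> t * ip U (g1 t) \<psi>) = (LINT t|?M. \<theta> t * ip U (g2 t) \<psi>)"
   proof -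
    have "- (LINT t|?M. \<theta> t * ip U (g1 t) \<psi>) = - (LINT t|?M. \<theta> t * ip U (g2 t) \<psi>)" unfolding ip_def
     using g1[unfolded has_time_deriv_def, THEN conjunct2, THEN conjunct2, rule_format, OF conjI[OF \<theta> \<psi>]]
      g2[unfolded has_time_deriv_def, THEN conjunct2, THEN conjunct2, rule_format, OF conjI[OF \<theta> \<psi>]]
     by (rule trans[OF sym])
    then show ?thesis by simp
   qed
   moreover have "integrable ?M (\<lambda>t. \<theta> t * h t)" if "integrable ?M h" for h :: "real \<Rightarrow> real"
   proof -
    have cont: "continuous_on UNIV \<theta>" using \<theta> unfolding time_test_def
     by (intro continuous_at_imp_continuous_on ballI field_differentiable_imp_continuous_at)
       (metis funpow_0)
    have "bounded (\<theta> ` {0..T})"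
     by (intro compact_imp_bounded compact_continuous_image continuous_on_subset[OF cont]) auto
    then obtain B where B: "\<And>x. x \<in> {0..T} \<Longrightarrow> \<bar>\<theta> x\<bar> \<le> B" unfolding bounded_iff by (metis imageI real_norm_def)
    have m: "\<theta> \<in> borel_measurable ?M"
     by (intro continuous_imp_measurable_on_sets_lebesgue continuous_on_subset[OF cont]) auto
    show ?thesis
    proof (rule Bochner_Integration.integrable_bound)
     show "integrable ?M (\<lambda>t. B * h t)" using that by simp
     show "(\<lambda>t. \<theta> t * h t) \<in> borel_measurable ?M" using m borel_measurable_integrable[OF that] by measurable
     show "AE t in ?M. norm (\<theta> t * h t) \<le> norm (B * h t)"
     proof (rule AE_I2)
      fix t assume "t \<in> space ?M"
      then have "\<bar>\<theta> t\<bar> \<le> \<bar>B\<bar>" using B[of t] by auto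
      then show "norm (\<theta> t * h t) \<le> norm (B * h t)" by (simp add: abs_mult mult_right_mono)
     qed
    qed
   qed
   ultimately show "(LINT t|?M. \<theta> t * (ip U (g1 t) \<psi> - ip U (g2 t) \<psi>)) = 0"
    using i by (simp add: right_diff_distrib)
  qed
 qed
 then show ?thesis using S1(3) S2(3) AE_space
 proof eventually_elim
  case (elim t)
  then have t: "t \<in> {0<..<T}" by simp
  have Lg: "L2 U (g1 t)" "L2 U (g2 t)" using elim by auto
  let ?e = "\<lambda>x. g1 t x - g2 t x"
  let ?\<psi> = "\<lambda>j x. S1 j t x - S2 j t x"
  have LS: "L2 U (?\<psi> j)" for j by (intro L2_diff S1 S2 t)
  have "L2_lim U ?\<psi> ?e"
  proof (rule tendsto_0_le)
   fix j :: nat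
   have "(\<lambda>x. ?\<psi> j x - ?e x) = (\<lambda>x. (S1 j t x - g1 t x) - (S2 j t x - g2 t x))" by (auto simp: algebra_simps)
   then show "dst (?\<psi> j) ?e \<le>
    dst (S1 j t) (g1 t) + dst (S2 j t) (g2 t)"
    using L2_norm_triangle_diff[OF L2_diff[OF S1(2)[OF t] Lg(1)] L2_diff[OF S2(2)[OF t] Lg(2)]] by simp
  next
   show "(\<lambda>j. dst (S1 j t) (g1 t) + dst (S2 j t) (g2 t)) \<longlonglongrightarrow> 0" by (rule tendsto_add_zero) (use elim in auto)
  qed auto
  then have "(\<lambda>j. ip U ?e (?\<psi> j)) \<longlonglongrightarrow> ip U ?e ?e" by (intro tendsto_ip_right LS L2_diff Lg)
  moreover have "ip U ?e (?\<psi> j) = 0" for j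
  proof -
   have "?\<psi> j \<in> D" unfolding D_def using t by (intro UN_I[of j] image_eqI[of _ _ "(S1 j t, S2 j t)"]) auto
   then show ?thesis using elim(1) Lg LD by (simp add: ip_diff_left)
  qed
  ultimately have "(\<lambda>j::nat. 0::real) \<longlonglongrightarrow> ip U ?e ?e" by simp
  then have "ip U ?e ?e = 0" using LIMSEQ_unique[OF _ tendsto_const] by metis
  then have "nrm ?e = 0" by (simp add: L2_norm_sq[symmetric])
  then show ?case using L2_norm_eq_0_iff[OF L2_diff[OF Lg]] by simp
 qed
qed

end

section \<open>Properties of the exact solution at every time\<close>

text \<open>A set of full measure meets every interval. The dyadic rate makes the increments of
  Lipschitz functions along the sequence geometric, as \<open>L2_complete\<close> requires.\<close>

lemma AE_interval_approx:
 fixes T t :: real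
 assumes "T > 0" "t \<in> {0..T}" and P: "AE r in lebesgue_on {0<..<T}. P r"
 obtains \<tau> where "\<And>j::nat. P (\<tau> j)" "\<And>j. \<tau> j \<in> {0<..<T}" "\<And>j. \<bar>\<tau> j - t\<bar> \<le> (1/2)^j"
proof -
 have "\<exists>r. P r \<and> r \<in> {0<..<T} \<and> \<bar>r - t\<bar> \<le> (1/2)^j" for j :: nat
 proof (rule ccontr)
  assume no: "\<not> ?thesis"
  define a b where "a = max 0 (t - (1/2::real)^j)" and "b = min T (t + (1/2::real)^j)"
  have pos: "(1/2)^j > (0::real)" by simp
  have "0 < t + (1/2)^j" "t - (1/2)^j < T"
   using assms(2) by (auto intro: add_nonneg_pos[OF _ pos] less_le_trans[of _ t] simp: pos)
  then have ab: "a < b" unfolding a_def b_def using assms(1) pos by simp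
  have ne: "\<not> P r" if "r \<in> {a<..<b}" for r
  proof
   assume "P r"
   moreover have "r \<in> {0<..<T}" "\<bar>r - t\<bar> \<le> (1/2)^j" using that unfolding a_def b_def by auto
   ultimately show False using no by blast
  qed
  have sub: "{a<..<b} \<subseteq> {0<..<T}" unfolding a_def b_def by auto
  have "AE r in lebesgue. r \<in> {0<..<T} \<longrightarrow> P r" using P by (simp add: AE_restrict_space_iff)
  then have "AE r in lebesgue. r \<notin> {a<..<b}" by eventually_elim (use ne sub in blast)
  then have "{a<..<b} \<in> null_sets lebesgue" by (subst (asm) AE_iff_null_sets[symmetric]) auto
  then have "emeasure lebesgue {a<..<b} = 0" by blast
  then show False using ab by simp
 qed
 then obtain \<tau> where "\<And>j. P (\<tau> j) \<and> \<tau> j \<in> {0<..<T} \<and> \<bar>\<tau> j - t\<bar> \<le> (1/2)^j" by metis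
 then show ?thesis using that by blast
qed

context bounded_open
begin

lemma AE_bound_limit:
 fixes f :: "real^2 \<Rightarrow> 'a::euclidean_space"
 assumes F: "\<And>j. L2 U (F j)" and f: "L2 U f"
  and lim: "L2_lim U F f"
  and bd: "\<And>j::nat. AE x in \<mu>. norm (F j x) \<le> K"
 shows "AE x in \<mu>. norm (f x) \<le> K"
proof -
 obtain r where r: "strict_mono r" "AE x in \<mu>. (\<lambda>j. F (r j) x) \<longlonglongrightarrow> f x" using L2_AE_subseq[OF F f lim] by blast
 have "AE x in \<mu>. \<forall>j. norm (F j x) \<le> K" using bd by (simp add: AE_all_countable)
 with r(2) show ?thesis
 proof eventually_elim
  case (elim x)
  show ?case by (rule LIMSEQ_le_const2[OF tendsto_norm[OF elim(1)]]) (use elim(2) in auto)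
 qed
qed

lemma L2_limit_of_Lipschitz:
 assumes le: "\<And>j. dst (h (\<tau> j)) (h t) \<le> M * \<bar>\<tau> j - t\<bar>" and \<tau>: "\<And>j. \<bar>\<tau> j - t\<bar> \<le> (1/2::real)^j" and "M \<ge> 0"
 shows "(\<lambda>j. dst (h (\<tau> j)) (h t)) \<longlonglongrightarrow> 0"
proof (rule tendsto_sandwich[OF _ _ tendsto_const])
 show "\<forall>\<^sub>F j in sequentially. dst (h (\<tau> j)) (h t) \<le> M * (1/2)^j"
  by (intro always_eventually allI order_trans[OF le] mult_left_mono \<tau> \<open>M \<ge> 0\<close>)
 show "(\<lambda>j. M * (1/2::real)^j) \<longlonglongrightarrow> 0" by (intro tendsto_mult_right_zero LIMSEQ_power_zero) simp
qed auto

text \<open>By duality it is enough to bound the increments of the pairings with test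
  functions.\<close>

lemma time_Lipschitz_L2:
 fixes f g :: "real \<Rightarrow> real^2 \<Rightarrow> 'a::euclidean_space"
 assumes T: "T > 0" and f: "C_L2 U T f" and fg: "has_time_deriv U T f g" and "M \<ge> 0"
  and bd: "AE t in lebesgue_on {0<..<T}. L2 U (g t) \<and> nrm (g t) \<le> M"
  and rt: "r \<in> {0..T}" "t \<in> {0..T}"
 shows "dst (f t) (f r) \<le> M * \<bar>t - r\<bar>"
proof -
 have L: "L2 U (f t)" if "t \<in> {0..T}" for t using f that by (simp add: C_L2_def)
 have *: "dst (f t) (f r) \<le> M * (t - r)" if rt: "r \<in> {0..T}" "t \<in> {0..T}" "r \<le> t" for r t
 proof (rule L2_norm_le_by_duality)
  show "L2 U (\<lambda>x. f t x - f r x)" by (intro L2_diff L rt)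
  show "0 \<le> M * (t - r)" using \<open>M \<ge> 0\<close> rt by simp
  fix \<phi> :: "real^2 \<Rightarrow> 'a" assume \<phi>: "test_fun U \<phi>"
  note L\<phi> = L2_test_fun[OF \<phi>]
  have "\<bar>ip U (f t) \<phi> - ip U (f r) \<phi> + (t - r) * 0\<bar> \<le> (t - r) * (M * nrm \<phi>)"
  proof (rule time_increment_bound[OF T f fg L\<phi>])
   show "AE s in lebesgue_on {0<..<T}. s \<in> {r<..<t} \<longrightarrow> \<bar>ip U (g s) \<phi> + 0\<bar> \<le> M * nrm \<phi>" using bd
   proof eventually_elim
    case (elim s)
    then have "\<bar>ip U (g s) \<phi>\<bar> \<le> nrm (g s) * nrm \<phi>" by (intro ip_Cauchy_Schwarz L\<phi>) auto
    also have "\<dots> \<le> M * nrm \<phi>" using elim by (intro mult_right_mono) auto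
    finally show ?case by simp
   qed
  qed (use rt in auto)
  then show "\<bar>ip U (\<lambda>x. f t x - f r x) \<phi>\<bar> \<le> M * (t - r) * nrm \<phi>"
   using ip_diff_left[OF L[OF rt(2)] L[OF rt(1)] L\<phi>] by (simp add: mult_ac)
 qed
 show ?thesis
 proof (cases "r \<le> t")
  case True
  then show ?thesis using *[OF rt] by simp
 next
  case False
  then show ?thesis using *[OF rt(2,1)] by (subst L2_norm_minus_commute) simp
 qed
qed

text \<open>Pairing the time increment with a derivative of the test function controls the increment
  of the weak derivative. At an exceptional time the weak derivatives along nearby good times form a
  Cauchy sequence, whose limit is the missing derivative.\<close>

proposition time_Lipschitz_sobolev:
 fixes f g :: "real \<Rightarrow> real^2 \<Rightarrow> 'a::euclidean_space"
 assumes T: "T > 0" and f: "C_L2 U T f" and fg: "has_time_deriv U T f g" and "M \<ge> 0"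
  and sf: "AE t in lebesgue_on {0<..<T}. sobolev U 1 (f t)"
  and bd: "AE t in lebesgue_on {0<..<T}. sobolev U 1 (g t) \<and> sobolev_norm U 1 (g t) \<le> M"
 shows "\<And>t. t \<in> {0..T} \<Longrightarrow> sobolev U 1 (f t)"
  and "\<And>r t. r \<in> {0..T} \<Longrightarrow> t \<in> {0..T} \<Longrightarrow> dst (f t) (f r) \<le> M * \<bar>t - r\<bar>"
  and "\<And>i r t. r \<in> {0..T} \<Longrightarrow> t \<in> {0..T} \<Longrightarrow>
   dst (weak_pd U i (f t)) (weak_pd U i (f r)) \<le> M * \<bar>t - r\<bar>"
proof -
 have L: "L2 U (f t)" if "t \<in> {0..T}" for t using f that by (simp add: C_L2_def)
 have bd': "AE t in lebesgue_on {0<..<T}. L2 U (g t) \<and> nrm (g t) \<le> M"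
  using bd by eventually_elim (auto dest: sobolev_1_L2 intro: order_trans[OF sobolev_norm_1_bounds(1)])
 show lip: "dst (f t) (f r) \<le> M * \<bar>t - r\<bar>" if "r \<in> {0..T}" "t \<in> {0..T}" for r t
  by (rule time_Lipschitz_L2[OF T f fg \<open>M \<ge> 0\<close> bd' that])
 have *: "dst (weak_pd U i (f t)) (weak_pd U i (f r)) \<le> M * (t - r)"
  if rt: "r \<in> {0..T}" "t \<in> {0..T}" "r \<le> t" and s: "sobolev U 1 (f r)" "sobolev U 1 (f t)" for r t i
 proof (rule L2_norm_le_by_duality)
  note w = sobolev_1D[OF s(1), of i] sobolev_1D[OF s(2), of i]
  note Lw = w[THEN has_weak_pd_L2(2)]
  show "L2 U (\<lambda>x. weak_pd U i (f t) x - weak_pd U i (f r) x)" by (intro L2_diff Lw)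
  show "0 \<le> M * (t - r)" using \<open>M \<ge> 0\<close> rt by simp
  fix \<phi> :: "real^2 \<Rightarrow> 'a" assume \<phi>: "test_fun U \<phi>"
  note L\<phi> = L2_test_fun[OF \<phi>] L2_test_fun[OF test_fun_pd[OF \<phi>], of i]
  have "\<bar>ip U (f t) (pd i \<phi>) - ip U (f r) (pd i \<phi>) + (t - r) * 0\<bar> \<le> (t - r) * (M * nrm \<phi>)"
  proof (rule time_increment_bound[OF T f fg L\<phi>(2)])
   show "AE s in lebesgue_on {0<..<T}. s \<in> {r<..<t} \<longrightarrow> \<bar>ip U (g s) (pd i \<phi>) + 0\<bar> \<le> M * nrm \<phi>" using bd
   proof eventually_elim
    case (elim s)
    note wg = sobolev_1D[of "g s" i]
    have "\<bar>ip U (g s) (pd i \<phi>)\<bar> = \<bar>ip U (weak_pd U i (g s)) \<phi>\<bar>" using has_weak_pd_ip[OF wg \<phi>] elim by simp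
    also have "\<dots> \<le> nrm (weak_pd U i (g s)) * nrm \<phi>" using elim by (intro ip_Cauchy_Schwarz L\<phi> sobolev_1_L2) auto
    also have "\<dots> \<le> M * nrm \<phi>" using elim sobolev_norm_1_bounds(2)[of i "g s"] by (intro mult_right_mono) auto
    finally show ?case by simp
   qed
  qed (use rt in auto)
  then show "\<bar>ip U (\<lambda>x. weak_pd U i (f t) x - weak_pd U i (f r) x) \<phi>\<bar> \<le> M * (t - r) * nrm \<phi>"
   using ip_diff_left[OF Lw(2,1) L\<phi>(1)] w[THEN has_weak_pd_ip, OF \<phi>] by (simp add: mult_ac)
 qed
 have **: "dst (weak_pd U i (f t)) (weak_pd U i (f r)) \<le> M * \<bar>t - r\<bar>"
  if rt: "r \<in> {0..T}" "t \<in> {0..T}" and s: "sobolev U 1 (f r)" "sobolev U 1 (f t)" for r t i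
 proof (cases "r \<le> t")
  case True
  then show ?thesis using *[OF rt _ s] by simp
 next
  case False
  then show ?thesis using *[OF rt(2,1) _ s(2,1)] by (subst L2_norm_minus_commute) simp
 qed
 show sob: "sobolev U 1 (f t)" if t: "t \<in> {0..T}" for t
 proof -
  obtain \<tau> where \<tau>: "\<And>j::nat. sobolev U 1 (f (\<tau> j))" "\<And>j. \<tau> j \<in> {0<..<T}" "\<And>j. \<bar>\<tau> j - t\<bar> \<le> (1/2)^j"
   using AE_interval_approx[OF T t sf] by blast
  have \<tau>': "\<tau> j \<in> {0..T}" for j using \<tau>(2)[of j] by auto
  have "\<exists>g. has_weak_pd U i (f t) g" for i
  proof -
   have "dst (weak_pd U i (f (\<tau> (Suc j)))) (weak_pd U i (f (\<tau> j))) \<le> (M * 2) * (1/2)^j" for j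
   proof -
    have "\<bar>\<tau> (Suc j) - \<tau> j\<bar> \<le> 2 * (1/2)^j" using \<tau>(3)[of j] \<tau>(3)[of "Suc j"] unfolding power_Suc by linarith
    then have "M * \<bar>\<tau> (Suc j) - \<tau> j\<bar> \<le> M * (2 * (1/2)^j)" using \<open>M \<ge> 0\<close> by (rule mult_left_mono)
    with **[OF \<tau>' \<tau>' \<tau>(1) \<tau>(1), of i "Suc j" j] show ?thesis by (simp add: mult.assoc)
   qed
   then obtain h where h: "L2 U h" "(\<lambda>j. dst (weak_pd U i (f (\<tau> j))) h) \<longlonglongrightarrow> 0"
    using L2_complete[where F = "\<lambda>j. weak_pd U i (f (\<tau> j))", OF dom_sets sobolev_1_L2(2)[OF \<tau>(1)]] by blast
   have "(\<lambda>j. dst (f (\<tau> j)) (f t)) \<longlonglongrightarrow> 0" by (rule L2_limit_of_Lipschitz[OF lip[OF t \<tau>'] \<tau>(3) \<open>M \<ge> 0\<close>])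
   then have "has_weak_pd U i (f t) h" using has_weak_pd_limit[OF sobolev_1D[OF \<tau>(1)] L[OF t] h(1) _ h(2)] by blast
   then show ?thesis by blast
  qed
  then show ?thesis using sobolev_1I by metis
 qed
 show "dst (weak_pd U i (f t)) (weak_pd U i (f r)) \<le> M * \<bar>t - r\<bar>"
  if rt: "r \<in> {0..T}" "t \<in> {0..T}" for r t i by (rule **[OF rt sob[OF rt(1)] sob[OF rt(2)]])
qed

lemma Linf_H_iff:
 fixes f :: "real \<Rightarrow> real^2 \<Rightarrow> 'a::euclidean_space"
 assumes "Linf_H U T k f"
 obtains M where "M \<ge> 0" "AE t in lebesgue_on {0<..<T}. sobolev U k (f t) \<and> sobolev_norm U k (f t) \<le> M"
proof -
 obtain M where M: "AE t in lebesgue_on {0<..<T}. sobolev_norm U k (f t) \<le> M"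
  using assms unfolding Linf_H_def by blast
 moreover obtain S where "AE t in lebesgue_on {0<..<T}. sobolev U k (f t) \<and>
   (\<lambda>j::nat. sobolev_norm U k (\<lambda>x. S j t x - f t x)) \<longlonglongrightarrow> 0"
  using assms unfolding Linf_H_def bochner_measurable_def by blast
 ultimately have "AE t in lebesgue_on {0<..<T}. sobolev U k (f t) \<and> sobolev_norm U k (f t) \<le> max M 0"
  by eventually_elim auto
 then show ?thesis using that[of "max M 0"] by simp
qed

end

section \<open>Planar cross products and their estimates\<close>

lemma cross_vv_commute: "cross_vv a b = - cross_vv b a" by (simp add: cross_vv_def)

lemma cross_vv_diff_left: "cross_vv (a - b) c = cross_vv a c - cross_vv b c"
 and cross_vv_diff_right: "cross_vv a (b - c) = cross_vv a b - cross_vv a c"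
 and cross_vv_scaleR_left: "cross_vv (r *\<^sub>R a) b = r * cross_vv a b" by (simp_all add: cross_vv_def algebra_simps)

text \<open>The algebra behind the coupling: the Lorentz force tested with a velocity equals the
  curl times the scalar product of the induction term.\<close>

lemma inner_cross_vs: "a \<bullet> cross_vs b c = c * cross_vv a b"
 by (simp add: cross_vs_def cross_vv_def inner_vec_def sum_2 algebra_simps)

lemma norm_cross_vs: "norm (cross_vs a c) = norm a * \<bar>c\<bar>"
proof -
 have "(norm (cross_vs a c))\<^sup>2 = (norm a * \<bar>c\<bar>)\<^sup>2"
  unfolding power2_norm_eq_inner power_mult_distrib by (simp add: cross_vs_def inner_vec_def sum_2 algebra_simps power2_eq_square)
 then show ?thesis by (rule power2_eq_imp_eq) auto
qed

lemma abs_cross_vv_le: "\<bar>cross_vv a b\<bar> \<le> norm a * norm b"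
 using Cauchy_Schwarz_ineq2[of a "cross_vs b 1"] by (simp add: inner_cross_vs norm_cross_vs)

lemma borel_measurable_vec_nth:
 fixes f :: "'a \<Rightarrow> real^2"
 shows "f \<in> borel_measurable M \<Longrightarrow> (\<lambda>x. f x $ i) \<in> borel_measurable M"
 unfolding cart_eq_inner_axis by (intro borel_measurable_inner borel_measurable_const)

lemma borel_measurable_cross_vv [measurable (raw)]:
 "f \<in> borel_measurable M \<Longrightarrow> g \<in> borel_measurable M \<Longrightarrow> (\<lambda>x. cross_vv (f x) (g x)) \<in> borel_measurable M"
 unfolding cross_vv_def by (intro borel_measurable_diff borel_measurable_times borel_measurable_vec_nth)

lemma borel_measurable_cross_vs [measurable (raw)]:
 assumes [measurable]: "f \<in> borel_measurable M" "g \<in> borel_measurable M"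
 shows "(\<lambda>x. cross_vs (f x) (g x)) \<in> borel_measurable M"
proof -
 have "(\<lambda>x. cross_vs (f x) (g x)) = (\<lambda>x. \<chi> k. if k = 1 then f x $ 2 * g x else - (f x $ 1 * g x))"
  by (simp add: cross_vs_def fun_eq_iff vec_eq_iff forall_2)
 moreover have "(\<lambda>x. if k = 1 then f x $ 2 * g x else - (f x $ 1 * g x)) \<in> borel_measurable M" for k :: 2
  by (cases "k = 1") (auto intro!: borel_measurable_uminus borel_measurable_times borel_measurable_vec_nth assms)
 note borel_measurable_vec[OF this]
 ultimately show ?thesis by (simp only:)
qed

context bounded_open
begin

lemma L2_cross_vv:
 assumes f: "L2 U f" and g: "g \<in> borel_measurable \<mu>" "AE x in \<mu>. norm (g x) \<le> K"
 shows "L2 U (\<lambda>x. cross_vv (f x) (g x))" "K \<ge> 0 \<Longrightarrow> nrm (\<lambda>x. cross_vv (f x) (g x)) \<le> K * nrm f"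
  "L2 U (\<lambda>x. cross_vv (g x) (f x))" "K \<ge> 0 \<Longrightarrow> nrm (\<lambda>x. cross_vv (g x) (f x)) \<le> K * nrm f"
proof -
 note [measurable] = L2_measurable[OF f] g(1)
 have 1: "AE x in \<mu>. norm (cross_vv (g x) (f x)) \<le> K * norm (f x)"
  using g(2) by eventually_elim (use abs_cross_vv_le in \<open>force intro: order_trans[OF _ mult_right_mono]\<close>)
 then have 2: "AE x in \<mu>. norm (cross_vv (f x) (g x)) \<le> K * norm (f x)" by (subst cross_vv_commute) simp
 from L2_dominated[OF f _ 1] L2_dominated[OF f _ 2]
 show "L2 U (\<lambda>x. cross_vv (f x) (g x))" "K \<ge> 0 \<Longrightarrow> nrm (\<lambda>x. cross_vv (f x) (g x)) \<le> K * nrm f"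
  "L2 U (\<lambda>x. cross_vv (g x) (f x))" "K \<ge> 0 \<Longrightarrow> nrm (\<lambda>x. cross_vv (g x) (f x)) \<le> K * nrm f" by measurable
qed

lemma L2_cross_vs_left:
 assumes f: "L2 U f" and c: "c \<in> borel_measurable \<mu>" "AE x in \<mu>. \<bar>c x\<bar> \<le> K"
 shows "L2 U (\<lambda>x. cross_vs (f x) (c x))" "K \<ge> 0 \<Longrightarrow> nrm (\<lambda>x. cross_vs (f x) (c x)) \<le> K * nrm f"
proof -
 note [measurable] = L2_measurable[OF f] c(1)
 have "AE x in \<mu>. norm (cross_vs (f x) (c x)) \<le> K * norm (f x)"
  using c(2) by eventually_elim (simp add: norm_cross_vs mult.commute mult_right_mono)
 from L2_dominated[OF f _ this]
 show "L2 U (\<lambda>x. cross_vs (f x) (c x))" "K \<ge> 0 \<Longrightarrow> nrm (\<lambda>x. cross_vs (f x) (c x)) \<le> K * nrm f" by measurable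
qed

lemma L2_cross_vs_right:
 assumes c: "L2 U c" and f: "f \<in> borel_measurable \<mu>" "AE x in \<mu>. norm (f x) \<le> K"
 shows "L2 U (\<lambda>x. cross_vs (f x) (c x))" "K \<ge> 0 \<Longrightarrow> nrm (\<lambda>x. cross_vs (f x) (c x)) \<le> K * nrm c"
proof -
 note [measurable] = L2_measurable[OF c] f(1)
 have "AE x in \<mu>. norm (cross_vs (f x) (c x)) \<le> K * norm (c x)"
  using f(2) by eventually_elim (simp add: norm_cross_vs mult_right_mono)
 from L2_dominated[OF c _ this]
 show "L2 U (\<lambda>x. cross_vs (f x) (c x))" "K \<ge> 0 \<Longrightarrow> nrm (\<lambda>x. cross_vs (f x) (c x)) \<le> K * nrm c" by measurable
qed

lemma distr_eq_ip: "distr U f \<phi> = ip U f \<phi>" by (simp add: distr_def ip_def)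

lemma distr_axis: "distr U f (\<lambda>x. \<theta> x *\<^sub>R axis k 1) = ip U (\<lambda>x. f x $ k) \<theta>"
 unfolding distr_def ip_def by (simp add: inner_axis mult.commute)

lemma distr_curl_axis:
 assumes "test_fun U \<theta>"
 shows "distr_curl U g (\<lambda>x. \<theta> x *\<^sub>R axis k 1) = ip U g (\<lambda>x. if k = 2 then pd 1 \<theta> x else - pd 2 \<theta> x)"
proof -
 have pd: "pd i (\<lambda>x. \<theta> x *\<^sub>R (axis k 1 :: real^2)) x = pd i \<theta> x *\<^sub>R axis k 1" for i x
  by (rule pd_bounded_linear[OF bounded_linear_scaleR_left test_fun_differentiable[OF assms]])
 show ?thesis unfolding distr_curl_def ip_def pd using exhaust_2[of k] by (auto simp: axis_def)
qed

lemma distr_convect: "ip U (convect U v w) \<phi> = ip U v (\<lambda>x. \<chi> i. weak_pd U i w x \<bullet> \<phi> x)"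
 unfolding ip_def convect_def by (simp add: inner_sum_left inner_vec_def[of "v _"])

lemma distr_laplacian_weak_pd:
 assumes v: "sobolev U 1 v" and \<phi>: "test_fun U \<phi>"
 shows "distr_laplacian U v \<phi> = - (\<Sum>i\<in>UNIV. ip U (weak_pd U i v) (pd i \<phi>))"
proof -
 have "distr_laplacian U v \<phi> = (\<Sum>i\<in>UNIV. ip U v (pd i (pd i \<phi>)))" unfolding distr_laplacian_def ip_def[symmetric]
  by (intro ip_sum_right L2_test_fun[OF test_fun_pd[OF test_fun_pd[OF \<phi>]]] sobolev_1_L2 v)
 then show ?thesis using has_weak_pd_ip[OF sobolev_1D[OF v] test_fun_pd[OF \<phi>]] by (simp add: sum_negf)
qed

lemma L2_norm_curl_le:
 fixes v' :: "2 \<Rightarrow> real^2 \<Rightarrow> real^2"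
 assumes "\<And>i. L2 U (v' i)"
 shows "nrm (\<lambda>x. v' 1 x $ 2 - v' 2 x $ 1) \<le> nrm (v' 1) + nrm (v' 2)"
 using L2_norm_triangle_diff[OF L2_nth[OF assms, of 1 2] L2_nth[OF assms, of 2 1]]
  L2_norm_nth_le[OF assms, of 1 2] L2_norm_nth_le[OF assms, of 2 1] by linarith

end

lemma (in lipschitz_open) Linf_embedding_sobolev_2:
 obtains C where "C > 0" "\<And>(v :: real^2 \<Rightarrow> real^2) M. sobolev U 2 v \<Longrightarrow> sobolev_norm U 2 v \<le> M \<Longrightarrow>
  AE x in \<mu>. norm (v x) \<le> C * M"
proof -
 obtain C where C: "C > 0"
  "\<And>f g h M. (\<And>i. has_weak_pd U i f (g i)) \<Longrightarrow> (\<And>i j. has_weak_pd U j (g i) (h i j)) \<Longrightarrow>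
    nrm f \<le> M \<Longrightarrow> (\<And>i. nrm (g i) \<le> M) \<Longrightarrow> (\<And>i j. nrm (h i j) \<le> M) \<Longrightarrow>
    AE x in \<mu>. \<bar>f x :: real\<bar> \<le> C * M" by (rule Linf_embedding) blast
 have "AE x in \<mu>. norm (v x) \<le> 2 * C * M"
  if v: "sobolev U 2 v" "sobolev_norm U 2 v \<le> M" for v :: "real^2 \<Rightarrow> real^2" and M
 proof -
  have v': "sobolev U (Suc 1) v" "sobolev_norm U (Suc 1) v \<le> M" using v by (simp_all add: numeral_2_eq_2)
  have w1: "has_weak_pd U i v (weak_pd U i v)" for i by (rule sobolev_SucD(1)[OF v'(1)])
  have w2: "has_weak_pd U j (weak_pd U i v) (weak_pd U j (weak_pd U i v))" for i j
  proof -
   obtain g where g: "AE x in \<mu>. weak_pd U i v x = g x" "sobolev U 1 g" using sobolev_SucD(2)[OF v'(1)] by blast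
   have "AE x in \<mu>. g x = weak_pd U i v x" using g(1) by eventually_elim simp
   from has_weak_pd_cong_AE[OF sobolev_1D[OF g(2)] this AE_I2[OF refl]] show ?thesis by (rule has_weak_pd_weak_pd)
  qed
  have a: "sobolev_norm U 1 (weak_pd U i v) \<le> M" for i by (rule order_trans[OF sobolev_norm_Suc_bounds(2) v'(2)])
  have M: "nrm v \<le> M" "nrm (weak_pd U i v) \<le> M" "nrm (weak_pd U j (weak_pd U i v)) \<le> M" for i j
   by (rule order_trans[OF sobolev_norm_Suc_bounds(1) v'(2)] order_trans[OF sobolev_norm_1_bounds(1) a]
     order_trans[OF sobolev_norm_1_bounds(2) a])+
  have "AE x in \<mu>. \<bar>v x $ k\<bar> \<le> C * M" for k
  proof (rule C(2))
   show "has_weak_pd U i (\<lambda>x. v x $ k) (\<lambda>x. weak_pd U i v x $ k)"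
    "has_weak_pd U j (\<lambda>x. weak_pd U i v x $ k) (\<lambda>x. weak_pd U j (weak_pd U i v) x $ k)" for i j
    by (intro has_weak_pd_nth w1 w2)+
   show "nrm (\<lambda>x. v x $ k) \<le> M" "nrm (\<lambda>x. weak_pd U i v x $ k) \<le> M"
    "nrm (\<lambda>x. weak_pd U j (weak_pd U i v) x $ k) \<le> M" for i j
    by (rule order_trans[OF L2_norm_nth_le M(1)] order_trans[OF L2_norm_nth_le M(2)] order_trans[OF L2_norm_nth_le M(3)];
      rule has_weak_pd_L2[OF w1] has_weak_pd_L2[OF w2])+
  qed
  from this[of 1] this[of 2] show ?thesis
  proof eventually_elim
   case (elim x)
   have "norm (v x) \<le> \<bar>v x $ 1\<bar> + \<bar>v x $ 2\<bar>" using norm_le_l1_cart[of "v x"] by (simp add: sum_2)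
   with elim show ?case by simp
  qed
 qed
 then show ?thesis using that[of "2 * C"] C(1) by simp
qed

text \<open>Everything the error analysis uses of the exact solution, with a single constant
  \<open>K\<close>. Traces, bounds and Lipschitz estimates hold at every time, the equations at
  almost every time. The induction equation is written as a weak gradient, because in this form it
  can be tested with every field of zero tangential trace.\<close>

locale exact_solution = lipschitz_open +
 fixes T \<nu> \<eta> s K :: real and u B u_t B_t :: "real \<Rightarrow> real^2 \<Rightarrow> real^2" and p :: "real \<Rightarrow> real^2 \<Rightarrow> real"
 assumes pos: "T > 0" "\<nu> > 0" "\<eta> > 0" "s > 0" "K > 0"
  and trace_u: "t \<in> {0..T} \<Longrightarrow> zero_trace U (u t)" and div_u: "t \<in> {0..T} \<Longrightarrow> div_free U (u t)"
  and trace_B: "t \<in> {0..T} \<Longrightarrow> zero_tangential_trace U (B t)"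
  and sobolev_p: "t \<in> {0..T} \<Longrightarrow> sobolev U 1 (p t)"
  and bound_u: "t \<in> {0..T} \<Longrightarrow> AE x in \<mu>. norm (u t x) \<le> K"
  and bound_B: "t \<in> {0..T} \<Longrightarrow> AE x in \<mu>. norm (B t x) \<le> K"
  and bound_curl: "t \<in> {0..T} \<Longrightarrow> AE x in \<mu>. \<bar>weak_curl U (B t) x\<bar> \<le> K"
  and Lipschitz_u: "r \<in> {0..T} \<Longrightarrow> t \<in> {0..T} \<Longrightarrow> dst (u t) (u r) \<le> K * \<bar>t - r\<bar>"
  and Lipschitz_pd_u: "r \<in> {0..T} \<Longrightarrow> t \<in> {0..T} \<Longrightarrow>
   dst (weak_pd U i (u t)) (weak_pd U i (u r)) \<le> K * \<bar>t - r\<bar>"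
  and Lipschitz_B: "r \<in> {0..T} \<Longrightarrow> t \<in> {0..T} \<Longrightarrow> dst (B t) (B r) \<le> K * \<bar>t - r\<bar>"
  and Lipschitz_curl: "r \<in> {0..T} \<Longrightarrow> t \<in> {0..T} \<Longrightarrow>
   dst (weak_curl U (B t)) (weak_curl U (B r)) \<le> K * \<bar>t - r\<bar>"
  and Lipschitz_grad_p: "r \<in> {0..T} \<Longrightarrow> t \<in> {0..T} \<Longrightarrow>
   dst (weak_grad U (p t)) (weak_grad U (p r)) \<le> K * \<bar>t - r\<bar>"
  and time_u: "C_L2 U T u" "has_time_deriv U T u u_t" and time_B: "C_L2 U T B" "has_time_deriv U T B B_t"
  and momentum: "AE t in lebesgue_on {0<..<T}. \<forall>\<phi>. test_fun U \<phi> \<longrightarrow>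
   ip U (u_t t) \<phi> + \<nu> * (\<Sum>i\<in>UNIV. ip U (weak_pd U i (u t)) (pd i \<phi>))
    + ip U (u t) (\<lambda>x. \<chi> i. weak_pd U i (u t) x \<bullet> \<phi> x) + ip U (weak_grad U (p t)) \<phi>
    + s * ip U (\<lambda>x. cross_vs (B t x) (weak_curl U (B t) x)) \<phi> = 0"
  and induction_eq: "AE t in lebesgue_on {0<..<T}.
   has_weak_pd U 1 (\<lambda>x. \<eta> * weak_curl U (B t) x - cross_vv (u t x) (B t x)) (\<lambda>x. B_t t x $ 2) \<and>
   has_weak_pd U 2 (\<lambda>x. \<eta> * weak_curl U (B t) x - cross_vv (u t x) (B t x)) (\<lambda>x. - B_t t x $ 1)"

proposition (in lipschitz_open) mhd_exact_solution:
 assumes par: "T > 0" "\<nu> > 0" "\<eta> > 0" "s > 0"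
  and mhd: "mhd_solution U T \<nu> \<eta> s u0 B0 u B p" and reg: "regular_solution U T u B p"
 obtains K u_t B_t where "exact_solution U T \<nu> \<eta> s K u B u_t B_t p"
proof -
 let ?I = "lebesgue_on {0<..<T}"
 obtain u_t B_t where C: "C_L2 U T u" "C_L2 U T B" "C_L2 U T p"
  and t: "has_time_deriv U T u u_t" "has_time_deriv U T B B_t"
  and sys: "AE t in ?I.
     zero_trace U (u t) \<and> zero_tangential_trace U (B t) \<and> sobolev U 1 (p t) \<and>
     div_free U (u t) \<and> div_free U (B t) \<and>
     (\<forall>\<phi>. test_fun U \<phi> \<longrightarrow>
       distr U (u_t t) \<phi> - \<nu> * distr_laplacian U (u t) \<phi>
        + distr U (convect U (u t) (u t)) \<phi> + distr U (weak_grad U (p t)) \<phi>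
        + s * distr U (\<lambda>x. cross_vs (B t x) (weak_curl U (B t) x)) \<phi> = 0) \<and>
     (\<forall>\<phi>. test_fun U \<phi> \<longrightarrow>
       distr U (B_t t) \<phi> + \<eta> * distr_curl U (weak_curl U (B t)) \<phi>
        - distr_curl U (\<lambda>x. cross_vv (u t x) (B t x)) \<phi> = 0)" using mhd unfolding mhd_solution_def by blast
 obtain u' where u': "has_time_deriv U T u u'" "Linf_H U T 2 u" "Linf_H U T 1 u'"
  using reg unfolding regular_solution_def by blast
 obtain B' where B': "has_time_deriv U T B B'" "Linf_H U T 2 B" "Linf_H U T 1 B'"
  using reg unfolding regular_solution_def by blast
 obtain p' where p': "has_time_deriv U T p p'" "Linf_H U T 1 p'" using reg unfolding regular_solution_def by blast
 obtain M1 where M1: "M1 \<ge> 0" "AE t in ?I. sobolev U 2 (u t) \<and> sobolev_norm U 2 (u t) \<le> M1" using Linf_H_iff[OF u'(2)] .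
 obtain M2 where M2: "M2 \<ge> 0" "AE t in ?I. sobolev U 1 (u' t) \<and> sobolev_norm U 1 (u' t) \<le> M2" using Linf_H_iff[OF u'(3)] .
 obtain M3 where M3: "M3 \<ge> 0" "AE t in ?I. sobolev U 2 (B t) \<and> sobolev_norm U 2 (B t) \<le> M3" using Linf_H_iff[OF B'(2)] .
 obtain M4 where M4: "M4 \<ge> 0" "AE t in ?I. sobolev U 1 (B' t) \<and> sobolev_norm U 1 (B' t) \<le> M4" using Linf_H_iff[OF B'(3)] .
 obtain M5 where M5: "M5 \<ge> 0" "AE t in ?I. sobolev U 1 (p' t) \<and> sobolev_norm U 1 (p' t) \<le> M5" using Linf_H_iff[OF p'(2)] .
 have su: "AE t in ?I. sobolev U 1 (u t)" using sys by eventually_elim (auto dest: zero_trace_sobolev)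
 have sp: "AE t in ?I. sobolev U 1 (p t)" using sys by eventually_elim auto
 have sB: "AE t in ?I. sobolev U 1 (B t)"
  using M3(2) by eventually_elim (auto simp: numeral_2_eq_2 intro: sobolev_1I sobolev_SucD(1))
 note Lu = time_Lipschitz_sobolev[OF par(1) C(1) u'(1) M2(1) su M2(2)]
  and LB = time_Lipschitz_sobolev[OF par(1) C(2) B'(1) M4(1) sB M4(2)]
  and Lp = time_Lipschitz_sobolev[OF par(1) C(3) p'(1) M5(1) sp M5(2)]
 obtain C1 where C1: "C1 > 0" "\<And>(v :: real^2 \<Rightarrow> real^2) M. sobolev U 2 v \<Longrightarrow> sobolev_norm U 2 v \<le> M \<Longrightarrow>
   AE x in \<mu>. norm (v x) \<le> C1 * M" using Linf_embedding_sobolev_2 by blast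
 obtain C2 where C2: "C2 > 0"
  "\<And>f g h M. (\<And>i. has_weak_pd U i f (g i)) \<Longrightarrow> (\<And>i j. has_weak_pd U j (g i) (h i j)) \<Longrightarrow>
    nrm f \<le> M \<Longrightarrow> (\<And>i. nrm (g i) \<le> M) \<Longrightarrow> (\<And>i j. nrm (h i j) \<le> M) \<Longrightarrow>
    AE x in \<mu>. \<bar>f x :: real\<bar> \<le> C2 * M" by (rule Linf_embedding) blast
 define K1 where "K1 = C1 * (M1 + M3)"
 have K1: "K1 \<ge> 0" using C1(1) M1(1) M3(1) by (simp add: K1_def)
 have buB: "AE t in ?I. (AE x in \<mu>. norm (u t x) \<le> K1) \<and> (AE x in \<mu>. norm (B t x) \<le> K1)" using M1(2) M3(2)
 proof eventually_elim
  case (elim t)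
  show ?case unfolding K1_def by (intro conjI C1(2)) (use elim M1(1) M3(1) in auto)
 qed
 have curl: "has_weak_curl U (B t) (\<lambda>x. weak_pd U 1 (B t) x $ 2 - weak_pd U 2 (B t) x $ 1)" if "t \<in> {0..T}" for t
  by (intro has_weak_curl_weak_pd sobolev_1D LB(1) that)
 note curl_eq = weak_curl_eq[OF curl]
 have Lcurl: "L2 U (weak_curl U (B t))" if "t \<in> {0..T}" for t
  using has_weak_curl_weak_curl[OF curl[OF that]] by (simp add: has_weak_curl_def)
 have lip_curl: "dst (weak_curl U (B t)) (weak_curl U (B r)) \<le> 2 * M4 * \<bar>t - r\<bar>"
  if rt: "r \<in> {0..T}" "t \<in> {0..T}" for r t
 proof -
  let ?v = "\<lambda>i x. weak_pd U i (B t) x - weak_pd U i (B r) x"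
  have "AE x in \<mu>. weak_curl U (B t) x - weak_curl U (B r) x = ?v 1 x $ 2 - ?v 2 x $ 1"
   using curl_eq[OF rt(1)] curl_eq[OF rt(2)] by eventually_elim simp
  from L2_norm_cong_AE[OF dom_sets L2_diff[OF Lcurl[OF rt(2)] Lcurl[OF rt(1)]] this]
  have "dst (weak_curl U (B t)) (weak_curl U (B r)) \<le> nrm (?v 1) + nrm (?v 2)"
   using L2_norm_curl_le[of ?v] sobolev_1_L2(2)[OF LB(1)] rt by (simp add: L2_diff)
  then show ?thesis using LB(3)[OF rt, of 1] LB(3)[OF rt, of 2] by simp
 qed
 \<comment> \<open>Bounds the second order data of \<open>q\<close>: the first two summands its
   norm, the curl costing two partial derivatives of \<open>B\<close>, and \<open>M4\<close> its
   first and second derivatives.\<close>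
 define M6 where "M6 = \<eta> * (2 * M3) + K1 * M3 + M4"
 define K2 where "K2 = (C2 * M6 + K1 * K1) / \<eta>"
 have LBt: "AE t in ?I. L2 U (B_t t)" using t(2) L2_H_L2[of T 0 B_t] by (simp add: has_time_deriv_def)
 have ind: "AE t in ?I.
   (has_weak_pd U 1 (\<lambda>x. \<eta> * weak_curl U (B t) x - cross_vv (u t x) (B t x)) (\<lambda>x. B_t t x $ 2) \<and>
   has_weak_pd U 2 (\<lambda>x. \<eta> * weak_curl U (B t) x - cross_vv (u t x) (B t x)) (\<lambda>x. - B_t t x $ 1))"
  using sys buB LBt AE_space
 proof eventually_elim
  case (elim t)
  then have t: "t \<in> {0..T}" by auto
  let ?q = "\<lambda>x. \<eta> * weak_curl U (B t) x - cross_vv (u t x) (B t x)"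
  have Lu': "L2 U (u t)" and LB': "L2 U (B t)" using sobolev_1_L2(1) Lu(1) LB(1) t by blast+
  have Lx: "L2 U (\<lambda>x. cross_vv (u t x) (B t x))" using elim by (intro L2_cross_vv(3)[OF LB' L2_measurable[OF Lu']]) auto
  have Lc: "L2 U (\<lambda>x. \<eta> * weak_curl U (B t) x)" by (intro L2_mult Lcurl t)
  note Lq = L2_diff[OF Lc Lx]
  have eq: "ip U (\<lambda>x. B_t t x $ k) \<theta> = - ip U ?q (\<lambda>x. if k = 2 then pd 1 \<theta> x else - pd 2 \<theta> x)"
   if \<theta>: "test_fun U \<theta>" for \<theta> k
  proof -
   let ?\<phi> = "\<lambda>x. \<theta> x *\<^sub>R (axis k 1 :: real^2)"
   let ?w = "\<lambda>x. if k = 2 then pd 1 \<theta> x else - pd 2 \<theta> x"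
   have Lw: "L2 U ?w" using L2_test_fun[OF test_fun_pd[OF \<theta>]] L2_minus by (cases "k = 2") auto
   note c = distr_curl_axis[OF \<theta>] and d = distr_axis
   have "test_fun U ?\<phi>" by (rule test_fun_scaleR_const[OF \<theta>])
   with elim have "distr U (B_t t) ?\<phi> + \<eta> * distr_curl U (weak_curl U (B t)) ?\<phi>
        - distr_curl U (\<lambda>x. cross_vv (u t x) (B t x)) ?\<phi> = 0" by blast
   then show ?thesis unfolding c d ip_diff_left[OF Lc Lx Lw] ip_mult_left by linarith
  qed
  have LBk: "L2 U (\<lambda>x. B_t t x $ k)" for k by (intro L2_nth elim)
  show ?case
  proof (unfold has_weak_pd_iff, intro conjI allI impI)
   fix \<theta> :: "real^2 \<Rightarrow> real" assume \<theta>: "test_fun U \<theta>"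
   show "ip U ?q (pd 1 \<theta>) = - ip U (\<lambda>x. B_t t x $ 2) \<theta>" using eq[OF \<theta>, of 2] by simp
   show "ip U ?q (pd 2 \<theta>) = - ip U (\<lambda>x. - B_t t x $ 1) \<theta>" using eq[OF \<theta>, of 1] by (simp add: ip_minus_left ip_minus_right)
  qed (intro Lq L2_minus LBk)+
 qed
 \<comment> \<open>\<open>B_t\<close> comes from the equations and \<open>B'\<close> from the
   regularity assumption; uniqueness of the time derivative identifies them, so the derivatives of
   \<open>?q\<close> have weak derivatives themselves. Then \<open>K2\<close> results from solving
   \<open>?q\<close> for the curl.\<close>
 have bJ: "AE t in ?I. AE x in \<mu>. \<bar>weak_curl U (B t) x\<bar> \<le> K2"
  using ind buB M3(2) M4(2) has_time_deriv_unique[OF t(2) B'(1)] AE_space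
 proof eventually_elim
  case (elim t)
  then have t: "t \<in> {0..T}" by auto
  let ?q = "\<lambda>x. \<eta> * weak_curl U (B t) x - cross_vv (u t x) (B t x)"
  have Lu': "L2 U (u t)" and LB': "L2 U (B t)" using sobolev_1_L2(1) Lu(1) LB(1) t by blast+
  have bd: "AE x in \<mu>. norm (u t x) \<le> K1" "AE x in \<mu>. norm (B t x) \<le> K1"
   and B't: "sobolev U 1 (B' t)" "sobolev_norm U 1 (B' t) \<le> M4"
   and Bt: "sobolev_norm U (Suc 1) (B t) \<le> M3" using elim by (auto simp: numeral_2_eq_2)
  note Lx = L2_cross_vv(3)[OF LB' L2_measurable[OF Lu'] bd(1)] and nx = L2_cross_vv(4)[OF LB' L2_measurable[OF Lu'] bd(1) K1]
  have Lc: "L2 U (\<lambda>x. \<eta> * weak_curl U (B t) x)" by (intro L2_mult Lcurl t)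
  define g where "g i x = (if i = (1::2) then B' t x $ 2 else - (B' t x $ 1))" for i x
  define h where "h i j x = (if i = (1::2) then weak_pd U j (B' t) x $ 2 else - (weak_pd U j (B' t) x $ 1))" for i j x
  have "AE x in \<mu>. \<bar>?q x\<bar> \<le> C2 * M6"
  proof (rule C2(2))
   have e1: "AE x in \<mu>. B_t t x $ 2 = g 1 x" using elim(5) by eventually_elim (simp add: g_def)
   have e2: "AE x in \<mu>. - B_t t x $ 1 = g 2 x" using elim(5) by eventually_elim (simp add: g_def)
   show "has_weak_pd U i ?q (g i)" for i
   proof (cases "i = 1")
    case True
    show ?thesis unfolding True by (rule has_weak_pd_cong_AE[OF elim(1)[THEN conjunct1] AE_I2[OF refl] e1])
   next
    case False
    then have "i = 2" using exhaust_2[of i] by simp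
    show ?thesis unfolding \<open>i = 2\<close> by (rule has_weak_pd_cong_AE[OF elim(1)[THEN conjunct2] AE_I2[OF refl] e2])
   qed
   note w = sobolev_1D[OF B't(1)]
   show "has_weak_pd U j (g i) (h i j)" for i j
    using has_weak_pd_nth[OF w, of j 2] has_weak_pd_mult[OF has_weak_pd_nth[OF w, of j 1], of "-1"] exhaust_2[of i]
    by (auto simp: g_def[abs_def] h_def[abs_def])
   have "nrm (g i) \<le> nrm (B' t)" "nrm (h i j) \<le> nrm (weak_pd U j (B' t))" for i j
    using exhaust_2[of i] L2_norm_nth_le[OF sobolev_1_L2(1)[OF B't(1)]] L2_norm_nth_le[OF sobolev_1_L2(2)[OF B't(1)]]
    by (auto simp: g_def[abs_def] h_def[abs_def] L2_norm_uminus)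
   moreover have "M4 \<le> M6" using M3(1) K1 par(3) by (simp add: M6_def)
   then have "nrm (B' t) \<le> M6" "nrm (weak_pd U j (B' t)) \<le> M6" for j
    using order_trans[OF sobolev_norm_1_bounds(1) B't(2)] order_trans[OF sobolev_norm_1_bounds(2) B't(2)]
    by (blast intro: order_trans)+
   ultimately show "nrm (g i) \<le> M6" "nrm (h i j) \<le> M6" for i j by (blast intro: order_trans)+
   have b: "nrm (B t) \<le> M3" "nrm (weak_pd U i (B t)) \<le> M3" for i
    using order_trans[OF sobolev_norm_Suc_bounds(1) Bt]
     order_trans[OF sobolev_norm_1_bounds(1) order_trans[OF sobolev_norm_Suc_bounds(2) Bt]] by blast+
   have "nrm (weak_curl U (B t)) \<le> 2 * M3" unfolding L2_norm_cong_AE[OF dom_sets Lcurl[OF t] curl_eq[OF t]]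
    using L2_norm_curl_le[of "\<lambda>i. weak_pd U i (B t)", OF sobolev_1_L2(2)[OF LB(1)[OF t]]] b(2)[of 1] b(2)[of 2] by linarith
   then have "\<eta> * nrm (weak_curl U (B t)) \<le> \<eta> * (2 * M3)" using par(3) by (intro mult_left_mono) auto
   moreover have "K1 * nrm (B t) \<le> K1 * M3" using b(1) K1 by (rule mult_left_mono)
   moreover have "nrm ?q \<le> \<eta> * nrm (weak_curl U (B t)) + K1 * nrm (B t)"
    using L2_norm_triangle_diff[OF Lc Lx] nx par(3) by (simp add: L2_norm_mult)
   ultimately show "nrm ?q \<le> M6" using M4(1) by (simp add: M6_def)
  qed
  with bd show ?case
  proof eventually_elim
   case (elim x)
   have "\<bar>cross_vv (u t x) (B t x)\<bar> \<le> K1 * K1"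
    by (rule order_trans[OF abs_cross_vv_le]) (use elim K1 in \<open>auto intro: mult_mono\<close>)
   then have "\<bar>\<eta> * weak_curl U (B t) x\<bar> \<le> C2 * M6 + K1 * K1" using elim by linarith
   then show ?case using par(3) by (simp add: K2_def abs_mult field_simps)
  qed
 qed
 \<comment> \<open>One constant for all bounds; the factors 2 arise because the curl of
   \<open>B\<close> and the gradient of \<open>p\<close> each combine two partial
   derivatives.\<close>
 define K where "K = 1 + K1 + K2 + M2 + 2 * M4 + 2 * M5"
 have "K2 \<ge> 0" using C2(1) M3(1) M4(1) K1 par(3) by (simp add: K2_def M6_def)
 then have K: "K > 0" "K1 \<le> K" "K2 \<le> K" "M2 \<le> K" "2 * M4 \<le> K" "2 * M5 \<le> K" "M4 \<le> K" "M5 \<le> K"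
  using K1 M2(1) M4(1) M5(1) by (auto simp: K_def)
 have K_mono: "a \<le> M * \<bar>t - r\<bar> \<Longrightarrow> M \<le> K \<Longrightarrow> a \<le> K * \<bar>t - r\<bar>" for a M t r :: real
  by (meson order_trans mult_right_mono abs_ge_zero)
 have all: "zero_trace U (u t) \<and> div_free U (u t) \<and> zero_tangential_trace U (B t) \<and>
   (AE x in \<mu>. norm (u t x) \<le> K) \<and> (AE x in \<mu>. norm (B t x) \<le> K) \<and>
   (AE x in \<mu>. \<bar>weak_curl U (B t) x\<bar> \<le> K)" if t: "t \<in> {0..T}" for t
 proof -
  \<comment> \<open>All properties that pass to limits in time are gathered, so that one sequence of
    good times serves for all of them.\<close>
  define P where "P r \<longleftrightarrow> zero_trace U (u r) \<and> div_free U (u r) \<and> zero_tangential_trace U (B r) \<and>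
   (AE x in \<mu>. norm (u r x) \<le> K) \<and> (AE x in \<mu>. norm (B r x) \<le> K) \<and>
   (AE x in \<mu>. norm (weak_curl U (B r) x) \<le> K)" for r
  have "AE r in ?I. P r" using sys buB bJ
  proof eventually_elim
   case (elim r)
   have AE_mono: "AE x in \<mu>. a x \<le> L \<Longrightarrow> L \<le> K \<Longrightarrow> AE x in \<mu>. a x \<le> K" for a L by (erule eventually_mono) simp
   show ?case unfolding P_def
   proof (intro conjI)
    show "AE x in \<mu>. norm (u r x) \<le> K" "AE x in \<mu>. norm (B r x) \<le> K"
     by (rule AE_mono[OF _ K(2)], use elim in blast)+
    show "AE x in \<mu>. norm (weak_curl U (B r) x) \<le> K" by (rule AE_mono[OF _ K(3)]) (use elim in simp)
   qed (use elim in blast)+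
  qed
  from AE_interval_approx[OF par(1) t this] obtain \<tau>
   where \<tau>: "\<And>j::nat. P (\<tau> j)" "\<And>j. \<tau> j \<in> {0<..<T}" "\<And>j. \<bar>\<tau> j - t\<bar> \<le> (1/2)^j" by blast
  note \<tau>1 = \<tau>(1)[unfolded P_def]
  have \<tau>': "\<tau> j \<in> {0..T}" for j using \<tau>(2)[of j] by auto
  have L\<tau>: "L2 U (u (\<tau> j))" "L2 U (u t)" "L2 U (B (\<tau> j))" "L2 U (B t)" for j
   using sobolev_1_L2(1) Lu(1) LB(1) t \<tau>' by blast+
  have limu: "(\<lambda>j. dst (u (\<tau> j)) (u t)) \<longlonglongrightarrow> 0" by (rule L2_limit_of_Lipschitz[OF Lu(2)[OF t \<tau>'] \<tau>(3) M2(1)])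
  have limB: "(\<lambda>j. dst (B (\<tau> j)) (B t)) \<longlonglongrightarrow> 0" by (rule L2_limit_of_Lipschitz[OF LB(2)[OF t \<tau>'] \<tau>(3) M4(1)])
  have limc: "(\<lambda>j. dst (weak_curl U (B (\<tau> j))) (weak_curl U (B t))) \<longlonglongrightarrow> 0"
   using M4(1) by (intro L2_limit_of_Lipschitz[of "\<lambda>r. weak_curl U (B r)", OF lip_curl[OF t \<tau>'] \<tau>(3)]) simp
  have "zero_trace U (u t)"
   using L2_limit_of_Lipschitz[of "\<lambda>r. weak_pd U i (u r)" for i, OF Lu(3)[OF t \<tau>'] \<tau>(3) M2(1)] \<tau>1
   by (intro zero_trace_limit[OF _ sobolev_1D[OF Lu(1)[OF t]] limu]) auto
  moreover have "div_free U (u t)" unfolding has_weak_div_iff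
  proof (intro conjI allI impI)
   fix \<phi> :: "real^2 \<Rightarrow> real" assume \<phi>: "test_fun U \<phi>"
   have "(\<lambda>j. ip U (u (\<tau> j)) (\<lambda>x. \<chi> i. pd i \<phi> x)) \<longlonglongrightarrow> ip U (u t) (\<lambda>x. \<chi> i. pd i \<phi> x)"
    by (rule tendsto_ip_left[OF L\<tau>(1,2) L2_grad_test[OF \<phi>] limu])
   moreover have "ip U (u (\<tau> j)) (\<lambda>x. \<chi> i. pd i \<phi> x) = 0" for j using \<tau>1[of j] \<phi> by (simp add: has_weak_div_iff)
   ultimately show "ip U (u t) (\<lambda>x. \<chi> i. pd i \<phi> x) = - ip U (\<lambda>_. 0) \<phi>"
    using LIMSEQ_unique[OF _ tendsto_const] by simp
  qed (simp_all add: L\<tau>)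
  moreover have "zero_tangential_trace U (B t)" using \<tau>1 has_weak_curl_weak_curl[OF curl[OF \<tau>']]
   by (intro zero_tangential_trace_limit(1)[OF _ _ L\<tau>(4) Lcurl[OF t] limB limc]) auto
  moreover have "AE x in \<mu>. norm (u t x) \<le> K" using \<tau>1 by (intro AE_bound_limit[OF L\<tau>(1,2) limu]) auto
  moreover have "AE x in \<mu>. norm (B t x) \<le> K" using \<tau>1 by (intro AE_bound_limit[OF L\<tau>(3,4) limB]) auto
  moreover have "AE x in \<mu>. norm (weak_curl U (B t) x) \<le> K"
   using \<tau>1 by (intro AE_bound_limit[OF Lcurl[OF \<tau>'] Lcurl[OF t] limc]) auto
  ultimately show ?thesis by simp
 qed
 have "exact_solution U T \<nu> \<eta> s K u B u_t B_t p"
 proof unfold_locales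
  show "T > 0" "\<nu> > 0" "\<eta> > 0" "s > 0" "K > 0" using par K by auto
  fix r t assume rt: "r \<in> {0..T}" "t \<in> {0..T}"
  show "dst (u t) (u r) \<le> K * \<bar>t - r\<bar>" by (rule K_mono[OF Lu(2)[OF rt] K(4)])
  show "dst (weak_pd U i (u t)) (weak_pd U i (u r)) \<le> K * \<bar>t - r\<bar>" for i by (rule K_mono[OF Lu(3)[OF rt] K(4)])
  show "dst (B t) (B r) \<le> K * \<bar>t - r\<bar>" by (rule K_mono[OF LB(2)[OF rt] K(7)])
  show "dst (weak_curl U (B t)) (weak_curl U (B r)) \<le> K * \<bar>t - r\<bar>" by (rule K_mono[OF lip_curl[OF rt] K(5)])
  have eq: "(\<lambda>x. weak_grad U (p t) x - weak_grad U (p r) x) = (\<lambda>x. \<chi> i. weak_pd U i (p t) x - weak_pd U i (p r) x)"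
   by (simp add: weak_grad_def vec_eq_iff fun_eq_iff)
  have "dst (weak_grad U (p t)) (weak_grad U (p r))
   \<le> dst (weak_pd U 1 (p t)) (weak_pd U 1 (p r)) + dst (weak_pd U 2 (p t)) (weak_pd U 2 (p r))"
   unfolding eq by (intro L2_norm_vec_le L2_diff sobolev_1_L2(2)[OF Lp(1)] rt)
  also have "\<dots> \<le> 2 * M5 * \<bar>t - r\<bar>" using Lp(3)[OF rt, of 1] Lp(3)[OF rt, of 2] by simp
  finally show "dst (weak_grad U (p t)) (weak_grad U (p r)) \<le> K * \<bar>t - r\<bar>" by (rule K_mono[OF _ K(6)])
 next
  show "AE t in ?I. \<forall>\<phi>. test_fun U \<phi> \<longrightarrow>
   ip U (u_t t) \<phi> + \<nu> * (\<Sum>i\<in>UNIV. ip U (weak_pd U i (u t)) (pd i \<phi>))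
    + ip U (u t) (\<lambda>x. \<chi> i. weak_pd U i (u t) x \<bullet> \<phi> x) + ip U (weak_grad U (p t)) \<phi>
    + s * ip U (\<lambda>x. cross_vs (B t x) (weak_curl U (B t) x)) \<phi> = 0" using sys AE_space
  proof eventually_elim
   case (elim t)
   then have t: "t \<in> {0..T}" by auto
   show ?case
   proof (intro allI impI)
    fix \<phi> :: "real^2 \<Rightarrow> real^2" assume \<phi>: "test_fun U \<phi>"
    have "distr U (u_t t) \<phi> - \<nu> * distr_laplacian U (u t) \<phi>
        + distr U (convect U (u t) (u t)) \<phi> + distr U (weak_grad U (p t)) \<phi>
        + s * distr U (\<lambda>x. cross_vs (B t x) (weak_curl U (B t) x)) \<phi> = 0" using elim \<phi> by blast
    then show "ip U (u_t t) \<phi> + \<nu> * (\<Sum>i\<in>UNIV. ip U (weak_pd U i (u t)) (pd i \<phi>))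
    + ip U (u t) (\<lambda>x. \<chi> i. weak_pd U i (u t) x \<bullet> \<phi> x) + ip U (weak_grad U (p t)) \<phi>
    + s * ip U (\<lambda>x. cross_vs (B t x) (weak_curl U (B t) x)) \<phi> = 0"
     unfolding distr_laplacian_weak_pd[OF Lu(1)[OF t] \<phi>] distr_eq_ip distr_convect by simp
   qed
  qed
 qed (use all Lp(1) C t ind in \<open>simp_all\<close>)
 then show ?thesis by (rule that)
qed

section \<open>Consistency of the scheme\<close>

context bounded_open
begin

lemma convection_Cauchy_Schwarz:
 fixes w :: "2 \<Rightarrow> real^2 \<Rightarrow> real^2"
 assumes v: "v \<in> borel_measurable \<mu>" "AE x in \<mu>. norm (v x) \<le> K" and "K \<ge> 0"
  and w: "\<And>i. L2 U (w i)" and \<phi>: "L2 U \<phi>"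
 shows "\<bar>ip U v (\<lambda>x. \<chi> i. w i x \<bullet> \<phi> x)\<bar> \<le> K * (nrm (w 1) + nrm (w 2)) * nrm \<phi>"
proof -
 have vw: "L2 U (\<lambda>x. v x $ i *\<^sub>R w i x)" "nrm (\<lambda>x. v x $ i *\<^sub>R w i x) \<le> K * nrm (w i)" for i
 proof -
  have "AE x in \<mu>. norm (v x $ i *\<^sub>R w i x) \<le> K * norm (w i x)"
   using v(2) by eventually_elim (auto intro!: mult_right_mono order_trans[OF component_le_norm_cart])
  moreover have "(\<lambda>x. v x $ i *\<^sub>R w i x) \<in> borel_measurable \<mu>"
   by (intro borel_measurable_scaleR borel_measurable_vec_nth v(1) L2_measurable[OF w])
  ultimately show "L2 U (\<lambda>x. v x $ i *\<^sub>R w i x)" "nrm (\<lambda>x. v x $ i *\<^sub>R w i x) \<le> K * nrm (w i)"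
   using L2_dominated[OF w] \<open>K \<ge> 0\<close> by blast+
 qed
 have 1: "ip U v (\<lambda>x. \<chi> i. w i x \<bullet> \<phi> x) = ip U (\<lambda>x. v x $ 1 *\<^sub>R w 1 x + v x $ 2 *\<^sub>R w 2 x) \<phi>"
  unfolding ip_def by (simp add: inner_vec_def[of "v _"] sum_2 inner_add_left)
 have 2: "\<bar>ip U (\<lambda>x. v x $ 1 *\<^sub>R w 1 x + v x $ 2 *\<^sub>R w 2 x) \<phi>\<bar>
   \<le> nrm (\<lambda>x. v x $ 1 *\<^sub>R w 1 x + v x $ 2 *\<^sub>R w 2 x) * nrm \<phi>" by (intro ip_Cauchy_Schwarz L2_add vw \<phi>)
 have "nrm (\<lambda>x. v x $ 1 *\<^sub>R w 1 x + v x $ 2 *\<^sub>R w 2 x) \<le> K * (nrm (w 1) + nrm (w 2))"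
  using L2_norm_triangle[OF vw(1) vw(1), of 1 2] vw(2)[of 1] vw(2)[of 2] by (simp add: distrib_left)
 from mult_right_mono[OF this, of "nrm \<phi>"] 2 show ?thesis unfolding 1 by simp
qed

end

context exact_solution
begin

abbreviation J where "J t \<equiv> weak_curl U (B t)"

text \<open>The exact counterpart of $u_\star^n$: with it, the defining relation of $u_\star^n$ has no consistency error.\<close>

definition uhat :: "real \<Rightarrow> real \<Rightarrow> real^2 \<Rightarrow> real^2" where
 "uhat \<tau> r x = u r x - (\<tau> * s) *\<^sub>R cross_vs (B r x) (J (r + \<tau>) x)"

lemma L2_exact:
 assumes "t \<in> {0..T}"
 shows "L2 U (u t)" "L2 U (B t)" "L2 U (J t)" "L2 U (weak_pd U i (u t))" "L2 U (weak_grad U (p t))"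
proof -
 show "L2 U (u t)" "L2 U (weak_pd U i (u t))" using sobolev_1_L2 zero_trace_sobolev[OF trace_u[OF assms]] by blast+
 show "L2 U (B t)" "L2 U (J t)"
  using zero_tangential_trace_weak_curl[OF trace_B[OF assms]] by (auto simp: has_weak_curl_def)
 show "L2 U (weak_grad U (p t))" by (rule L2_weak_grad[OF sobolev_p[OF assms]])
qed

lemma lip: "a \<le> K * \<bar>b\<bar> \<Longrightarrow> \<bar>b\<bar> \<le> \<tau> \<Longrightarrow> a \<le> K * \<tau>" using pos by (meson order_trans mult_left_mono less_imp_le)

lemma normal_u: "t \<in> {0..T} \<Longrightarrow> zero_normal_trace U (u t)" by (intro zero_trace_imp_zero_normal_trace trace_u div_u)

lemma L2_Lorentz:
 assumes "r \<in> {0..T}" "t \<in> {0..T}"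
 shows "L2 U (\<lambda>x. cross_vs (B r x) (J t x))" "AE x in \<mu>. norm (cross_vs (B r x) (J t x)) \<le> K * K"
proof -
 show "L2 U (\<lambda>x. cross_vs (B r x) (J t x))"
  by (rule L2_cross_vs_left(1)[OF L2_exact(2)[OF assms(1)] L2_measurable[OF L2_exact(3)[OF assms(2)]] bound_curl[OF assms(2)]])
 show "AE x in \<mu>. norm (cross_vs (B r x) (J t x)) \<le> K * K" using bound_B[OF assms(1)] bound_curl[OF assms(2)]
  by eventually_elim (auto simp: norm_cross_vs intro: mult_mono')
qed

lemma uhat_bound:
 assumes "0 < \<tau>" "0 \<le> r" "r + \<tau> \<le> T"
 shows "L2 U (uhat \<tau> r)" "AE x in \<mu>. norm (uhat \<tau> r x) \<le> K + T * s * K * K"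
proof -
 have rt: "r \<in> {0..T}" "r + \<tau> \<in> {0..T}" using assms by auto
 show "L2 U (uhat \<tau> r)" unfolding uhat_def[abs_def] by (intro L2_diff L2_scaleR L2_exact rt L2_Lorentz)
 show "AE x in \<mu>. norm (uhat \<tau> r x) \<le> K + T * s * K * K" using bound_u[OF rt(1)] L2_Lorentz(2)[OF rt]
 proof eventually_elim
  case (elim x)
  have "norm (uhat \<tau> r x) \<le> norm (u r x) + (\<tau> * s) * norm (cross_vs (B r x) (J (r + \<tau>) x))"
   unfolding uhat_def using norm_triangle_ineq4[of "u r x" "(\<tau> * s) *\<^sub>R cross_vs (B r x) (J (r + \<tau>) x)"] assms pos by simp
  also have "\<dots> \<le> K + (T * s) * (K * K)" using elim assms pos by (intro add_mono mult_mono) auto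
  finally show ?case by (simp add: mult_ac)
 qed
qed

text \<open>In order: the time shift of the curl, the shifts of \<open>u\<close> and of
  \<open>B\<close> in their product, and the correction of size \<open>\<tau> * s\<close> inside
  \<open>uhat\<close>; the bracket bounds the norm of \<open>B r\<close>.\<close>

definition induction_const where
 "induction_const = \<eta> * K + 2 * K * K + s * K * K * (nrm (B 0) + K * T)"

proposition induction_consistency:
 assumes \<tau>: "0 < \<tau>" "0 \<le> r" "r + \<tau> \<le> T" and v: "zero_tangential_trace U v" "has_weak_curl U v c"
 shows "\<bar>ip U (B (r + \<tau>)) v - ip U (B r) v
  + \<tau> * ip U (\<lambda>x. \<eta> * J (r + \<tau>) x - cross_vv (uhat \<tau> r x) (B r x)) c\<bar> \<le> induction_const * \<tau>\<^sup>2 * nrm c"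
proof -
 have rt: "r \<in> {0..T}" "r + \<tau> \<in> {0..T}" "0 \<in> {0..T}" using \<tau> by auto
 have Lv: "L2 U v" and Lc: "L2 U c" using v(2) by (auto simp: has_weak_curl_def)
 let ?a = "\<lambda>x. \<eta> * J (r + \<tau>) x - cross_vv (uhat \<tau> r x) (B r x)"
 note mB = L2_measurable[OF L2_exact(2)[OF rt(1)]]
 have La: "L2 U ?a"
  by (intro L2_diff L2_mult L2_exact rt L2_cross_vv(1)[OF uhat_bound(1)[OF \<tau>] mB bound_B[OF rt(1)]])
 let ?w = "\<lambda>x. cross_vs (B r x) (J (r + \<tau>) x)"
 have "nrm (\<lambda>x. B r x) \<le> nrm (B 0) + K * T"
 proof -
  have "nrm (B r) \<le> nrm (B 0) + dst (B r) (B 0)"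
   using L2_norm_triangle[OF L2_exact(2)[OF rt(3)] L2_diff[OF L2_exact(2)[OF rt(1)] L2_exact(2)[OF rt(3)]]] by simp
  moreover have "K * \<bar>r - 0\<bar> \<le> K * T" using rt pos by (intro mult_left_mono) auto
  ultimately show ?thesis using Lipschitz_B[OF rt(3,1)] by linarith
 qed
 then have w4: "nrm (\<lambda>x. cross_vv (?w x) (B r x)) \<le> K * K * (nrm (B 0) + K * T)"
  using L2_cross_vv(4)[OF L2_exact(2)[OF rt(1)] L2_measurable[OF L2_Lorentz(1)[OF rt(1,2)]] L2_Lorentz(2)[OF rt(1,2)]] pos
  by (auto intro: order_trans mult_left_mono)
 have "\<bar>ip U (B (r + \<tau>)) v - ip U (B r) v + ((r + \<tau>) - r) * ip U ?a c\<bar>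
   \<le> ((r + \<tau>) - r) * (induction_const * \<tau> * nrm c)"
 proof (rule time_increment_bound[OF pos(1) time_B Lv])
  show "AE t in lebesgue_on {0<..<T}. t \<in> {r<..<r + \<tau>} \<longrightarrow> \<bar>ip U (B_t t) v + ip U ?a c\<bar> \<le> induction_const * \<tau> * nrm c"
   using induction_eq
  proof eventually_elim
   case (elim t)
   show ?case
   proof
   assume "t \<in> {r<..<r + \<tau>}"
   then have t: "t \<in> {0..T}" "\<bar>t - r\<bar> \<le> \<tau>" "\<bar>r + \<tau> - t\<bar> \<le> \<tau>" using \<tau> by auto
   let ?q = "\<lambda>x. \<eta> * J t x - cross_vv (u t x) (B t x)"
   note mBt = L2_measurable[OF L2_exact(2)[OF t(1)]]
   have Lq: "L2 U ?q" using elim(1) by (auto dest: has_weak_pd_L2)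
   define g where "g i x = (if i = (1::2) then B_t t x $ 2 else - (B_t t x $ 1))" for i x
   have "has_weak_pd U i ?q (g i)" for i using elim(1) exhaust_2[of i] by (auto simp: g_def[abs_def])
   from zero_tangential_trace_ip[OF v this]
   have "ip U (B_t t) v = - ip U ?q c"
   proof -
    have "(\<lambda>x. vector [g 2 x, - g 1 x] :: real^2) = (\<lambda>x. - B_t t x)"
     by (simp add: g_def fun_eq_iff vec_eq_iff forall_2)
    with \<open>ip U v _ = _\<close> show ?thesis by (simp add: ip_minus_right ip_commute)
   qed
   then have eq: "ip U (B_t t) v + ip U ?a c = ip U (\<lambda>x. ?a x - ?q x) c" by (simp add: ip_diff_left[OF La Lq Lc])
   let ?d1 = "\<lambda>x. \<eta> * (J (r + \<tau>) x - J t x)" and ?d2 = "\<lambda>x. cross_vv (u t x - u r x) (B t x)"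
    and ?d3 = "\<lambda>x. cross_vv (u r x) (B t x - B r x)" and ?d4 = "\<lambda>x. (\<tau> * s) * cross_vv (?w x) (B r x)"
   have dec: "(\<lambda>x. ?a x - ?q x) = (\<lambda>x. ((?d1 x + ?d2 x) + ?d3 x) + ?d4 x)"
    by (simp add: fun_eq_iff uhat_def cross_vv_diff_left cross_vv_diff_right cross_vv_scaleR_left algebra_simps)
   have L1: "L2 U ?d1" "nrm ?d1 \<le> \<eta> * (K * \<tau>)"
   proof -
    show "L2 U ?d1" by (intro L2_mult L2_diff L2_exact t rt)
    show "nrm ?d1 \<le> \<eta> * (K * \<tau>)"
     using mult_left_mono[OF lip[OF Lipschitz_curl[OF t(1) rt(2)] t(3)], of \<eta>] pos by (simp add: L2_norm_mult)
   qed
   have L2': "L2 U ?d2" "nrm ?d2 \<le> K * (K * \<tau>)"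
   proof -
    note d = L2_diff[OF L2_exact(1)[OF t(1)] L2_exact(1)[OF rt(1)]]
    show "L2 U ?d2" by (rule L2_cross_vv(1)[OF d mBt bound_B[OF t(1)]])
    have "nrm ?d2 \<le> K * dst (u t) (u r)" using L2_cross_vv(2)[OF d mBt bound_B[OF t(1)]] pos by simp
    also have "\<dots> \<le> K * (K * \<tau>)" using pos by (intro mult_left_mono lip[OF Lipschitz_u[OF rt(1) t(1)] t(2)]) simp
    finally show "nrm ?d2 \<le> K * (K * \<tau>)" .
   qed
   have L3: "L2 U ?d3" "nrm ?d3 \<le> K * (K * \<tau>)"
   proof -
    note d = L2_diff[OF L2_exact(2)[OF t(1)] L2_exact(2)[OF rt(1)]]
     and mu = L2_measurable[OF L2_exact(1)[OF rt(1)]]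
    show "L2 U ?d3" by (rule L2_cross_vv(3)[OF d mu bound_u[OF rt(1)]])
    have "nrm ?d3 \<le> K * dst (B t) (B r)" using L2_cross_vv(4)[OF d mu bound_u[OF rt(1)]] pos by simp
    also have "\<dots> \<le> K * (K * \<tau>)" using pos by (intro mult_left_mono lip[OF Lipschitz_B[OF rt(1) t(1)] t(2)]) simp
    finally show "nrm ?d3 \<le> K * (K * \<tau>)" .
   qed
   have L4: "L2 U ?d4" "nrm ?d4 \<le> (\<tau> * s) * (K * K * (nrm (B 0) + K * T))"
   proof -
    show "L2 U ?d4" by (intro L2_mult L2_cross_vv(1)[OF L2_Lorentz(1)[OF rt(1,2)] mB bound_B[OF rt(1)]])
    show "nrm ?d4 \<le> (\<tau> * s) * (K * K * (nrm (B 0) + K * T))"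
     using w4 \<tau> pos by (simp add: L2_norm_mult mult_left_mono)
   qed
   have "dst ?a ?q \<le> nrm ?d1 + nrm ?d2 + nrm ?d3 + nrm ?d4" unfolding dec using L2_norm_triangle[OF L1(1) L2'(1)]
     L2_norm_triangle[OF L2_add[OF L1(1) L2'(1)] L3(1)]
     L2_norm_triangle[OF L2_add[OF L2_add[OF L1(1) L2'(1)] L3(1)] L4(1)] by linarith
   also have "\<dots> \<le> induction_const * \<tau>" using L1(2) L2'(2) L3(2) L4(2) by (simp add: induction_const_def algebra_simps)
   finally have "dst ?a ?q * nrm c \<le> induction_const * \<tau> * nrm c" by (rule mult_right_mono) simp
   with ip_Cauchy_Schwarz[OF L2_diff[OF La Lq] Lc] show "\<bar>ip U (B_t t) v + ip U ?a c\<bar> \<le> induction_const * \<tau> * nrm c"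
    unfolding eq by linarith
   qed
  qed
 qed (use \<tau> in auto)
 then show ?thesis by (simp add: power2_eq_square mult_ac)
qed

text \<open>The advecting field \<open>w\<close> is an error, small in norm only, and the gradient
  of \<open>u t\<close> need not be bounded. Integration by parts moves the derivative to
  \<open>\<phi>\<close>, leaving the bounded \<open>u t\<close>.\<close>

lemma convection_exact_bound:
 assumes w: "zero_normal_trace U w" "div_free U w" and t: "t \<in> {0..T}" and \<phi>: "test_fun U \<phi>"
 shows "\<bar>ip U w (\<lambda>x. \<chi> i. weak_pd U i (u t) x \<bullet> \<phi> x)\<bar> \<le> K * nrm w * (nrm (pd 1 \<phi>) + nrm (pd 2 \<phi>))"
proof -
 note p = L2_test_fun[OF test_fun_pd[OF \<phi>]] and m = L2_measurable[OF L2_exact(1)[OF t]]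
 have up: "L2 U (\<lambda>x. u t x \<bullet> pd i \<phi> x)" "nrm (\<lambda>x. u t x \<bullet> pd i \<phi> x) \<le> K * nrm (pd i \<phi>)" for i
  using L2_inner_bounded[OF p[of i] m bound_u[OF t]] pos by (auto simp: inner_commute)
 have "ip U w (\<lambda>x. \<chi> i. weak_pd U i (u t) x \<bullet> \<phi> x) = - ip U w (\<lambda>x. \<chi> i. u t x \<bullet> pd i \<phi> x)"
  by (rule convection_by_parts[OF w sobolev_1D[OF zero_trace_sobolev[OF trace_u[OF t]]] \<phi>])
 then have "\<bar>ip U w (\<lambda>x. \<chi> i. weak_pd U i (u t) x \<bullet> \<phi> x)\<bar> \<le> nrm w * nrm (\<lambda>x. \<chi> i. u t x \<bullet> pd i \<phi> x)"
  using ip_Cauchy_Schwarz[OF _ L2_vec[OF up(1)], of w] w(2) by (simp add: has_weak_div_def)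
 also have "\<dots> \<le> nrm w * (K * nrm (pd 1 \<phi>) + K * nrm (pd 2 \<phi>))"
  using L2_norm_vec_le[of "\<lambda>i x. u t x \<bullet> pd i \<phi> x", OF up(1)] up(2)[of 1] up(2)[of 2] by (intro mult_left_mono) auto
 finally show ?thesis by (simp add: algebra_simps)
qed

text \<open>In order: viscosity, convection (two parts for the shifted gradients, one for the
  shifted advecting field), pressure, Lorentz force.\<close>

definition momentum_const where
 "momentum_const = \<nu> * K + 3 * K * K + K + s * (2 * K * K)"

proposition momentum_consistency:
 assumes \<tau>: "0 < \<tau>" "0 \<le> r" "r + \<tau> \<le> T" and \<phi>: "test_fun U \<phi>"
 shows "\<bar>ip U (u (r + \<tau>)) \<phi> - ip U (u r) \<phi> + \<tau> * (\<nu> * (\<Sum>i\<in>UNIV. ip U (weak_pd U i (u (r + \<tau>))) (pd i \<phi>))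
   + ip U (u r) (\<lambda>x. \<chi> i. weak_pd U i (u (r + \<tau>)) x \<bullet> \<phi> x) + ip U (weak_grad U (p r)) \<phi>
   + s * ip U (\<lambda>x. cross_vs (B r x) (J (r + \<tau>) x)) \<phi>)\<bar>
  \<le> momentum_const * \<tau>\<^sup>2 * (nrm \<phi> + nrm (pd 1 \<phi>) + nrm (pd 2 \<phi>))"
proof -
 have rt: "r \<in> {0..T}" "r + \<tau> \<in> {0..T}" using \<tau> by auto
 note L\<phi> = L2_test_fun[OF \<phi>] and Lp = L2_test_fun[OF test_fun_pd[OF \<phi>]]
 let ?N = "nrm \<phi>" and ?P = "nrm (pd 1 \<phi>) + nrm (pd 2 \<phi>)"
 let ?A = "\<nu> * (\<Sum>i\<in>UNIV. ip U (weak_pd U i (u (r + \<tau>))) (pd i \<phi>))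
   + ip U (u r) (\<lambda>x. \<chi> i. weak_pd U i (u (r + \<tau>)) x \<bullet> \<phi> x) + ip U (weak_grad U (p r)) \<phi>
   + s * ip U (\<lambda>x. cross_vs (B r x) (J (r + \<tau>) x)) \<phi>"
 have "\<bar>ip U (u (r + \<tau>)) \<phi> - ip U (u r) \<phi> + ((r + \<tau>) - r) * ?A\<bar> \<le> ((r + \<tau>) - r) * (momentum_const * \<tau> * (?N + ?P))"
 proof (rule time_increment_bound[OF pos(1) time_u L\<phi>])
  show "AE t in lebesgue_on {0<..<T}. t \<in> {r<..<r + \<tau>} \<longrightarrow> \<bar>ip U (u_t t) \<phi> + ?A\<bar> \<le> momentum_const * \<tau> * (?N + ?P)"
   using momentum
  proof eventually_elim
   case (elim t)
   show ?case
   proof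
   assume "t \<in> {r<..<r + \<tau>}"
   then have t: "t \<in> {0..T}" "\<bar>t - r\<bar> \<le> \<tau>" "\<bar>r + \<tau> - t\<bar> \<le> \<tau>" "\<bar>r - t\<bar> \<le> \<tau>" using \<tau> by auto
   let ?w = "\<lambda>i x. weak_pd U i (u (r + \<tau>)) x - weak_pd U i (u t) x"
   have Lw: "L2 U (?w i)" "nrm (?w i) \<le> K * \<tau>" for i
    by (intro L2_diff L2_exact rt t lip[OF Lipschitz_pd_u[OF t(1) rt(2)] t(3)])+
   let ?v = "\<lambda>i. ip U (weak_pd U i (u (r + \<tau>))) (pd i \<phi>) - ip U (weak_pd U i (u t)) (pd i \<phi>)"
   have "\<bar>?v i\<bar> \<le> K * \<tau> * nrm (pd i \<phi>)" for i
   proof -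
    have "?v i = ip U (?w i) (pd i \<phi>)" using L2_exact(4)[OF rt(2)] L2_exact(4)[OF t(1)] Lp by (simp add: ip_diff_left)
    then have "\<bar>?v i\<bar> \<le> nrm (?w i) * nrm (pd i \<phi>)" using ip_Cauchy_Schwarz[OF Lw(1) Lp] by simp
    also have "\<dots> \<le> K * \<tau> * nrm (pd i \<phi>)" by (rule mult_right_mono[OF Lw(2)]) simp
    finally show ?thesis .
   qed
   from this[of 1] this[of 2] have "\<bar>(\<Sum>i\<in>UNIV. ip U (weak_pd U i (u (r + \<tau>))) (pd i \<phi>)) - (\<Sum>i\<in>UNIV. ip U (weak_pd U i (u t)) (pd i \<phi>))\<bar> \<le> K * \<tau> * ?P"
    by (simp add: sum_2 distrib_left)
   then have v: "\<bar>\<nu> * ((\<Sum>i\<in>UNIV. ip U (weak_pd U i (u (r + \<tau>))) (pd i \<phi>)) - (\<Sum>i\<in>UNIV. ip U (weak_pd U i (u t)) (pd i \<phi>)))\<bar> \<le> \<nu> * (K * \<tau> * ?P)"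
    using pos by (simp add: abs_mult mult_left_mono)
   let ?c = "\<lambda>a b. ip U (u a) (\<lambda>x. \<chi> i. weak_pd U i (u b) x \<bullet> \<phi> x)"
   have Lx: "L2 U (\<lambda>x. \<chi> i. weak_pd U i (u b) x \<bullet> \<phi> x)" if "b \<in> {0..T}" for b
    by (intro L2_vec L2_inner_test[OF _ \<phi>] L2_exact that)
   \<comment> \<open>The shift of the gradient is paired with the bounded \<open>u r\<close>; the
     shift of the advecting field is treated by integration by parts, at the price of derivatives of
     \<open>\<phi>\<close>.\<close>
   have ceq: "?c r (r + \<tau>) - ?c t t = ip U (u r) (\<lambda>x. \<chi> i. ?w i x \<bullet> \<phi> x)
    + ip U (\<lambda>x. u r x - u t x) (\<lambda>x. \<chi> i. weak_pd U i (u t) x \<bullet> \<phi> x)"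
   proof -
    have "(\<lambda>x. \<chi> i. ?w i x \<bullet> \<phi> x) = (\<lambda>x. (\<chi> i. weak_pd U i (u (r + \<tau>)) x \<bullet> \<phi> x) - (\<chi> i. weak_pd U i (u t) x \<bullet> \<phi> x))"
     by (simp add: fun_eq_iff vec_eq_iff inner_diff_left)
    then show ?thesis using ip_diff_right[OF Lx[OF rt(2)] Lx[OF t(1)] L2_exact(1)[OF rt(1)]]
      ip_diff_left[OF L2_exact(1)[OF rt(1)] L2_exact(1)[OF t(1)] Lx[OF t(1)]] by simp
   qed
   have c1: "\<bar>ip U (u r) (\<lambda>x. \<chi> i. ?w i x \<bullet> \<phi> x)\<bar> \<le> 2 * K * K * \<tau> * ?N"
   proof -
    have "\<bar>ip U (u r) (\<lambda>x. \<chi> i. ?w i x \<bullet> \<phi> x)\<bar> \<le> K * (nrm (?w 1) + nrm (?w 2)) * ?N"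
     using pos by (intro convection_Cauchy_Schwarz L2_measurable[OF L2_exact(1)] bound_u rt Lw L\<phi>) auto
    also have "\<dots> \<le> K * (K * \<tau> + K * \<tau>) * ?N" using pos by (intro mult_right_mono mult_left_mono add_mono Lw) auto
    finally show ?thesis by (simp add: algebra_simps)
   qed
   have c2: "\<bar>ip U (\<lambda>x. u r x - u t x) (\<lambda>x. \<chi> i. weak_pd U i (u t) x \<bullet> \<phi> x)\<bar> \<le> K * K * \<tau> * ?P"
   proof -
    have "\<bar>ip U (\<lambda>x. u r x - u t x) (\<lambda>x. \<chi> i. weak_pd U i (u t) x \<bullet> \<phi> x)\<bar> \<le> K * dst (u r) (u t) * ?P"
     by (intro convection_exact_bound zero_normal_trace_diff div_free_diff normal_u div_u rt t \<phi>)
    also have "\<dots> \<le> K * (K * \<tau>) * ?P"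
     using pos by (intro mult_right_mono mult_left_mono lip[OF Lipschitz_u[OF t(1) rt(1)] t(4)]) auto
    finally show ?thesis by (simp add: mult_ac)
   qed
   have g: "\<bar>ip U (weak_grad U (p r)) \<phi> - ip U (weak_grad U (p t)) \<phi>\<bar> \<le> K * \<tau> * ?N"
   proof -
    have "\<bar>ip U (\<lambda>x. weak_grad U (p r) x - weak_grad U (p t) x) \<phi>\<bar>
     \<le> dst (weak_grad U (p r)) (weak_grad U (p t)) * ?N" by (intro ip_Cauchy_Schwarz L2_diff L2_exact rt t L\<phi>)
    also have "\<dots> \<le> K * \<tau> * ?N" by (intro mult_right_mono lip[OF Lipschitz_grad_p[OF t(1) rt(1)] t(4)]) simp
    finally show ?thesis using L2_exact(5)[OF rt(1)] L2_exact(5)[OF t(1)] L\<phi> by (simp add: ip_diff_left)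
   qed
   let ?l = "\<lambda>a b x. cross_vs (B a x) (J b x)"
   have l: "\<bar>ip U (?l r (r + \<tau>)) \<phi> - ip U (?l t t) \<phi>\<bar> \<le> 2 * K * K * \<tau> * ?N"
   proof -
    let ?l1 = "\<lambda>x. cross_vs (B r x - B t x) (J (r + \<tau>) x)" and ?l2 = "\<lambda>x. cross_vs (B t x) (J (r + \<tau>) x - J t x)"
    note d1 = L2_diff[OF L2_exact(2)[OF rt(1)] L2_exact(2)[OF t(1)]] and d2 = L2_diff[OF L2_exact(3)[OF rt(2)] L2_exact(3)[OF t(1)]]
    note m1 = L2_measurable[OF L2_exact(3)[OF rt(2)]] and m2 = L2_measurable[OF L2_exact(2)[OF t(1)]]
    note e1 = L2_cross_vs_left[OF d1 m1 bound_curl[OF rt(2)]] and e2 = L2_cross_vs_right[OF d2 m2 bound_B[OF t(1)]]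
    have "ip U (?l r (r + \<tau>)) \<phi> - ip U (?l t t) \<phi> = ip U (\<lambda>x. ?l r (r + \<tau>) x - ?l t t x) \<phi>"
     by (intro ip_diff_left[symmetric] L2_Lorentz rt t L\<phi>)
    also have "(\<lambda>x. ?l r (r + \<tau>) x - ?l t t x) = (\<lambda>x. ?l1 x + ?l2 x)"
     by (simp add: fun_eq_iff cross_vs_def vec_eq_iff forall_2 algebra_simps)
    finally have "\<bar>ip U (?l r (r + \<tau>)) \<phi> - ip U (?l t t) \<phi>\<bar> \<le> nrm (\<lambda>x. ?l1 x + ?l2 x) * ?N"
     using ip_Cauchy_Schwarz[OF L2_add[OF e1(1) e2(1)] L\<phi>] by simp
    also have "nrm (\<lambda>x. ?l1 x + ?l2 x) \<le> K * (K * \<tau>) + K * (K * \<tau>)"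
    proof -
     have "K * dst (B r) (B t) \<le> K * (K * \<tau>)" "K * dst (J (r + \<tau>)) (J t) \<le> K * (K * \<tau>)"
      using pos by (intro mult_left_mono lip[OF Lipschitz_B[OF t(1) rt(1)] t(4)] lip[OF Lipschitz_curl[OF t(1) rt(2)] t(3)]; simp)+
     then show ?thesis using L2_norm_triangle[OF e1(1) e2(1)] e1(2) e2(2) pos by linarith
    qed
    finally show ?thesis by (simp add: mult_ac mult_right_mono)
   qed
   then have l': "\<bar>s * (ip U (?l r (r + \<tau>)) \<phi> - ip U (?l t t) \<phi>)\<bar> \<le> s * (2 * K * K * \<tau> * ?N)"
    using pos by (simp add: abs_mult mult_left_mono)
   have eq: "ip U (u_t t) \<phi> + \<nu> * (\<Sum>i\<in>UNIV. ip U (weak_pd U i (u t)) (pd i \<phi>)) + ?c t t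
     + ip U (weak_grad U (p t)) \<phi> + s * ip U (?l t t) \<phi> = 0" using elim(1) \<phi> by blast
   \<comment> \<open>The constant multiplies the sum of all norms, so it exceeds the required terms
     by the products in the last bracket, which are nonnegative.\<close>
   have fin: "momentum_const * \<tau> * (?N + ?P) = \<nu> * (K * \<tau> * ?P) + (2 * K * K * \<tau> * ?N + K * K * \<tau> * ?P) + K * \<tau> * ?N + s * (2 * K * K * \<tau> * ?N)
     + (\<nu> * (K * \<tau> * ?N) + K * K * \<tau> * ?N + 2 * (K * K * \<tau> * ?P) + K * \<tau> * ?P + s * (2 * K * K * \<tau> * ?P))"
    by (simp add: momentum_const_def algebra_simps)
   have rest: "0 \<le> \<nu> * (K * \<tau> * ?N) + K * K * \<tau> * ?N + 2 * (K * K * \<tau> * ?P) + K * \<tau> * ?P + s * (2 * K * K * \<tau> * ?P)"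
    using pos \<tau> by (intro add_nonneg_nonneg mult_nonneg_nonneg) auto
   show "\<bar>ip U (u_t t) \<phi> + ?A\<bar> \<le> momentum_const * \<tau> * (?N + ?P)"
    using v ceq c1 c2 g l' eq rest unfolding fin right_diff_distrib by linarith
   qed
  qed
 qed (use \<tau> in auto)
 then show ?thesis by (simp add: power2_eq_square mult_ac add_ac)
qed

end

lemma cross_vs_diff_left: "cross_vs (a - b) c = cross_vs a c - cross_vs b c"
 and cross_vs_diff_right: "cross_vs a (c - d) = cross_vs a c - cross_vs a d"
 by (simp_all add: cross_vs_def vec_eq_iff forall_2 algebra_simps)

lemma (in bounded_open) ip_diff_self:
 assumes "L2 U f" "L2 U g"
 shows "2 * ip U f (\<lambda>x. f x - g x) = (nrm f)\<^sup>2 - (nrm g)\<^sup>2 + (dst f g)\<^sup>2"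
 using assms by (simp add: L2_norm_sq ip_diff_left ip_diff_right L2_diff ip_commute[of U g f])

lemma (in bounded_open) ip_add_scaleR_self:
 fixes t :: real
 assumes "L2 U a" "L2 U b" "L2 U c"
 shows "ip U (\<lambda>x. a x + t *\<^sub>R b x + t *\<^sub>R c x) (\<lambda>x. a x + t *\<^sub>R b x + t *\<^sub>R c x)
  = ip U a a + 2 * t * ip U b a + t\<^sup>2 * ip U b b + 2 * t * ip U a c + 2 * t\<^sup>2 * ip U b c + t\<^sup>2 * ip U c c"
 using assms by (simp add: ip_add_left ip_add_right ip_scaleR_left ip_scaleR_right L2_add L2_scaleR
   ip_commute[of U a b] ip_commute[of U c a] ip_commute[of U c b] power2_eq_square algebra_simps)

section \<open>Energy estimates for one time step\<close>

text \<open>A single step from time \<open>r\<close> to \<open>r + \<tau>\<close>; primes mark the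
  new level, \<open>vs\<close> and \<open>vt\<close> are the two intermediate velocities. The old
  iterate is assumed only as regular as the previous step, or the initial data, provides.\<close>

locale scheme_step = exact_solution +
 fixes \<tau> r :: real and b v b' vs vt v' :: "real^2 \<Rightarrow> real^2" and P P' :: "real^2 \<Rightarrow> real"
 assumes time: "0 < \<tau>" "0 \<le> r" "r + \<tau> \<le> T"
  and L2_b: "L2 U b" and div_v: "div_free U v" and normal_v: "zero_normal_trace U v"
  and sobolev_P: "sobolev U 1 P"
  and step1: "scheme_step1 U \<eta> s \<tau> b v b' vs"
  and step2: "scheme_step2 U \<nu> \<tau> v P vs vt"
  and step3: "scheme_step3 U \<tau> P vt v' P'"
begin

abbreviation "curl_b' \<equiv> weak_curl U b'"
abbreviation "eb \<equiv> \<lambda>x. B r x - b x"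
abbreviation "eb' \<equiv> \<lambda>x. B (r + \<tau>) x - b' x"
abbreviation "ec \<equiv> \<lambda>x. J (r + \<tau>) x - curl_b' x"
abbreviation "eu \<equiv> \<lambda>x. u r x - v x"
abbreviation "es \<equiv> \<lambda>x. uhat \<tau> r x - vs x"
abbreviation "et \<equiv> \<lambda>x. u (r + \<tau>) x - vt x"
abbreviation "eu' \<equiv> \<lambda>x. u (r + \<tau>) x - v' x"
abbreviation "g \<equiv> \<lambda>x. weak_grad U (p r) x - weak_grad U P x"
abbreviation "g' \<equiv> \<lambda>x. weak_grad U (p (r + \<tau>)) x - weak_grad U P' x"

lemma rt: "r \<in> {0..T}" "r + \<tau> \<in> {0..T}" using time by auto

lemma trace_b': "zero_tangential_trace U b'" and L2_vs: "L2 U vs" and trace_vt: "zero_trace U vt"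
 using step1 step2 by (auto simp: scheme_step1_def scheme_step2_def)

lemma curl_b': "has_weak_curl U b' curl_b'" by (rule zero_tangential_trace_weak_curl[OF trace_b'])

lemma L2_iterates: "L2 U v" "L2 U b'" "L2 U curl_b'" "L2 U v'" "L2 U vt" "L2 U (weak_pd U i vt)"
 "L2 U (weak_grad U P)" "L2 U (weak_grad U P')"
 using div_v curl_b' step3 sobolev_1_L2[OF zero_trace_sobolev[OF trace_vt]] L2_weak_grad sobolev_P
 by (auto simp: has_weak_div_def has_weak_curl_def scheme_step3_def)

lemma L2_errors: "L2 U eb" "L2 U eb'" "L2 U ec" "L2 U eu" "L2 U es" "L2 U et" "L2 U eu'" "L2 U g" "L2 U g'"
 by (intro L2_diff L2_exact L2_iterates L2_b L2_vs uhat_bound time rt)+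

lemma trace_et: "zero_trace U et" by (intro zero_trace_diff trace_u rt trace_vt)

text \<open>The product \<open>cross_vv (vs x) (b x)\<close> of two $L^2$ fields is a priori only integrable. The induction step makes the weak gradient of $q$
the rotated difference quotient of the magnetic field, which is square integrable; hence so is $q$, and it may be paired with curls of fields with zero tangential trace.\<close>

definition q where "q x = \<eta> * curl_b' x - cross_vv (vs x) (b x)"

lemma scheme_induction:
 shows "L2 U q" and "zero_tangential_trace U w \<Longrightarrow> has_weak_curl U w c \<Longrightarrow>
  ip U b' w - ip U b w + \<tau> * ip U q c = 0"
proof -
 let ?G = "\<lambda>x. (1 / \<tau>) *\<^sub>R (b' x - b x)"
 have LG: "L2 U ?G" by (intro L2_scaleR L2_diff L2_iterates L2_b)
 \<comment> \<open>The gradient that the discrete induction equation assigns to \<open>q\<close>;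
   rotated back in the trace formula it is minus the difference quotient \<open>?G\<close>.\<close>
 define gq where "gq i x = (if i = (1::2) then ?G x $ 2 else - (?G x $ 1))" for i x
 have Lgq: "L2 U (gq i)" for i
  using L2_nth[OF LG, of 2] L2_minus[OF L2_nth[OF LG, of 1]] by (cases "i = 1") (simp_all add: gq_def[abs_def])
 have ic: "integrable \<mu> (\<lambda>x. \<eta> * curl_b' x)" by (intro L2_imp_integrable L2_mult L2_iterates)
 have ix: "integrable \<mu> (\<lambda>x. cross_vv (vs x) (b x))"
  using L2_integrable_inner[OF L2_nth[OF L2_vs, of 1] L2_nth[OF L2_b, of 2]]
   L2_integrable_inner[OF L2_nth[OF L2_vs, of 2] L2_nth[OF L2_b, of 1]] by (simp add: cross_vv_def)
 have w: "has_weak_pd U i q (gq i)" for i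
 proof (rule L2_of_L2_gradient)
  show "integrable \<mu> q" unfolding q_def[abs_def] by (intro Bochner_Integration.integrable_diff ic ix)
  fix i and \<theta> :: "real^2 \<Rightarrow> real" assume \<theta>: "test_fun U \<theta>"
  define k where "k = (if i = (1::2) then 2 else 1 :: 2)"
  let ?\<phi> = "\<lambda>x. \<theta> x *\<^sub>R (axis k 1 :: real^2)" and ?w = "\<lambda>x. if k = 2 then pd 1 \<theta> x else - pd 2 \<theta> x"
  have w: "?w = (\<lambda>x. (if i = 1 then 1 else -1) * pd i \<theta> x)" using exhaust_2[of i] by (auto simp: k_def)
  have it: "integrable \<mu> (\<lambda>x. f x * pd i \<theta> x)" if "integrable \<mu> f" for f
   using integrable_mult_test[OF that test_fun_pd[OF \<theta>], of i 0] by simp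
  have "distr U ?G ?\<phi> + \<eta> * distr_curl U curl_b' ?\<phi> - distr_curl U (\<lambda>x. cross_vv (vs x) (b x)) ?\<phi> = 0"
   using step1 test_fun_scaleR_const[OF \<theta>] unfolding scheme_step1_def by blast
  then have "ip U (\<lambda>x. ?G x $ k) \<theta> + \<eta> * ip U curl_b' ?w - ip U (\<lambda>x. cross_vv (vs x) (b x)) ?w = 0"
   unfolding distr_axis distr_curl_axis[OF \<theta>] .
  moreover have "(LINT x|\<mu>. q x * pd i \<theta> x) =
    \<eta> * ip U curl_b' (pd i \<theta>) - ip U (\<lambda>x. cross_vv (vs x) (b x)) (pd i \<theta>)"
   using it[OF ic] it[OF ix] by (simp add: q_def left_diff_distrib ip_def mult.assoc)
  moreover have "(LINT x|\<mu>. gq i x * \<theta> x) = (if i = 1 then 1 else -1) * ip U (\<lambda>x. ?G x $ k) \<theta>"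
   by (auto simp: ip_def gq_def k_def)
  ultimately show "(LINT x|\<mu>. q x * pd i \<theta> x) = - (LINT x|\<mu>. gq i x * \<theta> x)"
   unfolding w ip_mult_right by (auto split: if_splits)
 qed (rule Lgq)
 then show "L2 U q" using has_weak_pd_L2(1) by blast
 assume tr: "zero_tangential_trace U w" "has_weak_curl U w c"
 have "(\<lambda>x. vector [gq 2 x, - gq 1 x] :: real^2) = (\<lambda>x. - ?G x)" by (simp add: gq_def fun_eq_iff vec_eq_iff forall_2)
 with zero_tangential_trace_ip[OF tr w] have q: "- ip U ?G w = ip U q c" by (simp only: ip_minus_right ip_commute)
 have "L2 U w" using tr(2) by (simp add: has_weak_curl_def)
 then have "\<tau> * ip U ?G w = ip U b' w - ip U b w"
  unfolding ip_scaleR_left ip_diff_left[OF L2_iterates(2) L2_b \<open>L2 U w\<close>] using time(1) by simp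
 then show "ip U b' w - ip U b w + \<tau> * ip U q c = 0" unfolding q[symmetric] mult_minus_right by linarith
qed

text \<open>Weighting with \<open>s\<close> makes the coupling term equal to the pairing of
  \<open>es\<close> with \<open>es - eu\<close>, up to a remainder containing \<open>eb\<close>.
  This pairing is the velocity energy balance of Step 1.\<close>

lemma magnetic_energy:
 "s * ip U eb' (\<lambda>x. eb' x - eb x) + s * \<tau> * \<eta> * (nrm ec)\<^sup>2 + ip U es (\<lambda>x. es x - eu x)
  \<le> s * induction_const * \<tau>\<^sup>2 * nrm ec + s * \<tau> * (K + T * s * K * K) * nrm eb * nrm ec
   + s * \<tau> * K * nrm es * nrm eb"
proof -
 note e = L2_errors
 let ?a = "\<lambda>x. \<eta> * J (r + \<tau>) x - cross_vv (uhat \<tau> r x) (B r x)"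
 let ?h = "\<lambda>x. cross_vv (uhat \<tau> r x) (eb x)" and ?z = "\<lambda>x. cross_vv (es x) (b x)"
 let ?l = "\<lambda>x. cross_vs (eb x) (J (r + \<tau>) x)"
 have tr: "zero_tangential_trace U eb'" by (intro zero_tangential_trace_diff trace_B rt trace_b')
 have cu: "has_weak_curl U eb' ec" by (intro has_weak_curl_diff zero_tangential_trace_weak_curl trace_B rt trace_b')
 have La: "L2 U ?a"
  by (intro L2_diff L2_mult L2_exact rt L2_cross_vv(1)[OF uhat_bound(1)[OF time] L2_measurable[OF L2_exact(2)[OF rt(1)]] bound_B[OF rt(1)]])
 note h = L2_cross_vv(3,4)[OF e(1) L2_measurable[OF uhat_bound(1)[OF time]] uhat_bound(2)[OF time]]
 note l = L2_cross_vs_left[OF e(1) L2_measurable[OF L2_exact(3)[OF rt(2)]] bound_curl[OF rt(2)]]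
 have aq: "(\<lambda>x. ?a x - q x) = (\<lambda>x. \<eta> * ec x - ?h x - ?z x)"
  by (simp add: fun_eq_iff q_def cross_vv_diff_left cross_vv_diff_right algebra_simps)
 \<comment> \<open>A product of two square integrable fields is recognized as square integrable by
   difference, since every other term of the decomposition is.\<close>
 have "?z = (\<lambda>x. \<eta> * ec x - ?h x - (?a x - q x))" using aq by (simp add: fun_eq_iff)
 then have Lz: "L2 U ?z" using La scheme_induction(1) h(1) e(3) by (auto intro!: L2_diff L2_mult)
 let ?y = "\<lambda>x. (- 1 / (\<tau> * s)) *\<^sub>R (es x - eu x) - ?l x"
 have Ly: "L2 U ?y" by (intro L2_diff L2_scaleR e(4,5) l(1))
 \<comment> \<open>The term coupling the induction error to the velocity error is turned into a multiple of the one in the equation for $u_\star$.\<close>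
 have "ip U ?z ec = ip U es ?y" unfolding ip_def
 proof (rule integral_cong_AE)
  show "(\<lambda>x. ?z x \<bullet> ec x) \<in> borel_measurable \<mu>" "(\<lambda>x. es x \<bullet> ?y x) \<in> borel_measurable \<mu>"
   by (intro borel_measurable_inner L2_measurable Lz Ly e)+
  have "AE x in \<mu>. (1 / \<tau>) *\<^sub>R (vs x - v x) + s *\<^sub>R cross_vs (b x) (curl_b' x) = 0"
   using step1 by (simp add: scheme_step1_def)
  then show "AE x in \<mu>. ?z x \<bullet> ec x = es x \<bullet> ?y x"
  proof eventually_elim
   case (elim x)
   have "vs x - v x = - ((\<tau> * s) *\<^sub>R cross_vs (b x) (curl_b' x))"
    using arg_cong[OF elim, of "\<lambda>w. \<tau> *\<^sub>R w"] time(1) by (simp add: algebra_simps eq_neg_iff_add_eq_0)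
   moreover have "es x - eu x = - ((\<tau> * s) *\<^sub>R cross_vs (B r x) (J (r + \<tau>) x)) - (vs x - v x)"
    by (simp add: uhat_def)
   ultimately have "es x - eu x = - ((\<tau> * s) *\<^sub>R (?l x + cross_vs (b x) (ec x)))"
    by (simp add: cross_vs_diff_left cross_vs_diff_right algebra_simps)
   then have "?y x = cross_vs (b x) (ec x)" using time(1) pos by simp
   then show ?case by (simp only: inner_cross_vs) simp
  qed
 qed
 also have "\<dots> = - 1 / (\<tau> * s) * ip U es (\<lambda>x. es x - eu x) - ip U es ?l"
  by (rule trans[OF ip_diff_right[OF L2_scaleR[OF L2_diff[OF e(5,4)]] l(1) e(5)]]) (simp only: ip_scaleR_right)
 finally have "s * \<tau> * ip U ?z ec = s * \<tau> * (- 1 / (\<tau> * s) * ip U es (\<lambda>x. es x - eu x) - ip U es ?l)" by simp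
 also have "\<dots> = - ip U es (\<lambda>x. es x - eu x) - s * \<tau> * ip U es ?l" using time(1) pos by (simp add: field_simps)
 finally have z: "s * \<tau> * ip U ?z ec = - ip U es (\<lambda>x. es x - eu x) - s * \<tau> * ip U es ?l" .
 \<comment> \<open>The bookkeeping is done on plain reals, away from the integrals: subtract the
   scheme from the consistency estimate and regroup.\<close>
 have alg: "z + \<tau> * (h - i - j) \<le> R"
  if "\<bar>b1 - b2 + \<tau> * a\<bar> \<le> R" "a = q + (h - i - j)" "b3 - b4 + \<tau> * q = 0" "z = x - y" "x = b1 - b3" "y = b2 - b4"
  for z h i j R b1 b2 b3 b4 a q x y :: real using that by (simp add: algebra_simps)
 have "\<bar>ip U (B (r + \<tau>)) eb' - ip U (B r) eb' + \<tau> * ip U ?a ec\<bar> \<le> induction_const * \<tau>\<^sup>2 * nrm ec"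
  by (rule induction_consistency[OF time tr cu])
 moreover have "ip U ?a ec = ip U q ec + (\<eta> * (nrm ec)\<^sup>2 - ip U ?h ec - ip U ?z ec)"
 proof -
  have "ip U ?a ec - ip U q ec = ip U (\<lambda>x. \<eta> * ec x - ?h x - ?z x) ec"
   using ip_diff_left[OF La scheme_induction(1) e(3)] aq by simp
  also have "\<dots> = \<eta> * ip U ec ec - ip U ?h ec - ip U ?z ec"
   using ip_diff_left[OF L2_diff[OF L2_mult[OF e(3)] h(1)] Lz e(3)] ip_diff_left[OF L2_mult[OF e(3)] h(1) e(3)]
   by (simp add: ip_mult_left)
  finally show ?thesis by (simp add: L2_norm_sq)
 qed
 moreover have "ip U b' eb' - ip U b eb' + \<tau> * ip U q ec = 0" by (rule scheme_induction(2)[OF tr cu])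
 moreover have "ip U eb' (\<lambda>x. eb' x - eb x) = ip U eb' eb' - ip U eb eb'"
  unfolding ip_commute[of U eb eb'] by (rule ip_diff_right[OF e(2,1,2)])
 moreover have "ip U eb' eb' = ip U (B (r + \<tau>)) eb' - ip U b' eb'" "ip U eb eb' = ip U (B r) eb' - ip U b eb'"
  by (intro ip_diff_left L2_exact rt L2_iterates L2_b e)+
 ultimately have "ip U eb' (\<lambda>x. eb' x - eb x) + \<tau> * (\<eta> * (nrm ec)\<^sup>2 - ip U ?h ec - ip U ?z ec)
   \<le> induction_const * \<tau>\<^sup>2 * nrm ec" by (rule alg)
 from mult_left_mono[OF this, of s] have "s * ip U eb' (\<lambda>x. eb' x - eb x) + s * \<tau> * \<eta> * (nrm ec)\<^sup>2
   - s * \<tau> * ip U ?h ec - s * \<tau> * ip U ?z ec \<le> s * induction_const * \<tau>\<^sup>2 * nrm ec"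
  using pos by (simp add: algebra_simps)
 moreover have "s * \<tau> * ip U ?h ec \<le> s * \<tau> * ((K + T * s * K * K) * nrm eb * nrm ec)"
 proof (rule mult_left_mono)
  have "ip U ?h ec \<le> nrm ?h * nrm ec" using ip_Cauchy_Schwarz[OF h(1) e(3)] by simp
  also have "\<dots> \<le> (K + T * s * K * K) * nrm eb * nrm ec" using pos by (intro mult_right_mono h(2)) auto
  finally show "ip U ?h ec \<le> (K + T * s * K * K) * nrm eb * nrm ec" .
 qed (use time pos in auto)
 moreover have "- (s * \<tau> * ip U es ?l) \<le> s * \<tau> * (nrm es * (K * nrm eb))"
 proof -
  have "\<bar>ip U es ?l\<bar> \<le> nrm es * nrm ?l" by (rule ip_Cauchy_Schwarz[OF e(5) l(1)])
  also have "\<dots> \<le> nrm es * (K * nrm eb)" using pos by (intro mult_left_mono l(2)) auto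
  finally have "- ip U es ?l \<le> nrm es * (K * nrm eb)" by linarith
  from mult_left_mono[OF this, of "s * \<tau>"] show ?thesis using time pos by simp
 qed
 ultimately show ?thesis using z by (simp add: mult_ac)
qed

abbreviation "W \<equiv> \<lambda>i. weak_pd U i et"

lemma W: "has_weak_pd U i et (W i)" "L2 U (W i)"
 "AE x in \<mu>. W i x = weak_pd U i (u (r + \<tau>)) x - weak_pd U i vt x"
proof -
 show "has_weak_pd U i et (W i)" by (rule sobolev_1D[OF zero_trace_sobolev[OF trace_et]])
 then show "L2 U (W i)" by (rule has_weak_pd_L2)
 show "AE x in \<mu>. W i x = weak_pd U i (u (r + \<tau>)) x - weak_pd U i vt x"
  by (rule weak_pd_eq[OF has_weak_pd_diff[OF sobolev_1D sobolev_1D]])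
   (intro zero_trace_sobolev trace_u rt trace_vt)+
qed

text \<open>The convective error is split so that the iterate \<open>v\<close> advects the new
  error, which will drop out by skewness, and the old error \<open>eu\<close> advects the exact
  velocity, which integration by parts controls.\<close>

lemma velocity_equation:
 assumes \<phi>: "test_fun U \<phi>"
 shows "ip U et \<phi> - ip U es \<phi> + \<tau> * \<nu> * (\<Sum>i\<in>UNIV. ip U (W i) (pd i \<phi>))
   + \<tau> * ip U v (\<lambda>x. \<chi> i. W i x \<bullet> \<phi> x) + \<tau> * ip U g \<phi>
  \<le> (momentum_const * \<tau>\<^sup>2 + \<tau> * K * nrm eu) * (nrm \<phi> + nrm (pd 1 \<phi>) + nrm (pd 2 \<phi>))"
proof -
 note e = L2_errors and L\<phi> = L2_test_fun[OF \<phi>] and Lp = L2_test_fun[OF test_fun_pd[OF \<phi>]]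
 let ?u = "u (r + \<tau>)" and ?N = "nrm \<phi> + nrm (pd 1 \<phi>) + nrm (pd 2 \<phi>)"
 let ?S = "\<lambda>f. \<Sum>i\<in>UNIV. ip U (weak_pd U i f) (pd i \<phi>)" and ?c = "\<lambda>w f. ip U w (\<lambda>x. \<chi> i. weak_pd U i f x \<bullet> \<phi> x)"
 let ?l = "\<lambda>x. cross_vs (B r x) (J (r + \<tau>) x)"
 have "distr U (\<lambda>x. (1 / \<tau>) *\<^sub>R (vt x - vs x)) \<phi> + distr U (convect U v vt) \<phi>
     - \<nu> * distr_laplacian U vt \<phi> + distr U (weak_grad U P) \<phi> = 0"
  using step2 \<phi> unfolding scheme_step2_def by blast
 then have "(1 / \<tau>) * (ip U vt \<phi> - ip U vs \<phi>) + ?c v vt + \<nu> * ?S vt + ip U (weak_grad U P) \<phi> = 0"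
  unfolding distr_eq_ip distr_convect distr_laplacian_weak_pd[OF zero_trace_sobolev[OF trace_vt] \<phi>]
   ip_scaleR_left ip_diff_left[OF L2_iterates(5) L2_vs L\<phi>] by simp
 from arg_cong[OF this, of "\<lambda>z. \<tau> * z"]
 have num: "(ip U vt \<phi> - ip U vs \<phi>) + \<tau> * (?c v vt + \<nu> * ?S vt + ip U (weak_grad U P) \<phi>) = 0"
  using time(1) by (simp add: distrib_left add_ac)
 note ex = momentum_consistency[OF time \<phi>]
 have L: "L2 U (weak_pd U i ?u)" for i by (intro L2_exact rt)
 have Lx: "L2 U (\<lambda>x. \<chi> i. weak_pd U i ?u x \<bullet> \<phi> x)" "L2 U (\<lambda>x. \<chi> i. weak_pd U i vt x \<bullet> \<phi> x)"
  by (intro L2_vec L2_inner_test[OF _ \<phi>] L L2_iterates)+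
 have S: "(\<Sum>i\<in>UNIV. ip U (W i) (pd i \<phi>)) = ?S ?u - ?S vt"
 proof -
  have "ip U (W i) (pd i \<phi>) = ip U (weak_pd U i ?u) (pd i \<phi>) - ip U (weak_pd U i vt) (pd i \<phi>)" for i
   using ip_cong_AE[OF dom_sets L2_measurable[OF W(2)] L2_measurable[OF Lp] W(3) AE_I2[OF refl]]
    ip_diff_left[OF L L2_iterates(6) Lp] by simp
  then show ?thesis by (simp add: sum_subtractf)
 qed
 have c: "ip U v (\<lambda>x. \<chi> i. W i x \<bullet> \<phi> x) = ?c v ?u - ?c v vt"
 proof -
  have "AE x in \<mu>. (\<chi> i. W i x \<bullet> \<phi> x) = (\<chi> i. weak_pd U i ?u x \<bullet> \<phi> x) - (\<chi> i. weak_pd U i vt x \<bullet> \<phi> x)"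
   using W(3)[of 1] W(3)[of 2] by eventually_elim (subst vec_eq_iff, simp add: forall_2 inner_diff_left)
  from ip_cong_AE[OF dom_sets L2_measurable[OF L2_iterates(1)] _ AE_I2[OF refl] this]
  show ?thesis
   using ip_diff_right[OF Lx L2_iterates(1)] L2_measurable[OF L2_vec[OF L2_inner_test[OF W(2) \<phi>]]] by simp
 qed
 have ceu: "?c eu ?u = ?c (u r) ?u - ?c v ?u" by (rule ip_diff_left[OF L2_exact(1)[OF rt(1)] L2_iterates(1) Lx(1)])
 \<comment> \<open>Step 2 contains no magnetic term; comparing with \<open>uhat\<close> instead of
   \<open>u r\<close> supplies exactly the Lorentz term of the consistency estimate.\<close>
 have h: "ip U (uhat \<tau> r) \<phi> = ip U (u r) \<phi> - \<tau> * s * ip U ?l \<phi>"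
  unfolding uhat_def[abs_def] using ip_diff_left[OF L2_exact(1)[OF rt(1)] L2_scaleR[OF L2_Lorentz(1)[OF rt]] L\<phi>]
  by (simp add: ip_scaleR_left)
 have "\<bar>?c eu ?u\<bar> \<le> K * nrm eu * (nrm (pd 1 \<phi>) + nrm (pd 2 \<phi>))"
  by (intro convection_exact_bound zero_normal_trace_diff div_free_diff normal_u div_u rt div_v normal_v \<phi>)
 also have "\<dots> \<le> K * nrm eu * ?N" using pos by (intro mult_left_mono) auto
 finally have cb: "- (\<tau> * ?c eu ?u) \<le> \<tau> * (K * nrm eu * ?N)"
  using mult_left_mono[of "- ?c eu ?u" _ \<tau>] time(1) by simp
 have ips: "ip U et \<phi> = ip U ?u \<phi> - ip U vt \<phi>" "ip U es \<phi> = ip U (uhat \<tau> r) \<phi> - ip U vs \<phi>"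
  "ip U g \<phi> = ip U (weak_grad U (p r)) \<phi> - ip U (weak_grad U P) \<phi>"
  by (intro ip_diff_left L2_exact L2_iterates L2_vs uhat_bound time rt L\<phi>)+
 have alg: "A - B - ((C - \<tau> * s * L) - D) + \<tau> * \<nu> * (S1 - S2) + \<tau> * (c1 - c2) + \<tau> * (E - F) \<le> (m * \<tau>\<^sup>2 + \<tau> * K * a) * N"
  if "B - D + \<tau> * (c2 + \<nu> * S2 + F) = 0" "\<bar>A - C + \<tau> * (\<nu> * S1 + c3 + E + s * L)\<bar> \<le> m * \<tau>\<^sup>2 * N"
   "- (\<tau> * (c3 - c1)) \<le> \<tau> * (K * a * N)" for A B C D E F L S1 S2 c1 c2 c3 m a N :: real
  using that by (simp add: algebra_simps)
 show ?thesis unfolding S c ips h by (rule alg[OF num ex cb[unfolded ceu]])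
qed

text \<open>The product of \<open>v\<close> and \<open>W\<close> is only integrable, so convergence
  of the test fields in norm would not suffice; their uniform bound makes dominated convergence
  work.\<close>

lemma tendsto_convection:
 assumes \<Psi>: "\<And>j::nat. test_fun U (\<Psi> j)" and bd: "\<And>j x k. \<bar>\<Psi> j x $ k\<bar> \<le> M"
  and lim: "AE x in \<mu>. (\<lambda>j. \<Psi> j x) \<longlonglongrightarrow> \<psi> x" and L: "L2 U \<psi>"
 shows "(\<lambda>j. ip U v (\<lambda>x. \<chi> i. W i x \<bullet> \<Psi> j x)) \<longlonglongrightarrow> ip U v (\<lambda>x. \<chi> i. W i x \<bullet> \<psi> x)" unfolding ip_def
proof (rule integral_dominated_convergence)
 let ?w = "\<lambda>x. 2 * M * (norm (v x) * norm (W 1 x) + norm (v x) * norm (W 2 x))"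
 have mW: "(\<lambda>x. \<chi> i. W i x \<bullet> f x) \<in> borel_measurable \<mu>" if "f \<in> borel_measurable \<mu>" for f
  by (intro borel_measurable_vec borel_measurable_inner that L2_measurable[OF W(2)])
 show "(\<lambda>x. v x \<bullet> (\<chi> i. W i x \<bullet> \<psi> x)) \<in> borel_measurable \<mu>"
  by (intro borel_measurable_inner L2_measurable[OF L2_iterates(1)] mW L2_measurable[OF L])
 show "(\<lambda>x. v x \<bullet> (\<chi> i. W i x \<bullet> \<Psi> j x)) \<in> borel_measurable \<mu>" for j
  by (intro borel_measurable_inner L2_measurable[OF L2_iterates(1)] mW L2_measurable[OF L2_test_fun[OF \<Psi>]])
 show "integrable \<mu> ?w" using L2_integrable_inner[OF L2_norm[OF L2_iterates(1)] L2_norm[OF W(2)]] by simp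
 show "AE x in \<mu>. (\<lambda>j. v x \<bullet> (\<chi> i. W i x \<bullet> \<Psi> j x)) \<longlonglongrightarrow> v x \<bullet> (\<chi> i. W i x \<bullet> \<psi> x)"
  using lim by eventually_elim (intro tendsto_intros)
 show "AE x in \<mu>. norm (v x \<bullet> (\<chi> i. W i x \<bullet> \<Psi> j x)) \<le> ?w x" for j
 proof (rule AE_I2)
  fix x
  have n: "norm (\<Psi> j x) \<le> 2 * M" using norm_le_l1_cart[of "\<Psi> j x"] bd[of j x 1] bd[of j x 2] by (simp add: sum_2)
  have i: "\<bar>W i x \<bullet> \<Psi> j x\<bar> \<le> norm (W i x) * (2 * M)" for i
   by (rule order_trans[OF Cauchy_Schwarz_ineq2]) (intro mult_left_mono n norm_ge_zero)
  have "\<bar>v x \<bullet> (\<chi> i. W i x \<bullet> \<Psi> j x)\<bar> \<le> norm (v x) * norm (\<chi> i. W i x \<bullet> \<Psi> j x)" by (rule Cauchy_Schwarz_ineq2)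
  also have "\<dots> \<le> norm (v x) * (norm (W 1 x) * (2 * M) + norm (W 2 x) * (2 * M))"
   using norm_le_l1_cart[of "\<chi> i. W i x \<bullet> \<Psi> j x"] i[of 1] i[of 2] by (intro mult_left_mono) (auto simp: sum_2)
  finally show "norm (v x \<bullet> (\<chi> i. W i x \<bullet> \<Psi> j x)) \<le> ?w x" by (simp add: algebra_simps)
 qed
qed

text \<open>The order of the limits matters: for fixed \<open>M\<close> the approximation by test
  fields ends at a truncation for which convection vanishes exactly; only then does \<open>M\<close>
  tend to infinity, in an inequality without convective term.\<close>

lemma velocity_energy:
 "ip U et (\<lambda>x. et x - es x) + \<tau> * \<nu> * (grad_norm U et)\<^sup>2 + \<tau> * ip U g et
  \<le> (momentum_const * \<tau>\<^sup>2 + \<tau> * K * nrm eu) * (nrm et + nrm (W 1) + nrm (W 2))"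
proof -
 note e = L2_errors
 let ?R = "momentum_const * \<tau>\<^sup>2 + \<tau> * K * nrm eu"
 let ?T = "\<lambda>M x. trunc M (et x)" and ?D = "\<lambda>M i x. dtrunc M (et x) (W i x)"
 have trunc: "L2 U (?T M) \<and> (\<forall>i. L2 U (?D M i)) \<and>
   ip U et (?T M) - ip U es (?T M) + \<tau> * \<nu> * (\<Sum>i\<in>UNIV. ip U (W i) (?D M i)) + \<tau> * ip U g (?T M)
   \<le> ?R * (nrm (?T M) + nrm (?D M 1) + nrm (?D M 2))" if M: "M > 0" for M
 proof -
  obtain \<Psi> where \<Psi>: "\<And>j::nat. test_fun U (\<Psi> j)" "\<And>j x k. \<bar>\<Psi> j x $ k\<bar> \<le> M"
   "L2_lim U \<Psi> (?T M)"
   "\<And>i. (\<lambda>j. dst (pd i (\<Psi> j)) (?D M i)) \<longlonglongrightarrow> 0"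
   "AE x in \<mu>. (\<lambda>j. \<Psi> j x) \<longlonglongrightarrow> ?T M x"
   "L2 U (?T M)" "\<And>i. L2 U (?D M i)" by (rule zero_trace_trunc_approx[OF trace_et M]) blast
  note L\<Psi> = L2_test_fun[OF \<Psi>(1)] and Lp = L2_test_fun[OF test_fun_pd[OF \<Psi>(1)]]
  have c: "ip U v (\<lambda>x. \<chi> i. W i x \<bullet> ?T M x) = 0" by (rule convection_skew_trunc[OF normal_v div_v trace_et M])
  have "(\<lambda>j. ip U et (\<Psi> j) - ip U es (\<Psi> j) + \<tau> * \<nu> * (\<Sum>i\<in>UNIV. ip U (W i) (pd i (\<Psi> j)))
    + \<tau> * ip U v (\<lambda>x. \<chi> i. W i x \<bullet> \<Psi> j x) + \<tau> * ip U g (\<Psi> j))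
   \<longlonglongrightarrow> ip U et (?T M) - ip U es (?T M) + \<tau> * \<nu> * (\<Sum>i\<in>UNIV. ip U (W i) (?D M i)) + \<tau> * 0 + \<tau> * ip U g (?T M)"
   unfolding c[symmetric]
   by (intro tendsto_add tendsto_diff tendsto_mult tendsto_sum tendsto_const tendsto_convection[OF \<Psi>(1,2,5,6)] \<Psi>
     tendsto_ip_right L\<Psi> Lp e W(2))
  moreover have "(\<lambda>j. ?R * (nrm (\<Psi> j) + nrm (pd 1 (\<Psi> j)) + nrm (pd 2 (\<Psi> j))))
   \<longlonglongrightarrow> ?R * (nrm (?T M) + nrm (?D M 1) + nrm (?D M 2))"
   by (intro tendsto_add tendsto_mult tendsto_const tendsto_L2_norm L\<Psi> Lp \<Psi>)
  ultimately have "ip U et (?T M) - ip U es (?T M) + \<tau> * \<nu> * (\<Sum>i\<in>UNIV. ip U (W i) (?D M i)) + \<tau> * 0 + \<tau> * ip U g (?T M)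
    \<le> ?R * (nrm (?T M) + nrm (?D M 1) + nrm (?D M 2))"
   by (rule LIMSEQ_le) (use velocity_equation[OF \<Psi>(1)] in blast)
  then show ?thesis using \<Psi>(6,7) by simp
 qed
 let ?M = "\<lambda>n. real (Suc n)"
 have L: "L2 U (?T (?M n))" "L2 U (?D (?M n) i)" for n i using trunc[of "?M n"] by simp_all
 note lim = trunc_limit[OF trace_et]
 have "(\<lambda>n. ip U et (?T (?M n)) - ip U es (?T (?M n)) + \<tau> * \<nu> * (\<Sum>i\<in>UNIV. ip U (W i) (?D (?M n) i)) + \<tau> * ip U g (?T (?M n)))
   \<longlonglongrightarrow> ip U et et - ip U es et + \<tau> * \<nu> * (\<Sum>i\<in>UNIV. ip U (W i) (W i)) + \<tau> * ip U g et"
  by (intro tendsto_add tendsto_diff tendsto_mult tendsto_sum tendsto_const tendsto_ip_right L e W(2) lim)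
 moreover have "(\<lambda>n. ?R * (nrm (?T (?M n)) + nrm (?D (?M n) 1) + nrm (?D (?M n) 2)))
   \<longlonglongrightarrow> ?R * (nrm et + nrm (W 1) + nrm (W 2))"
  by (intro tendsto_add tendsto_mult tendsto_const tendsto_L2_norm L e W(2) lim)
 ultimately have "ip U et et - ip U es et + \<tau> * \<nu> * (\<Sum>i\<in>UNIV. ip U (W i) (W i)) + \<tau> * ip U g et
   \<le> ?R * (nrm et + nrm (W 1) + nrm (W 2))" by (rule LIMSEQ_le) (use trunc in \<open>auto intro!: exI[of _ 0]\<close>)
 moreover have "ip U et (\<lambda>x. et x - es x) = ip U et et - ip U es et"
  using ip_diff_right[OF e(6,5,6)] by (simp add: ip_commute)
 ultimately show ?thesis by (simp add: grad_norm_sq L2_norm_sq)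
qed

text \<open>The cross term of \<open>g\<close> and \<open>et\<close> here cancels the one left by
  \<open>velocity_energy\<close>. The increment \<open>d\<close> of the exact pressure gradient
  appears because Step 2 uses the old pressure. On the new level the cross term vanishes by
  Helmholtz orthogonality.\<close>

lemma projection_identity:
 obtains d where "L2 U d" "nrm d \<le> K * \<tau>"
  "(nrm eu')\<^sup>2 + \<tau>\<^sup>2 * (nrm g')\<^sup>2 =
   (nrm et)\<^sup>2 + 2 * \<tau> * ip U g et + \<tau>\<^sup>2 * (nrm g)\<^sup>2
   + 2 * \<tau> * ip U et d + 2 * \<tau>\<^sup>2 * ip U g d + \<tau>\<^sup>2 * (nrm d)\<^sup>2"
proof
 note e = L2_errors
 let ?d = "\<lambda>x. weak_grad U (p (r + \<tau>)) x - weak_grad U (p r) x"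
 show Ld: "L2 U ?d" by (intro L2_diff L2_exact rt)
 show "nrm ?d \<le> K * \<tau>" by (rule lip[OF Lipschitz_grad_p[OF rt]]) (use time in simp)
 have P': "sobolev U 1 P'" "div_free U v'" "zero_normal_trace U v'"
  and proj: "AE x in \<mu>. (1 / \<tau>) *\<^sub>R (v' x - vt x) + weak_grad U (\<lambda>y. P' y - P y) x = 0"
  using step3 by (auto simp: scheme_step3_def)
 have "AE x in \<mu>. weak_grad U (\<lambda>y. P' y - P y) x = (\<chi> i. weak_pd U i P' x - weak_pd U i P x)"
  by (rule weak_grad_eq[OF has_weak_pd_diff[OF sobolev_1D[OF P'(1)] sobolev_1D[OF sobolev_P]]])
 then have gP: "AE x in \<mu>. weak_grad U (\<lambda>y. P' y - P y) x = weak_grad U P' x - weak_grad U P x"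
  by eventually_elim (simp add: weak_grad_def vec_eq_iff)
 let ?l = "\<lambda>x. eu' x + \<tau> *\<^sub>R g' x" and ?r = "\<lambda>x. et x + \<tau> *\<^sub>R g x + \<tau> *\<^sub>R ?d x"
 have "AE x in \<mu>. ?l x = ?r x" using proj gP
 proof eventually_elim
  case (elim x)
  have "(v' x - vt x) + \<tau> *\<^sub>R (weak_grad U P' x - weak_grad U P x) = 0"
   using arg_cong[OF elim(1), of "\<lambda>w. \<tau> *\<^sub>R w"] time(1) by (simp add: elim(2) scaleR_add_right del: scaleR_diff_right)
  then show ?case by (simp add: algebra_simps)
 qed
 then have "nrm ?l = nrm ?r" by (rule L2_norm_cong_AE[OF dom_sets L2_add[OF e(7) L2_scaleR[OF e(9)]]])
 then have sq: "ip U ?l ?l = ip U ?r ?r" by (simp add: L2_norm_sq[symmetric])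
 have "ip U eu' (\<lambda>x. \<chi> i. weak_pd U i (p (r + \<tau>)) x - weak_pd U i P' x) = 0"
  by (rule zero_normal_trace_orthogonal[where q = "\<lambda>x. p (r + \<tau>) x - P' x"])
   (intro zero_normal_trace_diff div_free_diff normal_u div_u rt P' has_weak_pd_diff sobolev_1D sobolev_p)+
 moreover have "(\<lambda>x. \<chi> i. weak_pd U i (p (r + \<tau>)) x - weak_pd U i P' x) = g'"
  by (simp add: fun_eq_iff weak_grad_def vec_eq_iff)
 ultimately have orth: "ip U eu' g' = 0" by simp
 have l: "ip U ?l ?l = ip U eu' eu' + \<tau>\<^sup>2 * ip U g' g'"
  using ip_add_scaleR_self[OF e(7) e(9) L2_zero, of \<tau>] orth by (simp only: ip_zero_left ip_zero_right ip_commute[of U g' eu'] scaleR_zero_right add_0_right mult_zero_right)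
 have r: "ip U ?r ?r = ip U et et + 2 * \<tau> * ip U g et + \<tau>\<^sup>2 * ip U g g + 2 * \<tau> * ip U et ?d + 2 * \<tau>\<^sup>2 * ip U g ?d + \<tau>\<^sup>2 * ip U ?d ?d"
  by (rule ip_add_scaleR_self[OF e(6) e(8) Ld])
 show "(nrm eu')\<^sup>2 + \<tau>\<^sup>2 * (nrm g')\<^sup>2 =
   (nrm et)\<^sup>2 + 2 * \<tau> * ip U g et + \<tau>\<^sup>2 * (nrm g)\<^sup>2
   + 2 * \<tau> * ip U et ?d + 2 * \<tau>\<^sup>2 * ip U g ?d + \<tau>\<^sup>2 * (nrm ?d)\<^sup>2" unfolding L2_norm_sq l[symmetric] sq by (rule r)
qed

end

lemma Young: "0 < e \<Longrightarrow> 2 * a * b \<le> e * a\<^sup>2 + b\<^sup>2 / e" for a b e :: real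
proof -
 assume e: "0 < e"
 have "0 \<le> (e * a - b)\<^sup>2 / e" using e by simp
 also have "\<dots> = e * a\<^sup>2 - 2 * a * b + b\<^sup>2 / e" using e by (simp add: power2_eq_square field_simps)
 finally show ?thesis by simp
qed

text \<open>Here \<open>x\<close>, \<open>x'\<close> are the old and new magnetic error,
  \<open>y\<close> the curl error, \<open>w\<close> and \<open>z\<close> the velocity error before
  and after Step 1, \<open>a\<close> and \<open>d\<close> the increments. The product of
  \<open>z\<close> and \<open>x\<close> is not absorbed into the square of \<open>z\<close>: through
  \<open>z \<le> w + d\<close> it goes into growth and the square of \<open>d\<close>. The square of
  \<open>z\<close> thus keeps coefficient 1 without restriction on \<open>\<tau>\<close>. Two uses
  of Young's inequality consume half of the doubled dissipation.\<close>

lemma magnetic_absorption: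
 fixes s \<tau> \<eta> c h K T x x' y z w a d :: real
 assumes pos: "0 < s" "0 < \<eta>" "0 \<le> K" "0 < \<tau>" "\<tau> \<le> T" "0 \<le> x" and z: "z \<le> w + d"
  and energy: "s * (x'\<^sup>2 - x\<^sup>2 + a\<^sup>2) / 2 + s * \<tau> * \<eta> * y\<^sup>2 + (z\<^sup>2 - w\<^sup>2 + d\<^sup>2) / 2
   \<le> s * c * \<tau>\<^sup>2 * y + s * \<tau> * h * x * y + s * \<tau> * K * z * x"
 shows "s * x'\<^sup>2 + s * \<tau> * \<eta> * y\<^sup>2 + z\<^sup>2
  \<le> s * x\<^sup>2 + w\<^sup>2 + \<tau> * (2 * s / \<eta> * (c * \<tau>)\<^sup>2 + 2 * s / \<eta> * (h * x)\<^sup>2 + (1 + T) * (s * K * x)\<^sup>2 + w\<^sup>2)"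
proof -
 let ?k = "s * K * x"
 have y: "s * \<tau> * (2 * y * q) \<le> s * \<tau> * \<eta> * y\<^sup>2 / 2 + \<tau> * (2 * s / \<eta> * q\<^sup>2)" for q
  using mult_left_mono[OF Young[of "\<eta> / 2" y q], of "s * \<tau>"] pos by (simp add: algebra_simps)
 have "\<tau> * (2 * ?k) * z \<le> \<tau> * (2 * ?k) * (w + d)" using pos z by (intro mult_left_mono mult_nonneg_nonneg) auto
 moreover have "\<tau> * (2 * w * ?k) \<le> \<tau> * (w\<^sup>2 + ?k\<^sup>2)" using Young[of 1 w ?k] pos by (intro mult_left_mono) auto
 moreover have "2 * d * (\<tau> * ?k) \<le> d\<^sup>2 + \<tau> * (\<tau> * ?k\<^sup>2)"
  using Young[of 1 d "\<tau> * ?k"] by (simp add: power_mult_distrib power2_eq_square mult_ac)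
 moreover have "\<tau> * (\<tau> * ?k\<^sup>2) \<le> \<tau> * (T * ?k\<^sup>2)" using pos by (intro mult_left_mono mult_right_mono) auto
 moreover have "0 \<le> s * a\<^sup>2" using pos by simp
 moreover have "s * x'\<^sup>2 - s * x\<^sup>2 + s * a\<^sup>2 + 2 * (s * \<tau> * \<eta> * y\<^sup>2) + (z\<^sup>2 - w\<^sup>2 + d\<^sup>2)
   \<le> s * \<tau> * (2 * y * (c * \<tau>)) + s * \<tau> * (2 * y * (h * x)) + \<tau> * (2 * ?k) * z"
  using energy by (simp add: field_simps power2_eq_square)
 moreover have "\<tau> * (2 * ?k) * (w + d) = \<tau> * (2 * w * ?k) + 2 * d * (\<tau> * ?k)" by (simp add: algebra_simps)
 ultimately show ?thesis using y[of "c * \<tau>"] y[of "h * x"] unfolding distrib_left distrib_right by linarith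
qed

text \<open>Here \<open>z\<close> and \<open>e\<close> are the velocity errors before and after Step
  2, \<open>f\<close> the increment, \<open>G\<close> the gradient error, \<open>\<gamma>\<close>
  and \<open>\<gamma>'\<close> the pressure gradient errors and \<open>\<delta>\<close> the pressure
  increment. As in Step 1, \<open>e \<le> z + f\<close> sends products with \<open>e\<close> into
  the growth of \<open>z\<close> and the square of \<open>f\<close>.\<close>

lemma velocity_absorption:
 fixes \<tau> \<nu> c K T e G w1 w2 z w f E \<gamma> \<gamma>' \<delta> A b D :: real
 assumes pos: "0 < \<nu>" "0 \<le> K" "0 \<le> c" "0 < \<tau>" "\<tau> \<le> T"
  and nonneg: "0 \<le> w1" "0 \<le> w2" "0 \<le> w" "0 \<le> e" "0 \<le> \<gamma>" "0 \<le> \<delta>" and le: "e \<le> z + f" "w1 \<le> G" "w2 \<le> G" "\<delta> \<le> K * \<tau>"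
  and ip: "b \<le> e * \<delta>" "D \<le> \<gamma> * \<delta>"
  and energy: "(e\<^sup>2 - z\<^sup>2 + f\<^sup>2) / 2 + \<tau> * \<nu> * G\<^sup>2 + \<tau> * A \<le> (c * \<tau>\<^sup>2 + \<tau> * K * w) * (e + w1 + w2)"
  and proj: "E\<^sup>2 + \<tau>\<^sup>2 * \<gamma>'\<^sup>2 = e\<^sup>2 + 2 * \<tau> * A + \<tau>\<^sup>2 * \<gamma>\<^sup>2 + 2 * \<tau> * b + 2 * \<tau>\<^sup>2 * D + \<tau>\<^sup>2 * \<delta>\<^sup>2"
 shows "E\<^sup>2 + \<tau>\<^sup>2 * \<gamma>'\<^sup>2 + \<tau> * \<nu> * G\<^sup>2 \<le> z\<^sup>2 + \<tau> * z\<^sup>2 + \<tau>\<^sup>2 * \<gamma>\<^sup>2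
  + \<tau> * ((1 + T + 4 / \<nu>) * ((c + K) * (\<tau> + w))\<^sup>2 + (1 + T) * (K * \<tau>)\<^sup>2 + (\<tau> * \<gamma>)\<^sup>2)"
proof -
 \<comment> \<open>A common bound for consistency error, old velocity error and pressure increment,
   so that each product needs Young's inequality only once.\<close>
 define m where "m = (c + K) * (\<tau> + w)"
 have m: "0 \<le> m" "c * \<tau> + K * w \<le> m" "c * \<tau> + K * w + K * \<tau> \<le> m"
  using pos nonneg by (auto simp: m_def distrib_left distrib_right)
 have "(c * \<tau> + K * w) * (w1 + w2) \<le> m * (2 * G)" "(c * \<tau> + K * w + K * \<tau>) * e \<le> m * (z + f)"
  using pos nonneg le m by (intro mult_mono; simp)+
 moreover have "e * \<delta> \<le> e * (K * \<tau>)" using le nonneg by (intro mult_left_mono) auto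
 ultimately have "(c * \<tau> + K * w) * (e + w1 + w2) + b \<le> m * (2 * G) + m * (z + f)" using ip by (simp add: algebra_simps)
 from mult_left_mono[OF this, of "2 * \<tau>"] have 1: "2 * ((c * \<tau>\<^sup>2 + \<tau> * K * w) * (e + w1 + w2)) + 2 * \<tau> * b
   \<le> \<tau> * (2 * G * (2 * m)) + \<tau> * (2 * z * m) + 2 * f * (\<tau> * m)"
  using pos by (simp add: algebra_simps power2_eq_square)
 have 2: "\<tau> * (2 * G * (2 * m)) \<le> \<tau> * (\<nu> * G\<^sup>2 + 4 / \<nu> * m\<^sup>2)" "\<tau> * (2 * z * m) \<le> \<tau> * (z\<^sup>2 + m\<^sup>2)"
  using Young[OF pos(1), of G "2 * m"] Young[of 1 z m] pos by (intro mult_left_mono; simp add: power_mult_distrib)+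
 have "2 * f * (\<tau> * m) \<le> f\<^sup>2 + \<tau> * (\<tau> * m\<^sup>2)"
  using Young[of 1 f "\<tau> * m"] by (simp add: power_mult_distrib power2_eq_square mult_ac)
 moreover have "\<tau> * (\<tau> * q) \<le> \<tau> * (T * q)" if "0 \<le> q" for q using pos that by (intro mult_left_mono mult_right_mono) auto
 note T = this[of "m\<^sup>2", simplified] this[of "(K * \<tau>)\<^sup>2", simplified]
 ultimately have 3: "2 * f * (\<tau> * m) \<le> f\<^sup>2 + \<tau> * (T * m\<^sup>2)" by simp
 have "\<delta>\<^sup>2 \<le> (K * \<tau>)\<^sup>2" "\<gamma> * \<delta> \<le> \<gamma> * (K * \<tau>)" using le nonneg by (auto intro: power_mono mult_left_mono)
 then have "\<tau>\<^sup>2 * \<delta>\<^sup>2 \<le> \<tau> * (\<tau> * (K * \<tau>)\<^sup>2)" "2 * \<tau>\<^sup>2 * D \<le> \<tau> * (2 * (\<tau> * \<gamma>) * (K * \<tau>))"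
  using ip pos mult_left_mono[of D "\<gamma> * (K * \<tau>)" "2 * \<tau>\<^sup>2"] by (auto simp: power2_eq_square mult_ac)
 moreover have "\<tau> * (2 * (\<tau> * \<gamma>) * (K * \<tau>)) \<le> \<tau> * ((\<tau> * \<gamma>)\<^sup>2 + (K * \<tau>)\<^sup>2)"
  using Young[of 1 "\<tau> * \<gamma>" "K * \<tau>"] pos by (intro mult_left_mono) auto
 ultimately have 4: "\<tau>\<^sup>2 * \<delta>\<^sup>2 + 2 * \<tau>\<^sup>2 * D \<le> \<tau> * (T * (K * \<tau>)\<^sup>2) + \<tau> * ((\<tau> * \<gamma>)\<^sup>2 + (K * \<tau>)\<^sup>2)" using T(2) by linarith
 have "e2 + 2 * \<tau> * A \<le> z2 - f2 - 2 * n + 2 * Q" if "(e2 - z2 + f2) / 2 + n + \<tau> * A \<le> Q"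
  for e2 z2 f2 n Q :: real using that by (simp add: field_simps)
 from this[OF energy] proj 1 2 3 4
 have "E\<^sup>2 + \<tau>\<^sup>2 * \<gamma>'\<^sup>2 + 2 * (\<tau> * \<nu> * G\<^sup>2) \<le> z\<^sup>2 + \<tau>\<^sup>2 * \<gamma>\<^sup>2 + \<tau> * (\<nu> * G\<^sup>2 + 4 / \<nu> * m\<^sup>2) + \<tau> * (z\<^sup>2 + m\<^sup>2)
   + \<tau> * (T * m\<^sup>2) + (\<tau> * (T * (K * \<tau>)\<^sup>2) + \<tau> * ((\<tau> * \<gamma>)\<^sup>2 + (K * \<tau>)\<^sup>2))" by linarith
 moreover have "\<tau> * (\<nu> * g + n * q) + \<tau> * (y + q) + \<tau> * (T * q) + (\<tau> * (T * k) + \<tau> * (h + k))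
   = \<tau> * \<nu> * g + \<tau> * y + \<tau> * ((1 + T + n) * q + (1 + T) * k + h)" for g n q y k h by (simp add: algebra_simps)
 note this[of "G\<^sup>2" "4 / \<nu>" "m\<^sup>2" "z\<^sup>2" "(K * \<tau>)\<^sup>2" "(\<tau> * \<gamma>)\<^sup>2"]
 ultimately show ?thesis unfolding m_def[symmetric] by linarith
qed

text \<open>The forcing is proportional to the same \<kappa> as the growth, so a bound by the growth
  factor minus 1 reproduces itself exactly. Zero initial error starts the induction.\<close>

lemma discrete_Gronwall:
 fixes X D :: "nat \<Rightarrow> real"
 assumes "X 0 = 0" "\<kappa> \<ge> 0" "\<tau> > 0" and step: "\<And>n. n \<le> m \<Longrightarrow> X (Suc n) + \<tau> * D n \<le> (1 + \<kappa> * \<tau>) * X n + \<kappa> * \<tau> * \<tau>\<^sup>2"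
  and D: "\<And>n. 0 \<le> D n"
 shows "X (Suc m) + \<tau> * (\<Sum>n=0..m. D n) \<le> exp (\<kappa> * (real (Suc m) * \<tau>)) * \<tau>\<^sup>2"
proof -
 have *: "X n + \<tau> * (\<Sum>k<n. D k) \<le> ((1 + \<kappa> * \<tau>)^n - 1) * \<tau>\<^sup>2" if "n \<le> Suc m" for n using that
 proof (induction n)
  case (Suc n)
  have "X (Suc n) + \<tau> * (\<Sum>k<Suc n. D k) \<le> (1 + \<kappa> * \<tau>) * X n + \<kappa> * \<tau> * \<tau>\<^sup>2 + \<tau> * (\<Sum>k<n. D k)"
   using step[of n] Suc.prems by (simp add: distrib_left)
  also have "\<dots> \<le> (1 + \<kappa> * \<tau>) * (X n + \<tau> * (\<Sum>k<n. D k)) + \<kappa> * \<tau> * \<tau>\<^sup>2"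
   using assms(2,3) D by (simp add: algebra_simps sum_nonneg)
  also have "\<dots> \<le> (1 + \<kappa> * \<tau>) * (((1 + \<kappa> * \<tau>)^n - 1) * \<tau>\<^sup>2) + \<kappa> * \<tau> * \<tau>\<^sup>2"
   using Suc assms(2,3) by (intro add_right_mono mult_left_mono) auto
  also have "\<dots> = ((1 + \<kappa> * \<tau>)^Suc n - 1) * \<tau>\<^sup>2" by (simp add: algebra_simps)
  finally show ?case .
 qed (simp add: assms(1))
 have "(1 + \<kappa> * \<tau>)^Suc m \<le> exp (\<kappa> * \<tau>)^Suc m" using assms(2,3) by (intro power_mono exp_ge_add_one_self) simp
 also have "\<dots> = exp (\<kappa> * (real (Suc m) * \<tau>))" by (simp only: exp_of_nat_mult[symmetric] mult_ac)
 finally have "((1 + \<kappa> * \<tau>)^Suc m - 1) * \<tau>\<^sup>2 \<le> exp (\<kappa> * (real (Suc m) * \<tau>)) * \<tau>\<^sup>2" by (intro mult_right_mono) auto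
 moreover have "{..<Suc m} = {0..m}" by auto
 ultimately show ?thesis using *[of "Suc m"] by simp
qed

context bounded_open
begin

lemma grad_norm_diff:
 fixes f h :: "real^2 \<Rightarrow> real"
 assumes f: "sobolev U 1 f" and h: "sobolev U 1 h"
 shows "grad_norm U (\<lambda>x. f x - h x) = dst (weak_grad U f) (weak_grad U h)"
proof -
 let ?w = "\<lambda>i x. weak_pd U i f x - weak_pd U i h x"
 have w: "has_weak_pd U i (\<lambda>x. f x - h x) (?w i)" for i by (intro has_weak_pd_diff sobolev_1D f h)
 note L = has_weak_pd_L2(2)[OF w]
 have "nrm (weak_pd U i (\<lambda>x. f x - h x)) = nrm (?w i)" for i
  by (rule L2_norm_cong_AE[OF dom_sets has_weak_pd_L2(2)[OF has_weak_pd_weak_pd[OF w]] weak_pd_eq[OF w]])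
 then have "(grad_norm U (\<lambda>x. f x - h x))\<^sup>2 = ip U (?w 1) (?w 1) + ip U (?w 2) (?w 2)"
  by (simp add: grad_norm_sq sum_2 L2_norm_sq)
 also have "\<dots> = (LINT x|\<mu>. ?w 1 x \<bullet> ?w 1 x + ?w 2 x \<bullet> ?w 2 x)"
  unfolding ip_def by (intro Bochner_Integration.integral_add[symmetric] L2_integrable_inner L)
 also have "\<dots> = (dst (weak_grad U f) (weak_grad U h))\<^sup>2"
  unfolding L2_norm_sq ip_def by (simp add: inner_vec2 weak_grad_def)
 finally show ?thesis by (rule power2_eq_imp_eq) (auto simp: grad_norm_nonneg)
qed

end

context exact_solution
begin

text \<open>The coefficients on the right of \<open>magnetic_absorption\<close>, once each squared
  quantity is bounded by \<open>N\<close> of \<open>one_step\<close>.\<close>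

definition magnetic_const where
 "magnetic_const = 2 * s / \<eta> * induction_const\<^sup>2 + 2 * s / \<eta> * (K + T * s * K * K)\<^sup>2 + (1 + T) * (s * K)\<^sup>2 + 1"

text \<open>The same for \<open>velocity_absorption\<close>; the factor 2 comes from the square of
  \<open>\<tau> + w\<close>, which is at most \<open>2 * N\<close>.\<close>

definition velocity_const where
 "velocity_const = (1 + T + 4 / \<nu>) * (2 * (momentum_const + K)\<^sup>2) + (1 + T) * K\<^sup>2 + 1"

text \<open>The first factor collects both absorption estimates and the leftover
  \<open>\<tau> * z\<^sup>2\<close>; the factor \<open>1 + 1 / s\<close> passes from the unweighted
  squares in \<open>N\<close> to the energy, in which the magnetic part carries the weight
  \<open>s\<close>.\<close>

definition growth_const where
 "growth_const = (magnetic_const + T * magnetic_const + s + 1 + velocity_const) * (1 + 1 / s)"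

lemma const_nonneg: "magnetic_const \<ge> 0" "velocity_const \<ge> 0" "growth_const \<ge> 0"
proof -
 show "magnetic_const \<ge> 0" "velocity_const \<ge> 0" unfolding magnetic_const_def velocity_const_def using pos by auto
 then show "growth_const \<ge> 0" unfolding growth_const_def using pos by (auto intro!: mult_nonneg_nonneg add_nonneg_nonneg)
qed

end

context scheme_step
begin

lemma one_step:
 "s * (nrm eb')\<^sup>2 + (nrm eu')\<^sup>2 + \<tau>\<^sup>2 * (nrm g')\<^sup>2
   + \<tau> * (s * \<eta> * (nrm ec)\<^sup>2 + \<nu> * (grad_norm U et)\<^sup>2)
  \<le> (1 + growth_const * \<tau>) * (s * (nrm eb)\<^sup>2 + (nrm eu)\<^sup>2 + \<tau>\<^sup>2 * (nrm g)\<^sup>2) + growth_const * \<tau> * \<tau>\<^sup>2"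
proof -
 note e = L2_errors
 have T: "\<tau> \<le> T" using time by simp
 define x where "x = nrm eb"
 define w where "w = nrm eu"
 define z where "z = nrm es"
 define \<gamma> where "\<gamma> = nrm g"
 \<comment> \<open>One quantity dominating all squares on the right-hand sides; it includes the
   square of \<open>\<tau>\<close> for the consistency errors.\<close>
 define N where "N = \<tau>\<^sup>2 + x\<^sup>2 + w\<^sup>2 + (\<tau> * \<gamma>)\<^sup>2"
 have N: "\<tau>\<^sup>2 \<le> N" "x\<^sup>2 \<le> N" "w\<^sup>2 \<le> N" "(\<tau> * \<gamma>)\<^sup>2 \<le> N" "\<tau>\<^sup>2 + w\<^sup>2 \<le> N" "0 \<le> N" by (simp_all add: N_def)
 have cN: "c * (q * r)\<^sup>2 \<le> c * q\<^sup>2 * N" if "r\<^sup>2 \<le> N" "0 \<le> c" for c q r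
  using mult_left_mono[OF that(1), of "c * q\<^sup>2"] that by (simp add: power_mult_distrib mult.assoc)
 have "s * (nrm eb')\<^sup>2 + s * \<tau> * \<eta> * (nrm ec)\<^sup>2 + z\<^sup>2
  \<le> s * x\<^sup>2 + w\<^sup>2 + \<tau> * (2 * s / \<eta> * (induction_const * \<tau>)\<^sup>2 + 2 * s / \<eta> * ((K + T * s * K * K) * x)\<^sup>2 + (1 + T) * (s * K * x)\<^sup>2 + w\<^sup>2)"
  unfolding x_def w_def z_def
 proof (rule magnetic_absorption[where a = "nrm (\<lambda>x. eb' x - eb x)" and d = "nrm (\<lambda>x. es x - eu x)"])
  show "nrm es \<le> nrm eu + nrm (\<lambda>x. es x - eu x)" using L2_norm_triangle_rev[OF e(5,4)] by linarith
  show "s * ((nrm eb')\<^sup>2 - (nrm eb)\<^sup>2 + (nrm (\<lambda>x. eb' x - eb x))\<^sup>2) / 2 + s * \<tau> * \<eta> * (nrm ec)\<^sup>2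
   + ((nrm es)\<^sup>2 - (nrm eu)\<^sup>2 + (nrm (\<lambda>x. es x - eu x))\<^sup>2) / 2
   \<le> s * induction_const * \<tau>\<^sup>2 * nrm ec + s * \<tau> * (K + T * s * K * K) * nrm eb * nrm ec + s * \<tau> * K * nrm es * nrm eb"
   unfolding ip_diff_self[OF e(2,1), symmetric] ip_diff_self[OF e(5,4), symmetric] using magnetic_energy by simp
 qed (use pos time T in auto)
 also have "\<dots> \<le> s * x\<^sup>2 + w\<^sup>2 + \<tau> * (magnetic_const * N)"
  unfolding magnetic_const_def distrib_right[of _ _ N] mult_1
  using pos time by (intro add_left_mono mult_left_mono[of _ _ \<tau>] add_mono[of "_ + _"] add_mono[of "_ * _" _ "_ * _"] cN N) simp_all
 finally have mag: "s * (nrm eb')\<^sup>2 + s * \<tau> * \<eta> * (nrm ec)\<^sup>2 + z\<^sup>2 \<le> s * x\<^sup>2 + w\<^sup>2 + \<tau> * (magnetic_const * N)" .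
 obtain d where d: "L2 U d" "nrm d \<le> K * \<tau>"
  "(nrm eu')\<^sup>2 + \<tau>\<^sup>2 * (nrm g')\<^sup>2 = (nrm et)\<^sup>2 + 2 * \<tau> * ip U g et + \<tau>\<^sup>2 * (nrm g)\<^sup>2
   + 2 * \<tau> * ip U et d + 2 * \<tau>\<^sup>2 * ip U g d + \<tau>\<^sup>2 * (nrm d)\<^sup>2" by (rule projection_identity)
 have "(nrm eu')\<^sup>2 + \<tau>\<^sup>2 * (nrm g')\<^sup>2 + \<tau> * \<nu> * (grad_norm U et)\<^sup>2 \<le> z\<^sup>2 + \<tau> * z\<^sup>2 + \<tau>\<^sup>2 * \<gamma>\<^sup>2
   + \<tau> * ((1 + T + 4 / \<nu>) * ((momentum_const + K) * (\<tau> + w))\<^sup>2 + (1 + T) * (K * \<tau>)\<^sup>2 + (\<tau> * \<gamma>)\<^sup>2)"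
  unfolding w_def z_def \<gamma>_def
 proof (rule velocity_absorption[OF _ _ _ _ T _ _ _ _ _ _ _ L2_norm_weak_pd_le_grad_norm L2_norm_weak_pd_le_grad_norm d(2) _ _ _ d(3)])
  show "nrm et \<le> nrm es + nrm (\<lambda>x. et x - es x)" using L2_norm_triangle_rev[OF e(6,5)] by linarith
  show "ip U et d \<le> nrm et * nrm d" "ip U g d \<le> nrm g * nrm d"
   using ip_Cauchy_Schwarz[OF e(6) d(1)] ip_Cauchy_Schwarz[OF e(8) d(1)] by linarith+
  show "((nrm et)\<^sup>2 - (nrm es)\<^sup>2 + (nrm (\<lambda>x. et x - es x))\<^sup>2) / 2 + \<tau> * \<nu> * (grad_norm U et)\<^sup>2 + \<tau> * ip U g et
   \<le> (momentum_const * \<tau>\<^sup>2 + \<tau> * K * nrm eu) * (nrm et + nrm (W 1) + nrm (W 2))"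
   unfolding ip_diff_self[OF e(6,5), symmetric] using velocity_energy by simp
  show "0 \<le> momentum_const" unfolding momentum_const_def using pos by (intro add_nonneg_nonneg mult_nonneg_nonneg) auto
 qed (use pos time in auto)
 also have "\<dots> \<le> z\<^sup>2 + \<tau> * z\<^sup>2 + \<tau>\<^sup>2 * \<gamma>\<^sup>2 + \<tau> * (velocity_const * N)"
 proof -
  have "0 \<le> (\<tau> - w)\<^sup>2" by simp
  then have "(\<tau> + w)\<^sup>2 \<le> 2 * N" using N(5) by (simp add: power2_eq_square algebra_simps)
  from mult_left_mono[OF this, of "(1 + T + 4 / \<nu>) * (momentum_const + K)\<^sup>2"]
  have "(1 + T + 4 / \<nu>) * ((momentum_const + K) * (\<tau> + w))\<^sup>2 \<le> (1 + T + 4 / \<nu>) * (2 * (momentum_const + K)\<^sup>2) * N"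
   using pos by (simp add: power_mult_distrib mult_ac)
  then show ?thesis unfolding velocity_const_def distrib_right[of _ _ N] mult_1
   using pos time by (intro add_left_mono mult_left_mono[of _ _ \<tau>] add_mono[of "_ + _"] add_mono[of "_ * _" _ "_ * _"] cN N) simp_all
 qed
 finally have vel: "(nrm eu')\<^sup>2 + \<tau>\<^sup>2 * (nrm g')\<^sup>2 + \<tau> * \<nu> * (grad_norm U et)\<^sup>2
  \<le> z\<^sup>2 + \<tau> * z\<^sup>2 + \<tau>\<^sup>2 * \<gamma>\<^sup>2 + \<tau> * (velocity_const * N)" .
 let ?X = "s * x\<^sup>2 + w\<^sup>2 + \<tau>\<^sup>2 * \<gamma>\<^sup>2" and ?k = "magnetic_const + T * magnetic_const + s + 1 + velocity_const"
 \<comment> \<open>Adding \<open>mag\<close> and \<open>vel\<close> cancels the square of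
   \<open>z\<close>. The leftover \<open>\<tau> * z\<^sup>2\<close> already has a factor
   \<open>\<tau>\<close>, so a crude bound is enough: \<open>mag\<close> without its other
   nonnegative terms, with \<open>\<tau>\<close> replaced by \<open>T\<close>.\<close>
 have "0 \<le> s * (nrm eb')\<^sup>2" "0 \<le> s * \<tau> * \<eta> * (nrm ec)\<^sup>2" using pos time by auto
 with mag have "z\<^sup>2 \<le> s * x\<^sup>2 + w\<^sup>2 + \<tau> * (magnetic_const * N)" by linarith
 also have "\<dots> \<le> s * N + 1 * N + T * (magnetic_const * N)"
  using N pos T const_nonneg by (intro add_mono mult_mono mult_nonneg_nonneg) auto
 finally have "\<tau> * z\<^sup>2 \<le> \<tau> * (s * N + 1 * N + T * (magnetic_const * N))" using time by (intro mult_left_mono) auto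
 with mag vel have total: "s * (nrm eb')\<^sup>2 + s * \<tau> * \<eta> * (nrm ec)\<^sup>2 + (nrm eu')\<^sup>2 + \<tau>\<^sup>2 * (nrm g')\<^sup>2 + \<tau> * \<nu> * (grad_norm U et)\<^sup>2
   \<le> ?X + \<tau> * (?k * N)" by (simp add: algebra_simps)
 have "s * x\<^sup>2 \<le> ?X" using pos by simp
 then have "x\<^sup>2 \<le> (1 / s) * ?X" using pos by (simp add: field_simps)
 moreover have "0 \<le> s * x\<^sup>2" "0 \<le> 1 / s * \<tau>\<^sup>2" using pos by simp_all
 moreover have "(1 + 1 / s) * (?X + \<tau>\<^sup>2) = ?X + \<tau>\<^sup>2 + ((1 / s) * ?X + (1 / s) * \<tau>\<^sup>2)"
  by (simp only: distrib_left distrib_right mult_1 add_ac)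
 ultimately have "N \<le> (1 + 1 / s) * (?X + \<tau>\<^sup>2)" unfolding N_def power_mult_distrib by linarith
 then have "\<tau> * (?k * N) \<le> \<tau> * (?k * ((1 + 1 / s) * (?X + \<tau>\<^sup>2)))"
  using time pos const_nonneg by (intro mult_left_mono add_nonneg_nonneg mult_nonneg_nonneg) auto
 also have "\<dots> = growth_const * \<tau> * (?X + \<tau>\<^sup>2)" unfolding growth_const_def by (simp only: mult_ac)
 finally show ?thesis using total unfolding x_def[symmetric] w_def[symmetric] \<gamma>_def[symmetric] by (simp add: algebra_simps)
qed

end

context exact_solution
begin

lemma scheme_error:
 assumes init: "AE x in \<mu>. u 0 x = u0 x" "AE x in \<mu>. B 0 x = B0 x"
  and sch: "scheme_solution U \<nu> \<eta> s \<delta>t u0 B0 (p 0) un Bn pn ustar utilde"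
  and dt: "0 < \<delta>t" "real (Suc m) * \<delta>t \<le> T"
 shows "total_error U \<nu> \<eta> \<delta>t u B p un Bn pn utilde m \<le> exp (growth_const * T) / min 1 s * \<delta>t\<^sup>2"
proof -
 let ?t = "\<lambda>n. real n * \<delta>t"
 have t: "?t n \<in> {0..T}" if "n \<le> Suc m" for n
 proof -
  have "?t n \<le> ?t (Suc m)" using that dt by (intro mult_right_mono) auto
  then have "?t n \<le> T" using dt(2) by (rule order_trans)
  then show ?thesis using dt(1) by simp
 qed
 have z: "0 \<in> {0..T}" using pos by simp
 have steps: "scheme_step1 U \<eta> s \<delta>t (Bn n) (un n) (Bn (Suc n)) (ustar n)"
  "scheme_step2 U \<nu> \<delta>t (un n) (pn n) (ustar n) (utilde (Suc n))"
  "scheme_step3 U \<delta>t (pn n) (utilde (Suc n)) (un (Suc n)) (pn (Suc n))" for n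
  using sch unfolding scheme_solution_def by blast+
 have u0: "AE x in \<mu>. u 0 x = un 0 x" and B0: "AE x in \<mu>. B 0 x = Bn 0 x"
  and p0: "AE x in \<mu>. p 0 x = pn 0 x"
 proof -
  have "AE x in \<mu>. un 0 x = u0 x" "AE x in \<mu>. Bn 0 x = B0 x" "AE x in \<mu>. pn 0 x = p 0 x"
   using sch unfolding scheme_solution_def by blast+
  with init show "AE x in \<mu>. u 0 x = un 0 x" "AE x in \<mu>. B 0 x = Bn 0 x" "AE x in \<mu>. p 0 x = pn 0 x"
   by (auto elim: eventually_elim2)
 qed
 have wp0: "has_weak_pd U i (pn 0) (weak_pd U i (p 0))" for i
  by (rule has_weak_pd_cong_AE[OF sobolev_1D[OF sobolev_p[OF z]] p0 AE_I2[OF refl]])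
 \<comment> \<open>The regularity that a step presupposes: at level 0 inherited from the exact
   solution at time 0, afterwards from Step 1 for the magnetic field and from Step 3 for velocity
   and pressure.\<close>
 have inv: "L2 U (Bn n) \<and> div_free U (un n) \<and> zero_normal_trace U (un n) \<and> sobolev U 1 (pn n)" for n
 proof (cases n)
  case 0
  then show ?thesis using L2_cong_AE[OF dom_sets L2_exact(2)[OF z] B0] div_free_cong_AE[OF div_u[OF z] u0]
    zero_normal_trace_cong_AE[OF normal_u[OF z] div_u[OF z] u0] sobolev_1I[OF wp0] by blast
 next
  case (Suc k)
  have "zero_tangential_trace U (Bn (Suc k))" using steps(1)[of k] by (simp add: scheme_step1_def)
  then have "L2 U (Bn (Suc k))" using zero_tangential_trace_weak_curl by (auto simp: has_weak_curl_def)
  then show ?thesis using steps(3)[of k] unfolding Suc scheme_step3_def by blast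
 qed
 define X where "X n = s * (dst (B (?t n)) (Bn n))\<^sup>2 + (dst (u (?t n)) (un n))\<^sup>2
  + \<delta>t\<^sup>2 * (dst (weak_grad U (p (?t n))) (weak_grad U (pn n)))\<^sup>2" for n
 define D where "D n = s * \<eta> * (dst (J (?t (Suc n))) (weak_curl U (Bn (Suc n))))\<^sup>2
  + \<nu> * (grad_norm U (\<lambda>x. u (?t (Suc n)) x - utilde (Suc n) x))\<^sup>2" for n
 have D0: "0 \<le> D n" for n using pos by (simp add: D_def)
 have "X (Suc m) + \<delta>t * (\<Sum>n=0..m. D n) \<le> exp (growth_const * ?t (Suc m)) * \<delta>t\<^sup>2"
 proof (rule discrete_Gronwall[OF _ const_nonneg(3) dt(1) _ D0])
  \<comment> \<open>The initial energy vanishes exactly because the scheme also starts from the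
    exact pressure.\<close>
  have "AE x in \<mu>. weak_grad U (pn 0) x = weak_grad U (p 0) x"
   using weak_grad_eq[OF wp0] by (simp add: weak_grad_def)
  then have "dst (weak_grad U (p 0)) (weak_grad U (pn 0)) = 0"
   using L2_exact(5)[OF z] L2_weak_grad[OF sobolev_1I[OF wp0]] by (subst L2_norm_eq_0_iff) (auto intro: L2_diff)
  moreover have "dst (u 0) (un 0) = 0" "dst (B 0) (Bn 0) = 0"
   using u0 B0 inv[of 0] L2_exact[OF z] by (auto simp: L2_norm_eq_0_iff L2_diff has_weak_div_def)
  ultimately show "X 0 = 0" by (simp add: X_def)
  fix n assume n: "n \<le> m"
  have s: "?t n + \<delta>t = ?t (Suc n)" by (simp add: algebra_simps)
  interpret scheme_step U T \<nu> \<eta> s K u B u_t B_t p \<delta>t "?t n" "Bn n" "un n" "Bn (Suc n)" "ustar n" "utilde (Suc n)"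
   "un (Suc n)" "pn n" "pn (Suc n)"
  proof unfold_locales
   show "?t n + \<delta>t \<le> T" using t[of "Suc n"] n unfolding s by simp
  qed (use inv[of n] steps[of n] dt in auto)
  show "X (Suc n) + \<delta>t * D n \<le> (1 + growth_const * \<delta>t) * X n + growth_const * \<delta>t * \<delta>t\<^sup>2"
   using one_step unfolding s X_def D_def .
 qed
 also have "\<dots> \<le> exp (growth_const * T) * \<delta>t\<^sup>2"
  using dt(2) const_nonneg(3) by (intro mult_right_mono) (auto intro: mult_left_mono)
 finally have le: "X (Suc m) + \<delta>t * (\<Sum>n=0..m. D n) \<le> exp (growth_const * T) * \<delta>t\<^sup>2" .
 have gp: "grad_norm U (grid_error \<delta>t p pn (m + 1)) = dst (weak_grad U (p (?t (Suc m)))) (weak_grad U (pn (Suc m)))"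
  using grad_norm_diff[OF sobolev_p[OF t[of "Suc m"]], of "pn (Suc m)"] inv[of "Suc m"] by (simp add: grid_error_def[abs_def])
 have gc: "nrm (weak_curl U (grid_error \<delta>t B Bn (n + 1))) = dst (J (?t (Suc n))) (weak_curl U (Bn (Suc n)))"
  if "n \<le> m" for n
 proof -
  have "zero_tangential_trace U (Bn (Suc n))" using steps(1)[of n] by (simp add: scheme_step1_def)
  then have c: "has_weak_curl U (grid_error \<delta>t B Bn (n + 1)) (\<lambda>x. J (?t (Suc n)) x - weak_curl U (Bn (Suc n)) x)"
   using has_weak_curl_diff[OF zero_tangential_trace_weak_curl[OF trace_B[OF t[of "Suc n"]]] zero_tangential_trace_weak_curl] that
   by (simp add: grid_error_def[abs_def])
  have "L2 U (weak_curl U (grid_error \<delta>t B Bn (n + 1)))"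
   using has_weak_curl_weak_curl[OF c] by (simp add: has_weak_curl_def)
  from L2_norm_cong_AE[OF dom_sets this weak_curl_eq[OF c]] show ?thesis .
 qed
 \<comment> \<open>Removes the weight \<open>s\<close> from the magnetic part of the energy; it is
   the denominator of the final constant.\<close>
 let ?\<mu> = "min 1 s"
 have mu: "0 < ?\<mu>" "?\<mu> \<le> 1" "?\<mu> \<le> s" using pos by auto
 have scale: "?\<mu> * a \<le> c * a" if "0 \<le> a" "?\<mu> \<le> c" for a c using that by (rule mult_right_mono[rotated])
 have sumD: "?\<mu> * (\<Sum>n=0..m. \<eta> * (nrm (weak_curl U (grid_error \<delta>t B Bn (n + 1))))\<^sup>2
     + \<nu> * (grad_norm U (grid_error \<delta>t u utilde (n + 1)))\<^sup>2) \<le> (\<Sum>n=0..m. D n)" unfolding sum_distrib_left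
 proof (rule sum_mono)
  fix n assume n: "n \<in> {0..m}"
  have "grid_error \<delta>t u utilde (n + 1) = (\<lambda>x. u (?t (Suc n)) x - utilde (Suc n) x)" by (simp add: grid_error_def[abs_def])
  moreover have "?\<mu> * (\<eta> * c) \<le> s * (\<eta> * c)" "?\<mu> * (\<nu> * c) \<le> 1 * (\<nu> * c)" if "0 \<le> c" for c
   using that pos mu by (intro scale; simp)+
  ultimately show "?\<mu> * (\<eta> * (nrm (weak_curl U (grid_error \<delta>t B Bn (n + 1))))\<^sup>2
     + \<nu> * (grad_norm U (grid_error \<delta>t u utilde (n + 1)))\<^sup>2) \<le> D n"
   using gc[of n] n unfolding D_def distrib_left by (simp add: mult.assoc add_mono)
 qed
 have "?\<mu> * total_error U \<nu> \<eta> \<delta>t u B p un Bn pn utilde m \<le> X (Suc m) + \<delta>t * (\<Sum>n=0..m. D n)"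
 proof -
  have "?\<mu> * (a + b + c + \<delta>t * d) \<le> s * a + b + c + \<delta>t * e"
   if "0 \<le> a" "0 \<le> b" "0 \<le> c" "?\<mu> * d \<le> e" for a b c d e
  proof -
   have eq: "?\<mu> * (a + b + c + \<delta>t * d) = ?\<mu> * a + ?\<mu> * b + ?\<mu> * c + \<delta>t * (?\<mu> * d)" by (simp add: algebra_simps)
   have "\<delta>t * (?\<mu> * d) \<le> \<delta>t * e" using that(4) dt(1) by (intro mult_left_mono) auto
   then show ?thesis
    unfolding eq using scale[OF that(1) mu(3)] scale[OF that(2) mu(2)] scale[OF that(3) mu(2)] by linarith
  qed
  from this[OF _ _ _ sumD] show ?thesis unfolding total_error_def X_def gp by (simp add: grid_error_def[abs_def])
 qed
 with le have "?\<mu> * total_error U \<nu> \<eta> \<delta>t u B p un Bn pn utilde m \<le> exp (growth_const * T) * \<delta>t\<^sup>2" by linarith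
 then show ?thesis using mu(1) by (simp add: field_simps)
qed

end

theorem theorem3p2:
  fixes \<Omega> :: "(real^2) set"
    and T \<nu> \<eta> s :: real
    and u0 B0 :: "real^2 \<Rightarrow> real^2"
    and u B :: "real \<Rightarrow> real^2 \<Rightarrow> real^2"
    and p :: "real \<Rightarrow> real^2 \<Rightarrow> real"
  assumes "lipschitz_domain \<Omega>"
    and "T > 0" and "\<nu> > 0" and "\<eta> > 0" and "s > 0"
    and "mhd_solution \<Omega> T \<nu> \<eta> s u0 B0 u B p"
    and "regular_solution \<Omega> T u B p"
  shows "(\<exists>C>0. \<forall>\<delta>t>0. \<forall>un Bn pn ustar utilde.
            scheme_solution \<Omega> \<nu> \<eta> s \<delta>t u0 B0 (p 0) un Bn pn ustar utilde \<longrightarrow>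
            (\<forall>m. int m \<le> \<lfloor>T / \<delta>t\<rfloor> - 1 \<longrightarrow>
               total_error \<Omega> \<nu> \<eta> \<delta>t u B p un Bn pn utilde m \<le> C * \<delta>t\<^sup>2))
       \<and> (\<forall>\<epsilon>>0. \<exists>\<delta>>0. \<forall>\<delta>t. 0 < \<delta>t \<and> \<delta>t < \<delta> \<longrightarrow>
            (\<forall>un Bn pn ustar utilde.
              scheme_solution \<Omega> \<nu> \<eta> s \<delta>t u0 B0 (p 0) un Bn pn ustar utilde \<longrightarrow>
              (\<forall>m. int m \<le> \<lfloor>T / \<delta>t\<rfloor> - 1 \<longrightarrow>
                 total_error \<Omega> \<nu> \<eta> \<delta>t u B p un Bn pn utilde m < \<epsilon>)))"
proof -
 obtain K u_t B_t where "exact_solution \<Omega> T \<nu> \<eta> s K u B u_t B_t p"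
  using lipschitz_open.mhd_exact_solution[OF lipschitz_domain_imp_lipschitz_open[OF assms(1)] assms(2-7)] .
 then interpret exact_solution \<Omega> T \<nu> \<eta> s K u B u_t B_t p .
 define C where "C = exp (growth_const * T) / min 1 s"
 have C: "C > 0" using pos by (simp add: C_def)
 have init: "AE x in lebesgue_on \<Omega>. u 0 x = u0 x" "AE x in lebesgue_on \<Omega>. B 0 x = B0 x"
  using assms(6) unfolding mhd_solution_def by blast+
 have bound: "total_error \<Omega> \<nu> \<eta> \<delta>t u B p un Bn pn utilde m \<le> C * \<delta>t\<^sup>2"
  if "0 < \<delta>t" "scheme_solution \<Omega> \<nu> \<eta> s \<delta>t u0 B0 (p 0) un Bn pn ustar utilde" "int m \<le> \<lfloor>T / \<delta>t\<rfloor> - 1"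
  for \<delta>t un Bn pn ustar utilde m
 proof -
  \<comment> \<open>The bound on \<open>m\<close> says that all \<open>m + 1\<close> steps end no
    later than \<open>T\<close>, where the exact solution is controlled.\<close>
  have "int (Suc m) \<le> \<lfloor>T / \<delta>t\<rfloor>" using that(3) by simp
  then have "real (Suc m) \<le> T / \<delta>t" by (simp add: le_floor_iff)
  then have "real (Suc m) * \<delta>t \<le> T" using that(1) by (simp add: pos_le_divide_eq)
  then show ?thesis unfolding C_def by (rule scheme_error[OF init that(2,1)])
 qed
 show ?thesis
 proof (intro conjI allI impI)
  show "\<exists>C>0. \<forall>\<delta>t>0. \<forall>un Bn pn ustar utilde.
      scheme_solution \<Omega> \<nu> \<eta> s \<delta>t u0 B0 (p 0) un Bn pn ustar utilde \<longrightarrow>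
      (\<forall>m. int m \<le> \<lfloor>T / \<delta>t\<rfloor> - 1 \<longrightarrow>
        total_error \<Omega> \<nu> \<eta> \<delta>t u B p un Bn pn utilde m \<le> C * \<delta>t\<^sup>2)" using C bound by blast
  fix \<epsilon> :: real assume \<epsilon>: "\<epsilon> > 0"
  show "\<exists>\<delta>>0. \<forall>\<delta>t. 0 < \<delta>t \<and> \<delta>t < \<delta> \<longrightarrow>
      (\<forall>un Bn pn ustar utilde.
       scheme_solution \<Omega> \<nu> \<eta> s \<delta>t u0 B0 (p 0) un Bn pn ustar utilde \<longrightarrow>
       (\<forall>m. int m \<le> \<lfloor>T / \<delta>t\<rfloor> - 1 \<longrightarrow>
         total_error \<Omega> \<nu> \<eta> \<delta>t u B p un Bn pn utilde m < \<epsilon>))"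
  \<comment> \<open>The threshold solves C \<delta>t squared = \<epsilon>; it expresses convergence
    and is no stability restriction, as the first conjunct holds for every positive step.\<close>
  proof (rule exI[of _ "sqrt (\<epsilon> / C)"], intro conjI allI impI)
   fix \<delta>t un Bn pn ustar utilde m
   assume dt: "0 < \<delta>t \<and> \<delta>t < sqrt (\<epsilon> / C)"
    and h: "scheme_solution \<Omega> \<nu> \<eta> s \<delta>t u0 B0 (p 0) un Bn pn ustar utilde" "int m \<le> \<lfloor>T / \<delta>t\<rfloor> - 1"
   have "\<delta>t\<^sup>2 < (sqrt (\<epsilon> / C))\<^sup>2" using dt by (intro power_strict_mono) auto
   then have "C * \<delta>t\<^sup>2 < \<epsilon>" using C \<epsilon> by (simp add: field_simps)
   with bound[OF _ h] dt show "total_error \<Omega> \<nu> \<eta> \<delta>t u B p un Bn pn utilde m < \<epsilon>" by fastforce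
  qed (use C \<epsilon> in simp)
 qed
qed

end
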